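(* Let $A$ and $B$ be finite-dimensional local $k$-algebras with $A/J_A\cong k\cong B/J_B$, and let $X$ be a finite-dimensional $(A,B)$-bimodule on which $k$ acts centrally, such that the algebra $\Lambda=\begin{pmatrix}A&X\\0&B\end{pmatrix}$ is $g$-finite. Then $X/XJ_B$ is a uniserial left $A$-module and $X/J_AX$ is a uniserial right $B$-module.
   Context: $k$ is a field; $J_R$ denotes the Jacobson radical of $R$. A complex in $K^b(\operatorname{proj}\Lambda)$ is 2-term silting if it is concentrated in degrees $-1,0$, has no positive self-extensions ($\operatorname{Hom}(T,T[\ell])=0$ for $\ell>0$) and has exactly two non-isomorphic indecomposable direct summands. $\Lambda$ is $g$-finite if it has only finitely many isomorphism classes of basic 2-term silting complexes. *)

theory Defs
  imports Complex_Main
begin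

text \<open>Jacobson radical of a ring (type 'a), via the standard element-wise
  characterisation: x is in J iff 1 - r x is left invertible for every r.\<close>
definition jac :: "'a::ring_1 set" where
  "jac = {x. \<forall>r. \<exists>u. u * (1 - r * x) = 1}"

definition fin_dim :: "('k::field \<Rightarrow> 'v::ab_group_add \<Rightarrow> 'v) \<Rightarrow> bool" where
  "fin_dim s \<longleftrightarrow> vector_space s \<and> (\<exists>S. finite S \<and> module.span s S = UNIV)"

definition fd_algebra :: "('k::field \<Rightarrow> 'a::ring_1 \<Rightarrow> 'a) \<Rightarrow> bool" where
  "fd_algebra s \<longleftrightarrow> fin_dim s \<and>
     (\<forall>c x y. s c (x * y) = s c x * y \<and> s c (x * y) = x * s c y)"

definition local_ring :: "'a::ring_1 itself \<Rightarrow> bool" where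
  "local_ring _ \<longleftrightarrow> (\<forall>x::'a. x \<in> jac \<or> (\<exists>u. u * x = 1 \<and> x * u = 1))"

text \<open>The structure map k -> A/J_A, c |-> c.1 + J_A, is an isomorphism.\<close>
definition residue_field_is_k :: "('k::field \<Rightarrow> 'a::ring_1 \<Rightarrow> 'a) \<Rightarrow> bool" where
  "residue_field_is_k s \<longleftrightarrow>
     (\<forall>a. \<exists>c. a - s c 1 \<in> jac) \<and> (\<forall>c. s c 1 \<in> jac \<longrightarrow> c = 0)"

definition central_bimodule ::
  "('k::field \<Rightarrow> 'a::ring_1 \<Rightarrow> 'a) \<Rightarrow> ('k \<Rightarrow> 'b::ring_1 \<Rightarrow> 'b) \<Rightarrow> ('k \<Rightarrow> 'x::ab_group_add \<Rightarrow> 'x)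
   \<Rightarrow> ('a \<Rightarrow> 'x \<Rightarrow> 'x) \<Rightarrow> ('x \<Rightarrow> 'b \<Rightarrow> 'x) \<Rightarrow> bool" where
  "central_bimodule sA sB sX L R \<longleftrightarrow>
     (\<forall>a a' x x'. L (a + a') x = L a x + L a' x \<and> L a (x + x') = L a x + L a x'
        \<and> L (a * a') x = L a (L a' x) \<and> L 1 x = x) \<and>
     (\<forall>b b' x x'. R x (b + b') = R x b + R x b' \<and> R (x + x') b = R x b + R x' b
        \<and> R x (b * b') = R (R x b) b' \<and> R x 1 = x) \<and>
     (\<forall>a x b. R (L a x) b = L a (R x b)) \<and>
     (\<forall>c x. L (sA c 1) x = sX c x \<and> R x (sB c 1) = sX c x)"

text \<open>Right Lambda-modules. Indecomposable projectives P1 = e1 Lambda, P2 = e2 Lambda.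
  Every finitely generated projective is P1^m + P2^n, encoded as the pair (m,n).
  Hom(P1,P1) = A, Hom(P2,P1) = X, Hom(P1,P2) = 0, Hom(P2,P2) = B, so a morphism
  (m,n) -> (m',n') is a block matrix [[alpha, xi],[0, beta]] with alpha an m'xm matrix over A,
  xi an m'xn matrix over X and beta an n'xn matrix over B (entries outside the range are 0).\<close>

type_synonym obj = "nat \<times> nat"
type_synonym ('a,'x,'b) pmor = "(nat \<Rightarrow> nat \<Rightarrow> 'a) \<times> (nat \<Rightarrow> nat \<Rightarrow> 'x) \<times> (nat \<Rightarrow> nat \<Rightarrow> 'b)"

definition is_pmor :: "obj \<Rightarrow> obj \<Rightarrow> ('a::zero,'x::zero,'b::zero) pmor \<Rightarrow> bool" where
  "is_pmor P Q f \<longleftrightarrow>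
     (\<forall>i j. (fst Q \<le> i \<or> fst P \<le> j) \<longrightarrow> fst f i j = 0) \<and>
     (\<forall>i j. (fst Q \<le> i \<or> snd P \<le> j) \<longrightarrow> fst (snd f) i j = 0) \<and>
     (\<forall>i j. (snd Q \<le> i \<or> snd P \<le> j) \<longrightarrow> snd (snd f) i j = 0)"

definition pcomp :: "('a::ring_1 \<Rightarrow> 'x::ab_group_add \<Rightarrow> 'x) \<Rightarrow> ('x \<Rightarrow> 'b::ring_1 \<Rightarrow> 'x) \<Rightarrow> obj
   \<Rightarrow> ('a,'x,'b) pmor \<Rightarrow> ('a,'x,'b) pmor \<Rightarrow> ('a,'x,'b) pmor" where
  "pcomp L R Q g f =
     ((\<lambda>i j. \<Sum>l<fst Q. fst g i l * fst f l j),
      (\<lambda>i j. (\<Sum>l<fst Q. L (fst g i l) (fst (snd f) l j)) + (\<Sum>l<snd Q. R (fst (snd g) i l) (snd (snd f) l j))),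
      (\<lambda>i j. \<Sum>l<snd Q. snd (snd g) i l * snd (snd f) l j))"

definition padd :: "('a::plus,'x::plus,'b::plus) pmor \<Rightarrow> ('a,'x,'b) pmor \<Rightarrow> ('a,'x,'b) pmor" where
  "padd f g = ((\<lambda>i j. fst f i j + fst g i j), (\<lambda>i j. fst (snd f) i j + fst (snd g) i j),
               (\<lambda>i j. snd (snd f) i j + snd (snd g) i j))"

definition pid :: "obj \<Rightarrow> ('a::{zero,one},'x::zero,'b::{zero,one}) pmor" where
  "pid P = ((\<lambda>i j. if i = j \<and> i < fst P then 1 else 0), (\<lambda>i j. 0),
            (\<lambda>i j. if i = j \<and> i < snd P then 1 else 0))"

definition pzero :: "('a::zero,'x::zero,'b::zero) pmor" where
  "pzero = ((\<lambda>i j. 0), (\<lambda>i j. 0), (\<lambda>i j. 0))"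

definition odsum :: "obj \<Rightarrow> obj \<Rightarrow> obj" where
  "odsum P P' = (fst P + fst P', snd P + snd P')"

definition bdiag :: "nat \<Rightarrow> nat \<Rightarrow> (nat \<Rightarrow> nat \<Rightarrow> 'c::zero) \<Rightarrow> (nat \<Rightarrow> nat \<Rightarrow> 'c) \<Rightarrow> nat \<Rightarrow> nat \<Rightarrow> 'c" where
  "bdiag r c M M' i j = (if i < r \<and> j < c then M i j
                         else if r \<le> i \<and> c \<le> j then M' (i - r) (j - c) else 0)"

definition pdsum :: "obj \<Rightarrow> obj \<Rightarrow> ('a::zero,'x::zero,'b::zero) pmor \<Rightarrow> ('a,'x,'b) pmor \<Rightarrow> ('a,'x,'b) pmor" where
  "pdsum P Q f f' = (bdiag (fst Q) (fst P) (fst f) (fst f'),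
                     bdiag (fst Q) (snd P) (fst (snd f)) (fst (snd f')),
                     bdiag (snd Q) (snd P) (snd (snd f)) (snd (snd f')))"

text \<open>A 2-term complex T = (T^{-1}, T^0, d : T^{-1} -> T^0).\<close>
type_synonym ('a,'x,'b) cpx = "obj \<times> obj \<times> ('a,'x,'b) pmor"

definition is_cpx :: "('a::zero,'x::zero,'b::zero) cpx \<Rightarrow> bool" where
  "is_cpx T \<longleftrightarrow> is_pmor (fst T) (fst (snd T)) (snd (snd T))"

definition cdsum :: "('a::zero,'x::zero,'b::zero) cpx \<Rightarrow> ('a,'x,'b) cpx \<Rightarrow> ('a,'x,'b) cpx" where
  "cdsum T T' = (odsum (fst T) (fst T'), odsum (fst (snd T)) (fst (snd T')),
                 pdsum (fst T) (fst (snd T)) (snd (snd T)) (snd (snd T')))"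

definition czero :: "('a::zero,'x::zero,'b::zero) cpx" where
  "czero = ((0,0), (0,0), pzero)"

definition chain_map :: "('a::ring_1 \<Rightarrow> 'x::ab_group_add \<Rightarrow> 'x) \<Rightarrow> ('x \<Rightarrow> 'b::ring_1 \<Rightarrow> 'x)
   \<Rightarrow> ('a,'x,'b) cpx \<Rightarrow> ('a,'x,'b) cpx \<Rightarrow> ('a,'x,'b) pmor \<times> ('a,'x,'b) pmor \<Rightarrow> bool" where
  "chain_map L R T T' f \<longleftrightarrow>
     is_pmor (fst T) (fst T') (fst f) \<and> is_pmor (fst (snd T)) (fst (snd T')) (snd f) \<and>
     pcomp L R (fst T') (snd (snd T')) (fst f) = pcomp L R (fst (snd T)) (snd f) (snd (snd T))"

definition homotopic :: "('a::ring_1 \<Rightarrow> 'x::ab_group_add \<Rightarrow> 'x) \<Rightarrow> ('x \<Rightarrow> 'b::ring_1 \<Rightarrow> 'x)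
   \<Rightarrow> ('a,'x,'b) cpx \<Rightarrow> ('a,'x,'b) cpx \<Rightarrow> ('a,'x,'b) pmor \<times> ('a,'x,'b) pmor
   \<Rightarrow> ('a,'x,'b) pmor \<times> ('a,'x,'b) pmor \<Rightarrow> bool" where
  "homotopic L R T T' f g \<longleftrightarrow>
     (\<exists>h. is_pmor (fst (snd T)) (fst T') h \<and>
          fst f = padd (fst g) (pcomp L R (fst (snd T)) h (snd (snd T))) \<and>
          snd f = padd (snd g) (pcomp L R (fst T') (snd (snd T')) h))"

definition ciso :: "('a::ring_1 \<Rightarrow> 'x::ab_group_add \<Rightarrow> 'x) \<Rightarrow> ('x \<Rightarrow> 'b::ring_1 \<Rightarrow> 'x)
   \<Rightarrow> ('a,'x,'b) cpx \<Rightarrow> ('a,'x,'b) cpx \<Rightarrow> bool" where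
  "ciso L R T T' \<longleftrightarrow>
     (\<exists>f g. chain_map L R T T' f \<and> chain_map L R T' T g \<and>
        homotopic L R T T (pcomp L R (fst T') (fst g) (fst f), pcomp L R (fst (snd T')) (snd g) (snd f))
                          (pid (fst T), pid (fst (snd T))) \<and>
        homotopic L R T' T' (pcomp L R (fst T) (fst f) (fst g), pcomp L R (fst (snd T)) (snd f) (snd g))
                            (pid (fst T'), pid (fst (snd T'))))"

definition indecomposable :: "('a::ring_1 \<Rightarrow> 'x::ab_group_add \<Rightarrow> 'x) \<Rightarrow> ('x \<Rightarrow> 'b::ring_1 \<Rightarrow> 'x)
   \<Rightarrow> ('a,'x,'b) cpx \<Rightarrow> bool" where
  "indecomposable L R T \<longleftrightarrow> is_cpx T \<and> \<not> ciso L R T czero \<and>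
     (\<forall>S U. is_cpx S \<and> is_cpx U \<and> ciso L R T (cdsum S U) \<longrightarrow> ciso L R S czero \<or> ciso L R U czero)"

definition summand :: "('a::ring_1 \<Rightarrow> 'x::ab_group_add \<Rightarrow> 'x) \<Rightarrow> ('x \<Rightarrow> 'b::ring_1 \<Rightarrow> 'x)
   \<Rightarrow> ('a,'x,'b) cpx \<Rightarrow> ('a,'x,'b) cpx \<Rightarrow> bool" where
  "summand L R S T \<longleftrightarrow> is_cpx S \<and> (\<exists>U. is_cpx U \<and> ciso L R T (cdsum S U))"

text \<open>Hom(T, T[l]) = 0 for all l > 0. For 2-term complexes only l = 1 can be nonzero:
  Hom_K(T, T[1]) consists of maps f : T^{-1} -> T^0 modulo those of the form d h1 + h0 d.
  (For l >= 2, Hom(T,T[l]) = 0 trivially since T lives in degrees -1, 0.)\<close>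
definition presilting :: "('a::ring_1 \<Rightarrow> 'x::ab_group_add \<Rightarrow> 'x) \<Rightarrow> ('x \<Rightarrow> 'b::ring_1 \<Rightarrow> 'x)
   \<Rightarrow> ('a,'x,'b) cpx \<Rightarrow> bool" where
  "presilting L R T \<longleftrightarrow> is_cpx T \<and>
     (\<forall>f. is_pmor (fst T) (fst (snd T)) f \<longrightarrow>
        (\<exists>h1 h0. is_pmor (fst T) (fst T) h1 \<and> is_pmor (fst (snd T)) (fst (snd T)) h0 \<and>
           f = padd (pcomp L R (fst T) (snd (snd T)) h1) (pcomp L R (fst (snd T)) h0 (snd (snd T)))))"

definition two_term_silting :: "('a::ring_1 \<Rightarrow> 'x::ab_group_add \<Rightarrow> 'x) \<Rightarrow> ('x \<Rightarrow> 'b::ring_1 \<Rightarrow> 'x)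
   \<Rightarrow> ('a,'x,'b) cpx \<Rightarrow> bool" where
  "two_term_silting L R T \<longleftrightarrow> presilting L R T \<and>
     (\<exists>S1 S2. indecomposable L R S1 \<and> summand L R S1 T \<and>
              indecomposable L R S2 \<and> summand L R S2 T \<and> \<not> ciso L R S1 S2 \<and>
              (\<forall>S. indecomposable L R S \<and> summand L R S T \<longrightarrow> ciso L R S S1 \<or> ciso L R S S2))"

definition basic :: "('a::ring_1 \<Rightarrow> 'x::ab_group_add \<Rightarrow> 'x) \<Rightarrow> ('x \<Rightarrow> 'b::ring_1 \<Rightarrow> 'x)
   \<Rightarrow> ('a,'x,'b) cpx \<Rightarrow> bool" where
  "basic L R T \<longleftrightarrow> is_cpx T \<and>
     \<not> (\<exists>S U. indecomposable L R S \<and> is_cpx U \<and> ciso L R T (cdsum S (cdsum S U)))"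

definition g_finite :: "('a::ring_1 \<Rightarrow> 'x::ab_group_add \<Rightarrow> 'x) \<Rightarrow> ('x \<Rightarrow> 'b::ring_1 \<Rightarrow> 'x) \<Rightarrow> bool" where
  "g_finite L R \<longleftrightarrow>
     (\<exists>F. finite F \<and> (\<forall>T. basic L R T \<and> two_term_silting L R T \<longrightarrow> (\<exists>S\<in>F. ciso L R T S)))"

definition left_submodule :: "('a \<Rightarrow> 'x::ab_group_add \<Rightarrow> 'x) \<Rightarrow> 'x set \<Rightarrow> bool" where
  "left_submodule L U \<longleftrightarrow> 0 \<in> U \<and> (\<forall>x\<in>U. \<forall>y\<in>U. x + y \<in> U) \<and> (\<forall>x\<in>U. - x \<in> U) \<and>
     (\<forall>a. \<forall>x\<in>U. L a x \<in> U)"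

definition right_submodule :: "('x::ab_group_add \<Rightarrow> 'b \<Rightarrow> 'x) \<Rightarrow> 'x set \<Rightarrow> bool" where
  "right_submodule R U \<longleftrightarrow> 0 \<in> U \<and> (\<forall>x\<in>U. \<forall>y\<in>U. x + y \<in> U) \<and> (\<forall>x\<in>U. - x \<in> U) \<and>
     (\<forall>b. \<forall>x\<in>U. R x b \<in> U)"

text \<open>X / X J_B is a uniserial left A-module: its submodules, i.e. the left A-submodules of X
  containing X J_B, are totally ordered by inclusion. (A subgroup contains X J_B iff it contains
  all products x b with b in J_B.)\<close>
definition uniserial_left_top :: "('a \<Rightarrow> 'x::ab_group_add \<Rightarrow> 'x) \<Rightarrow> ('x \<Rightarrow> 'b::ring_1 \<Rightarrow> 'x) \<Rightarrow> bool" where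
  "uniserial_left_top L R \<longleftrightarrow>
     (\<forall>U V. left_submodule L U \<and> left_submodule L V \<and>
        (\<forall>x. \<forall>b\<in>jac. R x b \<in> U) \<and> (\<forall>x. \<forall>b\<in>jac. R x b \<in> V) \<longrightarrow> U \<subseteq> V \<or> V \<subseteq> U)"

definition uniserial_right_top :: "('a::ring_1 \<Rightarrow> 'x::ab_group_add \<Rightarrow> 'x) \<Rightarrow> ('x \<Rightarrow> 'b \<Rightarrow> 'x) \<Rightarrow> bool" where
  "uniserial_right_top L R \<longleftrightarrow>
     (\<forall>U V. right_submodule R U \<and> right_submodule R V \<and>
        (\<forall>x. \<forall>a\<in>jac. L a x \<in> U) \<and> (\<forall>x. \<forall>a\<in>jac. L a x \<in> V) \<longrightarrow> U \<subseteq> V \<or> V \<subseteq> U)"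

end

theory Submission
  imports Defs "HOL-Library.Function_Algebras" "HOL-Library.Product_Plus"
begin

text \<open>
  Homomorphisms of two-term complexes of projectives are handled inside one matrix ring, as honest chain
  maps; homotopies enter only through the vanishing of positive self-extensions. Starting from the
  projectives, repeated left mutation produces silting pairs \<open>(S, T)\<close> whose g-vectors form unimodular
  matrices, with growing total size. As long as the cones they span miss the ray through \<open>(1, n)\<close> the
  mutation can be continued, so g-finiteness puts this ray into one of the cones, and there is a
  self-orthogonal complex with g-vector exactly \<open>(1, n)\<close>: a vector \<open>\<xi>\<close> with entries in \<open>X\<close> whose orbit
  under the endomorphism algebras of the two projectives is everything, in other words
  \<open>X\<^sup>n = A \<xi> + \<xi> M\<^sub>n(B)\<close>. Two incomparable submodules of \<open>X / X J\<^sub>B\<close> give a quotient with a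
  two-dimensional subspace killed by \<open>J\<^sub>A\<close>, and for suitable \<open>n\<close> counting dimensions in this identity gives
  a contradiction. The other claim follows from the ray through \<open>(n, 1)\<close>.
\<close>

text \<open>A rank \<open>(m, n)\<close> below stands for the g-vector \<open>(m, -n)\<close>:
  \<open>m\<close> copies of the first projective in degree 0 and \<open>n\<close> copies of the
  second in degree -1. With this placement a homotopy would be a map from the first projective to
  the second, and there is none; hence no homotopies have to be divided out. The price is that
  mutation must stay inside this class. The cone of \<open>S \<rightarrow> U\<close> is in general a
  three-term complex; it is an object of the class when the map splits degreewise, and the
  coresolution carried along with each silting pair provides this in degree -1. An endless sequence
  is excluded by slopes: consecutive g-vectors have determinant 1, so the slopes
  \<open>n / m\<close> strictly increase, whereas finitely many silting complexes leave finitely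
  many slopes. The statement about g-finiteness itself lives in the homotopy category, so
  indecomposability, Krull-Schmidt and isomorphism are transferred there at the end, again because
  homotopies on these complexes vanish.\<close>

lemma asr: "a * b = c \<Longrightarrow> a * (b * z) = c * (z::'g::semigroup_mult)"
  by (simp add: mult.assoc[symmetric])

section \<open>Idempotents: equivalence, exchange, local corner rings\<close>

definition eqv :: "'g::{ring,monoid_mult} set \<Rightarrow> 'g \<Rightarrow> 'g \<Rightarrow> bool" where
  "eqv R p q \<longleftrightarrow> (\<exists>a\<in>R. \<exists>b\<in>R. a * b = p \<and> b * a = q \<and> p * a = a \<and> a * q = a \<and> q * b = b \<and> b * p = b)"

text \<open>Invertibility in the corner ring with identity \<open>p\<close>.\<close>

definition unit_in :: "'g::{ring,monoid_mult} set \<Rightarrow> 'g \<Rightarrow> 'g \<Rightarrow> bool" where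
  "unit_in R p g \<longleftrightarrow> (\<exists>w\<in>R. p * w = w \<and> w * p = w \<and> g * w = p \<and> w * g = p)"

lemma unit_inE:
  assumes "unit_in R p g"
  obtains w where "w \<in> R" "p * w = w" "w * p = w" "g * w = p" "w * g = p"
  using assms unfolding unit_in_def by auto

lemma eqv_sym: "eqv R p q \<Longrightarrow> eqv R q p"
  unfolding eqv_def by metis

text \<open>No unit is demanded: the notions are applied to \<open>D\<close>, which contains 1, and
  to endomorphism rings \<open>hom S S\<close>, whose unit is the idempotent
  \<open>fst S\<close>.\<close>

locale subrng =
  fixes R :: "'g::{ring,monoid_mult} set"
  assumes zero [simp, intro]: "0 \<in> R"
    and add [intro]: "a \<in> R \<Longrightarrow> b \<in> R \<Longrightarrow> a + b \<in> R"
    and uminus [intro]: "a \<in> R \<Longrightarrow> - a \<in> R"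
    and mult [intro]: "a \<in> R \<Longrightarrow> b \<in> R \<Longrightarrow> a * b \<in> R"
begin

lemma diff [intro]: "a \<in> R \<Longrightarrow> b \<in> R \<Longrightarrow> a - b \<in> R"
  using add[of a "- b"] uminus by simp

lemma eqv_refl: "p \<in> R \<Longrightarrow> p * p = p \<Longrightarrow> eqv R p p"
  unfolding eqv_def by blast

lemma eqv_trans:
  assumes "eqv R p q" "eqv R q r"
  shows "eqv R p r"
proof -
  obtain a b where ab: "a \<in> R" "b \<in> R" "a * b = p" "b * a = q" "p * a = a" "a * q = a" "q * b = b" "b * p = b"
    using assms(1) unfolding eqv_def by blast
  obtain c d where cd: "c \<in> R" "d \<in> R" "c * d = q" "d * c = r" "q * c = c" "c * r = c" "r * d = d" "d * q = d"
    using assms(2) unfolding eqv_def by blast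
  note s = ab(3-8) cd(3-8)
  have "a * c \<in> R" "d * b \<in> R" using ab cd by auto
  moreover have "(a * c) * (d * b) = p" "(d * b) * (a * c) = r" "p * (a * c) = a * c" "(a * c) * r = a * c"
    "r * (d * b) = d * b" "(d * b) * p = d * b"
    by (simp_all add: mult.assoc s s[THEN asr])
  ultimately show ?thesis unfolding eqv_def by blast
qed

lemma eqv_idem: "eqv R p q \<Longrightarrow> p \<in> R \<and> p * p = p"
  unfolding eqv_def by (metis mult mult.assoc)

lemma eqv_zero: "eqv R 0 q \<Longrightarrow> q = 0"
  unfolding eqv_def by force

lemma eqv_below:
  assumes "eqv R p q" "\<epsilon> \<in> R" "p * \<epsilon> = \<epsilon>" "\<epsilon> * p = \<epsilon>" "\<epsilon> * \<epsilon> = \<epsilon>"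
  obtains \<eta> where "\<eta> \<in> R" "q * \<eta> = \<eta>" "\<eta> * q = \<eta>" "\<eta> * \<eta> = \<eta>" "eqv R \<epsilon> \<eta>" "eqv R (p - \<epsilon>) (q - \<eta>)"
proof -
  obtain a b where ab: "a \<in> R" "b \<in> R" "a * b = p" "b * a = q" "p * a = a" "a * q = a" "q * b = b" "b * p = b"
    using assms(1) unfolding eqv_def by blast
  note s = ab(3-8) assms(3-5)
  \<comment> \<open>The \<open>asr\<close> copies make each equation applicable inside products that
    \<open>mult.assoc\<close> has nested to the right.\<close>
  note s = s s[THEN asr]
  let ?h = "b * \<epsilon> * a"
  have pq: "p \<in> R" "q \<in> R" "p * p = p" "q * q = q"
    using eqv_idem[OF assms(1)] eqv_idem[OF eqv_sym[OF assms(1)]] by auto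
  have 1: "eqv R \<epsilon> ?h"
    unfolding eqv_def
    by (rule bexI[of _ "\<epsilon> * a"], rule bexI[of _ "b * \<epsilon>"])
      (use ab assms(2) in \<open>auto simp: mult.assoc s\<close>)
  have 2: "eqv R (p - \<epsilon>) (q - ?h)"
    unfolding eqv_def
    by (rule bexI[of _ "(p - \<epsilon>) * a"], rule bexI[of _ "b * (p - \<epsilon>)"])
      (use ab assms(2) pq in \<open>auto simp: mult.assoc s pq(3,4) pq(3,4)[THEN asr] left_diff_distrib right_diff_distrib\<close>)
  show thesis
    by (rule that[of ?h]) (use ab assms(2) 1 2 in \<open>auto simp: mult.assoc s\<close>)
qed

text \<open>With \<open>w\<close> the inverse of \<open>p * \<epsilon> * p\<close> in the corner of
  \<open>p\<close>, the idempotent \<open>\<epsilon> * w * \<epsilon>\<close> lies below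
  \<open>\<epsilon>\<close> and its image is mapped isomorphically onto that of \<open>p\<close>.
  This image is therefore another complement of the image of \<open>q\<close>, and dividing it out
  leaves \<open>q\<close> up to equivalence.\<close>

lemma exchange:
  assumes R: "p \<in> R" "q \<in> R" "\<epsilon> \<in> R" "w \<in> R"
    and pq: "p * p = p" "q * q = q" "p * q = 0" "q * p = 0"
    and eps: "(p + q) * \<epsilon> = \<epsilon>" "\<epsilon> * (p + q) = \<epsilon>" "\<epsilon> * \<epsilon> = \<epsilon>"
    and w: "p * w = w" "w * p = w" "p * \<epsilon> * p * w = p" "w * (p * \<epsilon> * p) = p"
  obtains \<epsilon>' where "\<epsilon>' \<in> R" "\<epsilon>' * \<epsilon>' = \<epsilon>'" "\<epsilon> * \<epsilon>' = \<epsilon>'" "\<epsilon>' * \<epsilon> = \<epsilon>'"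
    "eqv R \<epsilon>' p" "eqv R (p + q - \<epsilon>') q"
proof -
  let ?e = "\<epsilon> * w * \<epsilon>"
  have p1: "p * (\<epsilon> * w) = p" using w by (simp add: mult.assoc)
  have p2: "w * (\<epsilon> * p) = p" using w by (simp add: mult.assoc[symmetric])
  have p3: "w * (\<epsilon> * w) = w" using p2 w(1) by (metis mult.assoc)
  have qw: "q * w = 0" by (metis w(1) pq(4) mult.assoc mult_zero_left)
  have wq: "w * q = 0" by (metis w(2) pq(3) mult.assoc mult_zero_right)
  have pe: "p * \<epsilon> = \<epsilon> - q * \<epsilon>" using eps(1) by (simp add: distrib_right eq_diff_eq)
  note s = pq w(1,2) eps(3) p1 p2 p3 qw wq
  have p1': "p * (\<epsilon> * (w * z)) = p * z" and p2': "w * (\<epsilon> * (p * z)) = p * z"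
    and p3': "w * (\<epsilon> * (w * z)) = w * z" for z
    using p1 p2 p3 by (metis mult.assoc)+
  note s' = s s[THEN asr] p1' p2' p3'
  have eR: "?e \<in> R" using R by auto
  have 1: "eqv R ?e p"
    unfolding eqv_def
    by (rule bexI[of _ "\<epsilon> * w"], rule bexI[of _ "p * \<epsilon>"]) (use R in \<open>auto simp: mult.assoc s'\<close>)
  have k: "(p + q) * ?e = ?e" "?e * (p + q) = ?e"
    using eps(1,2) by (simp_all add: mult.assoc) (simp_all add: mult.assoc[symmetric])
  define t where t_def: "t = p + q"
  have tt: "t * t = t" "t * p = p" "t * q = q" "p * t = p" "q * t = q" "t * \<epsilon> = \<epsilon>" "\<epsilon> * t = \<epsilon>"
      "t * w = w" "w * t = w"
    using eps pq unfolding t_def by (simp_all add: distrib_left distrib_right w(1,2) qw wq)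
  have tR: "t \<in> R" using R by (auto simp: t_def)
  note s'' = s' tt tt[THEN asr]
  \<comment> \<open>\<open>t - \<epsilon> * w\<close> projects onto the image of \<open>q\<close>
    along the image of \<open>\<epsilon> * w\<close>.\<close>
  have qtw: "q * (t - \<epsilon> * w) = t - \<epsilon> * w"
  proof -
    have "p * (t - \<epsilon> * w) = 0" by (simp add: right_diff_distrib s'')
    moreover have "q * (t - \<epsilon> * w) = t * (t - \<epsilon> * w) - p * (t - \<epsilon> * w)"
      by (simp add: t_def distrib_right)
    ultimately show ?thesis by (simp add: right_diff_distrib s'')
  qed
  have qa: "(t - ?e) * (q * ((t - \<epsilon> * w) * (t - ?e))) = t - ?e"
  proof -
    have "q * ((t - \<epsilon> * w) * (t - ?e)) = (t - \<epsilon> * w) * (t - ?e)"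
      using qtw by (metis mult.assoc)
    then show ?thesis by (simp add: left_diff_distrib right_diff_distrib mult.assoc s'')
  qed
  have 2: "eqv R (t - ?e) q"
    unfolding eqv_def
  proof (rule bexI[of _ "(t - ?e) * q"], rule bexI[of _ "(t - \<epsilon> * w) * (t - ?e)"], intro conjI)
    show "q * ((t - \<epsilon> * w) * (t - ?e)) = (t - \<epsilon> * w) * (t - ?e)"
      using qtw by (metis mult.assoc)
    show "(t - ?e) * q * ((t - \<epsilon> * w) * (t - ?e)) = t - ?e"
      using qa by (simp add: mult.assoc)
  qed (use R tR eR in \<open>auto simp: left_diff_distrib right_diff_distrib mult.assoc s''\<close>)
  show thesis
    by (rule that[of ?e]) (use eR 1 2 in \<open>auto simp: t_def mult.assoc s'\<close>)
qed

definition local_idem :: "'g \<Rightarrow> bool" where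
  "local_idem p \<longleftrightarrow> p \<in> R \<and> p * p = p \<and> p \<noteq> 0 \<and>
     (\<forall>g\<in>R. p * g = g \<longrightarrow> g * p = g \<longrightarrow> unit_in R p g \<or> unit_in R p (p - g))"

text \<open>Equivalent idempotents have isomorphic corners by \<open>g \<mapsto> b * g * a\<close>;
  an inverse \<open>w\<close> is carried back to \<open>a * w * b\<close>.\<close>

lemma local_idem_eqv:
  assumes "local_idem q" "eqv R p q"
  shows "local_idem p"
proof -
  obtain a b where ab: "a \<in> R" "b \<in> R" "a * b = p" "b * a = q" "p * a = a" "a * q = a" "q * b = b" "b * p = b"
    using assms(2) unfolding eqv_def by blast
  note s = ab(3-8) ab(3-8)[THEN asr]
  have bk: "unit_in R p g" if h: "unit_in R q (b * g * a)" "p * g = g" "g * p = g" for g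
  proof -
    obtain w where w: "w \<in> R" "q * w = w" "w * q = w" "b * g * a * w = q" "w * (b * g * a) = q"
      using h(1) by (rule unit_inE)
    have 1: "g * (a * (w * b)) = p"
    proof -
      have "a * (b * (g * (a * w))) = a" using w(4) ab(6) by (simp add: mult.assoc)
      then have "g * (a * w) = a" by (simp add: s h(2) h(2)[THEN asr] ab(3)[THEN asr])
      then have "g * (a * w) * b = a * b" by simp
      then show ?thesis using ab(3) by (simp add: mult.assoc)
    qed
    have 2: "a * (w * (b * g)) = p"
    proof -
      have "w * (b * (g * (a * b))) = b" using arg_cong[OF w(5), of "\<lambda>z. z * b"] ab(7) by (simp add: mult.assoc)
      then have "w * (b * g) = b" using ab(3) h(3) by simp
      then show ?thesis using ab(3) by simp
    qed
    show ?thesis unfolding unit_in_def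
      by (rule bexI[of _ "a * w * b"]) (use ab w 1 2 in \<open>auto simp: mult.assoc s\<close>)
  qed
  have q: "q \<noteq> 0" and loc: "\<And>g. g \<in> R \<Longrightarrow> q * g = g \<Longrightarrow> g * q = g \<Longrightarrow> unit_in R q g \<or> unit_in R q (q - g)"
    using assms(1) unfolding local_idem_def by auto
  have "p \<noteq> 0" using q ab eqv_zero assms(2) by blast
  moreover have "unit_in R p g \<or> unit_in R p (p - g)" if g: "g \<in> R" "p * g = g" "g * p = g" for g
  proof -
    have pp: "p * p = p" using eqv_idem[OF assms(2)] by simp
    have "unit_in R q (b * g * a) \<or> unit_in R q (q - b * g * a)"
      by (rule loc) (use ab g in \<open>auto simp: mult.assoc s\<close>)
    moreover have "q - b * g * a = b * (p - g) * a"
      by (simp add: right_diff_distrib left_diff_distrib mult.assoc s)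
    ultimately show ?thesis
      using bk[of g] bk[of "p - g"] g pp by (auto simp: right_diff_distrib left_diff_distrib)
  qed
  ultimately show ?thesis using eqv_idem[OF assms(2)] unfolding local_idem_def by blast
qed

lemma unit_idem_eq:
  assumes "unit_in R p g" "g * g = g" "p * g = g"
  shows "g = p"
  using assms unfolding unit_in_def by (metis mult.assoc)

lemma local_idem_trivial:
  assumes "local_idem p" "g \<in> R" "p * g = g" "g * p = g" "g * g = g"
  shows "g = 0 \<or> g = p"
proof -
  have "unit_in R p g \<or> unit_in R p (p - g)" using assms unfolding local_idem_def by blast
  moreover have "(p - g) * (p - g) = p - g" "p * (p - g) = p - g"
    using assms by (simp_all add: left_diff_distrib right_diff_distrib local_idem_def)
  ultimately show ?thesis using unit_idem_eq[of p g] unit_idem_eq[of p "p - g"] assms by auto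
qed

text \<open>Compressed to the corner of \<open>p\<close>, the idempotents \<open>\<epsilon>\<close>
  and \<open>p + q - \<epsilon>\<close> add up to \<open>p\<close>, so by locality one of the
  compressions is invertible. That idempotent is \<open>\<eta>\<close>, and \<open>exchange\<close>
  applies to it.\<close>

lemma local_exchange:
  assumes "local_idem p" "q \<in> R" "q * q = q" "p * q = 0" "q * p = 0"
    and eps: "\<epsilon> \<in> R" "(p + q) * \<epsilon> = \<epsilon>" "\<epsilon> * (p + q) = \<epsilon>" "\<epsilon> * \<epsilon> = \<epsilon>"
  obtains \<eta> \<epsilon>' where "\<eta> = \<epsilon> \<or> \<eta> = p + q - \<epsilon>" "\<epsilon>' \<in> R" "\<epsilon>' * \<epsilon>' = \<epsilon>'" "\<eta> * \<epsilon>' = \<epsilon>'" "\<epsilon>' * \<eta> = \<epsilon>'"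
    "eqv R \<epsilon>' p" "eqv R (p + q - \<epsilon>') q"
proof -
  have p: "p \<in> R" "p * p = p" using assms(1) by (auto simp: local_idem_def)
  define \<eta>' where e'_def: "\<eta>' = p + q - \<epsilon>"
  have e': "\<eta>' \<in> R" "(p + q) * \<eta>' = \<eta>'" "\<eta>' * (p + q) = \<eta>'" "\<eta>' * \<eta>' = \<eta>'"
  proof -
    have "(p + q) * (p + q) = p + q" by (simp add: distrib_left distrib_right assms p)
    then show "(p + q) * \<eta>' = \<eta>'" "\<eta>' * (p + q) = \<eta>'" "\<eta>' * \<eta>' = \<eta>'"
      using eps(2-4) unfolding e'_def by (simp_all only: left_diff_distrib right_diff_distrib) simp_all
    show "\<eta>' \<in> R" using p assms eps(1) unfolding e'_def by blast
  qed
  have sum: "p - p * \<epsilon> * p = p * \<eta>' * p"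
    unfolding e'_def by (simp add: right_diff_distrib left_diff_distrib distrib_left distrib_right p assms)
  have "unit_in R p (p * \<epsilon> * p) \<or> unit_in R p (p - p * \<epsilon> * p)"
    using assms(1) p eps(1) unfolding local_idem_def by (metis mult mult.assoc)
  then obtain \<eta> where \<eta>: "\<eta> = \<epsilon> \<or> \<eta> = p + q - \<epsilon>" "unit_in R p (p * \<eta> * p)"
    "\<eta> \<in> R" "(p + q) * \<eta> = \<eta>" "\<eta> * (p + q) = \<eta>" "\<eta> * \<eta> = \<eta>"
    using sum eps e' unfolding e'_def by metis
  obtain w where w: "w \<in> R" "p * w = w" "w * p = w" "p * \<eta> * p * w = p" "w * (p * \<eta> * p) = p"
    using \<eta>(2) unfolding unit_in_def by blast
  show thesis
    by (rule exchange[OF p(1) assms(2) \<eta>(3) w(1) p(2) assms(3-5) \<eta>(4-6) w(2-5)]) (use that[OF \<eta>(1)] in blast)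
qed

text \<open>Krull-Schmidt for two local summands. After the exchange,
  \<open>\<eta> - \<epsilon>'\<close> is an idempotent in the corner of
  \<open>p + q - \<epsilon>'\<close>, which is equivalent to \<open>q\<close> and hence local, so
  only its two trivial idempotents are possible.\<close>

lemma idem_cases:
  assumes "local_idem p" "local_idem q" "p * q = 0" "q * p = 0"
    and eps: "\<epsilon> \<in> R" "(p + q) * \<epsilon> = \<epsilon>" "\<epsilon> * (p + q) = \<epsilon>" "\<epsilon> * \<epsilon> = \<epsilon>"
  shows "\<epsilon> = 0 \<or> \<epsilon> = p + q \<or> eqv R \<epsilon> p \<and> eqv R (p + q - \<epsilon>) q \<or> eqv R \<epsilon> q \<and> eqv R (p + q - \<epsilon>) p"
proof -
  have q: "q \<in> R" "q * q = q" and p: "p \<in> R" "p * p = p" using assms by (auto simp: local_idem_def)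
  have tt: "(p + q) * (p + q) = p + q" by (simp add: distrib_left distrib_right assms p q)
  obtain \<eta> \<epsilon>' where h: "\<eta> = \<epsilon> \<or> \<eta> = p + q - \<epsilon>" "\<epsilon>' \<in> R" "\<epsilon>' * \<epsilon>' = \<epsilon>'" "\<eta> * \<epsilon>' = \<epsilon>'" "\<epsilon>' * \<eta> = \<epsilon>'"
    "eqv R \<epsilon>' p" "eqv R (p + q - \<epsilon>') q"
    using local_exchange[OF assms(1) q assms(3,4) eps] by metis
  have \<eta>: "\<eta> \<in> R" "(p + q) * \<eta> = \<eta>" "\<eta> * (p + q) = \<eta>" "\<eta> * \<eta> = \<eta>"
  proof -
    have e: "p + q - \<epsilon> \<in> R" "(p + q) * (p + q - \<epsilon>) = p + q - \<epsilon>"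
      "(p + q - \<epsilon>) * (p + q) = p + q - \<epsilon>" "(p + q - \<epsilon>) * (p + q - \<epsilon>) = p + q - \<epsilon>"
      using p q eps(1) apply blast
      using eps(2-4) tt by (simp_all only: left_diff_distrib right_diff_distrib) simp_all
    show "\<eta> \<in> R" "(p + q) * \<eta> = \<eta>" "\<eta> * (p + q) = \<eta>" "\<eta> * \<eta> = \<eta>"
      using h(1) e eps by auto
  qed
  have tz: "(p + q) * \<epsilon>' = \<epsilon>'" "\<epsilon>' * (p + q) = \<epsilon>'"
    using h \<eta> by (metis mult.assoc)+
  have l: "local_idem (p + q - \<epsilon>')" by (rule local_idem_eqv[OF assms(2) h(7)])
  define t where t_def: "t = p + q"
  have "t * \<eta> = \<eta>" "\<eta> * t = \<eta>" "t * \<epsilon>' = \<epsilon>'" "\<epsilon>' * t = \<epsilon>'" using \<eta> tz by (simp_all add: t_def)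
  then have "(t - \<epsilon>') * (\<eta> - \<epsilon>') = \<eta> - \<epsilon>'" "(\<eta> - \<epsilon>') * (t - \<epsilon>') = \<eta> - \<epsilon>'"
    "(\<eta> - \<epsilon>') * (\<eta> - \<epsilon>') = \<eta> - \<epsilon>'"
    using h(3-5) \<eta>(4) by (simp_all add: left_diff_distrib right_diff_distrib)
  moreover have "\<eta> - \<epsilon>' \<in> R" using h(2) \<eta>(1) by auto
  ultimately have "\<eta> - \<epsilon>' = 0 \<or> \<eta> - \<epsilon>' = p + q - \<epsilon>'"
    using local_idem_trivial[OF l] unfolding t_def by blast
  then show ?thesis using h(1,6,7) by auto
qed

end

text \<open>Axioms for a ring of endomorphisms of a countable power of Lambda. \<open>e1\<close> and
  \<open>e2\<close> cut out the powers of the first and of the second projective,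
  \<open>\<epsilon>1\<close> and \<open>\<epsilon>2\<close> one copy of each,
  \<open>triangular\<close> says that no map leads from the first to the second, and
  \<open>\<kappa>\<close> embeds the scalars. \<open>i1\<close>, \<open>i2\<close>,
  \<open>r1\<close>, \<open>r2\<close> place two copies of the module side by side inside itself, so
  that direct sums stay in the same ring.\<close>

locale tri_ring =
  fixes G :: "'g::{ring,monoid_mult} set" and e1 e2 \<epsilon>1 \<epsilon>2 i1 i2 r1 r2 :: 'g and \<kappa> :: "'k::field \<Rightarrow> 'g"
  assumes G_add: "a \<in> G \<Longrightarrow> b \<in> G \<Longrightarrow> a + b \<in> G"
    and G_uminus: "a \<in> G \<Longrightarrow> - a \<in> G"
    and G_mult: "a \<in> G \<Longrightarrow> b \<in> G \<Longrightarrow> a * b \<in> G"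
    and G_one: "1 \<in> G"
    and e1_G: "e1 \<in> G" and e1_idem: "e1 * e1 = e1" and e12: "e1 + e2 = 1"
    and triangular: "g \<in> G \<Longrightarrow> e2 * g * e1 = 0"
    and eps_G: "\<epsilon>1 \<in> G" "\<epsilon>2 \<in> G"
    and eps_idem: "\<epsilon>1 * \<epsilon>1 = \<epsilon>1" "\<epsilon>2 * \<epsilon>2 = \<epsilon>2" "\<epsilon>1 \<noteq> 0" "\<epsilon>2 \<noteq> 0"
    and eps_e: "e1 * \<epsilon>1 = \<epsilon>1" "\<epsilon>1 * e1 = \<epsilon>1" "e2 * \<epsilon>2 = \<epsilon>2" "\<epsilon>2 * e2 = \<epsilon>2"
    and eps_local: "\<epsilon> = \<epsilon>1 \<or> \<epsilon> = \<epsilon>2 \<Longrightarrow> g \<in> G \<Longrightarrow> \<epsilon> * g = g \<Longrightarrow> g * \<epsilon> = g \<Longrightarrow> unit_in G \<epsilon> g \<or> unit_in G \<epsilon> (\<epsilon> - g)"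
    and kap: "\<kappa> (c + d) = \<kappa> c + \<kappa> d" "\<kappa> (c * d) = \<kappa> c * \<kappa> d" "\<kappa> 1 = 1"
    and kap_G: "\<kappa> c \<in> G" and kap_comm: "g \<in> G \<Longrightarrow> \<kappa> c * g = g * \<kappa> c"
    and fin_G: "\<exists>F. finite F \<and> (\<forall>g\<in>G. (\<epsilon>1 + \<epsilon>2) * g * (\<epsilon>1 + \<epsilon>2) \<in> module.span (\<lambda>c v. \<kappa> c * v) F)"
    and iso_G: "i1 \<in> G" "i2 \<in> G" "r1 \<in> G" "r2 \<in> G"
    and iso_e: "i1 * e1 = e1 * i1" "i2 * e1 = e1 * i2" "r1 * e1 = e1 * r1" "r2 * e1 = e1 * r2"
    and iso: "r1 * i1 = 1" "r2 * i2 = 1" "r1 * i2 = 0" "r2 * i1 = 0"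
begin

sublocale vs: vector_space "\<lambda>c v. \<kappa> c * v"
  by unfold_locales (simp_all add: kap distrib_left distrib_right mult.assoc)

text \<open>The degree-preserving elements, once the second projective is put in degree -1 and the
  first in degree 0.\<close>

definition D :: "'g set" where "D = {g \<in> G. g * e1 = e1 * g}"

lemma e2_eq: "e2 = 1 - e1"
  using e12 by (simp add: algebra_simps)

lemma G_diff: "a \<in> G \<Longrightarrow> b \<in> G \<Longrightarrow> a - b \<in> G"
  using G_add[of a "- b"] G_uminus by simp

lemma G_zero: "0 \<in> G"
  using G_diff[OF G_one G_one] by simp

lemma e2_G: "e2 \<in> G"
  by (simp add: e2_eq G_diff G_one e1_G)

lemma e_simps [simp]: "e1 * e1 = e1" "e2 * e2 = e2" "e1 * e2 = 0" "e2 * e1 = 0"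
  by (simp_all add: e1_idem e2_eq right_diff_distrib left_diff_distrib)

lemmas e_simps' [simp] = e_simps[THEN asr, simplified]
lemmas eps_simps [simp] = eps_idem eps_e eps_idem(1,2)[THEN asr] eps_e[THEN asr]
lemmas iso_simps [simp] = iso iso[THEN asr, simplified]

lemma D_subrng: "subrng D"
  unfolding D_def
  by unfold_locales (auto simp: G_add G_uminus G_mult G_zero distrib_left distrib_right, metis mult.assoc)

sublocale D: subrng D by (rule D_subrng)

lemma D_G: "a \<in> D \<Longrightarrow> a \<in> G" by (simp add: D_def)

lemma D_e1: "a \<in> D \<Longrightarrow> a * e1 = e1 * a" by (simp add: D_def)
lemma D_e2: "a \<in> D \<Longrightarrow> a * e2 = e2 * a" by (simp add: e2_eq D_e1 algebra_simps)

lemma eps_D [simp, intro]: "\<epsilon>1 \<in> D" "\<epsilon>2 \<in> D"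
proof -
  have "\<epsilon>2 * e1 = 0" "e1 * \<epsilon>2 = 0"
    using eps_e(3,4) by (simp_all add: e2_eq left_diff_distrib right_diff_distrib)
  then show "\<epsilon>1 \<in> D" "\<epsilon>2 \<in> D" by (simp_all add: D_def eps_G)
qed

lemma one_D [simp, intro]: "1 \<in> D" by (simp add: D_def G_one)
lemma e_D [simp, intro]: "e1 \<in> D" "e2 \<in> D" by (simp_all add: D_def e1_G e2_G)
lemma iso_D [simp, intro]: "i1 \<in> D" "i2 \<in> D" "r1 \<in> D" "r2 \<in> D" by (simp_all add: D_def iso_G iso_e)
lemma kap_D [simp, intro]: "\<kappa> c \<in> D" by (simp add: D_def kap_G kap_comm e1_G)

lemma eps_e0 [simp]: "e1 * \<epsilon>2 = 0" "\<epsilon>2 * e1 = 0" "e2 * \<epsilon>1 = 0" "\<epsilon>1 * e2 = 0"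
  by (metis eps_e e_simps mult.assoc mult_zero_left mult_zero_right)+

lemmas eps_e0' [simp] = eps_e0[THEN asr, simplified]

text \<open>Locality is given in \<open>G\<close>. An inverse in the corner of
  \<open>\<epsilon>1\<close> or \<open>\<epsilon>2\<close> lives on one side of
  \<open>e1 + e2 = 1\<close>, hence commutes with \<open>e1\<close> and belongs to
  \<open>D\<close>.\<close>

lemma eps_local_idem: "D.local_idem \<epsilon>1" "D.local_idem \<epsilon>2"
proof -
  have bk: "unit_in D \<epsilon> g" if h: "unit_in G \<epsilon> g" "\<epsilon> = \<epsilon>1 \<or> \<epsilon> = \<epsilon>2" for \<epsilon> g
  proof -
    obtain w where w: "w \<in> G" "\<epsilon> * w = w" "w * \<epsilon> = w" "g * w = \<epsilon>" "w * g = \<epsilon>"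
      using h(1) by (rule unit_inE)
    have "w * e1 = e1 * w"
      using h(2)
    proof
      assume e: "\<epsilon> = \<epsilon>1"
      have "w * e1 = w" using w(3) e by (metis eps_e(2) mult.assoc)
      moreover have "e1 * w = w" using w(2) e by (metis eps_e(1) mult.assoc)
      ultimately show ?thesis by simp
    next
      assume e: "\<epsilon> = \<epsilon>2"
      have "w * e1 = 0" using w(3) e by (metis eps_e0(2) mult.assoc mult_zero_right)
      moreover have "e1 * w = 0" using w(2) e by (metis eps_e0(1) mult.assoc mult_zero_left)
      ultimately show ?thesis by simp
    qed
    then have "w \<in> D" using w by (simp add: D_def)
    then show ?thesis using w unfolding unit_in_def by auto
  qed
  show "D.local_idem \<epsilon>1" "D.local_idem \<epsilon>2"
    unfolding D.local_idem_def using eps_local bk D_G by (simp, blast)+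
qed

lemma not_eqv_eps: "eqv D p \<epsilon>1 \<Longrightarrow> eqv D p \<epsilon>2 \<Longrightarrow> False"
proof -
  assume "eqv D p \<epsilon>1" "eqv D p \<epsilon>2"
  then have "eqv D \<epsilon>1 \<epsilon>2" using D.eqv_trans eqv_sym by blast
  then obtain a b where a: "a \<in> D" "a * b = \<epsilon>1" "\<epsilon>1 * a = a" "a * \<epsilon>2 = a"
    unfolding eqv_def by auto
  have "a = e1 * a" using a(3) by (metis eps_e(1) mult.assoc)
  also have "\<dots> = a * e1" using D_e1[OF a(1)] by simp
  also have "\<dots> = 0" using a(4) by (metis eps_e0(2) mult.assoc mult_zero_right)
  finally show False using a(2) by simp
qed

subsection \<open>Ranks\<close>

definition simple :: "'g \<Rightarrow> nat \<Rightarrow> nat \<Rightarrow> bool" where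
  "simple p a b \<longleftrightarrow> (eqv D p \<epsilon>1 \<and> a = 1 \<and> b = 0) \<or> (eqv D p \<epsilon>2 \<and> a = 0 \<and> b = 1)"

inductive rk :: "'g \<Rightarrow> nat \<Rightarrow> nat \<Rightarrow> bool" where
  rk_0: "rk 0 0 0"
| rk_step: "rk s m n \<Longrightarrow> simple p a b \<Longrightarrow> p * s = 0 \<Longrightarrow> s * p = 0 \<Longrightarrow> rk (p + s) (a + m) (b + n)"

lemma simple_idem: "simple p a b \<Longrightarrow> p \<in> D \<and> p * p = p"
  unfolding simple_def using D.eqv_idem by blast

lemma simple_local: "simple p a b \<Longrightarrow> D.local_idem p"
  unfolding simple_def using D.local_idem_eqv eps_local_idem by blast

lemma simple_eqv: "simple p a b \<Longrightarrow> eqv D p q \<Longrightarrow> simple q a b"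
  unfolding simple_def using D.eqv_trans eqv_sym by blast

lemma simple_unique: "simple p a b \<Longrightarrow> simple p c d \<Longrightarrow> a = c \<and> b = d"
  unfolding simple_def using not_eqv_eps by blast

lemma simple_same: "simple p a b \<Longrightarrow> simple q a b \<Longrightarrow> eqv D p q"
  unfolding simple_def using D.eqv_trans eqv_sym by (metis zero_neq_one)

lemma simple_nonzero: "simple p a b \<Longrightarrow> p \<noteq> 0"
  using simple_local unfolding D.local_idem_def by blast

lemma rk_idem: "rk s m n \<Longrightarrow> s \<in> D \<and> s * s = s"
  by (induction rule: rk.induct) (auto simp: distrib_left distrib_right dest: simple_idem)

lemma rk_zero_iff: "rk s m n \<Longrightarrow> m = 0 \<Longrightarrow> n = 0 \<Longrightarrow> s = 0"
  by (induction rule: rk.induct) (auto simp: simple_def)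

lemma rk_0_unique: "rk s m n \<Longrightarrow> s = 0 \<Longrightarrow> m = 0 \<and> n = 0"
proof (induction rule: rk.induct)
  case (rk_step s m n p a b)
  then have "p = 0" using simple_idem[OF rk_step(2)] by (metis add.right_neutral distrib_left mult_zero_right)
  then show ?case using simple_nonzero rk_step by blast
qed simp

lemma eqv_split:
  assumes "eqv D (p + s) t" "p \<in> D" "p * p = p" "s \<in> D" "s * s = s" "p * s = 0" "s * p = 0"
  obtains p' s' where "t = p' + s'" "eqv D p p'" "eqv D s s'" "p' * s' = 0" "s' * p' = 0"
proof -
  obtain \<eta> where h: "\<eta> \<in> D" "t * \<eta> = \<eta>" "\<eta> * t = \<eta>" "\<eta> * \<eta> = \<eta>" "eqv D p \<eta>" "eqv D (p + s - p) (t - \<eta>)"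
    by (rule D.eqv_below[OF assms(1,2)]) (use assms in \<open>auto simp: distrib_left distrib_right\<close>)
  show thesis
    by (rule that[of \<eta> "t - \<eta>"]) (use h in \<open>auto simp: left_diff_distrib right_diff_distrib\<close>)
qed

lemma rk_eqv: "rk s m n \<Longrightarrow> eqv D s t \<Longrightarrow> rk t m n"
proof (induction arbitrary: t rule: rk.induct)
  case rk_0
  then show ?case using D.eqv_zero rk.rk_0 by blast
next
  case (rk_step s m n p a b)
  obtain p' s' where h: "t = p' + s'" "eqv D p p'" "eqv D s s'" "p' * s' = 0" "s' * p' = 0"
    using eqv_split[OF rk_step(6)] simple_idem[OF rk_step(2)] rk_idem[OF rk_step(1)] rk_step(3,4) by metis
  then show ?case using rk.rk_step[OF rk_step(5)[OF h(3)] simple_eqv[OF rk_step(2) h(2)] h(4,5)] by simp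
qed

lemma eqv_add:
  assumes "eqv D p p'" "eqv D s s'" "p * s = 0" "s * p = 0" "p' * s' = 0" "s' * p' = 0"
  shows "eqv D (p + s) (p' + s')"
proof -
  obtain a b where ab: "a \<in> D" "b \<in> D" "a * b = p" "b * a = p'" "p * a = a" "a * p' = a" "p' * b = b" "b * p = b"
    using assms(1) unfolding eqv_def by auto
  obtain c d where cd: "c \<in> D" "d \<in> D" "c * d = s" "d * c = s'" "s * c = c" "c * s' = c" "s' * d = d" "d * s = d"
    using assms(2) unfolding eqv_def by auto
  have z: "a * d = 0" "c * b = 0" "b * c = 0" "d * a = 0" "p * c = 0" "s * a = 0" "a * s' = 0" "c * p' = 0"
    "p' * d = 0" "s' * b = 0" "b * s = 0" "d * p = 0"
    using ab cd assms by (metis mult.assoc mult_zero_left mult_zero_right)+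
  show ?thesis
    unfolding eqv_def
    by (rule bexI[of _ "a + c"], rule bexI[of _ "b + d"]) (use ab cd z in \<open>auto simp: distrib_left distrib_right\<close>)
qed

lemma rk_add: "rk s m n \<Longrightarrow> rk t m' n' \<Longrightarrow> s * t = 0 \<Longrightarrow> t * s = 0 \<Longrightarrow> rk (s + t) (m + m') (n + n')"
proof (induction rule: rk.induct)
  case (rk_step s m n p a b)
  have "p = p * (p + s)" "p = (p + s) * p" "s = s * (p + s)" "s = (p + s) * s"
    using rk_step rk_idem[OF rk_step(1)] simple_idem[OF rk_step(2)] by (simp_all add: distrib_left distrib_right)
  then have z: "p * t = 0" "t * p = 0" "s * t = 0" "t * s = 0"
    using rk_step by (metis mult.assoc mult_zero_left mult_zero_right)+
  have "rk (s + t) (m + m') (n + n')" using rk_step z by auto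
  from rk.rk_step[OF this rk_step(2)] show ?case using z rk_step by (simp add: distrib_left distrib_right add.assoc)
qed simp

text \<open>Idempotents of finite rank split into pieces of finite rank: projective modules over the
  local rings \<open>A\<close> and \<open>B\<close> are free.\<close>

lemma rk_split:
  "rk s m n \<Longrightarrow> \<epsilon> \<in> D \<Longrightarrow> s * \<epsilon> = \<epsilon> \<Longrightarrow> \<epsilon> * s = \<epsilon> \<Longrightarrow> \<epsilon> * \<epsilon> = \<epsilon> \<Longrightarrow>
    \<exists>a b c d. rk \<epsilon> a b \<and> rk (s - \<epsilon>) c d \<and> a + c = m \<and> b + d = n"
proof (induction arbitrary: \<epsilon> rule: rk.induct)
  case rk_0
  then show ?case using rk.rk_0 by auto
next
  case (rk_step s m n p x y)
  note p = simple_idem[OF rk_step(2)] rk_idem[OF rk_step(1)]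
  obtain \<eta> \<epsilon>' where h: "\<eta> = \<epsilon> \<or> \<eta> = p + s - \<epsilon>" "\<epsilon>' \<in> D" "\<epsilon>' * \<epsilon>' = \<epsilon>'" "\<eta> * \<epsilon>' = \<epsilon>'" "\<epsilon>' * \<eta> = \<epsilon>'"
    "eqv D \<epsilon>' p" "eqv D (p + s - \<epsilon>') s"
    using D.local_exchange[OF simple_local[OF rk_step(2)] _ _ rk_step(3,4) rk_step(6,7,8,9)] p by blast
  obtain a b c d where k: "rk \<eta> a b" "rk (p + s - \<eta>) c d" "a + c = x + m" "b + d = y + n"
  proof -
    define t where t_def: "t = p + s"
    have tD: "t \<in> D" using p unfolding t_def by blast
    have tt: "t * t = t" using p rk_step(3,4) unfolding t_def by (simp add: distrib_left distrib_right)
    have e: "t * \<epsilon> = \<epsilon>" "\<epsilon> * t = \<epsilon>" using rk_step unfolding t_def by auto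
    have \<eta>: "\<eta> \<in> D" "t * \<eta> = \<eta>" "\<eta> * t = \<eta>" "\<eta> * \<eta> = \<eta>"
      using h(1) rk_step(6,9) e tt tD unfolding t_def[symmetric] by (auto simp: left_diff_distrib right_diff_distrib)
    have et: "t * \<epsilon>' = \<epsilon>'" "\<epsilon>' * t = \<epsilon>'" using \<eta> h by (metis mult.assoc)+
    have q: "eqv D (t - \<epsilon>') s" using h(7) by (simp add: t_def)
    \<comment> \<open>\<open>\<eta> - \<epsilon>'\<close> sits below \<open>t - \<epsilon>'\<close>,
      which is equivalent to \<open>s\<close>; its transport \<open>\<zeta>\<close> falls under the
      induction hypothesis.\<close>
    obtain \<zeta> where z: "\<zeta> \<in> D" "s * \<zeta> = \<zeta>" "\<zeta> * s = \<zeta>" "\<zeta> * \<zeta> = \<zeta>"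
       "eqv D (\<eta> - \<epsilon>') \<zeta>" "eqv D (t - \<epsilon>' - (\<eta> - \<epsilon>')) (s - \<zeta>)"
      by (rule D.eqv_below[OF q, of "\<eta> - \<epsilon>'"]) (use h \<eta> et in \<open>auto simp: left_diff_distrib right_diff_distrib\<close>)
    obtain a b c d where k: "rk \<zeta> a b" "rk (s - \<zeta>) c d" "a + c = m" "b + d = n"
      using rk_step(5)[OF z(1-4)] by auto
    have 1: "rk (\<eta> - \<epsilon>') a b" "rk (t - \<eta>) c d"
      using rk_eqv[OF k(1) eqv_sym[OF z(5)]] rk_eqv[OF k(2) eqv_sym[OF z(6)]] by simp_all
    have "rk (\<epsilon>' + (\<eta> - \<epsilon>')) (x + a) (y + b)"
      by (rule rk.rk_step[OF 1(1) simple_eqv[OF rk_step(2) eqv_sym[OF h(6)]]])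
        (use h in \<open>auto simp: left_diff_distrib right_diff_distrib\<close>)
    then show thesis using 1 k by (intro that[of "x + a" "y + b" c d]) (auto simp: t_def)
  qed
  show ?case using h(1)
  proof
    assume "\<eta> = \<epsilon>" then show ?case using k by blast
  next
    assume "\<eta> = p + s - \<epsilon>"
    then have "rk \<epsilon> c d" "rk (p + s - \<epsilon>) a b" using k by simp_all
    then show ?case using k(3,4) by (metis add.commute)
  qed
qed

lemma rk_local:
  assumes "rk p a b" "D.local_idem p"
  shows "simple p a b"
  using assms(1)
proof cases
  case rk_0
  then show ?thesis using assms(2) by (simp add: D.local_idem_def)
next
  case (rk_step s m n p' x y)
  note p' = simple_idem[OF rk_step(5)]
  have "p' = 0 \<or> p' = p"
    by (rule D.local_idem_trivial[OF assms(2)]) (use p' rk_step in \<open>auto simp: distrib_left distrib_right\<close>)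
  then have "p' = p" using simple_nonzero rk_step by blast
  then have "s = 0" using rk_step by simp
  then have "m = 0 \<and> n = 0" using rk_0_unique rk_step(4) by blast
  then show ?thesis using rk_step \<open>p' = p\<close> by simp
qed

lemma rk_remove:
  assumes "rk (p + s) m n" "simple p a b" "s \<in> D" "s * s = s" "p * s = 0" "s * p = 0"
  obtains c d where "rk s c d" "m = a + c" "n = b + d"
proof -
  note p = simple_idem[OF assms(2)]
  have "\<exists>a b c d. rk p a b \<and> rk (p + s - p) c d \<and> a + c = m \<and> b + d = n"
    by (rule rk_split[OF assms(1)]) (use p assms in \<open>auto simp: distrib_left distrib_right\<close>)
  then obtain a' b' c d where k: "rk p a' b'" "rk s c d" "a' + c = m" "b' + d = n" by auto
  have "a' = a \<and> b' = b"
    using simple_unique[OF rk_local[OF k(1) simple_local[OF assms(2)]] assms(2)] .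
  then show thesis using that k by blast
qed

lemma rk_unique: "rk s m n \<Longrightarrow> rk s m' n' \<Longrightarrow> m = m' \<and> n = n'"
proof (induction arbitrary: m' n' rule: rk.induct)
  case rk_0
  then show ?case using rk_0_unique by blast
next
  case (rk_step s m n p a b)
  then show ?case using rk_remove[OF rk_step(6,2)] rk_idem[OF rk_step(1)] by metis
qed

lemma rk_eps: "rk \<epsilon>1 1 0" "rk \<epsilon>2 0 1"
  using rk.rk_step[OF rk.rk_0, of \<epsilon>1 1 0] rk.rk_step[OF rk.rk_0, of \<epsilon>2 0 1] D.eqv_refl
  by (simp_all add: simple_def)

text \<open>The summands can be taken in any order: one of the prescribed type is moved to the front
  of \<open>t\<close>. Comparing two decompositions piece by piece then shows that the rank
  determines an idempotent up to equivalence.\<close>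

lemma rk_extract:
  assumes "rk t m' n'" "m' = a + m" "n' = b + n" "(a = 1 \<and> b = 0) \<or> (a = 0 \<and> b = 1)"
  shows "\<exists>q u. t = q + u \<and> rk u m n \<and> simple q a b \<and> q * u = 0 \<and> u * q = 0"
  using assms
proof (induction arbitrary: m n rule: rk.induct)
  case (rk_step u m' n' q c d)
  show ?case
  proof (cases "c = a \<and> d = b")
    case True
    then show ?thesis using rk_step by (intro exI[of _ q] exI[of _ u]) auto
  next
    case False
    then obtain m0 n0 where mn: "m' = a + m0" "n' = b + n0" "m = c + m0" "n = d + n0"
      using rk_step(2,6,7,8) that[of "m' - a" "n' - b"] by (auto simp: simple_def)
    obtain q' u' where h: "u = q' + u'" "rk u' m0 n0" "simple q' a b" "q' * u' = 0" "u' * q' = 0"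
      using rk_step(5)[OF mn(1,2) rk_step(8)] by blast
    note q'2 = simple_idem[OF h(3)] rk_idem[OF h(2)]
    have "q' = q' * u" "q' = u * q'" "u' = u' * u" "u' = u * u'"
      using h q'2 by (simp_all add: distrib_left distrib_right)
    then have z: "q * q' = 0" "q' * q = 0" "q * u' = 0" "u' * q = 0"
      using rk_step by (metis mult.assoc mult_zero_left mult_zero_right)+
    have "rk (q + u') m n" using rk.rk_step[OF h(2) rk_step(2) z(3,4)] mn by simp
    then show ?thesis
      using z h by (intro exI[of _ q'] exI[of _ "q + u'"]) (auto simp: distrib_left distrib_right add.assoc add.left_commute)
  qed
qed auto

lemma rk_eqv_same: "rk s m n \<Longrightarrow> rk t m n \<Longrightarrow> eqv D s t"
proof (induction arbitrary: t rule: rk.induct)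
  case rk_0
  then have "t = 0" using rk_zero_iff by blast
  then show ?case using D.eqv_refl[of 0] by simp
next
  case (rk_step s m n p a b)
  obtain q u where "t = q + u" "rk u m n" "simple q a b" "q * u = 0" "u * q = 0"
    using rk_extract[OF rk_step(6) refl refl] rk_step(2) unfolding simple_def by blast
  then show ?case using eqv_add simple_same rk_step by metis
qed

subsection \<open>Finite dimensionality\<close>

text \<open>Finite dimension over the field of the space of maps from \<open>t\<close> to
  \<open>s\<close>.\<close>

definition fdim :: "'g \<Rightarrow> 'g \<Rightarrow> bool" where
  "fdim s t \<longleftrightarrow> (\<exists>F. finite F \<and> (\<forall>g\<in>G. s * g * t \<in> vs.span F))"

lemma kap_span_mult:
  assumes "x \<in> vs.span F" "a \<in> G"
  shows "a * x * b \<in> vs.span ((\<lambda>x. a * x * b) ` F)"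
  using assms(1)
proof (induction rule: vs.span_induct_alt)
  case base
  then show ?case by (simp add: vs.span_zero)
next
  case (step c x y)
  have "a * (\<kappa> c * x + y) * b = \<kappa> c * (a * x * b) + a * y * b"
    by (simp add: distrib_left distrib_right mult.assoc[symmetric] kap_comm[OF assms(2)])
  then show ?case
    using step by (simp add: vs.span_add vs.span_scale vs.span_base)
qed

lemma fdim_add1: "fdim s u \<Longrightarrow> fdim t u \<Longrightarrow> fdim (s + t) u"
  unfolding fdim_def
proof (elim exE conjE)
  fix F F' assume h: "finite F" "\<forall>g\<in>G. s * g * u \<in> vs.span F" "finite F'" "\<forall>g\<in>G. t * g * u \<in> vs.span F'"
  have "(s + t) * g * u \<in> vs.span (F \<union> F')" if "g \<in> G" for g
    using h that vs.span_mono[of F "F \<union> F'"] vs.span_mono[of F' "F \<union> F'"]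
    by (auto simp: distrib_right intro!: vs.span_add)
  then show "\<exists>F. finite F \<and> (\<forall>g\<in>G. (s + t) * g * u \<in> vs.span F)" using h by blast
qed

lemma fdim_add2: "fdim s t \<Longrightarrow> fdim s u \<Longrightarrow> fdim s (t + u)"
  unfolding fdim_def
proof (elim exE conjE)
  fix F F' assume h: "finite F" "\<forall>g\<in>G. s * g * t \<in> vs.span F" "finite F'" "\<forall>g\<in>G. s * g * u \<in> vs.span F'"
  have "s * g * (t + u) \<in> vs.span (F \<union> F')" if "g \<in> G" for g
    using h that vs.span_mono[of F "F \<union> F'"] vs.span_mono[of F' "F \<union> F'"]
    by (auto simp: distrib_left intro!: vs.span_add)
  then show "\<exists>F. finite F \<and> (\<forall>g\<in>G. s * g * (t + u) \<in> vs.span F)" using h by blast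
qed

lemma fdim_mult: "fdim s t \<Longrightarrow> s' = a * s * b \<Longrightarrow> t' = c * t * d \<Longrightarrow> a \<in> G \<Longrightarrow> b \<in> G \<Longrightarrow> c \<in> G \<Longrightarrow> fdim s' t'"
  unfolding fdim_def
proof (elim exE conjE)
  fix F assume h: "s' = a * s * b" "t' = c * t * d" "a \<in> G" "b \<in> G" "c \<in> G" "finite F" "\<forall>g\<in>G. s * g * t \<in> vs.span F"
  have "s' * g * t' \<in> vs.span ((\<lambda>x. a * x * d) ` F)" if "g \<in> G" for g
  proof -
    have "s * (b * g * c) * t \<in> vs.span F" using h that by (auto intro: G_mult)
    from kap_span_mult[OF this h(3), of d] show ?thesis using h by (simp add: mult.assoc)
  qed
  then show "\<exists>F. finite F \<and> (\<forall>g\<in>G. s' * g * t' \<in> vs.span F)" using h by blast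
qed

lemma fdim_eps: "\<epsilon> = \<epsilon>1 \<or> \<epsilon> = \<epsilon>2 \<Longrightarrow> \<eta> = \<epsilon>1 \<or> \<eta> = \<epsilon>2 \<Longrightarrow> fdim \<epsilon> \<eta>"
proof -
  assume "\<epsilon> = \<epsilon>1 \<or> \<epsilon> = \<epsilon>2" "\<eta> = \<epsilon>1 \<or> \<eta> = \<epsilon>2"
  have z: "\<epsilon>1 * \<epsilon>2 = 0" "\<epsilon>2 * \<epsilon>1 = 0" by (metis eps_e eps_e0 mult.assoc mult_zero_left)+
  have "fdim (\<epsilon>1 + \<epsilon>2) (\<epsilon>1 + \<epsilon>2)" using fin_G by (simp add: fdim_def)
  then show "fdim \<epsilon> \<eta>"
    by (rule fdim_mult[of _ _ _ \<epsilon> \<epsilon> _ \<eta> \<eta>])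
      (use \<open>\<epsilon> = \<epsilon>1 \<or> \<epsilon> = \<epsilon>2\<close> \<open>\<eta> = \<epsilon>1 \<or> \<eta> = \<epsilon>2\<close> z in \<open>auto simp: eps_G distrib_left distrib_right\<close>)
qed

lemma eqv_factor:
  assumes "eqv D p \<epsilon>"
  obtains a b where "a \<in> D" "b \<in> D" "p = a * \<epsilon> * b" "b * a = \<epsilon>"
  using assms unfolding eqv_def by metis

lemma fdim_simple1:
  assumes "simple p a b" "fdim \<epsilon>1 t" "fdim \<epsilon>2 t"
  shows "fdim p t"
proof -
  obtain \<epsilon> where e: "eqv D p \<epsilon>" "fdim \<epsilon> t" using assms unfolding simple_def by blast
  obtain a b where "a \<in> D" "b \<in> D" "p = a * \<epsilon> * b" using eqv_factor[OF e(1)] .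
  then show ?thesis by (intro fdim_mult[OF e(2), of p a b t 1 1]) (auto simp: D_G G_one)
qed

lemma fdim_simple2:
  assumes "simple p a b" "fdim t \<epsilon>1" "fdim t \<epsilon>2"
  shows "fdim t p"
proof -
  obtain \<epsilon> where e: "eqv D p \<epsilon>" "fdim t \<epsilon>" using assms unfolding simple_def by blast
  obtain a b where "a \<in> D" "b \<in> D" "p = a * \<epsilon> * b" using eqv_factor[OF e(1)] .
  then show ?thesis by (intro fdim_mult[OF e(2), of t 1 1 p a b]) (auto simp: D_G G_one)
qed

lemma fdim_rk:
  assumes "rk s m n" "rk t m' n'"
  shows "fdim s t"
proof -
  have 0: "fdim \<epsilon> t" if e: "\<epsilon> = \<epsilon>1 \<or> \<epsilon> = \<epsilon>2" for \<epsilon>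
    using assms(2)
  proof (induction rule: rk.induct)
    case rk_0
    show ?case unfolding fdim_def by (intro exI[of _ "{}"]) (simp add: vs.span_zero)
  next
    case (rk_step s m n p a b)
    show ?case by (rule fdim_add2[OF fdim_simple2[OF rk_step(2)] rk_step(5)]) (use fdim_eps e in auto)
  qed
  show ?thesis using assms(1)
  proof (induction rule: rk.induct)
    case rk_0
    show ?case unfolding fdim_def by (intro exI[of _ "{}"]) (simp add: vs.span_zero)
  next
    case (rk_step s m n p a b)
    show ?case by (rule fdim_add1[OF fdim_simple1[OF rk_step(2)] rk_step(5)]) (use 0 in auto)
  qed
qed

subsection \<open>Two-term complexes\<close>

text \<open>The pair \<open>(s, x)\<close> stands for the complex \<open>e2 s \<rightarrow> e1 s\<close> with differential \<open>x\<close>, concentrated in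
  degrees -1 and 0. A diagonal element is a pair of degreewise maps, which explains \<open>hom\<close>; there are no
  homotopies because there are no maps from the first to the second projective.\<close>

definition obj :: "'g \<times> 'g \<Rightarrow> bool" where
  "obj S \<longleftrightarrow> fst S \<in> D \<and> fst S * fst S = fst S \<and> snd S \<in> G \<and> e1 * snd S = snd S \<and> snd S * e2 = snd S \<and>
     fst S * snd S = snd S \<and> snd S * fst S = snd S"

definition dmap :: "'g \<times> 'g \<Rightarrow> 'g \<times> 'g \<Rightarrow> 'g set" where
  "dmap S T = {a \<in> D. fst T * a = a \<and> a * fst S = a}"

text \<open>The differential of the Hom complex, from degreewise maps to the degree 1 maps
  \<open>hx S T\<close>. Its kernel consists of the chain maps.\<close>

definition del :: "'g \<times> 'g \<Rightarrow> 'g \<times> 'g \<Rightarrow> 'g \<Rightarrow> 'g" where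
  "del S T a = a * snd S - snd T * a"

definition hom :: "'g \<times> 'g \<Rightarrow> 'g \<times> 'g \<Rightarrow> 'g set" where
  "hom S T = {a \<in> dmap S T. del S T a = 0}"

definition hx :: "'g \<times> 'g \<Rightarrow> 'g \<times> 'g \<Rightarrow> 'g set" where
  "hx S T = {z \<in> G. e1 * z = z \<and> z * e2 = z \<and> fst T * z = z \<and> z * fst S = z}"

text \<open>This is Hom(S, T[1]) = 0. The components of \<open>a\<close> in degrees -1 and 0 are the
  two halves of a null homotopy of \<open>z\<close>.\<close>

definition ext0 :: "'g \<times> 'g \<Rightarrow> 'g \<times> 'g \<Rightarrow> bool" where
  "ext0 S T \<longleftrightarrow> (\<forall>z\<in>hx S T. \<exists>a\<in>dmap S T. z = del S T a)"

lemma D_power: "a \<in> D \<Longrightarrow> a ^ n \<in> D"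
  by (induction n) auto

lemma homI: "a \<in> D \<Longrightarrow> fst T * a = a \<Longrightarrow> a * fst S = a \<Longrightarrow> a * snd S = snd T * a \<Longrightarrow> a \<in> hom S T"
  by (simp add: hom_def dmap_def del_def)

lemma homD:
  assumes "a \<in> hom S T"
  shows "a \<in> D" "fst T * a = a" "a * fst S = a" "a * snd S = snd T * a" "a \<in> dmap S T" "del S T a = 0"
  using assms by (simp_all add: hom_def dmap_def del_def)

lemma dmapD:
  assumes "a \<in> dmap S T"
  shows "a \<in> D" "fst T * a = a" "a * fst S = a"
  using assms by (simp_all add: dmap_def)

lemma objD:
  assumes "obj S"
  shows "fst S \<in> D" "fst S * fst S = fst S" "snd S \<in> G" "e1 * snd S = snd S" "snd S * e2 = snd S"
    "fst S * snd S = snd S" "snd S * fst S = snd S"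
  using assms by (simp_all add: obj_def)

lemma dmap_comp: "a \<in> dmap T U \<Longrightarrow> b \<in> dmap S T \<Longrightarrow> a * b \<in> dmap S U"
  by (auto simp: dmap_def mult.assoc) (simp add: mult.assoc[symmetric])

lemma dmap_add: "a \<in> dmap S T \<Longrightarrow> b \<in> dmap S T \<Longrightarrow> a + b \<in> dmap S T"
  by (auto simp: dmap_def distrib_left distrib_right)

lemma dmap_diff: "a \<in> dmap S T \<Longrightarrow> b \<in> dmap S T \<Longrightarrow> a - b \<in> dmap S T"
  by (auto simp: dmap_def left_diff_distrib right_diff_distrib)

lemma dmap_zero: "0 \<in> dmap S T"
  by (auto simp: dmap_def)

lemma dmap_id: "obj S \<Longrightarrow> fst S \<in> dmap S S"
  by (auto simp: dmap_def obj_def)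

lemma del_add: "del S T (a + b) = del S T a + del S T b"
  by (simp add: del_def distrib_left distrib_right)

lemma del_diff: "del S T (a - b) = del S T a - del S T b"
  by (simp add: del_def left_diff_distrib right_diff_distrib)

lemma del_zero [simp]: "del S T 0 = 0"
  by (simp add: del_def)

lemma del_comp_left: "c \<in> hom T U \<Longrightarrow> del S U (c * a) = c * del S T a"
  by (simp add: del_def right_diff_distrib mult.assoc[symmetric] homD(4)[symmetric])

lemma del_comp_right: "d \<in> hom U S \<Longrightarrow> del U T (a * d) = del S T a * d"
  by (simp add: del_def left_diff_distrib mult.assoc homD(4))

lemma hom_comp: "a \<in> hom T U \<Longrightarrow> b \<in> hom S T \<Longrightarrow> a * b \<in> hom S U"
  using del_comp_left[of a T U S b] dmap_comp[of a T U b S] by (simp add: hom_def)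

lemma hom_add: "a \<in> hom S T \<Longrightarrow> b \<in> hom S T \<Longrightarrow> a + b \<in> hom S T"
  by (simp add: hom_def dmap_add del_add)

lemma hom_diff: "a \<in> hom S T \<Longrightarrow> b \<in> hom S T \<Longrightarrow> a - b \<in> hom S T"
  by (simp add: hom_def dmap_diff del_diff)

lemma hom_zero: "0 \<in> hom S T"
  by (simp add: hom_def dmap_zero)

lemma hom_uminus: "a \<in> hom S T \<Longrightarrow> - a \<in> hom S T"
  using hom_diff[OF hom_zero, of a S T] by simp

lemma hom_id: "obj S \<Longrightarrow> fst S \<in> hom S S"
  by (simp add: hom_def dmap_id del_def objD)

lemma hom_kap: "a \<in> hom S T \<Longrightarrow> obj T \<Longrightarrow> \<kappa> c * a \<in> hom S T"
  by (rule homI) (auto simp: homD objD mult.assoc mult.assoc[symmetric, of _ "\<kappa> c"] kap_comm[symmetric] D_G[OF objD(1)])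

lemma hom_subrng: "subrng (hom S S)"
  by unfold_locales (auto intro: hom_zero hom_add hom_uminus hom_comp)

lemma hom_power: "a \<in> hom S S \<Longrightarrow> 0 < N \<Longrightarrow> a ^ N \<in> hom S S"
proof (induction N)
  case (Suc N)
  then show ?case by (cases N) (auto intro: hom_comp)
qed simp

lemma del_hx: "obj S \<Longrightarrow> obj T \<Longrightarrow> a \<in> dmap S T \<Longrightarrow> del S T a \<in> hx S T"
proof -
  assume h: "obj S" "obj T" "a \<in> dmap S T"
  note d = objD[OF h(1)] objD[OF h(2)] dmapD[OF h(3)]
  have 1: "e1 * a = a * e1" "a * e2 = e2 * a" using D_e1 D_e2 d(15) by simp_all
  have "e1 * (a * snd S) = a * snd S" using 1 d by (metis mult.assoc)
  moreover have "snd T * a * e2 = snd T * a" using 1 d by (metis mult.assoc)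
  ultimately show ?thesis
    unfolding hx_def del_def using d
    by (auto simp: left_diff_distrib right_diff_distrib mult.assoc d(16)[THEN asr] d(13)[THEN asr] d(11)[THEN asr]
          intro!: G_diff G_mult D_G[OF d(15)])
qed

lemma hxD:
  assumes "z \<in> hx S T"
  shows "z \<in> G" "e1 * z = z" "z * e2 = z" "fst T * z = z" "z * fst S = z"
  using assms by (simp_all add: hx_def)

lemma hx_left: "z \<in> hx S T \<Longrightarrow> a \<in> dmap T U \<Longrightarrow> a * z \<in> hx S U"
proof -
  assume h: "z \<in> hx S T" "a \<in> dmap T U"
  note d = hxD[OF h(1)] dmapD[OF h(2)]
  have "e1 * (a * z) = a * e1 * z" using D_e1[OF d(6)] by (simp add: mult.assoc[symmetric])
  then show ?thesis
    using d unfolding hx_def by (auto simp: mult.assoc d(7)[THEN asr] intro!: G_mult D_G[OF d(6)])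
qed

lemma hx_right: "z \<in> hx S T \<Longrightarrow> a \<in> dmap U S \<Longrightarrow> z * a \<in> hx U T"
proof -
  assume h: "z \<in> hx S T" "a \<in> dmap U S"
  note d = hxD[OF h(1)] dmapD[OF h(2)]
  show ?thesis
    using d unfolding hx_def
    by (auto simp: mult.assoc D_e2[OF d(6)] d(2,3,4)[THEN asr] intro!: G_mult D_G[OF d(6)])
qed

subsection \<open>Maps factoring through powers of an object\<close>

inductive_set thru :: "'g \<times> 'g \<Rightarrow> 'g \<times> 'g \<Rightarrow> 'g \<times> 'g \<Rightarrow> 'g set" for T V W where
  thru_0: "0 \<in> thru T V W"
| thru_step: "g \<in> thru T V W \<Longrightarrow> a \<in> hom T W \<Longrightarrow> b \<in> hom V T \<Longrightarrow> g + a * b \<in> thru T V W"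

text \<open>Membership of \<open>U\<close> in add \<open>T\<close>: an identity that factors through
  a power of \<open>T\<close> exhibits \<open>U\<close> as a direct summand of that power, and no
  complement has to be chosen.\<close>

definition add_of :: "'g \<times> 'g \<Rightarrow> 'g \<times> 'g \<Rightarrow> bool" where
  "add_of T U \<longleftrightarrow> fst U \<in> thru T U U"

lemma thru_hom: "g \<in> thru T V W \<Longrightarrow> g \<in> hom V W"
  by (induction rule: thru.induct) (auto intro: hom_zero hom_add hom_comp)

lemma thru_comp: "a \<in> hom T W \<Longrightarrow> b \<in> hom V T \<Longrightarrow> a * b \<in> thru T V W"
  using thru_step[OF thru_0, of a T W b V] by simp

lemma thru_add: "g \<in> thru T V W \<Longrightarrow> h \<in> thru T V W \<Longrightarrow> h + g \<in> thru T V W"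
proof (induction rule: thru.induct)
  case (thru_step g a b)
  then show ?case using thru.thru_step[of "h + g"] by (simp add: add.assoc)
qed simp

lemma thru_left: "g \<in> thru T V W \<Longrightarrow> c \<in> hom W U \<Longrightarrow> c * g \<in> thru T V U"
proof (induction rule: thru.induct)
  case (thru_step g a b)
  then show ?case using thru.thru_step[of "c * g" T V U "c * a" b] hom_comp[of c W U a T]
    by (simp add: distrib_left mult.assoc)
qed (simp add: thru_0)

lemma thru_right: "g \<in> thru T V W \<Longrightarrow> c \<in> hom U V \<Longrightarrow> g * c \<in> thru T U W"
proof (induction rule: thru.induct)
  case (thru_step g a b)
  then show ?case using thru.thru_step[of "g * c" T U W a "b * c"] hom_comp[of b V T c U]
    by (simp add: distrib_right mult.assoc)
qed (simp add: thru_0)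

lemma add_of_self: "obj T \<Longrightarrow> add_of T T"
  unfolding add_of_def using thru_comp[OF hom_id hom_id] objD(2) by metis

lemma add_of_hom:
  assumes "add_of T U" "a \<in> hom V U"
  shows "a \<in> thru T V U"
  using thru_right[OF assms(1)[unfolded add_of_def] assms(2)] homD(2)[OF assms(2)] by simp

lemma thru_trans:
  assumes "g \<in> thru S V W" "\<And>a. a \<in> hom S W \<Longrightarrow> a \<in> thru T S W"
  shows "g \<in> thru T V W"
  using assms(1)
proof (induction rule: thru.induct)
  case thru_0
  show ?case by (rule thru.thru_0)
next
  case (thru_step g a b)
  then show ?case using thru_add thru_right assms(2) by blast
qed

text \<open>Along each summand \<open>a * b\<close> of \<open>g\<close>, the degree 1 map
  \<open>z * a\<close> starts at \<open>V'\<close> and is a boundary there; composing with the chain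
  map \<open>b\<close> keeps it a boundary.\<close>

lemma ext0_thru_left:
  assumes "ext0 V' W" "g \<in> thru V' V V" "z \<in> hx V W" "obj V"
  shows "\<exists>a\<in>dmap V W. z * g = del V W a"
  using assms(2)
proof (induction rule: thru.induct)
  case thru_0
  show ?case using dmap_zero by (intro bexI[of _ 0]) auto
next
  case (thru_step g a b)
  obtain c where c: "c \<in> dmap V W" "z * g = del V W c" using thru_step by blast
  obtain d where d: "d \<in> dmap V' W" "z * a = del V' W d"
    using assms(1) hx_right[OF assms(3)] homD(5)[OF thru_step(2)] unfolding ext0_def by blast
  have "z * (g + a * b) = del V W (c + d * b)"
    using c d del_comp_right[OF thru_step(3), of W d] by (simp add: del_add distrib_left mult.assoc[symmetric])
  then show ?case using c d dmap_add dmap_comp homD(5)[OF thru_step(3)] by blast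
qed

lemma ext0_thru_right:
  assumes "ext0 V W'" "g \<in> thru W' W W" "z \<in> hx V W" "obj W"
  shows "\<exists>a\<in>dmap V W. g * z = del V W a"
  using assms(2)
proof (induction rule: thru.induct)
  case thru_0
  show ?case using dmap_zero by (intro bexI[of _ 0]) auto
next
  case (thru_step g a b)
  obtain c where c: "c \<in> dmap V W" "g * z = del V W c" using thru_step by blast
  obtain d where d: "d \<in> dmap V W'" "b * z = del V W' d"
    using assms(1) hx_left[OF assms(3)] homD(5)[OF thru_step(3)] unfolding ext0_def by blast
  have "(g + a * b) * z = del V W (c + a * d)"
    using c d del_comp_left[OF thru_step(2), of V d] by (simp add: del_add distrib_right mult.assoc)
  then show ?case using c d dmap_add dmap_comp homD(5)[OF thru_step(2)] by blast
qed

lemma ext0_add_left: "ext0 V' W \<Longrightarrow> add_of V' V \<Longrightarrow> obj V \<Longrightarrow> ext0 V W"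
  unfolding add_of_def ext0_def
proof
  fix z assume h: "\<forall>z\<in>hx V' W. \<exists>a\<in>dmap V' W. z = del V' W a" "fst V \<in> thru V' V V" "obj V" "z \<in> hx V W"
  show "\<exists>a\<in>dmap V W. z = del V W a"
    using ext0_thru_left[OF _ h(2,4,3)] h(1) hxD(5)[OF h(4)] by (simp add: ext0_def)
qed

lemma ext0_add_right: "ext0 V W' \<Longrightarrow> add_of W' W \<Longrightarrow> obj W \<Longrightarrow> ext0 V W"
  unfolding add_of_def ext0_def
proof
  fix z assume h: "\<forall>z\<in>hx V W'. \<exists>a\<in>dmap V W'. z = del V W' a" "fst W \<in> thru W' W W" "obj W" "z \<in> hx V W"
  show "\<exists>a\<in>dmap V W. z = del V W a"
    using ext0_thru_right[OF _ h(2,4,3)] h(1) hxD(4)[OF h(4)] by (simp add: ext0_def)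
qed

text \<open>Membership of \<open>U\<close> in the additive closure of \<open>S\<close> and
  \<open>T\<close> together.\<close>

definition add2_of :: "'g \<times> 'g \<Rightarrow> 'g \<times> 'g \<Rightarrow> 'g \<times> 'g \<Rightarrow> bool" where
  "add2_of S T U \<longleftrightarrow> (\<exists>g h. g \<in> thru S U U \<and> h \<in> thru T U U \<and> fst U = g + h)"

lemma ext0_add2_left:
  assumes "ext0 S W" "ext0 T W" "add2_of S T V" "obj V"
  shows "ext0 V W"
  unfolding ext0_def
proof
  fix z assume z: "z \<in> hx V W"
  obtain g h where gh: "g \<in> thru S V V" "h \<in> thru T V V" "fst V = g + h" using assms(3) unfolding add2_of_def by auto
  obtain a b where "a \<in> dmap V W" "z * g = del V W a" "b \<in> dmap V W" "z * h = del V W b"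
    using ext0_thru_left[OF assms(1) gh(1) z assms(4)] ext0_thru_left[OF assms(2) gh(2) z assms(4)] by blast
  moreover have "z = z * g + z * h" using z gh by (simp add: hx_def distrib_left[symmetric])
  ultimately show "\<exists>a\<in>dmap V W. z = del V W a" using dmap_add del_add by metis
qed

lemma ext0_add2_right:
  assumes "ext0 W S" "ext0 W T" "add2_of S T V" "obj V"
  shows "ext0 W V"
  unfolding ext0_def
proof
  fix z assume z: "z \<in> hx W V"
  obtain g h where gh: "g \<in> thru S V V" "h \<in> thru T V V" "fst V = g + h" using assms(3) unfolding add2_of_def by auto
  obtain a b where "a \<in> dmap W V" "g * z = del W V a" "b \<in> dmap W V" "h * z = del W V b"
    using ext0_thru_right[OF assms(1) gh(1) z assms(4)] ext0_thru_right[OF assms(2) gh(2) z assms(4)] by blast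
  moreover have "z = g * z + h * z" using z gh by (simp add: hx_def distrib_right[symmetric])
  ultimately show "\<exists>a\<in>dmap W V. z = del W V a" using dmap_add del_add by metis
qed

subsection \<open>Direct sums\<close>

definition osum :: "'g \<times> 'g \<Rightarrow> 'g \<times> 'g \<Rightarrow> 'g \<times> 'g" where
  "osum S T = (i1 * fst S * r1 + i2 * fst T * r2, i1 * snd S * r1 + i2 * snd T * r2)"

lemma osum_obj: "obj S \<Longrightarrow> obj T \<Longrightarrow> obj (osum S T)"
proof -
  assume h: "obj S" "obj T"
  note d = objD[OF h(1)] objD[OF h(2)]
  note d' = d(2,4-7,9,11-14)
  note ie = iso_e(1,2)[symmetric]
  have r: "r1 * e2 = e2 * r1" "r2 * e2 = e2 * r2" using D_e2 by auto
  show ?thesis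
    unfolding obj_def osum_def using d
    by (auto simp: distrib_left distrib_right mult.assoc d'[THEN asr] d' ie ie[THEN asr] r intro!: G_add G_mult iso_G)
qed

lemma osum_incl: "obj S \<Longrightarrow> obj T \<Longrightarrow> i1 * fst S \<in> hom S (osum S T)" "obj S \<Longrightarrow> obj T \<Longrightarrow> i2 * fst T \<in> hom T (osum S T)"
  by (rule homI; auto simp: osum_def distrib_right mult.assoc objD objD(7)[THEN asr] objD(2)[THEN asr])+

lemma osum_proj: "obj S \<Longrightarrow> obj T \<Longrightarrow> fst S * r1 \<in> hom (osum S T) S" "obj S \<Longrightarrow> obj T \<Longrightarrow> fst T * r2 \<in> hom (osum S T) T"
  by (rule homI; auto simp: osum_def distrib_left mult.assoc objD objD(2,6,7)[THEN asr])+

lemma osum_id: "obj S \<Longrightarrow> obj T \<Longrightarrow> fst (osum S T) = (i1 * fst S) * (fst S * r1) + (i2 * fst T) * (fst T * r2)"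
  by (simp add: osum_def mult.assoc objD(2)[THEN asr])

lemma rk_osum:
  assumes "rk (fst S) m n" "rk (fst T) m' n'"
  shows "rk (fst (osum S T)) (m + m') (n + n')"
proof -
  have s: "fst S \<in> D" "fst S * fst S = fst S" and t: "fst T \<in> D" "fst T * fst T = fst T"
    using rk_idem assms by auto
  have 1: "eqv D (fst S) (i1 * fst S * r1)"
    unfolding eqv_def by (rule bexI[of _ "fst S * r1"], rule bexI[of _ "i1 * fst S"])
      (use s in \<open>auto simp: mult.assoc s(2)[THEN asr]\<close>)
  have 2: "eqv D (fst T) (i2 * fst T * r2)"
    unfolding eqv_def by (rule bexI[of _ "fst T * r2"], rule bexI[of _ "i2 * fst T"])
      (use t in \<open>auto simp: mult.assoc t(2)[THEN asr]\<close>)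
  show ?thesis
    unfolding osum_def fst_conv
    by (rule rk_add[OF rk_eqv[OF assms(1) 1] rk_eqv[OF assms(2) 2]]) (simp_all add: mult.assoc)
qed

lemma thru_osum:
  assumes "obj S" "obj T" "g \<in> thru V S S" "h \<in> thru W T T"
  shows "(i1 * fst S) * g * (fst S * r1) \<in> thru V (osum S T) (osum S T)"
    "(i2 * fst T) * h * (fst T * r2) \<in> thru W (osum S T) (osum S T)"
  using thru_right[OF thru_left[OF assms(3) osum_incl(1)] osum_proj(1)]
    thru_right[OF thru_left[OF assms(4) osum_incl(2)] osum_proj(2)] assms by blast+

lemma add_osum:
  assumes "obj S" "obj T" "add_of V S" "add_of V T"
  shows "add_of V (osum S T)"
proof -
  have "(i1 * fst S) * fst S * (fst S * r1) + (i2 * fst T) * fst T * (fst T * r2) = fst (osum S T)"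
    using osum_id[OF assms(1,2)] by (simp add: mult.assoc objD(2)[THEN asr] assms)
  then show ?thesis
    unfolding add_of_def
    using thru_add thru_osum[OF assms(1,2) assms(3,4)[unfolded add_of_def]] by metis
qed

lemma add2_osum_of:
  assumes "obj S" "obj T" "add_of V S" "add_of W T"
  shows "add2_of V W (osum S T)"
proof -
  have "(i1 * fst S) * fst S * (fst S * r1) + (i2 * fst T) * fst T * (fst T * r2) = fst (osum S T)"
    using osum_id[OF assms(1,2)] by (simp add: mult.assoc objD(2)[THEN asr] assms)
  then show ?thesis
    unfolding add2_of_def
    using thru_osum[OF assms(1,2) assms(3,4)[unfolded add_of_def]] by metis
qed

subsection \<open>Fitting's lemma and indecomposable objects\<close>

text \<open>Otherwise the powers of \<open>h\<close>, adjoined from the highest exponent downwards,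
  stay independent. Starting at exponent \<open>card F + 1\<close> yields more independent elements
  than the finite-dimensional endomorphism space admits.\<close>

lemma power_in_later_span:
  assumes "rk (fst S) m n" "h \<in> hom S S"
  shows "\<exists>N>0. h ^ N \<in> vs.span {h ^ j |j. N < j}"
proof (rule ccontr)
  assume neg: "\<not> ?thesis"
  obtain F where F: "finite F" "\<forall>g\<in>G. fst S * g * fst S \<in> vs.span F"
    using fdim_rk[OF assms(1,1)] unfolding fdim_def by auto
  have inF: "h ^ j \<in> vs.span F" if "0 < j" for j
    using F(2) hom_power[OF assms(2) that] homD[of "h ^ j" S S] D_G by metis
  define M where M_def: "M = Suc (card F)"
  have "\<exists>B. finite B \<and> vs.independent B \<and> card B = k \<and> B \<subseteq> {h ^ j |j. M - k < j \<and> j \<le> M}" if "k \<le> M" for k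
    using that
  proof (induction k)
    case 0
    show ?case by (intro exI[of _ "{}"]) (simp add: vs.independent_empty)
  next
    case (Suc k)
    then obtain B where B: "finite B" "vs.independent B" "card B = k" "B \<subseteq> {h ^ j |j. M - k < j \<and> j \<le> M}" by auto
    have "h ^ (M - k) \<notin> vs.span {h ^ j |j. M - k < j}" 
    proof -
      have "0 < M - k" using Suc(2) by simp
      then show ?thesis using neg by blast
    qed
    moreover have "vs.span B \<subseteq> vs.span {h ^ j |j. M - k < j}" by (rule vs.span_mono) (use B in auto)
    ultimately have nB: "h ^ (M - k) \<notin> vs.span B" by blast
    then have "h ^ (M - k) \<notin> B" using vs.span_base by blast
    moreover have "vs.independent (insert (h ^ (M - k)) B)"
      using vs.independent_insertI[OF nB B(2)] .
    moreover have "insert (h ^ (M - k)) B \<subseteq> {h ^ j |j. M - Suc k < j \<and> j \<le> M}"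
    proof -
      have "h ^ (M - k) \<in> {h ^ j |j. M - Suc k < j \<and> j \<le> M}" using Suc(2) by auto
      moreover have "{h ^ j |j. M - k < j \<and> j \<le> M} \<subseteq> {h ^ j |j. M - Suc k < j \<and> j \<le> M}" by auto
      ultimately show ?thesis using B(4) by auto
    qed
    ultimately show ?case using B by (intro exI[of _ "insert (h ^ (M - k)) B"]) auto
  qed
  then obtain B where B: "vs.independent B" "card B = M" "B \<subseteq> {h ^ j |j. M - M < j \<and> j \<le> M}" by blast
  have "B \<subseteq> vs.span F" using B(3) inF by auto
  then have "card B \<le> card F" using vs.independent_span_bound[OF F(1) B(1)] by simp
  then show False using B(2) M_def by simp
qed

text \<open>The preceding lemma gives \<open>h ^ N = h ^ N * (h * q)\<close> with \<open>q\<close> a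
  polynomial in \<open>h\<close>. For \<open>g = h * q\<close> the equation
  \<open>h ^ N * g = h ^ N\<close> makes \<open>\<epsilon> = g ^ N\<close> idempotent, with
  \<open>h\<close> invertible on its image and nilpotent on the complement. The polynomial may have
  a constant term, and 1 is not in \<open>hom S S\<close>; so \<open>q\<close> is only stated to be
  diagonal and to commute with the differential.\<close>

lemma fitting:
  assumes "obj S" "rk (fst S) m n" "h \<in> hom S S"
  obtains \<epsilon> N q where "\<epsilon> \<in> hom S S" "\<epsilon> * \<epsilon> = \<epsilon>" "0 < N" "h ^ N * \<epsilon> = h ^ N" "\<epsilon> = h * q" "\<epsilon> = q * h"
    "q \<in> D" "q * snd S = snd S * q"
proof -
  obtain N where N: "N > 0" "h ^ N \<in> vs.span {h ^ j |j. N < j}" using power_in_later_span[OF assms(2,3)] by auto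
  note hd = homD[OF assms(3)]
  have hG: "h \<in> G" using D_G hd by blast
  have hx: "h ^ j * snd S = snd S * h ^ j" for j
    by (induction j) (simp_all add: mult.assoc, metis hd(4) mult.assoc)
  have hD: "h ^ j \<in> D" for j using hd by (induction j) auto
  have "\<exists>q\<in>D. x = h ^ N * (h * q) \<and> h * q = q * h \<and> q * snd S = snd S * q"
    if "x \<in> vs.span {h ^ j |j. N < j}" for x
    using that
  proof (induction rule: vs.span_induct_alt)
    case base
    show ?case by (intro bexI[of _ 0]) auto
  next
    case (step c x y)
    obtain j where j: "x = h ^ j" "N < j" using step by auto
    obtain q where q: "q \<in> D" "y = h ^ N * (h * q)" "h * q = q * h" "q * snd S = snd S * q" using step by auto
    define p where p_def: "p = h ^ (j - Suc N)"
    have x: "x = h ^ N * (h * p)"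
      unfolding p_def j(1) using j(2) by (simp add: power_add[symmetric] power_Suc[symmetric] del: power_Suc)
    have kc: "\<kappa> c * g = g * \<kappa> c" if "g \<in> G" for g using kap_comm that by blast
    have hNG: "h ^ N \<in> G" using hD D_G by blast
    have p: "p \<in> D" "h * p = p * h" "p * snd S = snd S * p" unfolding p_def using hD hx by (auto simp: power_commutes)
    have "\<kappa> c * x + y = h ^ N * (h * (\<kappa> c * p + q))"
      unfolding x q(2) distrib_left
      by (simp add: mult.assoc[symmetric] kc[OF hNG]) (simp add: mult.assoc kc[OF hG])
    moreover have "h * (\<kappa> c * p + q) = (\<kappa> c * p + q) * h"
      using q p kc[OF hG] by (simp add: distrib_left distrib_right) (metis mult.assoc)
    moreover have "(\<kappa> c * p + q) * snd S = snd S * (\<kappa> c * p + q)"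
      using q p kc[OF objD(3)[OF assms(1)]] by (simp add: distrib_left distrib_right) (metis mult.assoc)
    moreover have "\<kappa> c * p + q \<in> D" using p q by auto
    ultimately show ?case by blast
  qed
  then obtain q where q: "q \<in> D" "h ^ N = h ^ N * (h * q)" "h * q = q * h" "q * snd S = snd S * q" using N by blast
  define g where g_def: "g = h * q"
  have gD: "g \<in> D" using q hd by (auto simp: g_def)
  have g: "g \<in> hom S S"
  proof (rule homI[OF gD])
    show "fst S * g = g" using hd by (simp add: g_def mult.assoc[symmetric])
    show "g * fst S = g" unfolding g_def q(3) using hd by (simp add: mult.assoc)
    show "g * snd S = snd S * g" unfolding g_def using hd q by (metis mult.assoc)
  qed
  have gN: "g ^ k = q ^ k * h ^ k" for k
  proof (induction k)
    case (Suc k)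
    have "h * q ^ k = q ^ k * h" using q(3) power_commuting_commutes[of q h] by metis
    then show ?case using Suc q(3) by (simp add: g_def mult.assoc) (metis mult.assoc)
  qed simp
  have gNg: "g ^ N * g = g ^ N" unfolding gN using q(2) by (simp add: mult.assoc g_def)
  have gNk: "g ^ N * g ^ k = g ^ N" for k
    by (induction k) (simp_all add: mult.assoc[symmetric] gNg power_Suc2 del: power_Suc)
  have hNk: "h ^ N * g ^ k = h ^ N" for k
  proof (induction k)
    case (Suc k)
    have "h ^ N * g ^ Suc k = h ^ N * g * g ^ k" by (simp add: mult.assoc)
    also have "h ^ N * g = h ^ N" using q(2) by (simp add: g_def)
    finally show ?case using Suc by simp
  qed simp
  have qk: "g ^ k * snd S = snd S * g ^ k" for k
    by (induction k) (simp_all add: mult.assoc, metis homD(4)[OF g] mult.assoc)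
  have gkD: "g ^ k \<in> D" for k using gD by (induction k) auto
  have N1: "g ^ N = g ^ (N - 1) * g" "g ^ N = g * g ^ (N - 1)" using N(1)
    by (metis Suc_diff_1 power_Suc2, metis Suc_diff_1 power_Suc)
  have hg: "h * g ^ k = g ^ k * h" for k
    using q(3) power_commuting_commutes[of g h] unfolding g_def by (metis mult.assoc)
  show thesis
  proof (rule that[of "g ^ N" N "q * g ^ (N - 1)"])
    show "g ^ N = h * (q * g ^ (N - 1))" using N1(2) by (simp add: g_def mult.assoc)
    show "g ^ N = q * g ^ (N - 1) * h" using N1(2) hg[of "N - 1"] q(3) by (simp add: g_def mult.assoc)
    show "q * g ^ (N - 1) * snd S = snd S * (q * g ^ (N - 1))" using qk q(4) by (metis mult.assoc)
  qed (use N g q gkD hom_power gNk hNk in auto)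
qed

text \<open>Phrased with honest idempotent chain maps. That nothing new splits off in the homotopy
  category is \<open>indec_ksum\<close>.\<close>

definition indec :: "'g \<times> 'g \<Rightarrow> bool" where
  "indec T \<longleftrightarrow> obj T \<and> (\<exists>m n. rk (fst T) m n) \<and> fst T \<noteq> 0 \<and> (\<forall>g\<in>hom T T. g * g = g \<longrightarrow> g = 0 \<or> g = fst T)"

abbreviation un :: "'g \<times> 'g \<Rightarrow> 'g \<Rightarrow> bool" where
  "un T g \<equiv> unit_in (hom T T) (fst T) g"

lemma indec_obj: "indec T \<Longrightarrow> obj T" by (simp add: indec_def)

lemma unI: "obj T \<Longrightarrow> w \<in> D \<Longrightarrow> w * snd T = snd T * w \<Longrightarrow> g \<in> hom T T \<Longrightarrow> g * w = fst T \<Longrightarrow> w * g = fst T \<Longrightarrow> un T g"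
  unfolding unit_in_def
proof (rule bexI[of _ "fst T * w * fst T"])
  assume h: "obj T" "w \<in> D" "w * snd T = snd T * w" "g \<in> hom T T" "g * w = fst T" "w * g = fst T"
  note d = objD[OF h(1)] homD[OF h(4)]
  have "snd T * (w * fst T) = snd T * w" using h(3) d(7) by (metis mult.assoc)
  then show "fst T * w * fst T \<in> hom T T"
    by (intro homI) (use d h in \<open>auto simp: mult.assoc d(2)[THEN asr] d(6)[THEN asr] d(7)[THEN asr] h(3)[THEN asr]\<close>)
  show "fst T * (fst T * w * fst T) = fst T * w * fst T \<and> fst T * w * fst T * fst T = fst T * w * fst T \<and>
    g * (fst T * w * fst T) = fst T \<and> fst T * w * fst T * g = fst T"
    using d h by (simp add: mult.assoc d(2)[THEN asr] d(10)[THEN asr] h(5)[THEN asr])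
qed

text \<open>The Fitting idempotent of \<open>g\<close> is trivial: if it is the identity then
  \<open>q\<close> inverts \<open>g\<close>, and if it is 0 then a power of \<open>g\<close>
  vanishes.\<close>

lemma un_or_nilpotent:
  assumes "indec T" "g \<in> hom T T"
  shows "un T g \<or> (\<exists>N. g ^ N = 0)"
proof -
  obtain m n where T: "obj T" "rk (fst T) m n" using assms unfolding indec_def by auto
  obtain \<epsilon> N q where e: "\<epsilon> \<in> hom T T" "\<epsilon> * \<epsilon> = \<epsilon>" "0 < N" "g ^ N * \<epsilon> = g ^ N" "\<epsilon> = g * q" "\<epsilon> = q * g"
    "q \<in> D" "q * snd T = snd T * q" by (rule fitting[OF T assms(2)])
  have "\<epsilon> = 0 \<or> \<epsilon> = fst T" using assms e unfolding indec_def by blast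
  then show ?thesis using e unI[OF T(1) e(7,8) assms(2)] by (metis mult_zero_right)
qed

lemma un_id: "obj T \<Longrightarrow> un T (fst T)"
  unfolding unit_in_def using hom_id objD by blast

lemma not_nilpotent_left:
  assumes "fst T \<noteq> 0" "g \<in> hom T T" "c \<in> hom T T" "g * c = fst T \<or> c * g = fst T"
  shows "g ^ N \<noteq> 0"
proof (induction N)
  case 0
  then show ?case using assms(1) by (metis mult.right_neutral mult_zero_right power_0)
next
  case (Suc N)
  have gN: "N > 0 \<Longrightarrow> g ^ N * fst T = g ^ N \<and> fst T * g ^ N = g ^ N" using homD[OF hom_power[OF assms(2)]] by blast
  have "g ^ N * g * c = g ^ N * fst T \<or> c * (g * g ^ N) = fst T * g ^ N"
    using assms(4) by (auto simp: mult.assoc) (auto simp: mult.assoc[symmetric])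
  moreover have "g ^ N * fst T \<noteq> 0" "fst T * g ^ N \<noteq> 0" using Suc gN assms(1) by (cases "N = 0"; simp)+
  ultimately show ?case by (metis mult_zero_left mult_zero_right power_Suc power_Suc2)
qed

lemma un_one_sided:
  assumes "indec T" "g \<in> hom T T" "c \<in> hom T T" "g * c = fst T \<or> c * g = fst T"
  shows "un T g"
  using un_or_nilpotent[OF assms(1,2)] not_nilpotent_left[OF _ assms(2-4)] assms(1) unfolding indec_def by blast

lemma un_prod:
  assumes "indec T" "g \<in> hom T T" "h \<in> hom T T" "un T (g * h)"
  shows "un T g" "un T h"
proof -
  obtain w where w: "w \<in> hom T T" "g * h * w = fst T" "w * (g * h) = fst T" using assms(4) unfolding unit_in_def by auto
  show "un T g" by (rule un_one_sided[OF assms(1,2), of "h * w"]) (use w assms hom_comp in \<open>auto simp: mult.assoc\<close>)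
  show "un T h" by (rule un_one_sided[OF assms(1,3), of "w * g"]) (use w assms hom_comp in \<open>auto simp: mult.assoc\<close>)
qed

lemma nilpotent_un_diff:
  assumes "obj T" "g \<in> hom T T" "g ^ N = 0"
  shows "un T (fst T - g)"
proof -
  have "(\<Sum>j<N. g ^ j) \<in> D" using homD(1)[OF assms(2)]
    by (induction N) (auto intro: D_power)
  moreover have gx: "g ^ j * snd T = snd T * g ^ j" for j
    by (induction j) (simp_all add: mult.assoc, metis homD(4)[OF assms(2)] mult.assoc)
  have "(\<Sum>j<N. g ^ j) * snd T = snd T * (\<Sum>j<N. g ^ j)"
    by (simp add: sum_distrib_left sum_distrib_right gx)
  moreover have 1: "(1 - g) * (\<Sum>j<N. g ^ j) = 1 \<and> (\<Sum>j<N. g ^ j) * (1 - g) = 1"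
  proof -
    have "(1 - g) * (\<Sum>j<k. g ^ j) = 1 - g ^ k \<and> (\<Sum>j<k. g ^ j) * (1 - g) = 1 - g ^ k" for k
    proof (induction k)
      case (Suc k)
      have st: "(1 - g) * (\<Sum>j<Suc k. g ^ j) = (1 - g) * (\<Sum>j<k. g ^ j) + (1 - g) * g ^ k"
        "(\<Sum>j<Suc k. g ^ j) * (1 - g) = (\<Sum>j<k. g ^ j) * (1 - g) + g ^ k * (1 - g)"
        by (simp_all add: distrib_left distrib_right)
      show ?case
        by (simp only: st Suc[THEN conjunct1] Suc[THEN conjunct2])
          (simp add: left_diff_distrib right_diff_distrib power_commutes)
    qed simp
    then show ?thesis using assms(3) by simp
  qed
  note d = homD[OF assms(2)] objD[OF assms(1)]
  have comm: "fst T * g ^ j = g ^ j * fst T" for j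
    by (induction j) (simp_all add: mult.assoc, metis d(2,3) mult.assoc)
  have "(\<Sum>j<N. g ^ j) * fst T = fst T * (\<Sum>j<N. g ^ j)"
    by (simp add: sum_distrib_left sum_distrib_right comm)
  moreover have "fst T - g = (1 - g) * fst T" "fst T - g = fst T * (1 - g)" using d by (simp_all add: left_diff_distrib right_diff_distrib)
  ultimately show ?thesis
    using 1 by (intro unI[OF assms(1), of "\<Sum>j<N. g ^ j"] hom_diff hom_id assms(1,2)) (metis mult.assoc mult.right_neutral mult.left_neutral)+
qed

text \<open>Endomorphism rings of indecomposables are local. With \<open>w\<close> inverse to the
  sum, a non-invertible \<open>w * g\<close> is nilpotent, so \<open>fst T - w * g = w * h\<close>
  is invertible.\<close>

lemma un_add:
  assumes "indec T" "g \<in> hom T T" "h \<in> hom T T" "un T (g + h)"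
  shows "un T g \<or> un T h"
proof (rule ccontr)
  assume n: "\<not> (un T g \<or> un T h)"
  obtain w where w: "w \<in> hom T T" "(g + h) * w = fst T" "w * (g + h) = fst T" using assms(4) unfolding unit_in_def by auto
  have "\<not> un T (w * g)" using un_prod[OF assms(1) w(1) assms(2)] n by blast
  then obtain N where "(w * g) ^ N = 0" using un_or_nilpotent[OF assms(1) hom_comp[OF w(1) assms(2)]] by blast
  then have "un T (fst T - w * g)" using nilpotent_un_diff indec_obj[OF assms(1)] hom_comp[OF w(1) assms(2)] by blast
  moreover have "fst T - w * g = w * h" using w(3) by (simp add: distrib_left diff_eq_eq add.commute)
  ultimately show False using un_prod[OF assms(1) w(1) assms(3)] n by simp
qed

definition isom :: "'g \<times> 'g \<Rightarrow> 'g \<times> 'g \<Rightarrow> bool" where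
  "isom S T \<longleftrightarrow> (\<exists>a\<in>hom S T. \<exists>b\<in>hom T S. b * a = fst S \<and> a * b = fst T)"

text \<open>With \<open>w\<close> inverse to \<open>b * a\<close>, the endomorphism
  \<open>a * (w * b)\<close> of \<open>T\<close> is a nonzero idempotent, hence the
  identity.\<close>

lemma isom_of_un:
  assumes "indec S" "indec T" "a \<in> hom S T" "b \<in> hom T S" "un S (b * a)"
  shows "isom S T"
proof -
  obtain w where w: "w \<in> hom S S" "w * (b * a) = fst S" "fst S * w = w" using assms(5) unfolding unit_in_def by auto
  have wb: "w * b \<in> hom T S" using hom_comp w assms by blast
  have "a * (w * b) \<in> hom T T" using hom_comp wb assms by blast
  moreover have "a * (w * b) * (a * (w * b)) = a * (w * b)" using w(2,3) by (metis mult.assoc)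
  ultimately have "a * (w * b) = 0 \<or> a * (w * b) = fst T" using assms(2) unfolding indec_def by blast
  moreover have "a * (w * b) \<noteq> 0"
  proof
    assume "a * (w * b) = 0"
    then have "w * b * (a * (w * b) * a) = 0" by simp
    then have "fst S * fst S = 0" using w(2) by (metis mult.assoc)
    then show False using assms(1) objD(2) unfolding indec_def by metis
  qed
  ultimately show ?thesis unfolding isom_def using wb w(2) assms(3) by (metis mult.assoc)
qed

lemma isom_rk: "obj S \<Longrightarrow> isom S T \<Longrightarrow> rk (fst S) m n \<Longrightarrow> rk (fst T) m n"
proof -
  assume "obj S" "isom S T" "rk (fst S) m n"
  then obtain a b where "a \<in> hom S T" "b \<in> hom T S" "b * a = fst S" "a * b = fst T" unfolding isom_def by auto
  then have "eqv D (fst S) (fst T)" unfolding eqv_def using homD by (intro bexI[of _ b] bexI[of _ a]) auto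
  then show ?thesis using rk_eqv \<open>rk (fst S) m n\<close> by blast
qed

text \<open>Radical maps: if no component \<open>T \<rightarrow> E \<rightarrow> T\<close> is invertible, everything factoring through \<open>T\<close>
  is in the radical of the endomorphism ring of \<open>E\<close>. The step uses that \<open>1 - a b\<close> is invertible as soon as
  \<open>1 - b a\<close> is.\<close>

lemma thru_radical:
  assumes "indec T" "obj E" "g \<in> thru T E E" "\<And>a b. a \<in> hom T E \<Longrightarrow> b \<in> hom E T \<Longrightarrow> \<not> un T (b * a)"
  shows "un E (fst E - g)"
  using assms(3)
proof (induction rule: thru.induct)
  case thru_0
  then show ?case using un_id assms(2) by simp
next
  case (thru_step g a b)
  obtain w where w: "w \<in> hom E E" "(fst E - g) * w = fst E" "w * (fst E - g) = fst E"
    using thru_step(4) unfolding unit_in_def by auto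
  note ho = hom_comp thru_step w indec_obj[OF assms(1)] hom_id
  have wa: "w * a \<in> hom T E" and bw: "b * w \<in> hom E T" and bwa: "b * (w * a) \<in> hom T T" using ho by blast+
  have "\<not> un T (b * (w * a))" using assms(4) wa thru_step by blast
  then have "un T (fst T - b * (w * a))"
    using un_add[OF assms(1) bwa, of "fst T - b * (w * a)"] un_id ho hom_diff by (metis add.commute diff_add_cancel)
  then obtain v where v: "v \<in> hom T T" "(fst T - b * (w * a)) * v = fst T" "v * (fst T - b * (w * a)) = fst T"
    unfolding unit_in_def by auto
  \<comment> \<open>Rank-one update of an inverse: \<open>w\<close> inverts
    \<open>fst E - g\<close>, and \<open>v\<close> inverts \<open>fst T - b * w * a\<close>.\<close>
  define y where y_def: "y = w + w * a * v * (b * w)"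
  have yh: "y \<in> hom E E" unfolding y_def
    using hom_add[OF w(1) hom_comp[OF hom_comp[OF wa v(1)] bw]] .
  note d = homD(2,3)[OF w(1)] homD(2,3)[OF thru_step(2)] homD(2,3)[OF thru_step(3)] homD(2,3)[OF v(1)]
  have g1: "g * w = w * 0 + fst E * w - fst E" "w * g = w * fst E - fst E"
    using w(2,3) by (simp_all add: left_diff_distrib right_diff_distrib algebra_simps)
  have v1: "b * (w * (a * v)) = v - fst T" "v * (b * (w * a)) = v - fst T"
    using v d by (simp_all add: left_diff_distrib right_diff_distrib mult.assoc algebra_simps)
  have gw: "g * w = w - fst E" "w * g = w - fst E" using g1 d by simp_all
  have v1': "b * (w * (a * (v * z))) = v * z - fst T * z" "v * (b * (w * (a * z))) = v * z - fst T * z"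
     and gw': "g * (w * z) = w * z - fst E * z" "w * (g * z) = w * z - fst E * z" for z
    using v1 gw by (metis left_diff_distrib mult.assoc)+
  have "(fst E - (g + a * b)) * y = fst E" "y * (fst E - (g + a * b)) = fst E"
    unfolding y_def
    by (simp_all add: left_diff_distrib right_diff_distrib distrib_left distrib_right mult.assoc v1 v1' gw gw' d d[THEN asr]
         objD[OF assms(2)])
  then show ?case unfolding unit_in_def using yh homD(2,3)[OF yh] by blast
qed

definition sized :: "'g \<times> 'g \<Rightarrow> bool" where
  "sized S \<longleftrightarrow> (\<exists>m n. rk (fst S) m n)"

lemma indec_sized: "indec T \<Longrightarrow> sized T"
  by (simp add: indec_def sized_def)

subsection \<open>Splitting idempotents\<close>

definition sub :: "'g \<times> 'g \<Rightarrow> 'g \<Rightarrow> 'g \<times> 'g" where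
  "sub U \<epsilon> = (\<epsilon>, \<epsilon> * snd U)"

lemma sub_hom:
  assumes "obj U" "\<epsilon> \<in> hom U U" "\<epsilon> * \<epsilon> = \<epsilon>"
  shows "obj (sub U \<epsilon>)" "\<epsilon> \<in> hom U (sub U \<epsilon>)" "\<epsilon> \<in> hom (sub U \<epsilon>) U"
proof -
  note d = objD[OF assms(1)] homD[OF assms(2)]
  have 1: "\<epsilon> * (snd U * z) = snd U * (\<epsilon> * z)" for z using d(11) by (metis mult.assoc)
  have 2: "e1 * (snd U * \<epsilon>) = snd U * \<epsilon>" "\<epsilon> * e2 = e2 * \<epsilon>" "snd U * (e2 * \<epsilon>) = snd U * \<epsilon>"
    using d D_e2 by (auto simp: mult.assoc[symmetric])
  note s = d(2,4-7,9-11) assms(3) 1 2 assms(3)[THEN asr]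
  show "obj (sub U \<epsilon>)"
    unfolding obj_def sub_def using d(1,3,8) D_G[OF d(8)] by (auto simp: s mult.assoc intro!: G_mult)
  show "\<epsilon> \<in> hom U (sub U \<epsilon>)" "\<epsilon> \<in> hom (sub U \<epsilon>) U"
    by (rule homI; use d(8) in \<open>simp add: sub_def s mult.assoc\<close>)+
qed

lemma thru_sub:
  assumes "obj U" "\<epsilon> \<in> hom U U" "\<epsilon> * \<epsilon> = \<epsilon>" "g \<in> thru T U U"
  shows "\<epsilon> * g * \<epsilon> \<in> thru T (sub U \<epsilon>) (sub U \<epsilon>)"
  using thru_right[OF thru_left[OF assms(4) sub_hom(2)[OF assms(1-3)]] sub_hom(3)[OF assms(1-3)]] .

lemma add_of_sub:
  assumes "obj U" "\<epsilon> \<in> hom U U" "\<epsilon> * \<epsilon> = \<epsilon>" "add_of T U"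
  shows "add_of T (sub U \<epsilon>)"
  using thru_sub[OF assms(1-3) assms(4)[unfolded add_of_def]] assms homD[OF assms(2)]
  by (simp add: add_of_def sub_def)

lemma add2_of_sub:
  assumes "obj U" "\<epsilon> \<in> hom U U" "\<epsilon> * \<epsilon> = \<epsilon>" "add2_of S T U"
  shows "add2_of S T (sub U \<epsilon>)"
proof -
  obtain g h where gh: "g \<in> thru S U U" "h \<in> thru T U U" "fst U = g + h" using assms(4) unfolding add2_of_def by auto
  have "\<epsilon> * g * \<epsilon> + \<epsilon> * h * \<epsilon> = \<epsilon> * fst U * \<epsilon>" using gh(3) by (simp add: distrib_left distrib_right)
  also have "\<dots> = \<epsilon>" using homD[OF assms(2)] assms(3) by simp
  finally show ?thesis
    unfolding add2_of_def
    using thru_sub[OF assms(1-3) gh(1)] thru_sub[OF assms(1-3) gh(2)] by (metis fst_conv sub_def)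
qed

subsection \<open>Minimal approximations\<close>

text \<open>A left add \<open>T\<close>-approximation of \<open>S\<close>; factoring maps into
  \<open>T\<close> alone suffices, because \<open>apx_thru\<close> extends this to powers of
  \<open>T\<close>.\<close>

definition apx :: "'g \<times> 'g \<Rightarrow> 'g \<times> 'g \<Rightarrow> 'g \<times> 'g \<Rightarrow> 'g \<Rightarrow> bool" where
  "apx S T U f \<longleftrightarrow> obj U \<and> sized U \<and> add_of T U \<and> f \<in> hom S U \<and> (\<forall>\<phi>\<in>hom S T. \<exists>c\<in>hom U T. \<phi> = c * f)"

lemma zero_obj: "obj (0, 0)" "rk (fst ((0, 0)::'g \<times> 'g)) 0 0" "add_of T (0, 0)"
  by (auto simp: obj_def G_zero rk_0 add_of_def intro: thru_0)

lemma ex_apx_finite: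
  assumes "finite B" "B \<subseteq> hom S T" "obj S" "obj T" "sized T"
  shows "\<exists>U f. obj U \<and> sized U \<and> add_of T U \<and> f \<in> hom S U \<and> (\<forall>\<phi>\<in>B. \<exists>c\<in>hom U T. \<phi> = c * f)"
  using assms(1,2)
proof (induction B)
  case empty
  show ?case by (intro exI[of _ "(0, 0)"] exI[of _ 0]) (use zero_obj in \<open>auto simp: hom_zero sized_def\<close>)
next
  case (insert \<phi> B)
  then obtain U f where U: "obj U" "sized U" "add_of T U" "f \<in> hom S U" "\<forall>\<phi>\<in>B. \<exists>c\<in>hom U T. \<phi> = c * f" by auto
  have p: "\<phi> \<in> hom S T" using insert by simp
  let ?f = "(i1 * fst U) * f + (i2 * fst T) * \<phi>"
  note i = osum_incl[OF U(1) assms(4)] osum_proj[OF U(1) assms(4)]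
  have f: "?f \<in> hom S (osum U T)" by (intro hom_add hom_comp[OF i(1) U(4)] hom_comp[OF i(2) p])
  have 1: "(fst U * r1) * ?f = f" "(fst T * r2) * ?f = \<phi>"
    using objD(2)[OF U(1)] objD(2)[OF assms(4)] homD(2)[OF U(4)] homD(2)[OF p] by (simp_all add: distrib_left mult.assoc)
  have "\<exists>c\<in>hom (osum U T) T. \<psi> = c * ?f" if \<psi>: "\<psi> \<in> insert \<phi> B" for \<psi>
  proof (cases "\<psi> = \<phi>")
    case True
    then show ?thesis using 1 i by metis
  next
    case False
    then obtain c where "c \<in> hom U T" "\<psi> = c * f" using \<psi> False U(5) by auto
    then show ?thesis using 1 hom_comp[OF _ i(3)] by (metis mult.assoc)
  qed
  moreover have "sized (osum U T)" using U(2) assms(5) rk_osum unfolding sized_def by blast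
  ultimately show ?case
    using f osum_obj[OF U(1) assms(4)] add_osum[OF U(1) assms(4) U(3) add_of_self[OF assms(4)]] by blast
qed

lemma finite_spanning:
  assumes "V \<subseteq> vs.span F" "finite F"
  obtains B where "finite B" "B \<subseteq> V" "V \<subseteq> vs.span B"
proof -
  obtain B where B: "B \<subseteq> V" "vs.independent B" "V \<subseteq> vs.span B" using vs.maximal_independent_subset[of V] by metis
  have "finite B" using vs.independent_span_bound[OF assms(2) B(2)] B(1) assms(1) by blast
  then show thesis using B that by blast
qed

lemma ex_apx:
  assumes "obj S" "obj T" "sized S" "sized T"
  shows "\<exists>U f. apx S T U f"
proof -
  obtain m n m' n' where rk: "rk (fst S) m n" "rk (fst T) m' n'" using assms unfolding sized_def by auto
  obtain F where F: "finite F" "\<forall>g\<in>G. fst T * g * fst S \<in> vs.span F"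
    using fdim_rk[OF rk(2,1)] unfolding fdim_def by auto
  have "hom S T \<subseteq> vs.span F"
  proof
    fix h assume h: "h \<in> hom S T"
    then have "fst T * h * fst S = h" "h \<in> G" using homD[OF h] D_G by auto
    then show "h \<in> vs.span F" using F by metis
  qed
  then obtain B where B: "finite B" "B \<subseteq> hom S T" "hom S T \<subseteq> vs.span B" using finite_spanning F(1) by metis
  obtain U f where U: "obj U" "sized U" "add_of T U" "f \<in> hom S U" "\<forall>\<phi>\<in>B. \<exists>c\<in>hom U T. \<phi> = c * f"
    using ex_apx_finite[OF B(1,2) assms(1,2,4)] by blast
  have "\<exists>c\<in>hom U T. \<phi> = c * f" if "\<phi> \<in> vs.span B" for \<phi>
    using that
  proof (induction rule: vs.span_induct_alt)
    case base
    show ?case by (rule bexI[OF _ hom_zero]) simp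
  next
    case (step c x y)
    obtain a b where "a \<in> hom U T" "x = a * f" "b \<in> hom U T" "y = b * f" using step U(5) by blast
    then show ?case using hom_add[OF hom_kap[OF _ assms(2)]]
      by (intro bexI[of _ "\<kappa> c * a + b"]) (auto simp: distrib_right mult.assoc)
  qed
  then show ?thesis using U B(3) unfolding apx_def by blast
qed

lemma apx_thru:
  assumes "apx S T U f" "\<phi> \<in> thru T S V"
  shows "\<exists>c\<in>hom U V. \<phi> = c * f"
  using assms(2)
proof (induction rule: thru.induct)
  case thru_0
  show ?case by (rule bexI[OF _ hom_zero]) simp
next
  case (thru_step g a b)
  obtain c d where "c \<in> hom U V" "g = c * f" "d \<in> hom U T" "b = d * f"
    using thru_step assms(1) unfolding apx_def by blast
  then show ?case using hom_add hom_comp[OF thru_step(2)]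
    by (intro bexI[of _ "c + a * d"]) (auto simp: distrib_right mult.assoc)
qed

lemma apx_add: "apx S T U f \<Longrightarrow> add_of T V \<Longrightarrow> \<phi> \<in> hom S V \<Longrightarrow> \<exists>c\<in>hom U V. \<phi> = c * f"
  using apx_thru add_of_hom by blast

text \<open>Minimality is expressed by nilpotency of the endomorphisms that kill \<open>f\<close>.
  Consequently an endomorphism fixing \<open>f\<close> is invertible, the form in which it is
  applied.\<close>

definition minapx :: "'g \<times> 'g \<Rightarrow> 'g \<times> 'g \<Rightarrow> 'g \<times> 'g \<Rightarrow> 'g \<Rightarrow> bool" where
  "minapx S T U f \<longleftrightarrow> apx S T U f \<and> (\<forall>h\<in>hom U U. h * f = 0 \<longrightarrow> (\<exists>N. h ^ N = 0))"

text \<open>Take \<open>U\<close> of least total rank. If \<open>h * f = 0\<close>, the Fitting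
  idempotent of \<open>h\<close> also kills \<open>f\<close>, so its complement still approximates
  \<open>S\<close>; by minimality the idempotent is 0 and \<open>h\<close> is nilpotent.\<close>

lemma ex_minapx:
  assumes "obj S" "obj T" "sized S" "sized T"
  shows "\<exists>U f. minapx S T U f"
proof -
  define P where "P k \<longleftrightarrow> (\<exists>U f m n. apx S T U f \<and> rk (fst U) m n \<and> m + n = k)" for k
  have "\<exists>k. P k" using ex_apx[OF assms] unfolding P_def apx_def sized_def by blast
  then obtain k where k: "P k" "\<And>l. l < k \<Longrightarrow> \<not> P l" using exists_least_iff[of P] by blast
  obtain U f m n where U: "apx S T U f" "rk (fst U) m n" "m + n = k" using k(1) unfolding P_def by blast
  note u = U(1)[unfolded apx_def]
  have "\<exists>N. h ^ N = 0" if h: "h \<in> hom U U" "h * f = 0" for h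
  proof -
    have ob: "obj U" using u by blast
    obtain \<epsilon> N q where e: "\<epsilon> \<in> hom U U" "\<epsilon> * \<epsilon> = \<epsilon>" "0 < N" "h ^ N * \<epsilon> = h ^ N" "\<epsilon> = h * q" "\<epsilon> = q * h"
      by (rule fitting[OF ob U(2) h(1)])
    let ?g = "fst U - \<epsilon>"
    note he = homD[OF e(1)] objD[OF ob]
    have g: "?g \<in> hom U U" "?g * ?g = ?g" using hom_diff[OF hom_id[OF ob] e(1)] e(2) he
      by (auto simp: left_diff_distrib right_diff_distrib)
    have ef: "\<epsilon> * f = 0" using e(6) h(2) by (simp add: mult.assoc)
    have f: "f \<in> hom S U" using u by blast
    have gf: "?g * f = f" using ef homD[OF f] by (simp add: left_diff_distrib)
    have "f \<in> hom S (sub U ?g)" using hom_comp[OF sub_hom(2)[OF ob g] f] gf by simp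
    moreover have "\<exists>c\<in>hom (sub U ?g) T. \<phi> = c * f" if \<phi>: "\<phi> \<in> hom S T" for \<phi>
    proof -
      obtain c where "c \<in> hom U T" "\<phi> = c * f" using u \<phi> by blast
      then show ?thesis using hom_comp[OF _ sub_hom(3)[OF ob g]] gf by (metis mult.assoc)
    qed
    moreover obtain a b c d where rk: "rk \<epsilon> a b" "rk ?g c d" "a + c = m" "b + d = n"
      using rk_split[OF U(2)] he(1-3) e(2) by blast
    ultimately have "P (c + d)"
      unfolding P_def apx_def using sub_hom(1)[OF ob g] add_of_sub[OF ob g] u
      by (intro exI[of _ "sub U ?g"] exI[of _ f] exI[of _ c] exI[of _ d]) (auto simp: sub_def sized_def)
    then have "\<not> c + d < k" using k(2) by blast
    then have "\<epsilon> = 0" using rk U(3) rk_zero_iff[OF rk(1)] by linarith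
    then show ?thesis using e(4) by (metis mult_zero_right)
  qed
  then show ?thesis using U(1) unfolding minapx_def by blast
qed

subsection \<open>Conflations\<close>

text \<open>A degreewise split exact sequence \<open>A \<rightarrow> E \<rightarrow> C\<close> with maps \<open>j\<close>, \<open>\<pi>\<close>; the diagonal elements \<open>r\<close> and \<open>i\<close>
  split it degreewise, but need not be maps of complexes.\<close>

definition confl :: "'g \<times> 'g \<Rightarrow> 'g \<times> 'g \<Rightarrow> 'g \<times> 'g \<Rightarrow> 'g \<Rightarrow> 'g \<Rightarrow> 'g \<Rightarrow> 'g \<Rightarrow> bool" where
  "confl A E C j \<pi> r i \<longleftrightarrow> obj A \<and> obj E \<and> obj C \<and> j \<in> hom A E \<and> \<pi> \<in> hom E C \<and> r \<in> dmap E A \<and> i \<in> dmap C E \<and>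
     r * j = fst A \<and> \<pi> * i = fst C \<and> \<pi> * j = 0 \<and> j * r + i * \<pi> = fst E"

lemma conflD:
  assumes "confl A E C j \<pi> r i"
  shows "obj A" "obj E" "obj C" "j \<in> hom A E" "\<pi> \<in> hom E C" "r \<in> dmap E A" "i \<in> dmap C E"
    "r * j = fst A" "\<pi> * i = fst C" "\<pi> * j = 0" "j * r + i * \<pi> = fst E"
  using assms unfolding confl_def by auto

lemma confl_ri:
  assumes "confl A E C j \<pi> r i"
  shows "r * i = 0"
proof -
  note c = conflD[OF assms]
  have "r = r * (j * r + i * \<pi>)" using c(6,11) dmapD by simp
  also have "\<dots> = r + r * i * \<pi>" using c(8) dmapD(2)[OF c(6)] by (simp add: distrib_left mult.assoc[symmetric])
  finally have "r * i * \<pi> = 0" by simp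
  then have "r * i * (\<pi> * i) = 0" by (simp add: mult.assoc[symmetric])
  then show ?thesis using c(9) dmapD(3)[OF c(7)] by (simp add: mult.assoc)
qed

lemma confl_left: "confl A E C j \<pi> r i \<Longrightarrow> fst E * a = a \<Longrightarrow> a = j * (r * a) + i * (\<pi> * a)"
  using conflD(11)[of A E C j \<pi> r i] distrib_right[of "j * r" "i * \<pi>" a] by (simp add: mult.assoc)

lemma confl_right: "confl A E C j \<pi> r i \<Longrightarrow> a * fst E = a \<Longrightarrow> a = a * j * r + a * i * \<pi>"
  using conflD(11)[of A E C j \<pi> r i] distrib_left[of a "j * r" "i * \<pi>"] by (simp add: mult.assoc)

text \<open>The degreewise lift \<open>i * \<phi>\<close> fails to be a chain map by a degree 1 map
  with values in \<open>A\<close>. Vanishing of extensions from \<open>V\<close> to \<open>A\<close>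
  supplies the correction.\<close>

lemma confl_lift:
  assumes "confl A E C j \<pi> r i" "\<phi> \<in> hom V C" "ext0 V A" "obj V"
  shows "\<exists>k\<in>hom V E. \<pi> * k = \<phi>"
proof -
  note c = conflD[OF assms(1)]
  let ?a = "i * \<phi>"
  have a: "?a \<in> dmap V E" using dmap_comp c(7) homD(5)[OF assms(2)] by blast
  have pa: "\<pi> * ?a = \<phi>" using c(9) homD(2)[OF assms(2)] by (simp add: mult.assoc[symmetric])
  let ?z = "del V E ?a"
  have z: "?z \<in> hx V E" using del_hx a assms(4) c(2) by blast
  have "\<pi> * ?z = 0" using del_comp_left[OF c(5), of V ?a] pa homD(6)[OF assms(2)] by simp
  then have z1: "?z = j * (r * ?z)" using confl_left[OF assms(1) hxD(4)[OF z]] by simp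
  obtain b where b: "b \<in> dmap V A" "r * ?z = del V A b" using hx_left[OF z c(6)] assms(3) unfolding ext0_def by blast
  have "?a - j * b \<in> dmap V E" using a b dmap_comp dmap_diff homD(5)[OF c(4)] by blast
  moreover have "del V E (?a - j * b) = 0" using z1 b(2) del_comp_left[OF c(4), of V b] by (simp add: del_diff)
  moreover have "\<pi> * (?a - j * b) = \<phi>" using pa c(10) by (simp add: right_diff_distrib mult.assoc[symmetric])
  ultimately show ?thesis unfolding hom_def by blast
qed

lemma confl_extend:
  assumes "confl A E C j \<pi> r i" "\<phi> \<in> hom A V" "ext0 C V" "obj V"
  shows "\<exists>k\<in>hom E V. k * j = \<phi>"
proof -
  note c = conflD[OF assms(1)]
  let ?a = "\<phi> * r"
  have a: "?a \<in> dmap E V" using dmap_comp c(6) homD(5)[OF assms(2)] by blast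
  have pa: "?a * j = \<phi>" using c(8) homD(3)[OF assms(2)] by (simp add: mult.assoc)
  let ?z = "del E V ?a"
  have z: "?z \<in> hx E V" using del_hx a assms(4) c(2) by blast
  have "?z * j = 0" using del_comp_right[OF c(4), of V ?a] pa homD(6)[OF assms(2)] by simp
  then have z1: "?z = ?z * i * \<pi>" using confl_right[OF assms(1) hxD(5)[OF z]] by simp
  obtain b where b: "b \<in> dmap C V" "?z * i = del C V b" using hx_right[OF z c(7)] assms(3) unfolding ext0_def by blast
  have "?a - b * \<pi> \<in> dmap E V" using a b dmap_comp dmap_diff homD(5)[OF c(5)] by blast
  moreover have "del E V (?a - b * \<pi>) = 0" using z1 b(2) del_comp_right[OF c(5), of V b] by (simp add: del_diff)
  moreover have "(?a - b * \<pi>) * j = \<phi>" using pa c(10) by (simp add: left_diff_distrib mult.assoc)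
  ultimately show ?thesis unfolding hom_def by blast
qed

lemma confl_factor:
  assumes "confl A E C j \<pi> r i" "f \<in> hom V E" "\<pi> * f = 0"
  shows "r * f \<in> hom V A" "f = j * (r * f)"
proof -
  note c = conflD[OF assms(1)]
  show 1: "f = j * (r * f)" using confl_left[OF assms(1) homD(2)[OF assms(2)]] assms(3) by simp
  have "j * del V A (r * f) = 0" using del_comp_left[OF c(4), of V "r * f"] 1 homD(6)[OF assms(2)] by simp
  then have "r * j * del V A (r * f) = 0" by (simp add: mult.assoc)
  moreover have "fst A * del V A (r * f) = del V A (r * f)"
    using dmapD(2)[OF c(6)] objD(6)[OF c(1)] by (simp add: del_def right_diff_distrib mult.assoc[symmetric])
  ultimately show "r * f \<in> hom V A"
    unfolding hom_def using dmap_comp[OF c(6) homD(5)[OF assms(2)]] c(8) by simp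
qed

lemma confl_cofactor:
  assumes "confl A E C j \<pi> r i" "f \<in> hom E V" "f * j = 0"
  shows "f * i \<in> hom C V" "f = f * i * \<pi>"
proof -
  note c = conflD[OF assms(1)]
  show 1: "f = f * i * \<pi>" using confl_right[OF assms(1) homD(3)[OF assms(2)]] assms(3) by simp
  have "del C V (f * i) * \<pi> = 0" using del_comp_right[OF c(5), of V "f * i"] 1 homD(6)[OF assms(2)] by simp
  then have "del C V (f * i) * (\<pi> * i) = 0" by (simp add: mult.assoc[symmetric])
  moreover have "del C V (f * i) * fst C = del C V (f * i)"
    using dmapD(3)[OF c(7)] objD(7)[OF c(3)] by (simp add: del_def left_diff_distrib mult.assoc)
  ultimately show "f * i \<in> hom C V"
    unfolding hom_def using dmap_comp[OF homD(5)[OF assms(2)] c(7)] c(9) by simp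
qed

text \<open>Hom(V, -[1]) is right exact, as two-term complexes admit no degree 2 maps: a degree 1
  map lifts along the degreewise section \<open>i\<close>.\<close>

lemma ext0_quot:
  assumes "confl A E C j \<pi> r i" "ext0 V E"
  shows "ext0 V C"
  unfolding ext0_def
proof
  note c = conflD[OF assms(1)]
  fix z assume z: "z \<in> hx V C"
  obtain a where a: "a \<in> dmap V E" "i * z = del V E a" using hx_left[OF z c(7)] assms(2) unfolding ext0_def by blast
  have "z = \<pi> * (i * z)" using c(9) hxD(4)[OF z] by (simp add: mult.assoc[symmetric])
  also have "\<dots> = del V C (\<pi> * a)" using a(2) del_comp_left[OF c(5)] by simp
  finally show "\<exists>a\<in>dmap V C. z = del V C a" using a dmap_comp homD(5)[OF c(5)] by blast
qed

text \<open>A piece of the long exact sequence. If the pullback of \<open>z\<close> to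
  \<open>E\<close> is the boundary of \<open>a\<close>, then \<open>a * j\<close> is a chain map on
  \<open>A\<close>; subtracting its extension \<open>k\<close> from \<open>a\<close> gives a map
  that descends to \<open>C\<close>.\<close>

lemma ext0_cokernel:
  assumes "confl A E C j \<pi> r i" "ext0 E V" "\<And>\<phi>. \<phi> \<in> hom A V \<Longrightarrow> \<exists>k\<in>hom E V. \<phi> = k * j"
  shows "ext0 C V"
  unfolding ext0_def
proof
  note c = conflD[OF assms(1)]
  fix z assume z: "z \<in> hx C V"
  obtain a where a: "a \<in> dmap E V" "z * \<pi> = del E V a"
    using hx_right[OF z homD(5)[OF c(5)]] assms(2) unfolding ext0_def by blast
  have "del A V (a * j) = 0" using del_comp_right[OF c(4), of V a] a(2) c(10) by (metis mult.assoc mult_zero_right)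
  then have "a * j \<in> hom A V" unfolding hom_def using dmap_comp[OF a(1) homD(5)[OF c(4)]] by simp
  then obtain k where k: "k \<in> hom E V" "a * j = k * j" using assms(3) by blast
  define b where b_def: "b = a - k"
  have b: "b \<in> dmap E V" "b * j = 0" "del E V b = z * \<pi>"
    using a k dmap_diff homD[OF k(1)] unfolding b_def by (auto simp: left_diff_distrib del_diff)
  have "b = b * i * \<pi>" using confl_right[OF assms(1) dmapD(3)[OF b(1)]] b(2) by simp
  then have "z * \<pi> = del C V (b * i) * \<pi>" using b(3) del_comp_right[OF c(5), of V "b * i"] by simp
  then have "z * (\<pi> * i) = del C V (b * i) * (\<pi> * i)" by (simp add: mult.assoc[symmetric])
  moreover have "del C V (b * i) * fst C = del C V (b * i)"
    using dmapD(3)[OF c(7)] objD(7)[OF c(3)] by (simp add: del_def left_diff_distrib mult.assoc)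
  ultimately have "z = del C V (b * i)" using c(9) hxD(5)[OF z] by simp
  then show "\<exists>a\<in>dmap C V. z = del C V a" using dmap_comp[OF b(1) c(7)] by blast
qed

lemma ext0_middle:
  assumes "confl A E C j \<pi> r i" "ext0 V A" "ext0 V C" "obj V"
  shows "ext0 V E"
  unfolding ext0_def
proof
  note c = conflD[OF assms(1)]
  fix z assume z: "z \<in> hx V E"
  obtain a where a: "a \<in> dmap V C" "\<pi> * z = del V C a" using hx_left[OF z homD(5)[OF c(5)]] assms(3) unfolding ext0_def by blast
  let ?w = "z - del V E (i * a)"
  have ia: "i * a \<in> dmap V E" using dmap_comp c(7) a by blast
  have wd: "?w \<in> hx V E" using z del_hx[OF assms(4) c(2) ia] unfolding hx_def
    by (auto simp: left_diff_distrib right_diff_distrib G_diff)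
  have pia: "\<pi> * (i * a) = a" using c(9) dmapD(2)[OF a(1)] by (simp add: mult.assoc[symmetric])
  have "\<pi> * ?w = 0" using a(2) del_comp_left[OF c(5), of V "i * a"] pia by (simp add: right_diff_distrib)
  then have w: "?w = j * (r * ?w)" using confl_left[OF assms(1) hxD(4)[OF wd]] by simp
  obtain b where b: "b \<in> dmap V A" "r * ?w = del V A b" using hx_left[OF wd c(6)] assms(2) unfolding ext0_def by blast
  have "?w = del V E (j * b)" using w b(2) del_comp_left[OF c(4), of V b] by simp
  then have "z = del V E (j * b + i * a)" by (simp add: del_add diff_eq_eq)
  then show "\<exists>a\<in>dmap V E. z = del V E a"
    using ia dmap_add dmap_comp[OF homD(5)[OF c(4)] b(1)] by blast
qed

lemma confl_rk:
  assumes "confl A E C j \<pi> r i" "rk (fst E) M N" "rk (fst A) m n"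
  obtains c d where "rk (fst C) c d" "M = m + c" "N = n + d"
proof -
  note c = conflD[OF assms(1)]
  note d = homD[OF c(4)] homD[OF c(5)] dmapD[OF c(6)] dmapD[OF c(7)]
  have 1: "eqv D (fst A) (j * r)" unfolding eqv_def
    by (rule bexI[of _ r], rule bexI[of _ j]) (use d c(8) in \<open>auto simp: mult.assoc[symmetric]\<close>, simp_all add: mult.assoc c(8) d)
  have 2: "eqv D (i * \<pi>) (fst C)" unfolding eqv_def
    by (rule bexI[of _ i], rule bexI[of _ \<pi>]) (use d c(9) in \<open>auto simp: mult.assoc\<close>, simp_all add: mult.assoc[symmetric] c(9) d)
  have ip: "fst E - j * r = i * \<pi>" using c(11) by (metis add_diff_cancel_left')
  note jr = D.eqv_idem[OF eqv_sym[OF 1]]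
  have "fst E * (j * r) = j * r" "j * r * fst E = j * r" using d by (simp_all add: mult.assoc[symmetric]) (simp add: mult.assoc d)
  then obtain a b x y where k: "rk (j * r) a b" "rk (i * \<pi>) x y" "a + x = M" "b + y = N"
    using rk_split[OF assms(2), of "j * r"] jr unfolding ip by blast
  have "a = m \<and> b = n" using rk_unique[OF k(1) rk_eqv[OF assms(3) 1]] .
  then show thesis using that[OF rk_eqv[OF k(2) 2]] k by blast
qed

lemma un_zero: "un U 0 \<Longrightarrow> fst U = 0"
  unfolding unit_in_def by auto

lemma add_of_unit:
  assumes "indec T" "obj U" "add_of T U" "fst U \<noteq> 0"
  obtains a b where "a \<in> hom T U" "b \<in> hom U T" "un T (b * a)"
  using thru_radical[OF assms(1,2) assms(3)[unfolded add_of_def]] un_zero[of U] assms(4) that by (metis diff_self)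

text \<open>A nonzero object of add \<open>T\<close> has an invertible composite
  \<open>T \<rightarrow> U \<rightarrow> T\<close> by \<open>thru_radical\<close>, hence a direct
  summand \<open>T\<close>. Removing it lowers the rank by that of \<open>T\<close>.\<close>

lemma add_of_rk:
  assumes "indec T" "rk (fst T) m n"
  shows "rk (fst U) M N \<Longrightarrow> obj U \<Longrightarrow> add_of T U \<Longrightarrow> \<exists>k. M = k * m \<and> N = k * n"
proof (induction "M + N" arbitrary: U M N rule: less_induct)
  case less
  show ?case
  proof (cases "fst U = 0")
    case True
    then show ?thesis using rk_0_unique[OF less(2)] by (intro exI[of _ 0]) simp
  next
    case False
    obtain a b where ab: "a \<in> hom T U" "b \<in> hom U T" "un T (b * a)"
      using add_of_unit[OF assms(1) less(3,4) False] .
    obtain w where w: "w \<in> hom T T" "w * (b * a) = fst T" using ab(3) unfolding unit_in_def by auto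
    define c where c_def: "c = w * b"
    have c: "c \<in> hom U T" "c * a = fst T" using hom_comp[OF w(1) ab(2)] w by (simp_all add: c_def mult.assoc)
    note d = homD[OF ab(1)] homD[OF c(1)] objD[OF less(3)]
    let ?e = "fst U - a * c"
    have ac: "a * c \<in> hom U U" "a * c * (a * c) = a * c"
      using hom_comp[OF ab(1) c(1)] c(2) d by (simp_all add: mult.assoc) (simp add: mult.assoc[symmetric])
    note acd = homD[OF ac(1)]
    have e: "?e \<in> hom U U" "?e * ?e = ?e"
      using hom_diff[OF hom_id[OF less(3)] ac(1)] ac(2) acd d by (auto simp: left_diff_distrib right_diff_distrib)
    have "eqv D (fst T) (a * c)" unfolding eqv_def
      by (rule bexI[of _ c], rule bexI[of _ a]) (use d c(2) in \<open>auto simp: mult.assoc\<close>, simp_all add: mult.assoc[symmetric] c(2) d)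
    then have "rk (a * c) m n" using rk_eqv[OF assms(2)] by blast
    moreover obtain p q x y where k: "rk (a * c) p q" "rk ?e x y" "p + x = M" "q + y = N"
      using rk_split[OF less(2), of "a * c"] acd ac by blast
    ultimately have pq: "p = m" "q = n" using rk_unique by blast+
    have "m + n \<noteq> 0" using rk_zero_iff[OF assms(2)] assms(1) unfolding indec_def by auto
    then have "x + y < M + N" using k pq by linarith
    moreover have "rk (fst (sub U ?e)) x y" using k by (simp add: sub_def)
    ultimately obtain l where "x = l * m" "y = l * n"
      using less(1) sub_hom(1)[OF less(3) e] add_of_sub[OF less(3) e less(4)] by blast
    then show ?thesis using k pq by (intro exI[of _ "Suc l"]) auto
  qed
qed

section \<open>The two projectives as complexes concentrated in one degree\<close>

definition P0 :: "'g \<times> 'g" where "P0 = (\<epsilon>1, 0)"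
definition N0 :: "'g \<times> 'g" where "N0 = (\<epsilon>2, 0)"

lemma PN_simps [simp]: "fst P0 = \<epsilon>1" "snd P0 = 0" "fst N0 = \<epsilon>2" "snd N0 = 0"
  by (simp_all add: P0_def N0_def)

lemma PN_obj: "obj P0" "obj N0" "sized P0" "sized N0"
  using rk_eps by (auto simp: obj_def sized_def G_zero)

lemma local_indec:
  assumes "obj (s, 0)" "D.local_idem s" "rk s m n"
  shows "indec (s, 0)"
  unfolding indec_def using assms D.local_idem_trivial[OF assms(2)]
  by (auto simp: D.local_idem_def hom_def dmap_def)

lemma PN_indec: "indec P0" "indec N0"
  unfolding P0_def N0_def
  using local_indec[OF _ eps_local_idem(1) rk_eps(1)] local_indec[OF _ eps_local_idem(2) rk_eps(2)] PN_obj
  by (auto simp: P0_def N0_def)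

lemma ext0_N: "ext0 V N0"
proof -
  have "z = 0" if "z \<in> hx V N0" for z
    using hxD[OF that] by (metis PN_simps(3) eps_e0(2) mult.assoc mult_zero_left)
  then show ?thesis unfolding ext0_def using dmap_zero del_zero by metis
qed

lemma ext0_P: "ext0 P0 V"
proof -
  have "z = 0" if "z \<in> hx P0 V" for z
    using hxD[OF that] by (metis PN_simps(1) eps_e0(3) mult.assoc mult_zero_right)
  then show ?thesis unfolding ext0_def using dmap_zero del_zero by metis
qed

text \<open>Diagonal elements factoring through a power of the single projective
  \<open>\<epsilon>\<close>. Between objects with zero differential they become maps through
  \<open>P0\<close> or \<open>N0\<close>.\<close>

inductive_set dthru :: "'g \<Rightarrow> 'g set" for \<epsilon> where
  dthru_0: "0 \<in> dthru \<epsilon>"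
| dthru_step: "g \<in> dthru \<epsilon> \<Longrightarrow> a \<in> D \<Longrightarrow> b \<in> D \<Longrightarrow> g + a * \<epsilon> * b \<in> dthru \<epsilon>"

lemma simple_e:
  assumes "simple p a b"
  shows "(e1 * p = 0 \<or> (\<exists>x\<in>D. \<exists>y\<in>D. e1 * p = x * \<epsilon>1 * y)) \<and> (e2 * p = 0 \<or> (\<exists>x\<in>D. \<exists>y\<in>D. e2 * p = x * \<epsilon>2 * y))"
  using assms unfolding simple_def
proof (elim disjE conjE)
  assume "eqv D p \<epsilon>1"
  then obtain x y where xy: "x \<in> D" "y \<in> D" "p = x * \<epsilon>1 * y" using eqv_factor by metis
  then have "e1 * p = x * \<epsilon>1 * y" "e2 * p = 0"
    by (simp_all add: mult.assoc D_e1[OF xy(1), symmetric, THEN asr] D_e2[OF xy(1), symmetric, THEN asr])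
  then show ?thesis using xy by blast
next
  assume "eqv D p \<epsilon>2"
  then obtain x y where xy: "x \<in> D" "y \<in> D" "p = x * \<epsilon>2 * y" using eqv_factor by metis
  then have "e2 * p = x * \<epsilon>2 * y" "e1 * p = 0"
    by (simp_all add: mult.assoc D_e1[OF xy(1), symmetric, THEN asr] D_e2[OF xy(1), symmetric, THEN asr])
  then show ?thesis using xy by blast
qed

lemma rk_dthru: "rk s m n \<Longrightarrow> e1 * s \<in> dthru \<epsilon>1 \<and> e2 * s \<in> dthru \<epsilon>2"
proof (induction rule: rk.induct)
  case rk_0
  show ?case by (simp add: dthru_0)
next
  case (rk_step s m n p a b)
  have *: "e * (p + s) \<in> dthru \<epsilon>" if "e * s \<in> dthru \<epsilon>" "e * p = 0 \<or> (\<exists>x\<in>D. \<exists>y\<in>D. e * p = x * \<epsilon> * y)" for e \<epsilon>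
    using that dthru_step[OF that(1)] by (auto simp: distrib_left add.commute)
  show ?case using * simple_e[OF rk_step(2)] rk_step by blast
qed

lemma dthru_compress:
  assumes "obj W" "snd W = 0" "s \<in> D" "V = (s, 0)" "e2 * fst W = fst W" "s * s = s"
  shows "g \<in> dthru \<epsilon>2 \<Longrightarrow> fst W * g * s \<in> thru N0 V W"
proof (induction rule: dthru.induct)
  case dthru_0
  show ?case by (simp add: thru_0)
next
  case (dthru_step g a b)
  note w = objD[OF assms(1)]
  have 1: "fst W * a * \<epsilon>2 \<in> hom N0 W"
    by (rule homI) (use dthru_step w assms in \<open>auto simp: mult.assoc w(2)[THEN asr]\<close>)
  have 2: "\<epsilon>2 * b * s \<in> hom V N0"
    by (rule homI) (use dthru_step w assms in \<open>auto simp: mult.assoc\<close>)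
  have "fst W * (g + a * \<epsilon>2 * b) * s = fst W * g * s + (fst W * a * \<epsilon>2) * (\<epsilon>2 * b * s)"
    by (simp add: distrib_left distrib_right mult.assoc)
  then show ?case using thru_step[OF dthru_step(4) 1 2] by simp
qed

subsection \<open>The mutation step\<close>

text \<open>Projection onto the degree -1 part is a chain map since the differential takes values in
  degree 0, and its target is a sum of copies of \<open>N0\<close>.\<close>

lemma e2_thru:
  assumes "obj S" "sized S"
  shows "e2 * fst S \<in> thru N0 S (e2 * fst S, 0)" "e2 * fst S \<in> hom S (e2 * fst S, 0)" "obj (e2 * fst S, 0)"
proof -
  let ?t = "e2 * fst S"
  note s = objD[OF assms(1)]
  have c: "fst S * e2 = e2 * fst S" using D_e2 s by blast
  have tt: "?t \<in> D" "?t * ?t = ?t" "fst S * ?t = ?t" "?t * fst S = ?t"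
    using s c by (auto simp: mult.assoc s(2)[THEN asr] c c[THEN asr])
  have "e2 * snd S = e2 * (e1 * snd S)" using s by simp
  also have "\<dots> = 0" by simp
  finally have z: "e2 * snd S = 0" .
  show ob: "obj (?t, 0)" using tt by (simp add: obj_def G_zero)
  show h: "?t \<in> hom S (?t, 0)" by (rule homI) (use tt s z in \<open>auto simp: mult.assoc\<close>)
  obtain m n where "rk (fst S) m n" using assms(2) unfolding sized_def by auto
  then have "?t \<in> dthru \<epsilon>2" using rk_dthru by blast
  then have "fst (?t, 0::'g) * ?t * ?t \<in> thru N0 (?t, 0) (?t, 0)"
    by (intro dthru_compress[OF ob]) (use tt in auto)
  then have "?t \<in> thru N0 (?t, 0) (?t, 0)" using tt by simp
  from thru_right[OF this h] show "?t \<in> thru N0 S (?t, 0)" using tt by simp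
qed

lemma thru_trans':
  assumes "g \<in> thru N V W" "\<And>b. b \<in> hom V N \<Longrightarrow> b \<in> thru T V N"
  shows "g \<in> thru T V W"
  using assms(1)
proof (induction rule: thru.induct)
  case thru_0
  show ?case by (rule thru.thru_0)
next
  case (thru_step g a b)
  then show ?case using thru_add thru_left assms(2) by blast
qed

text \<open>The approximation of \<open>S\<close> is a degreewise split monomorphism. In degree -1 this is the hypothesis that
  maps \<open>S \<rightarrow> N0\<close> factor through \<open>T\<close>; in degree 0 it follows because, by rigidity of \<open>T\<close>, every degree-0 map
  from \<open>S\<close> to \<open>T\<close> extends along the approximation.\<close>

lemma apx_split:
  assumes S: "obj S" "sized S" and T: "obj T" "rk (fst T) m' n'" "0 < m'" "ext0 T T"
    and U: "apx S T U f" and F: "\<And>\<phi>. \<phi> \<in> hom S N0 \<Longrightarrow> \<phi> \<in> thru T S N0"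
  shows "\<exists>r\<in>dmap U S. r * f = fst S"
proof -
  note s = objD[OF S(1)]
  note t = objD[OF T(1)]
  have u: "obj U" "add_of T U" "f \<in> hom S U" and U3: "\<And>\<phi>. \<phi> \<in> hom S T \<Longrightarrow> \<exists>c\<in>hom U T. \<phi> = c * f"
    using U unfolding apx_def by auto
  note f = homD[OF u(3)]
  have c: "fst S * e2 = e2 * fst S" "fst S * e1 = e1 * fst S" using D_e2 D_e1 s by blast+
  \<comment> \<open>The projection of \<open>S\<close> to its degree -1 part passes through
    \<open>N0\<close>, hence by \<open>F\<close> through \<open>T\<close>, hence through the
    approximation. So \<open>\<rho>\<close> retracts \<open>f\<close> in degree -1.\<close>
  obtain \<rho> where \<rho>: "\<rho> \<in> hom U (e2 * fst S, 0)" "\<rho> * f = e2 * fst S"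
    using apx_thru[OF U thru_trans'[OF e2_thru(1)[OF S] F]] by metis
  note r = homD[OF \<rho>(1)]
  have sr: "fst S * \<rho> = \<rho>"
  proof -
    have "\<rho> = e2 * fst S * \<rho>" using r by simp
    then have "fst S * \<rho> = fst S * (e2 * (fst S * \<rho>))" by (metis mult.assoc)
    also have "\<dots> = e2 * (fst S * \<rho>)" using c(1)[THEN asr] s(2)[THEN asr] by (simp add: mult.assoc)
    also have "\<dots> = \<rho>" using r by (simp add: mult.assoc)
    finally show ?thesis .
  qed
  have rd: "\<rho> \<in> dmap U S" using r sr by (simp add: dmap_def)
  \<comment> \<open>A degree 0 map \<open>a\<close> misses being a chain map by
    \<open>a * snd S\<close>. Composed with \<open>\<rho>\<close> this defect lives on
    \<open>U\<close>, where it is a boundary because \<open>U\<close> is in add \<open>T\<close> and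
    \<open>T\<close> is rigid; the corrected map factors through the approximation.\<close>
  have ext1: "\<exists>b\<in>dmap U T. a = b * f" if a: "a \<in> dmap S T" "e1 * a = a" for a
  proof -
    note ad = dmapD[OF a(1)]
    have "snd T * a = snd T * e2 * (e1 * a)" using t a by simp
    also have "\<dots> = 0" by (simp add: mult.assoc)
    finally have da: "del S T a = a * snd S" by (simp add: del_def)
    have "a * snd S * \<rho> \<in> hx U T" using hx_right[OF del_hx[OF S(1) T(1) a(1)] rd] da by simp
    then obtain b where b: "b \<in> dmap U T" "a * snd S * \<rho> = del U T b"
      using ext0_add_left[OF T(4) u(2,1)] unfolding ext0_def by blast
    have "del S T (b * f) = a * snd S * \<rho> * f" using del_comp_right[OF u(3)] b(2) by simp
    also have "\<dots> = a * (snd S * e2 * fst S)" using \<rho>(2) by (simp add: mult.assoc)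
    also have "\<dots> = a * snd S" using s by simp
    finally have "a - b * f \<in> hom S T"
      unfolding hom_def using da dmap_diff[OF a(1) dmap_comp[OF b(1) f(5)]] by (simp add: del_diff)
    then obtain c where "c \<in> hom U T" "a - b * f = c * f" using U3 by blast
    then show ?thesis using dmap_add[OF b(1) homD(5)[of c U T]]
      by (intro bexI[of _ "b + c"]) (auto simp: distrib_right diff_eq_eq add.commute)
  qed
  \<comment> \<open>Since \<open>0 < m'\<close>, a copy of the first projective sits in degree 0 of
    \<open>T\<close>. Its inclusion \<open>\<alpha>\<close> and projection \<open>\<beta>\<close>
    turn maps into \<open>\<epsilon>1\<close> into maps into \<open>T\<close>, to which
    \<open>ext1\<close> applies.\<close>
  obtain q t' where q: "fst T = q + t'" "simple q 1 0" "t' * q = 0"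
    using rk_extract[OF T(2), of 1 "m' - 1" 0 n'] T(3) by auto
  have "eqv D q \<epsilon>1" using q(2) unfolding simple_def by auto
  then obtain \<alpha> \<beta> where ab: "\<alpha> \<in> D" "\<beta> \<in> D" "\<beta> * \<alpha> = \<epsilon>1" "q * \<alpha> = \<alpha>" "\<alpha> * \<epsilon>1 = \<alpha>"
    unfolding eqv_def by auto
  have qq: "q * q = q" using simple_idem[OF q(2)] by blast
  have tq: "fst T * q = q" using q qq by (simp add: distrib_right)
  have t\<alpha>: "fst T * \<alpha> = \<alpha>" using tq ab(4) by (metis mult.assoc)
  have e\<alpha>: "e1 * \<alpha> = \<alpha>" using D_e1[OF ab(1)] ab(5) by (metis eps_e(2) mult.assoc)
  have "\<exists>r\<in>dmap U S. r * f = fst S * g * fst S" if "g \<in> dthru \<epsilon>1" for g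
    using that
  proof (induction rule: dthru.induct)
    case dthru_0
    show ?case by (rule bexI[OF _ dmap_zero]) simp
  next
    case (dthru_step g a b)
    obtain r0 where r0: "r0 \<in> dmap U S" "r0 * f = fst S * g * fst S" using dthru_step by blast
    have "\<alpha> * \<epsilon>1 * b * fst S \<in> dmap S T" using dthru_step ab s t\<alpha> t\<alpha>[THEN asr] unfolding dmap_def by (auto simp: mult.assoc)
    moreover have "e1 * (\<alpha> * \<epsilon>1 * b * fst S) = \<alpha> * \<epsilon>1 * b * fst S" using e\<alpha> by (simp add: mult.assoc[symmetric])
    ultimately obtain d where d: "d \<in> dmap U T" "\<alpha> * \<epsilon>1 * b * fst S = d * f" using ext1 by blast
    have x: "fst S * a * \<beta> * fst T \<in> dmap T S" unfolding dmap_def using dthru_step ab s t by (auto simp: mult.assoc s(2)[THEN asr])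
    have "(fst S * a * \<beta> * fst T) * d * f = fst S * a * (\<beta> * (fst T * \<alpha>)) * \<epsilon>1 * b * fst S"
      using d(2) by (simp add: mult.assoc)
    also have "\<dots> = fst S * (a * \<epsilon>1 * b) * fst S" using t\<alpha> ab(3) by (simp add: mult.assoc)
    finally show ?case using r0 dmap_add[OF r0(1) dmap_comp[OF x d(1)]]
      by (intro bexI[of _ "r0 + (fst S * a * \<beta> * fst T) * d"]) (auto simp: distrib_left distrib_right)
  qed
  moreover obtain m n where "rk (fst S) m n" using S(2) unfolding sized_def by auto
  then have "e1 * fst S \<in> dthru \<epsilon>1" using rk_dthru by blast
  ultimately obtain r1 where r1: "r1 \<in> dmap U S" "r1 * f = fst S * (e1 * fst S) * fst S" by blast
  have "r1 * f = e1 * fst S" using r1(2) c(2)[THEN asr] s(2) s(2)[THEN asr] by (simp add: mult.assoc)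
  then have "(r1 + \<rho>) * f = (e1 + e2) * fst S" using \<rho>(2) by (simp only: distrib_right)
  then show ?thesis using dmap_add[OF r1(1) rd] e12 by (intro bexI[of _ "r1 + \<rho>"]) auto
qed

text \<open>The complement \<open>\<epsilon>\<close> of the split image kills \<open>f\<close>,
  hence also \<open>snd U * f = f * snd S\<close>; so the differential of \<open>U\<close> descends
  to the image of \<open>\<epsilon>\<close>.\<close>

lemma cokernel:
  assumes "obj S" "obj U" "f \<in> hom S U" "r \<in> dmap U S" "r * f = fst S"
  shows "\<exists>C \<pi> i. confl S U C f \<pi> r i"
proof -
  define \<epsilon> where eps_def: "\<epsilon> = fst U - f * r"
  note d = objD[OF assms(1)] objD[OF assms(2)] homD[OF assms(3)] dmapD[OF assms(4)]
  have fr: "f * r * (f * r) = f * r" "fst U * (f * r) = f * r" "f * r * fst U = f * r" "f * r \<in> D"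
    using d assms(5) assms(5)[THEN asr] by (auto simp: mult.assoc) (simp add: mult.assoc[symmetric])
  have e: "\<epsilon> \<in> D" "\<epsilon> * \<epsilon> = \<epsilon>" "fst U * \<epsilon> = \<epsilon>" "\<epsilon> * fst U = \<epsilon>" "\<epsilon> * f = 0"
    using fr d assms(5) unfolding eps_def by (auto simp: left_diff_distrib right_diff_distrib mult.assoc)
  have ef: "\<epsilon> * (snd U * (f * r)) = 0"
  proof -
    have "\<epsilon> * (snd U * (f * r)) = \<epsilon> * f * (snd S * r)" using d(18)[THEN asr] by (simp add: mult.assoc)
    then show ?thesis using e(5) by simp
  qed
  have ewe: "\<epsilon> * (snd U * \<epsilon>) = \<epsilon> * snd U"
  proof -
    have "snd U * \<epsilon> = snd U - snd U * (f * r)" using d(14) unfolding eps_def by (simp add: right_diff_distrib)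
    then show ?thesis using ef by (simp add: right_diff_distrib)
  qed
  let ?C = "(\<epsilon>, \<epsilon> * snd U)"
  have "e1 * (\<epsilon> * snd U) = \<epsilon> * snd U" using D_e1[OF e(1)] d(11) by (metis mult.assoc)
  then have C: "obj ?C"
    unfolding obj_def using e d ewe D_G[OF e(1)] by (auto simp: mult.assoc e(2)[THEN asr] intro: G_mult)
  have p: "\<epsilon> \<in> hom U ?C" by (rule homI) (use e d ewe in \<open>auto simp: mult.assoc\<close>)
  have i: "\<epsilon> \<in> dmap ?C U" unfolding dmap_def using e by auto
  have "confl S U ?C f \<epsilon> r \<epsilon>"
    unfolding confl_def using assms C p i e by (auto simp: eps_def)
  then show ?thesis by blast
qed

text \<open>Minimal left approximation with cokernel; this is left mutation at \<open>S\<close>.\<close>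

definition mut :: "'g \<times> 'g \<Rightarrow> 'g \<times> 'g \<Rightarrow> 'g \<times> 'g \<Rightarrow> 'g \<times> 'g \<Rightarrow> 'g \<Rightarrow> 'g \<Rightarrow> 'g \<Rightarrow> 'g \<Rightarrow> bool" where
  "mut S T U C f \<pi> r i \<longleftrightarrow> minapx S T U f \<and> confl S U C f \<pi> r i \<and> sized C"

lemma ex_mut:
  assumes S: "obj S" "sized S" and T: "obj T" "rk (fst T) m' n'" "0 < m'" "ext0 T T"
    and F: "\<And>\<phi>. \<phi> \<in> hom S N0 \<Longrightarrow> \<phi> \<in> thru T S N0"
  shows "\<exists>U C f \<pi> r i. mut S T U C f \<pi> r i"
proof -
  have "sized T" using T(2) unfolding sized_def by blast
  then obtain U f where U: "minapx S T U f" using ex_minapx[OF S(1) T(1) S(2)] by blast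
  then have u: "apx S T U f" "obj U" "f \<in> hom S U" "sized U" unfolding minapx_def apx_def by auto
  obtain r where r: "r \<in> dmap U S" "r * f = fst S" using apx_split[OF S T u(1) F] by blast
  obtain C \<pi> i where C: "confl S U C f \<pi> r i" using cokernel[OF S(1) u(2,3) r] by blast
  have "sized C" using confl_rk[OF C] S(2) u(4) unfolding sized_def by metis
  then show ?thesis using U C unfolding mut_def by blast
qed

text \<open>Vanishing from \<open>C\<close> to \<open>T\<close> is the approximation property in the
  long exact sequence. Vanishing into \<open>C\<close> follows by right exactness, \<open>C\<close>
  being a quotient of \<open>U\<close> in add \<open>T\<close>.\<close>

lemma mut_ext0:
  assumes "mut S T U C f \<pi> r i" "ext0 T T" "obj T"
  shows "ext0 C T" "ext0 T S \<Longrightarrow> ext0 U S" "ext0 T C" "ext0 C C"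
proof -
  have u: "confl S U C f \<pi> r i" "obj U" "add_of T U" "\<And>\<phi>. \<phi> \<in> hom S T \<Longrightarrow> \<exists>c\<in>hom U T. \<phi> = c * f"
    using assms(1) unfolding mut_def minapx_def apx_def by auto
  show ct: "ext0 C T" using ext0_cokernel[OF u(1) ext0_add_left[OF assms(2) u(3,2)] u(4)] .
  show "ext0 T S \<Longrightarrow> ext0 U S" using ext0_add_left u(3,2) by blast
  show "ext0 T C" using ext0_quot[OF u(1) ext0_add_right[OF assms(2) u(3,2)]] .
  show "ext0 C C" using ext0_quot[OF u(1) ext0_add_right[OF ct u(3,2)]] .
qed

text \<open>An idempotent \<open>g\<close> of \<open>C\<close> lifts to \<open>h\<close> on
  \<open>U\<close> and then induces \<open>\<sigma>\<close> on \<open>S\<close>. As \<open>S\<close>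
  is indecomposable, \<open>\<sigma>\<close> is nilpotent or invertible; minimality of the
  approximation passes this on to \<open>h\<close>, and then \<open>g\<close> is 0 or the
  identity.\<close>

lemma mut_indec:
  assumes m: "mut S T U C f \<pi> r i" and S: "indec S" and T: "obj T" "ext0 T S" "ext0 T T" and C0: "fst C \<noteq> 0"
  shows "indec C"
  unfolding indec_def
proof (intro conjI ballI impI)
  have c: "confl S U C f \<pi> r i" and a: "apx S T U f" and ob: "obj U" and ad: "add_of T U" and f: "f \<in> hom S U"
    and mi: "\<And>h. h \<in> hom U U \<Longrightarrow> h * f = 0 \<Longrightarrow> \<exists>N. h ^ N = 0"
    using m unfolding mut_def minapx_def apx_def by auto
  note cd = conflD[OF c]
  show "obj C" using cd by blast
  show "fst C \<noteq> 0" by fact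
  show "\<exists>m n. rk (fst C) m n" using m unfolding mut_def sized_def by blast
  fix g assume g: "g \<in> hom C C" "g * g = g"
  have gp: "g * \<pi> \<in> hom U C" using hom_comp[OF g(1) cd(5)] .
  obtain h where h: "h \<in> hom U U" "\<pi> * h = g * \<pi>"
    using confl_lift[OF c gp mut_ext0(2)[OF m T(3,1,2)] ob] by blast
  have hk: "\<pi> * h ^ k = g ^ k * \<pi>" for k
    by (induction k) (simp_all add: mult.assoc, metis h(2) mult.assoc)
  have "\<pi> * (h * f) = 0" using h(2) cd(10) by (metis mult.assoc mult_zero_right)
  then have hf: "r * (h * f) \<in> hom S S" "h * f = f * (r * (h * f))" using confl_factor[OF c hom_comp[OF h(1) f]] by auto
  define \<sigma> where sg: "\<sigma> = r * (h * f)"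
  have hfs: "h * f = f * \<sigma>" "\<sigma> \<in> hom S S" using hf sg by auto
  have pi_inj: "x = 0" if "x * \<pi> = 0" "x * fst C = x" for x
    using that cd(9) by (metis mult.assoc mult_zero_left)
  have nil: "\<exists>N. k ^ N = 0 \<and> 0 < N" if "k \<in> hom U U" "k * f = 0" for k
    using mi[OF that] by (metis mult_zero_right power_Suc zero_less_Suc)
  consider (u) "un S \<sigma>" | (n) N where "\<sigma> ^ N = 0" using un_or_nilpotent[OF S hfs(2)] by blast
  then show "g = 0 \<or> g = fst C"
  proof cases
    case n
    \<comment> \<open>Some power of \<open>h\<close> kills \<open>f\<close>, so it is nilpotent by
      minimality, and the idempotent \<open>g\<close> vanishes with it.\<close>
    have "h ^ k * f = f * \<sigma> ^ k" for k by (induction k) (simp_all add: mult.assoc, metis hfs(1) mult.assoc)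
    then have "h ^ Suc N * f = 0" using n by (simp add: mult.assoc)
    moreover have "h ^ Suc N \<in> hom U U" using hom_power[OF h(1)] by blast
    ultimately obtain M where "(h ^ Suc N) ^ M = 0" "0 < M" using nil by blast
    then have "h ^ (Suc N * M) = 0" "0 < Suc N * M" by (simp_all only: power_mult) simp_all
    then obtain K where K: "h ^ K = 0" "0 < K" by blast
    have "g ^ K = g" using K(2) g(2)
    proof (induction K)
      case (Suc K)
      then show ?case by (cases K) auto
    qed simp
    then have "g * \<pi> = 0" using hk[of K] K by simp
    then show ?thesis using pi_inj homD(3)[OF g(1)] by blast
  next
    case u
    then obtain w where w: "w \<in> hom S S" "\<sigma> * w = fst S" "w * \<sigma> = fst S" unfolding unit_in_def by auto
    \<comment> \<open>\<open>\<kappa>'\<close> covers the inverse of \<open>\<sigma>\<close>; both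
      \<open>h * \<kappa>'\<close> and \<open>\<kappa>' * h\<close> fix \<open>f\<close>, so they
      are invertible by minimality.\<close>
    obtain \<kappa>' where k: "\<kappa>' \<in> hom U U" "f * w = \<kappa>' * f" using apx_add[OF a ad hom_comp[OF f w(1)]] by blast
    note fd = homD[OF f]
    have "(fst U - h * \<kappa>') * f = 0"
    proof -
      have "h * \<kappa>' * f = h * f * w" using k(2) by (simp add: mult.assoc)
      also have "\<dots> = f" using hfs(1) w(2) fd(3) by (simp add: mult.assoc)
      finally show ?thesis using fd(2) by (simp add: left_diff_distrib)
    qed
    moreover have "(fst U - \<kappa>' * h) * f = 0"
    proof -
      have "\<kappa>' * h * f = \<kappa>' * f * \<sigma>" using hfs(1) by (simp add: mult.assoc)
      also have "\<dots> = f" using k(2)[symmetric] w(3) fd(3) by (simp add: mult.assoc)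
      finally show ?thesis using fd(2) by (simp add: left_diff_distrib)
    qed
    moreover have d: "fst U - h * \<kappa>' \<in> hom U U" using hom_diff hom_id[OF ob] hom_comp h k by blast
    ultimately obtain N where "(fst U - h * \<kappa>') ^ N = 0" using nil by blast
    then have "un U (fst U - (fst U - h * \<kappa>'))" using nilpotent_un_diff[OF ob d] by blast
    then obtain v where v: "v \<in> hom U U" "h * \<kappa>' * v = fst U" unfolding unit_in_def by auto
    have "g * \<pi> * (\<kappa>' * v) = \<pi>"
      using v(2) h(2)[symmetric] homD(3)[OF cd(5)] by (simp add: mult.assoc)
    then have "(fst C - g) * \<pi> = (fst C - g) * g * (\<pi> * (\<kappa>' * v))" by (simp add: mult.assoc)
    also have "\<dots> = 0" using g homD(2)[OF g(1)] by (simp add: left_diff_distrib)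
    finally have "(fst C - g) * \<pi> = 0" .
    moreover have "(fst C - g) * fst C = fst C - g"
      using homD(3)[OF g(1)] objD(2)[OF cd(3)] by (simp add: left_diff_distrib)
    ultimately have "fst C - g = 0" by (rule pi_inj)
    then show ?thesis by simp
  qed
qed

text \<open>Functoriality of minimal approximations: the cokernel of an object of \<open>add S\<close> lies in \<open>add\<close> of the
  cokernel of \<open>S\<close>.\<close>

lemma mut_add:
  assumes m: "mut S T U C f \<pi> r i" and m': "mut A T U' C' f' \<pi>' r' i'" and A: "add_of S A"
  shows "add_of C C'"
proof -
  have c: "confl S U C f \<pi> r i" and a: "apx S T U f" and ad: "add_of T U"
    using m unfolding mut_def minapx_def apx_def by auto
  have c': "confl A U' C' f' \<pi>' r' i'" and a': "apx A T U' f'" and ad': "add_of T U'"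
    and mi: "\<And>h. h \<in> hom U' U' \<Longrightarrow> h * f' = 0 \<Longrightarrow> \<exists>N. h ^ N = 0"
    using m' unfolding mut_def minapx_def apx_def by auto
  note cd = conflD[OF c] and cd' = conflD[OF c']
  have "\<exists>H\<in>hom U' U'. \<exists>H'\<in>thru C C' C'. H * f' = f' * g \<and> \<pi>' * H = H' * \<pi>'" if "g \<in> thru S A A" for g
    using that
  proof (induction rule: thru.induct)
    case thru_0
    show ?case using hom_zero thru.thru_0 by (metis mult_zero_left mult_zero_right)
  next
    case (thru_step g x y)
    obtain H H' where H: "H \<in> hom U' U'" "H' \<in> thru C C' C'" "H * f' = f' * g" "\<pi>' * H = H' * \<pi>'" using thru_step by blast
    obtain X where X: "X \<in> hom U U'" "f' * x = X * f" using apx_add[OF a ad' hom_comp[OF cd'(4) thru_step(2)]] by blast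
    obtain Y where Y: "Y \<in> hom U' U" "f * y = Y * f'" using apx_add[OF a' ad hom_comp[OF cd(4) thru_step(3)]] by blast
    have "\<pi>' * X * f = 0" using X(2) cd'(10) by (metis mult.assoc mult_zero_left)
    from confl_cofactor[OF c hom_comp[OF cd'(5) X(1)] this]
    obtain X' where X': "X' \<in> hom C C'" "\<pi>' * X = X' * \<pi>" by blast
    have "\<pi> * Y * f' = 0" using Y(2) cd(10) by (metis mult.assoc mult_zero_left)
    from confl_cofactor[OF c' hom_comp[OF cd(5) Y(1)] this]
    obtain Y' where Y': "Y' \<in> hom C' C" "\<pi> * Y = Y' * \<pi>'" by blast
    show ?case
    proof (rule bexI[of _ "H + X * Y"], rule bexI[of _ "H' + X' * Y'"], intro conjI)
      show "(H + X * Y) * f' = f' * (g + x * y)"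
        using H(3) X(2) Y(2) by (simp add: distrib_left distrib_right) (metis mult.assoc)
      show "\<pi>' * (H + X * Y) = (H' + X' * Y') * \<pi>'"
        using H(4) X'(2) Y'(2) by (simp add: distrib_left distrib_right) (metis mult.assoc)
      show "H' + X' * Y' \<in> thru C C' C'" using thru.thru_step[OF H(2) X'(1) Y'(1)] .
      show "H + X * Y \<in> hom U' U'" using hom_add[OF H(1) hom_comp[OF X(1) Y(1)]] .
    qed
  qed
  then obtain H H' where H: "H \<in> hom U' U'" "H' \<in> thru C C' C'" "H * f' = f' * fst A" "\<pi>' * H = H' * \<pi>'"
    using A unfolding add_of_def by blast
  note fd = homD[OF cd'(4)]
  \<comment> \<open>\<open>H\<close> covers the identity of \<open>A\<close>, so
    \<open>fst U' - H\<close> is nilpotent by minimality. The induced \<open>fst C' - H'\<close> is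
    then nilpotent as well, and \<open>H'\<close>, which factors through powers of \<open>C\<close>,
    is invertible.\<close>
  have "(fst U' - H) * f' = 0" using H(3) fd by (simp add: left_diff_distrib)
  moreover have d: "fst U' - H \<in> hom U' U'" using hom_diff hom_id cd'(2) H(1) by blast
  ultimately obtain N where N: "(fst U' - H) ^ N = 0" using mi by blast
  have H'h: "H' \<in> hom C' C'" using thru_hom H(2) by blast
  have d': "fst C' - H' \<in> hom C' C'" using hom_diff hom_id cd'(3) H'h by blast
  have st: "\<pi>' * (fst U' - H) = (fst C' - H') * \<pi>'"
    using H(4) homD(2,3)[OF cd'(5)] by (simp add: left_diff_distrib right_diff_distrib)
  have "\<pi>' * (fst U' - H) ^ k = (fst C' - H') ^ k * \<pi>'" for k
    by (induction k) (simp_all add: mult.assoc, metis st mult.assoc)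
  then have "(fst C' - H') ^ N * \<pi>' = 0" using N by (metis mult_zero_right)
  then have "(fst C' - H') ^ N * fst C' = 0" using cd'(9) by (metis mult.assoc mult_zero_left)
  then have "(fst C' - H') ^ Suc N = 0" using homD(3)[OF d'] by (metis homD(2)[OF d'] mult.assoc mult_zero_left power_Suc2)
  then have "un C' (fst C' - (fst C' - H'))" using nilpotent_un_diff[OF cd'(3) d'] by blast
  then obtain w where w: "w \<in> hom C' C'" "H' * w = fst C'" unfolding unit_in_def by auto
  show ?thesis unfolding add_of_def using thru_right[OF H(2) w(1)] w(2) by simp
qed

subsection \<open>Coresolutions of the shifted projective\<close>

text \<open>The object \<open>N0\<close> is the second projective placed in degree -1. For a silting pair \<open>(S, T)\<close> met by the
  mutation sequence it is the cokernel of a map from \<open>add S\<close> to \<open>add T\<close>; this is what keeps the next mutation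
  a two-term complex.\<close>

definition cores :: "'g \<times> 'g \<Rightarrow> 'g \<times> 'g \<Rightarrow> bool" where
  "cores S T \<longleftrightarrow> (\<exists>A E j \<pi> r i. confl A E N0 j \<pi> r i \<and> sized A \<and> sized E \<and> add_of S A \<and> add_of T E)"

text \<open>Rigidity of \<open>S\<close> removes the obstruction to lifting \<open>\<phi>\<close>
  along \<open>E \<rightarrow> N0\<close>, and \<open>E\<close> is in add \<open>T\<close>.\<close>

lemma cores_factor:
  assumes "cores S T" "ext0 S S" "obj S" "\<phi> \<in> hom S N0"
  shows "\<phi> \<in> thru T S N0"
proof -
  obtain A E j \<pi> r i where c: "confl A E N0 j \<pi> r i" "add_of S A" "add_of T E" using assms(1) unfolding cores_def by blast
  obtain k where k: "k \<in> hom S E" "\<pi> * k = \<phi>"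
    using confl_lift[OF c(1) assms(4) ext0_add_right[OF assms(2) c(2)] assms(3)] conflD[OF c(1)] by blast
  then show ?thesis using thru_left[OF add_of_hom[OF c(3) k(1)] conflD(5)[OF c(1)]] by simp
qed

text \<open>A section \<open>i\<close> of \<open>\<pi>\<close> becomes compatible with the
  retraction \<open>r\<close> after subtracting \<open>j * r * i\<close>. The factorisation of
  \<open>fst E - i * \<pi>\<close> through \<open>j\<close> expresses exactness in the
  middle.\<close>

lemma conflI:
  assumes "obj A" "obj E" "obj C" "j \<in> hom A E" "\<pi> \<in> hom E C" "r \<in> dmap E A" "i \<in> dmap C E"
    "r * j = fst A" "\<pi> * i = fst C" "\<pi> * j = 0" "fst E - i * \<pi> = j * y" "fst A * y = y"
  shows "confl A E C j \<pi> r ((fst E - j * r) * i)"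
proof -
  have e: "fst E - j * r \<in> dmap E E" using dmap_diff dmap_id dmap_comp homD(5) assms by metis
  have "(fst E - j * r) * (fst E - i * \<pi>) = j * y - j * (r * j) * y"
    using homD(2)[OF assms(4)] unfolding assms(11) by (simp add: left_diff_distrib mult.assoc[symmetric])
  also have "\<dots> = 0" using assms(8,12) homD(3)[OF assms(4)] by (simp add: mult.assoc)
  finally have "(fst E - j * r) * fst E = (fst E - j * r) * (i * \<pi>)"
    by (simp only: right_diff_distrib[of "fst E - j * r"]) simp
  moreover have "(fst E - j * r) * fst E = fst E - j * r"
    using objD(2)[OF assms(2)] dmapD(3)[OF assms(6)] by (simp add: left_diff_distrib mult.assoc)
  ultimately have "(fst E - j * r) * i * \<pi> = fst E - j * r" by (simp add: mult.assoc)
  moreover have "\<pi> * ((fst E - j * r) * i) = fst C"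
    using assms(9,10) homD(3)[OF assms(5)] by (simp add: right_diff_distrib left_diff_distrib mult.assoc[symmetric])
  ultimately show ?thesis unfolding confl_def using assms(1-8,10) dmap_comp[OF e assms(7)] by simp
qed

text \<open>The pushout of \<open>A \<rightarrow> E \<rightarrow> N0\<close> along \<open>A \<rightarrow> U\<close>, whose middle term splits as \<open>E\<close> plus the cokernel of
  \<open>A \<rightarrow> U\<close>.\<close>

lemma pushout_confl:
  assumes c0: "confl A E N j \<pi> r i" and c1: "confl A U C f p s t" and ext: "ext0 C E"
  shows "\<exists>J P R I. confl U (osum E C) N J P R I"
proof -
  note d0 = conflD[OF c0] and d1 = conflD[OF c1]
  \<comment> \<open>The extension \<open>k\<close> of \<open>j\<close> over \<open>f\<close> exists
    because \<open>C\<close> has no extensions with \<open>E\<close>; it is what splits the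
    pushout.\<close>
  obtain k where k: "k \<in> hom U E" "k * f = j" using confl_extend[OF c1 d0(4) ext d0(2)] by blast
  have "\<pi> * k * f = 0" using k(2) d0(10) by (simp add: mult.assoc)
  from confl_cofactor[OF c1 hom_comp[OF d0(5) k(1)] this]
  obtain \<theta> where th: "\<theta> \<in> hom C N" "\<pi> * k = \<theta> * p" by blast
  let ?E = "osum E C"
  note oi = osum_incl[OF d0(2) d1(3)] osum_proj[OF d0(2) d1(3)]
  \<comment> \<open>In components \<open>J = (k, p)\<close> and
    \<open>P = (\<pi>, -\<theta>)\<close>. \<open>R\<close> and \<open>I\<close> split them
    degreewise, and \<open>Y\<close> witnesses exactness in the middle.\<close>
  define J where J_def: "J = i1 * fst E * k + i2 * fst C * p"
  define P where P_def: "P = \<pi> * (fst E * r1) - \<theta> * (fst C * r2)"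
  define R where R_def: "R = f * r * (fst E * r1) + (t - f * r * k * t) * (fst C * r2)"
  define I where I_def: "I = i1 * fst E * i"
  define Y where Y_def: "Y = f * r * r1 + t * r2 + f * r * (i * \<theta> - k * t) * r2"
  note x = homD(2,3)[OF k(1)] homD(2,3)[OF th(1)] homD(2,3)[OF d0(4)] homD(2,3)[OF d0(5)] homD(2,3)[OF d1(4)]
     homD(2,3)[OF d1(5)] dmapD(2,3)[OF d0(6)] dmapD(2,3)[OF d0(7)] dmapD(2,3)[OF d1(6)] dmapD(2,3)[OF d1(7)]
     objD(2)[OF d0(1)] objD(2)[OF d0(2)] objD(2)[OF d0(3)] objD(2)[OF d1(2)] objD(2)[OF d1(3)]
     d0(8-10) d1(8-10) k(2) th(2) confl_ri[OF c0] confl_ri[OF c1]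
  note x' = x x[THEN asr]
  have f1: "f * s = fst U - t * p" using d1(11) by (simp add: eq_diff_eq)
  have j1: "j * r = fst E - i * \<pi>" using d0(11) by (simp add: eq_diff_eq)
  have Jh: "J \<in> hom U ?E" unfolding J_def using hom_add[OF hom_comp[OF oi(1) k(1)] hom_comp[OF oi(2) d1(5)]] .
  have Ph: "P \<in> hom ?E N" unfolding P_def using hom_diff[OF hom_comp[OF d0(5) oi(3)] hom_comp[OF th(1) oi(4)]] .
  have fr: "f * r \<in> dmap E U" using dmap_comp homD(5)[OF d1(4)] d0(6) by blast
  have Rd: "R \<in> dmap ?E U" unfolding R_def
    using dmap_add[OF dmap_comp[OF fr homD(5)[OF oi(3)]] dmap_comp[OF dmap_diff[OF d1(7) dmap_comp[OF dmap_comp[OF fr homD(5)[OF k(1)]] d1(7)]] homD(5)[OF oi(4)]]] .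
  have Id: "I \<in> dmap N ?E" unfolding I_def using dmap_comp[OF homD(5)[OF oi(1)] d0(7)] .
  have RJ: "R * J = fst U"
  proof -
    have "R * J = f * (r * k) + (t * p - f * (r * (k * (t * p))))"
      unfolding R_def J_def by (simp add: distrib_left distrib_right left_diff_distrib mult.assoc x')
    also have "t * p = fst U - f * s" using f1 by simp
    also have "f * (r * (k * (fst U - f * s))) = f * (r * k) - f * s"
      by (simp add: right_diff_distrib x' mult.assoc)
    finally show ?thesis by simp
  qed
  have PI: "P * I = fst N" unfolding P_def I_def by (simp add: left_diff_distrib mult.assoc x')
  have PJ: "P * J = 0" unfolding P_def J_def by (simp add: left_diff_distrib distrib_left mult.assoc x')
  have pt: "\<pi> * (i * \<theta> - k * t) = 0" by (simp add: right_diff_distrib mult.assoc[symmetric] d0(9) th(2)) (simp add: mult.assoc x')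
  have "fst E * (i * \<theta> - k * t) = i * \<theta> - k * t" by (simp add: right_diff_distrib x')
  then have jr: "j * (r * (i * \<theta> - k * t)) = i * \<theta> - k * t" using confl_left[OF c0] pt by (metis add.right_neutral mult_zero_right)
  have Y: "fst ?E - I * P = J * Y"
  proof -
    have "J * Y = i1 * (j * r) * r1 + i1 * (k * (t * r2)) + i2 * fst C * r2 + i1 * (j * (r * (i * \<theta> - k * t))) * r2"
      unfolding J_def Y_def by (simp add: distrib_left distrib_right mult.assoc x')
    also have "\<dots> = i1 * (fst E - i * \<pi>) * r1 + i2 * fst C * r2 + i1 * (i * \<theta>) * r2"
      unfolding jr j1 by (simp add: right_diff_distrib left_diff_distrib mult.assoc)
    also have "\<dots> = fst ?E - I * P"
      unfolding osum_def I_def P_def by (simp add: right_diff_distrib left_diff_distrib mult.assoc x')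
    finally show ?thesis by simp
  qed
  have "fst U * Y = Y" unfolding Y_def by (simp add: distrib_left mult.assoc x')
  then show ?thesis
    using conflI[OF d1(2) osum_obj[OF d0(2) d1(3)] d0(3) Jh Ph Rd Id RJ PI PJ Y] by blast
qed

text \<open>A minimal conflation \<open>A \<rightarrow> E \<rightarrow> N0\<close> with \<open>A\<close> in \<open>add T\<close> has no summand \<open>T\<close> in \<open>E\<close>: a common summand of
  \<open>A\<close> and \<open>E\<close> matched by the map could be cancelled, and an unmatched one contradicts rigidity.\<close>

lemma cores_of_add2:
  assumes "confl A E N0 j \<pi> r i" "sized A" "sized E" "add_of T A" "add2_of T S' E"
    and T: "indec T" "rk (fst T) m' n'" "0 < m'" "ext0 T T" and S': "ext0 S' T"
  shows "cores T S'"
proof -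
  \<comment> \<open>Minimality is measured by the size of \<open>A\<close>: cancelling a common copy
    of \<open>T\<close> shrinks \<open>A\<close> and \<open>E\<close> together.\<close>
  define Q where "Q k \<longleftrightarrow> (\<exists>A E j \<pi> r i m n. confl A E N0 j \<pi> r i \<and> rk (fst A) m n \<and> sized E \<and> add_of T A \<and>
     add2_of T S' E \<and> m + n = k)" for k
  have "\<exists>k. Q k" using assms(1-5) unfolding Q_def sized_def by blast
  then obtain k where k: "Q k" "\<And>l. l < k \<Longrightarrow> \<not> Q l" using exists_least_iff[of Q] by blast
  obtain A E j \<pi> r i m n where c: "confl A E N0 j \<pi> r i" and A: "rk (fst A) m n" "add_of T A" and
    E: "sized E" "add2_of T S' E" and mn: "m + n = k" using k(1) unfolding Q_def by blast
  note cd = conflD[OF c]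
  note oT = indec_obj[OF T(1)]
  have notN: "\<not> isom T N0"
    using isom_rk[OF oT _ T(2)] rk_unique[OF rk_eps(2)] T(3) by fastforce
  \<comment> \<open>An invertible \<open>T \<rightarrow> A \<rightarrow> E \<rightarrow> T\<close>
    would give idempotents \<open>\<mu>\<close> of \<open>A\<close> and \<open>\<eta>\<close> of
    \<open>E\<close>, matched by \<open>j\<close> and with \<open>\<pi> * \<eta> = 0\<close>.
    Splitting off both leaves a smaller conflation ending in \<open>N0\<close>.\<close>
  have red: "\<not> un T (v * j * l)" if v: "v \<in> hom E T" and l: "l \<in> hom T A" for v l
  proof
    assume u: "un T (v * j * l)"
    obtain w where w: "w \<in> hom T T" "v * j * l * w = fst T" using u unfolding unit_in_def by auto
    define l' where l'_def: "l' = l * w"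
    have l': "l' \<in> hom T A" "v * (j * l') = fst T" using hom_comp[OF l w(1)] w(2) by (simp_all add: l'_def mult.assoc)
    define \<mu> where lam: "\<mu> = l' * (v * j)"
    define \<eta> where eta: "\<eta> = j * (l' * v)"
    note x = homD(2,3)[OF l'(1)] homD(2,3)[OF v] homD(2,3)[OF cd(4)] homD(2,3)[OF cd(5)] dmapD(2,3)[OF cd(6)] dmapD(2,3)[OF cd(7)]
      objD(2)[OF cd(1)] objD(2)[OF cd(2)] l'(2) cd(8-10)
    note x' = x x[THEN asr]
    have lh: "\<mu> \<in> hom A A" unfolding lam using hom_comp l' v cd by blast
    have eh: "\<eta> \<in> hom E E" unfolding eta using hom_comp l' v cd by blast
    have vjl: "v * (j * (l' * z)) = fst T * z" for z using l'(2) by (metis mult.assoc)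
    have l2: "\<mu> * \<mu> = \<mu>" "\<eta> * \<eta> = \<eta>" "j * \<mu> = \<eta> * j" "\<pi> * \<eta> = 0"
      unfolding lam eta by (simp_all add: mult.assoc vjl x')
    let ?l = "fst A - \<mu>" and ?e = "fst E - \<eta>"
    have l1: "?l \<in> hom A A" "?l * ?l = ?l" and e1: "?e \<in> hom E E" "?e * ?e = ?e"
      using hom_diff[OF hom_id[OF cd(1)] lh] hom_diff[OF hom_id[OF cd(2)] eh] l2 homD[OF lh] homD[OF eh] x
      by (auto simp: left_diff_distrib right_diff_distrib)
    note y = homD(2,3)[OF lh] homD(2,3)[OF eh] l2
    have jl: "j * ?l = ?e * j" using l2(3) x by (simp add: left_diff_distrib right_diff_distrib)
    have pe: "\<pi> * ?e = \<pi>" using l2(4) x by (simp add: right_diff_distrib)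
    have "confl (sub A ?l) (sub E ?e) N0 (j * ?l) (\<pi> * ?e) (?l * r * ?e) (?e * i)"
      unfolding confl_def
    proof (intro conjI)
      have jj: "j * ?l = ?e * j * ?l" using jl l1(2) by (metis mult.assoc)
      show "j * ?l \<in> hom (sub A ?l) (sub E ?e)"
        unfolding jj using hom_comp[OF hom_comp[OF sub_hom(2)[OF cd(2) e1] cd(4)] sub_hom(3)[OF cd(1) l1]] .
      show "\<pi> * ?e \<in> hom (sub E ?e) N0" using hom_comp[OF cd(5) sub_hom(3)[OF cd(2) e1]] .
      show "?l * r * ?e \<in> dmap (sub E ?e) (sub A ?l)"
        using dmap_comp[OF dmap_comp[OF homD(5)[OF sub_hom(2)[OF cd(1) l1]] cd(6)] homD(5)[OF sub_hom(3)[OF cd(2) e1]]] .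
      show "?e * i \<in> dmap N0 (sub E ?e)" using dmap_comp[OF homD(5)[OF sub_hom(2)[OF cd(2) e1]] cd(7)] .
      have "?l * r * ?e * (j * ?l) = ?l * (r * (?e * (?e * j)))" using jl by (simp add: mult.assoc)
      also have "?e * (?e * j) = j * ?l" using e1(2) jl by (simp add: mult.assoc[symmetric])
      also have "?l * (r * (j * ?l)) = ?l * (fst A * ?l)" using cd(8) by (metis mult.assoc)
      finally show "?l * r * ?e * (j * ?l) = fst (sub A ?l)" using l1(2) homD(2)[OF l1(1)] by (simp add: sub_def)
      show "\<pi> * ?e * (?e * i) = fst N0" using pe cd(9) by (metis mult.assoc)
      show "\<pi> * ?e * (j * ?l) = 0" using pe cd(10) by (metis mult.assoc mult_zero_left)
      have "j * ?l * (?l * r * ?e) = ?e * (j * r) * ?e" using l1(2) jl by (metis mult.assoc)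
      moreover have "?e * i * (\<pi> * ?e) = ?e * (i * \<pi>) * ?e" by (simp add: mult.assoc)
      ultimately have "j * ?l * (?l * r * ?e) + ?e * i * (\<pi> * ?e) = ?e * fst E * ?e"
        using cd(11) by (metis distrib_left distrib_right)
      then show "j * ?l * (?l * r * ?e) + ?e * i * (\<pi> * ?e) = fst (sub E ?e)" using e1(2) homD(3)[OF e1(1)] by (simp add: sub_def)
      show "obj (sub A ?l)" "obj (sub E ?e)" "obj N0" using sub_hom(1) cd e1 l1 by auto
    qed
    moreover obtain a b c' d where rk: "rk \<mu> a b" "rk ?l c' d" "a + c' = m" "b + d = n"
      using rk_split[OF A(1), of \<mu>] y homD(1)[OF lh] by blast
    moreover have "sized (sub E ?e)"
    proof -
      obtain M N where "rk (fst E) M N" using E(1) unfolding sized_def by blast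
      then show ?thesis using rk_split[OF _ homD(1)[OF eh], of "fst E" M N] y unfolding sized_def sub_def by auto
    qed
    ultimately have "Q (c' + d)"
      unfolding Q_def using add_of_sub[OF cd(1) l1 A(2)] add2_of_sub[OF cd(2) e1 E(2)]
      by (metis fst_conv sub_def)
    then have "a = 0" "b = 0" using k(2)[of "c' + d"] rk mn by linarith+
    then have "\<mu> = 0" using rk_zero_iff[OF rk(1)] by simp
    then have "v * j * \<mu> * l' = 0" by simp
    then have "fst T * fst T = 0" unfolding lam using l'(2) by (simp add: mult.assoc vjl)
    then show False using T(1) objD(2)[OF oT] unfolding indec_def by simp
  qed
  have ET: "ext0 E A" using ext0_add2_left[OF ext0_add_right[OF T(4) A(2) cd(1)] ext0_add_right[OF S' A(2) cd(1)] E(2) cd(2)] .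
  have no: "\<not> un T (v * u)" if u: "u \<in> hom T E" and v: "v \<in> hom E T" for u v
  proof
    assume un: "un T (v * u)"
    show False
    proof (cases "fst A = 0")
      case True
      \<comment> \<open>Without \<open>A\<close> the map \<open>\<pi>\<close> identifies
        \<open>E\<close> with \<open>N0\<close>, so the summand \<open>T\<close> of \<open>E\<close>
        would be \<open>N0\<close>, contrary to \<open>0 < m'\<close>.\<close>
      have "j = 0" using homD(3)[OF cd(4)] True by (metis mult_zero_right)
      then have ip: "i * \<pi> = fst E" using cd(11) by simp
      have "\<pi> * (snd E * i) = 0" using homD(4)[OF cd(5)] by (simp add: mult.assoc[symmetric])
      then have "fst E * (snd E * i) = 0" using ip by (metis mult.assoc mult_zero_right)
      then have "snd E * i = 0" using objD(6)[OF cd(2)] by (metis mult.assoc)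
      then have ih: "i \<in> hom N0 E" using cd(7) by (simp add: hom_def del_def)
      have "v * i * (\<pi> * u) = v * (fst E * u)" using ip by (metis mult.assoc)
      then have "un T (v * i * (\<pi> * u))" using un homD(2)[OF u] by simp
      then have "isom T N0" using isom_of_un[OF T(1) PN_indec(2) hom_comp[OF cd(5) u] hom_comp[OF v ih]] by simp
      then show False using notN by simp
    next
      case False
      obtain c' b where b: "c' \<in> hom T A" "b \<in> hom A T" "un T (b * c')" using add_of_unit[OF T(1) cd(1) A(2) False] .
      obtain w where w: "w \<in> hom T T" "w * (v * u) = fst T" using un unfolding unit_in_def by auto
      have v': "w * v \<in> hom E T" using hom_comp[OF w(1) v] .
      have h: "u * b \<in> hom A E" using hom_comp[OF u b(2)] .
      \<comment> \<open>\<open>\<pi> * (u * b)\<close> extends over \<open>j\<close> and is lifted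
        back to an endomorphism \<open>g\<close> of \<open>E\<close>. Hence \<open>u * b\<close>
        differs from \<open>g * j\<close> by some \<open>j * l\<close>, and the invertible
        \<open>b * c'\<close> becomes a sum of two maps passing through \<open>j\<close>; by
        locality one of them contradicts \<open>red\<close>.\<close>
      obtain \<psi> where ps: "\<psi> \<in> hom E N0" "\<psi> * j = \<pi> * (u * b)"
        using confl_extend[OF c hom_comp[OF cd(5) h] ext0_N cd(3)] by blast
      obtain g where g: "g \<in> hom E E" "\<pi> * g = \<psi>" using confl_lift[OF c ps(1) ET cd(2)] by blast
      have "\<pi> * (u * b - g * j) = 0" using ps(2) g(2) by (simp add: right_diff_distrib mult.assoc[symmetric])
      moreover have "u * b - g * j \<in> hom A E" using hom_diff[OF h hom_comp[OF g(1) cd(4)]] .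
      ultimately obtain l where l: "l \<in> hom A A" "u * b - g * j = j * l" using confl_factor[OF c] by metis
      have "w * v * (u * b - g * j) * c' = w * (v * u) * (b * c') - w * v * g * j * c'"
        by (simp add: right_diff_distrib left_diff_distrib mult.assoc)
      also have "w * (v * u) * (b * c') = b * c'" using w(2) homD(2)[OF hom_comp[OF b(2,1)]] by simp
      finally have eq: "b * c' = (w * v * g) * j * c' + (w * v) * j * (l * c')"
        using l(2) by (simp add: mult.assoc diff_eq_eq add.commute)
      have h1: "w * v * g \<in> hom E T" "l * c' \<in> hom T A" using hom_comp v' g(1) l(1) b(1) by blast+
      have "un T ((w * v * g) * j * c') \<or> un T ((w * v) * j * (l * c'))"
        by (rule un_add[OF T(1)]) (use eq b(3) h1 v' b(1) hom_comp cd(4) in metis)+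
      then show False using red h1 v' b(1) by blast
    qed
  qed
  obtain g h where gh: "g \<in> thru T E E" "h \<in> thru S' E E" "fst E = g + h" using E(2) unfolding add2_of_def by auto
  have "un E (fst E - g)" using thru_radical[OF T(1) cd(2) gh(1)] no by blast
  then have "un E h" using gh(3) by (metis add_diff_cancel_left')
  then obtain w where "w \<in> hom E E" "h * w = fst E" unfolding unit_in_def by auto
  then have "add_of S' E" unfolding add_of_def using thru_right[OF gh(2)] by metis
  then show ?thesis unfolding cores_def using c A E unfolding sized_def by blast
qed

subsection \<open>The mutation sequence\<close>

text \<open>A silting pair about to be mutated at \<open>S\<close>. The determinant says that the
  g-vectors form a basis of the lattice, with the ray of \<open>T\<close> on the steeper side;
  \<open>0 < m\<close> means that \<open>S\<close> has a degree 0 part.\<close>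

definition state :: "'g \<times> 'g \<Rightarrow> 'g \<times> 'g \<Rightarrow> nat \<Rightarrow> nat \<Rightarrow> nat \<Rightarrow> nat \<Rightarrow> bool" where
  "state S T m n m' n' \<longleftrightarrow> indec S \<and> indec T \<and> rk (fst S) m n \<and> rk (fst T) m' n' \<and> 0 < m \<and>
     ext0 S S \<and> ext0 S T \<and> ext0 T S \<and> ext0 T T \<and> cores S T \<and> int m * int n' - int m' * int n = 1"

lemma state_step:
  assumes "state S T m n m' n'" "0 < m'"
  shows "\<exists>S' m'' n''. state T S' m' n' m'' n''"
proof -
  note st = assms(1)[unfolded state_def]
  have S: "indec S" "obj S" "sized S" and T: "indec T" "obj T" and rkS: "rk (fst S) m n" and rkT: "rk (fst T) m' n'"
    using st indec_obj indec_sized by auto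
  have ex: "ext0 S S" "ext0 S T" "ext0 T S" "ext0 T T" and co: "cores S T" and det: "int m * int n' - int m' * int n = 1"
    using st by auto
  obtain U C f \<pi> r i where m: "mut S T U C f \<pi> r i"
    using ex_mut[OF S(2,3) T(2) rkT assms(2) ex(4) cores_factor[OF co ex(1) S(2)]] by blast
  have c: "confl S U C f \<pi> r i" and U: "obj U" "sized U" "add_of T U"
    using m unfolding mut_def minapx_def apx_def by auto
  obtain M N where rkU: "rk (fst U) M N" using U unfolding sized_def by auto
  obtain l where l: "M = l * m'" "N = l * n'" using add_of_rk[OF T(1) rkT rkU U(1,3)] by auto
  obtain a b where ab: "rk (fst C) a b" "M = m + a" "N = n + b" using confl_rk[OF c rkU rkS] .
  have ab': "int a = int l * int m' - int m" "int b = int l * int n' - int n"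
    using ab(2,3) unfolding l by (simp_all flip: of_nat_mult)
  \<comment> \<open>The new object has rank \<open>l (m', n') - (m, n)\<close>; pairing it with
    \<open>(m', n')\<close> in the swapped order preserves the determinant.\<close>
  have "int m' * int b - int a * int n' = int m * int n' - int m' * int n"
    unfolding ab' by (simp add: algebra_simps)
  then have det': "int m' * int b - int a * int n' = 1" using det by simp
  have C0: "fst C \<noteq> 0"
  proof
    assume "fst C = 0"
    then have "a = 0 \<and> b = 0" using rk_0_unique[OF ab(1)] by simp
    then show False using det' by simp
  qed
  note mx = mut_ext0[OF m ex(4) T(2)]
  have Ci: "indec C" using mut_indec[OF m S(1) T(2) ex(3,4) C0] .
  obtain A E j p s t where co': "confl A E N0 j p s t" "sized A" "sized E" "add_of S A" "add_of T E"
    using co unfolding cores_def by blast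
  note cd = conflD[OF co'(1)]
  \<comment> \<open>The term \<open>A\<close> of the coresolution lies in add \<open>S\<close>, so
    it can be mutated along with \<open>S\<close>; by \<open>mut_add\<close> its cokernel lies in
    add \<open>C\<close>.\<close>
  have FA: "\<phi> \<in> thru T A N0" if "\<phi> \<in> hom A N0" for \<phi>
  proof -
    have "\<phi> * fst A \<in> thru S A N0" using thru_left[OF co'(4)[unfolded add_of_def] that] .
    then have "\<phi> \<in> thru S A N0" using homD(3)[OF that] by simp
    then show ?thesis using thru_trans cores_factor[OF co ex(1) S(2)]
    proof (induction rule: thru.induct)
      case thru_0
      show ?case by (rule thru.thru_0)
    next
      case (thru_step g a b)
      then show ?case using thru_add thru_right by metis
    qed
  qed
  obtain U' C' f' p' s' t' where m': "mut A T U' C' f' p' s' t'"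
    using ex_mut[OF cd(1) co'(2) T(2) rkT assms(2) ex(4) FA] by blast
  have c': "confl A U' C' f' p' s' t'" and U': "obj U'" "sized U'" "add_of T U'" and C': "sized C'" "obj C'"
    using m' conflD(3)[of A U' C' f' p' s' t'] unfolding mut_def minapx_def apx_def by auto
  have CC: "add_of C C'" using mut_add[OF m m' co'(4)] .
  \<comment> \<open>The pushout of \<open>A \<rightarrow> E \<rightarrow> N0\<close> along
    \<open>A \<rightarrow> U'\<close> has \<open>U'\<close> in add \<open>T\<close> on the left and
    \<open>E\<close> plus \<open>C'\<close> in the middle; \<open>cores_of_add2\<close> then clears
    the middle term of \<open>T\<close>.\<close>
  have "ext0 C' E" using ext0_add_left[OF ext0_add_right[OF mx(1) co'(5) cd(2)] CC C'(2)] .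
  then obtain J P R I where po: "confl U' (osum E C') N0 J P R I" using pushout_confl[OF co'(1) c'] by blast
  have "sized (osum E C')" using co'(3) C'(1) rk_osum unfolding sized_def by blast
  then have "cores T C"
    using cores_of_add2[OF po U'(2) _ U'(3) add2_osum_of[OF cd(2) C'(2) co'(5) CC] T(1) rkT assms(2) ex(4) mx(1)] by blast
  then show ?thesis unfolding state_def using T Ci rkT ab(1) assms(2) ex(4) mx det' by blast
qed

section \<open>The initial silting pair\<close>

lemma dthru_P:
  assumes "s \<in> D" "s * s = s" "e1 * s = s" "g \<in> dthru \<epsilon>1"
  shows "s * g * s \<in> thru P0 (s, 0) (s, 0)"
  using assms(4)
proof (induction rule: dthru.induct)
  case dthru_0
  show ?case by (simp add: thru_0)
next
  case (dthru_step g a b)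
  have 1: "s * a * \<epsilon>1 \<in> hom P0 (s, 0)"
    by (rule homI) (use dthru_step assms in \<open>auto simp: mult.assoc assms(2)[THEN asr]\<close>)
  have 2: "\<epsilon>1 * b * s \<in> hom (s, 0) P0"
    by (rule homI) (use dthru_step assms in \<open>auto simp: mult.assoc\<close>)
  have "s * (g + a * \<epsilon>1 * b) * s = s * g * s + (s * a * \<epsilon>1) * (\<epsilon>1 * b * s)"
    by (simp add: distrib_left distrib_right mult.assoc)
  then show ?case using thru_step[OF dthru_step(4) 1 2] by simp
qed

text \<open>\<open>hx N0 P0\<close> is a copy of X, so \<open>z\<close> amounts to a finite family
  in X that generates it as a left A-module; as a map it approximates the second projective by
  copies of the first.\<close>

definition gens :: "'g \<Rightarrow> 'g \<Rightarrow> bool" where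
  "gens p z \<longleftrightarrow> e1 * p = p \<and> z \<in> hx N0 (p, 0) \<and> (\<forall>\<zeta>\<in>hx N0 P0. \<exists>a\<in>dmap (p, 0) P0. \<zeta> = a * z)"

lemma ex_gens: "\<exists>p z m n. rk p m n \<and> gens p z"
proof -
  obtain F where F: "finite F" "\<forall>g\<in>G. \<epsilon>1 * g * \<epsilon>2 \<in> vs.span F" using fdim_eps[of \<epsilon>1 \<epsilon>2] unfolding fdim_def by auto
  have "hx N0 P0 \<subseteq> vs.span F"
  proof
    fix h assume h: "h \<in> hx N0 P0"
    have "\<epsilon>1 * h * \<epsilon>2 = h" using hxD[OF h] by simp
    then show "h \<in> vs.span F" using F hxD(1)[OF h] by metis
  qed
  then obtain B where B: "finite B" "B \<subseteq> hx N0 P0" "hx N0 P0 \<subseteq> vs.span B" using finite_spanning F(1) by metis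
  have "\<exists>p z m n. rk p m n \<and> e1 * p = p \<and> z \<in> hx N0 (p, 0) \<and> (\<forall>\<zeta>\<in>B. \<exists>a\<in>dmap (p, 0) P0. \<zeta> = a * z)"
    using B(1,2)
  proof (induction B)
    case empty
    show ?case by (intro exI[of _ 0] exI[of _ 0]) (auto intro: rk_0 simp: hx_def G_zero)
  next
    case (insert x B)
    then obtain p z m n where p: "rk p m n" "e1 * p = p" "z \<in> hx N0 (p, 0)" "\<forall>\<zeta>\<in>B. \<exists>a\<in>dmap (p, 0) P0. \<zeta> = a * z" by auto
    have x: "x \<in> hx N0 P0" using insert by simp
    define p' where p'_def: "p' = i1 * p * r1 + i2 * \<epsilon>1 * r2"
    define z' where z'_def: "z' = i1 * z + i2 * x"
    have pp: "p \<in> D" "p * p = p" using rk_idem p(1) by auto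
    note ie = iso_e(1,2)[symmetric]
    note ie' = ie ie[THEN asr]
    have ep: "e1 * p' = p'" unfolding p'_def using p(2)
      by (simp add: distrib_left mult.assoc ie' p(2)[THEN asr])
    have rk': "rk p' (m + 1) (n + 0)" using rk_osum[of "(p, 0)" m n P0 1 0] p(1) rk_eps(1) by (simp add: osum_def p'_def)
    have z': "z' \<in> hx N0 (p', 0)"
      unfolding hx_def z'_def p'_def using hxD[OF p(3)] hxD[OF x]
      by (auto simp: distrib_left distrib_right mult.assoc ie' intro!: G_add G_mult iso_G)
    have "\<exists>a\<in>dmap (p', 0) P0. y = a * z'" if y: "y \<in> insert x B" for y
    proof (cases "y = x")
      case True
      show ?thesis
        by (rule bexI[of _ "\<epsilon>1 * r2"]) (use True hxD[OF x] in \<open>auto simp: z'_def p'_def dmap_def distrib_left mult.assoc\<close>)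
    next
      case False
      then obtain a where a: "a \<in> dmap (p, 0) P0" "y = a * z" using y p(4) by auto
      show ?thesis
        by (rule bexI[of _ "a * p * r1"])
          (use a dmapD[OF a(1)] hxD[OF p(3)] pp in \<open>auto simp: z'_def p'_def dmap_def distrib_left mult.assoc pp(2)[THEN asr] dmapD(2,3)[OF a(1), simplified, THEN asr]\<close>)
    qed
    then show ?case using ep rk' z' by blast
  qed
  then obtain p z m n where p: "rk p m n" "e1 * p = p" "z \<in> hx N0 (p, 0)" "\<forall>\<zeta>\<in>B. \<exists>a\<in>dmap (p, 0) P0. \<zeta> = a * z" by auto
  have "\<exists>a\<in>dmap (p, 0) P0. \<zeta> = a * z" if "\<zeta> \<in> vs.span B" for \<zeta>
    using that
  proof (induction rule: vs.span_induct_alt)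
    case base
    show ?case by (rule bexI[OF _ dmap_zero]) simp
  next
    case (step c x y)
    obtain a b where a: "a \<in> dmap (p, 0) P0" "x = a * z" "b \<in> dmap (p, 0) P0" "y = b * z" using step p(4) by blast
    have "\<kappa> c * a \<in> dmap (p, 0) P0" using dmapD[OF a(1)] kap_comm[OF eps_G(1), symmetric]
      unfolding dmap_def by (auto simp: mult.assoc kap_comm[OF eps_G(1), symmetric, THEN asr])
    then show ?case using dmap_add a by (intro bexI[of _ "\<kappa> c * a + b"]) (auto simp: distrib_right mult.assoc)
  qed
  then show ?thesis using p B(3) unfolding gens_def by blast
qed

text \<open>Left mutation of Lambda at its second projective. The new summand is the cone
  \<open>E\<close> of a minimal approximation \<open>z\<close>, and its rank \<open>(m, 1)\<close>
  records the least number of generators of X over A. The conflation with end terms \<open>p\<close>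
  and \<open>N0\<close> is the coresolution asked for.\<close>

lemma state_base: "\<exists>T k. state P0 T 1 0 k 1"
proof -
  define Q where "Q k \<longleftrightarrow> (\<exists>p z m n. rk p m n \<and> gens p z \<and> m + n = k)" for k
  have "\<exists>k. Q k" using ex_gens unfolding Q_def by blast
  then obtain k where k: "Q k" "\<And>l. l < k \<Longrightarrow> \<not> Q l" using exists_least_iff[of Q] by blast
  obtain p z m n where p: "rk p m n" "gens p z" "m + n = k" using k(1) unfolding Q_def by blast
  have pp: "p \<in> D" "p * p = p" using rk_idem p(1) by auto
  have ep: "e1 * p = p" "p * e1 = p" and z: "z \<in> hx N0 (p, 0)" and ge: "\<And>\<zeta>. \<zeta> \<in> hx N0 P0 \<Longrightarrow> \<exists>a\<in>dmap (p, 0) P0. \<zeta> = a * z"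
    using p(2) D_e1[OF pp(1)] unfolding gens_def by auto
  have e2p: "e2 * p = 0" "p * e2 = 0" using ep D_e2[OF pp(1)] by (metis e_simps(4) mult.assoc mult_zero_left)+
  note zd = hxD[OF z, simplified]
  have "e1 * p \<in> dthru \<epsilon>1" using rk_dthru p(1) by blast
  then have "p * p * p \<in> thru P0 (p, 0) (p, 0)" using dthru_P[OF pp ep(1)] ep by simp
  then have aP: "add_of P0 (p, 0)" using pp by (simp add: add_of_def)
  have oP: "obj (p, 0)" using pp by (simp add: obj_def G_zero)
  define E where E_def: "E = (i1 * p * r1 + i2 * \<epsilon>2 * r2, i1 * z * r2)"
  note ie = iso_e(1,2)[symmetric]
  note ie' = ie ie[THEN asr]
  note re = D_e2[OF iso_D(3)] D_e2[OF iso_D(4)]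
  note sm = zd zd(2-5)[THEN asr] pp(2) pp(2)[THEN asr] ep ep[THEN asr] ie' re
  have oE: "obj E" unfolding obj_def E_def using zd(1) pp(1)
    by (auto simp: distrib_left distrib_right mult.assoc sm intro!: G_mult G_add iso_G)
  have rkE: "rk (fst E) m (n + 1)" using rk_osum[of "(p, 0)" m n N0 0 1] p(1) rk_eps(2) by (simp add: osum_def E_def)
  define j where j_def: "j = i1 * p"
  define \<pi> where pi_def: "\<pi> = \<epsilon>2 * r2"
  define r where r_def: "r = p * r1"
  define i where i_def: "i = i2 * \<epsilon>2"
  note df = j_def pi_def r_def i_def E_def
  have pz: "\<epsilon>2 * z = 0" using zd(2) by (metis eps_e0(2) mult.assoc mult_zero_left)
  have c: "confl (p, 0) E N0 j \<pi> r i"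
    unfolding confl_def
  proof (intro conjI)
    show "j \<in> hom (p, 0) E" by (rule homI) (use pp in \<open>auto simp: df distrib_left distrib_right mult.assoc sm\<close>)
    show "\<pi> \<in> hom E N0" by (rule homI) (auto simp: df distrib_left distrib_right mult.assoc sm)
    show "r \<in> dmap E (p, 0)" "i \<in> dmap N0 E" using pp by (auto simp: dmap_def df distrib_left distrib_right mult.assoc sm)
  qed (use oP oE PN_obj pp in \<open>auto simp: df distrib_left distrib_right mult.assoc sm\<close>)
  note cd = conflD[OF c]
  \<comment> \<open>A degree 1 map from \<open>E\<close> to \<open>P0\<close> is an element of X,
    and it is a boundary because \<open>z\<close> generates.\<close>
  have EP: "ext0 E P0" unfolding ext0_def
  proof
    fix w assume w: "w \<in> hx E P0"
    note wd = hxD[OF w, simplified]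
    have "w * i1 * p = w * (e2 * (i1 * p))" using wd(3) by (metis mult.assoc)
    also have "\<dots> = w * (i1 * (e2 * p))" using D_e2[OF iso_D(1)] by (metis mult.assoc)
    finally have w1: "w * (i1 * p) = 0" using e2p by (simp add: mult.assoc)
    have "w = w * (i1 * p * r1 + i2 * \<epsilon>2 * r2)" using wd(5) by (simp add: E_def)
    also have "\<dots> = w * (i1 * p) * r1 + w * (i2 * \<epsilon>2) * r2" by (simp add: distrib_left mult.assoc)
    finally have w2: "w = w * (i2 * \<epsilon>2) * r2" using w1 by simp
    have "w * (i2 * \<epsilon>2) \<in> hx N0 P0" using wd eps_G iso_G unfolding hx_def
      by (auto simp: mult.assoc wd(2,4)[THEN asr] intro!: G_mult)
    then obtain a where a: "a \<in> dmap (p, 0) P0" "w * (i2 * \<epsilon>2) = a * z" using ge by blast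
    have "w = del E P0 (a * r)"
      using w2 a(2) dmapD(3)[OF a(1)] unfolding del_def by (simp add: df mult.assoc sm)
    then show "\<exists>a\<in>dmap E P0. w = del E P0 a" using dmap_comp[OF a(1) cd(6)] by blast
  qed
  have EE: "ext0 E E" using ext0_middle[OF c ext0_add_right[OF EP aP oP] ext0_N oE] .
  \<comment> \<open>Such a \<open>g\<close> is concentrated on \<open>p\<close>, as an idempotent
    \<open>h\<close> with \<open>h * z = 0\<close>. Then \<open>z\<close> takes values in
    \<open>p - h\<close> and still generates, so \<open>h = 0\<close> by minimality.\<close>
  have key: "g = 0" if g: "g \<in> hom E E" "g * g = g" "\<pi> * g * i = 0" for g
  proof -
    note gd = homD[OF g(1)]
    define h where h_def: "h = r * g * j"
    have gD: "r1 * g * i1 \<in> D" "r2 * g * i1 \<in> D" "r1 * g * i2 \<in> D" using gd(1) by auto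
    have g21: "\<pi> * g * j = 0"
    proof -
      have "\<epsilon>2 * (r2 * g * i1) * p = \<epsilon>2 * ((r2 * g * i1) * e1) * p" using ep by (simp add: mult.assoc)
      also have "\<dots> = 0" unfolding D_e1[OF gD(2)] by (simp add: mult.assoc[symmetric])
      finally show ?thesis by (simp add: df mult.assoc)
    qed
    have g12: "r * g * i = 0"
    proof -
      have "p * (r1 * g * i2) * \<epsilon>2 = p * (e1 * (r1 * g * i2)) * \<epsilon>2" using ep by (simp add: mult.assoc[symmetric])
      also have "\<dots> = 0" unfolding D_e1[OF gD(3), symmetric] by (simp add: mult.assoc)
      finally show ?thesis by (simp add: df mult.assoc)
    qed
    have "g = (j * r + i * \<pi>) * g * (j * r + i * \<pi>)" using cd(11) gd by simp
    also have "\<dots> = j * (r * g * j) * r + j * (r * g * i) * \<pi> + i * (\<pi> * g * j) * r + i * (\<pi> * g * i) * \<pi>"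
      by (simp add: distrib_left distrib_right mult.assoc add.assoc)
    finally have gh: "g = j * h * r" using g21 g12 g(3) by (simp add: h_def)
    have hp: "p * h = h" "h * p = h" using pp gd(1) by (auto simp: h_def df mult.assoc sm)
    have hD: "h \<in> D" unfolding h_def df using pp gd(1) by (intro D.mult) auto
    have hh: "h * h = h"
    proof -
      have "r * (g * g) * j = h * (r * j) * h"
        unfolding gh by (simp add: mult.assoc) (simp add: mult.assoc[symmetric] cd(8) hp)
      then show ?thesis using g(2) cd(8) hp by (simp add: h_def mult.assoc)
    qed
    have hz: "h * z = 0"
    proof -
      have "r * (g * snd E) * i = r * (snd E * g) * i" using gd(4) by simp
      moreover have "r * (g * snd E) * i = h * z" unfolding h_def by (simp add: df mult.assoc sm)
      moreover have "r * (snd E * g) * i = z * (\<pi> * g * i)" by (simp add: df mult.assoc sm)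
      ultimately show ?thesis using g(3) by simp
    qed
    obtain a b c' d where rk: "rk h a b" "rk (p - h) c' d" "a + c' = m" "b + d = n"
      using rk_split[OF p(1) hD hp(1,2) hh] by blast
    have pz': "(p - h) * z = z" using hz zd by (simp add: left_diff_distrib)
    have phD: "p - h \<in> D" using pp hD by blast
    have "gens (p - h) z"
      unfolding gens_def
    proof (intro conjI ballI)
      show "e1 * (p - h) = p - h" using ep hp by (metis mult.assoc right_diff_distrib)
      show "z \<in> hx N0 (p - h, 0)" using z pz' by (simp add: hx_def)
      fix \<zeta> assume "\<zeta> \<in> hx N0 P0"
      then obtain a where a: "a \<in> dmap (p, 0) P0" "\<zeta> = a * z" using ge by blast
      have "(p - h) * (p - h) = p - h" using hp hh pp by (simp add: left_diff_distrib right_diff_distrib)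
      moreover have "a * (p - h) \<in> D" using dmapD(1)[OF a(1)] phD by blast
      ultimately have "a * (p - h) \<in> dmap (p - h, 0) P0" using dmapD(2)[OF a(1)] unfolding dmap_def
        by (auto simp: mult.assoc) (simp add: mult.assoc[symmetric])
      moreover have "a * (p - h) * z = \<zeta>" using pz' a(2) by (simp add: mult.assoc)
      ultimately show "\<exists>a\<in>dmap (p - h, 0) P0. \<zeta> = a * z" by metis
    qed
    then have "Q (c' + d)" using rk(2) unfolding Q_def by blast
    then have "a = 0" "b = 0" using k(2)[of "c' + d"] rk p(3) by linarith+
    then have "h = 0" using rk_zero_iff[OF rk(1)] by simp
    then show ?thesis using gh by simp
  qed
  have iE: "indec E"
    unfolding indec_def
  proof (intro conjI ballI impI)
    show "obj E" by (rule oE)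
    show "\<exists>m n. rk (fst E) m n" using rkE by blast
    show "fst E \<noteq> 0" using rk_0_unique[OF rkE] by auto
    fix g assume g: "g \<in> hom E E" "g * g = g"
    note gd = homD[OF g(1)]
    \<comment> \<open>The component at \<open>\<epsilon>2\<close> is an idempotent of a local
      corner, hence trivial; \<open>key\<close> then applies to \<open>g\<close> or to
      \<open>fst E - g\<close>.\<close>
    define h where h_def: "h = \<pi> * g * i"
    have g21: "\<pi> * g * j = 0"
    proof -
      have D: "r2 * g * i1 \<in> D" using gd(1) by auto
      have "\<epsilon>2 * (r2 * g * i1) * p = \<epsilon>2 * ((r2 * g * i1) * e1) * p" using ep by (simp add: mult.assoc)
      also have "\<dots> = 0" unfolding D_e1[OF D] by (simp add: mult.assoc[symmetric])
      finally show ?thesis by (simp add: df mult.assoc)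
    qed
    have hh: "h * h = h"
    proof -
      have "h = \<pi> * (g * fst E * g) * i" using g(2) gd by (simp add: h_def)
      also have "\<dots> = \<pi> * g * j * (r * g * i) + h * h"
        unfolding cd(11)[symmetric] h_def by (simp add: distrib_left distrib_right mult.assoc)
      finally show ?thesis using g21 by simp
    qed
    have "h \<in> D" unfolding h_def df using gd(1) by (intro D.mult) auto
    moreover have "\<epsilon>2 * h = h" "h * \<epsilon>2 = h" by (simp_all add: h_def df mult.assoc)
    ultimately have "h = 0 \<or> h = \<epsilon>2" using D.local_idem_trivial[OF eps_local_idem(2)] hh by blast
    then show "g = 0 \<or> g = fst E"
    proof
      assume "h = 0"
      then have "\<pi> * g * i = 0" by (simp only: h_def)
      from key[OF g this] show ?thesis by (rule disjI1)
    next
      assume h: "h = \<epsilon>2"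
      have "\<pi> * (fst E - g) * i = \<pi> * fst E * i - h" unfolding h_def by (simp add: right_diff_distrib left_diff_distrib)
      also have "\<dots> = 0" using h cd(9) homD(3)[OF cd(5)] by simp
      finally have "\<pi> * (fst E - g) * i = 0" .
      moreover have "(fst E - g) * (fst E - g) = fst E - g"
        using g(2) gd(2,3) objD(2)[OF oE] by (simp add: left_diff_distrib right_diff_distrib)
      ultimately have "fst E - g = 0" using key[OF hom_diff[OF hom_id[OF oE] g(1)]] by simp
      then show ?thesis by simp
    qed
  qed
  have n0: "n = 0"
  proof -
    have "eqv D p p" using D.eqv_refl pp by blast
    show ?thesis
    proof (rule ccontr)
      assume "n \<noteq> 0"
      then obtain q u where q: "p = q + u" "simple q 0 1" "q * u = 0" "u * q = 0"
        using rk_extract[OF p(1), of 0 m 1 "n - 1"] by auto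
      have "q = q * p" using q simple_idem[OF q(2)] by (simp add: distrib_left)
      then have "q * e2 = 0" using e2p by (metis mult.assoc mult_zero_right)
      moreover have "eqv D q \<epsilon>2" using q(2) unfolding simple_def by auto
      then obtain x y where xy: "x \<in> D" "y \<in> D" "x * y = q" "x * \<epsilon>2 = x" "\<epsilon>2 * y = y" "y * q = y" "y * x = \<epsilon>2"
        unfolding eqv_def by auto
      have "x * e2 = x" using xy(4) by (metis eps_e(4) mult.assoc)
      ultimately have "y * (q * e2) * x = \<epsilon>2" using xy D_e2[OF xy(1)] by (metis mult.assoc eps_e(4))
      then show False using \<open>q * e2 = 0\<close> eps_idem(4) by simp
    qed
  qed
  have "sized (p, 0)" "sized E" using p(1) rkE unfolding sized_def by auto
  then have "cores P0 E" unfolding cores_def using c aP add_of_self[OF oE] by blast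
  then have "state P0 E 1 0 m 1"
    unfolding state_def using PN_indec(1) iE rk_eps(1) rkE n0 ext0_P EP EE by simp
  then show ?thesis by blast
qed

section \<open>Cones of g-vectors and the slope argument\<close>

lemma ex_multiple:
  assumes "obj S" "rk (fst S) m n"
  shows "\<exists>V. obj V \<and> rk (fst V) (k * m) (k * n) \<and> add_of S V"
proof (induction k)
  case 0
  show ?case by (rule exI[of _ "(0, 0)"]) (use zero_obj in auto)
next
  case (Suc k)
  then obtain V where "obj V" "rk (fst V) (k * m) (k * n)" "add_of S V" by blast
  then show ?case
    using osum_obj[OF _ assms(1)] rk_osum[OF _ assms(2)] add_osum[OF _ assms(1) _ add_of_self[OF assms(1)]]
    by (metis add.commute mult_Suc)
qed

text \<open>Sums of copies of \<open>S\<close> and \<open>T\<close> remain rigid, so every lattice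
  point of the cone of a state is realised by a rigid object.\<close>

lemma state_rigid:
  assumes "state S T m n m' n'"
  shows "\<exists>V. obj V \<and> rk (fst V) (a * m + b * m') (a * n + b * n') \<and> ext0 V V"
proof -
  note st = assms[unfolded state_def]
  obtain V where V: "obj V" "rk (fst V) (a * m) (a * n)" "add_of S V" using ex_multiple st indec_obj by metis
  obtain W where W: "obj W" "rk (fst W) (b * m') (b * n')" "add_of T W" using ex_multiple st indec_obj by metis
  have o: "obj (osum V W)" "add2_of S T (osum V W)" using osum_obj add2_osum_of V W by auto
  have "ext0 (osum V W) S" "ext0 (osum V W) T" using ext0_add2_left[OF _ _ o(2,1)] st by auto
  then have "ext0 (osum V W) (osum V W)" using ext0_add2_right[OF _ _ o(2,1)] by blast
  then show ?thesis using o rk_osum[OF V(2) W(2)] by blast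
qed

text \<open>Either the cones spanned by the mutation sequence reach the ray through \<open>(p, q)\<close>, or the sequence
  never stops.\<close>

theorem rigid_or_infinite:
  assumes "0 < p"
  shows "(\<exists>V. obj V \<and> rk (fst V) p q \<and> ext0 V V) \<or>
    infinite {(m + m', n + n') |m n m' n'. 0 < m' \<and> (\<exists>S T. state S T m n m' n')}"
proof (rule ccontr)
  assume neg: "\<not> ?thesis"
  define Z where "Z = {(m + m', n + n') |m n m' n'. 0 < m' \<and> (\<exists>S T. state S T m n m' n')}"
  have finZ: "finite Z" and nr: "\<And>V. obj V \<Longrightarrow> rk (fst V) p q \<Longrightarrow> ext0 V V \<Longrightarrow> False"
    using neg by (auto simp: Z_def)
  \<comment> \<open>Cramer's rule with determinant 1: \<open>a\<close> and \<open>b\<close> are the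
    coordinates of \<open>(p, q)\<close> in the basis of the two g-vectors. If both were
    nonnegative, the ray would lie in this cone; so the whole sequence stays below the slope
    \<open>q / p\<close>, which also keeps \<open>m'\<close> positive.\<close>
  have cover: "p * n' < q * m'" if st: "state S T m n m' n'" and le: "p * n \<le> q * m" for S T m n m' n'
  proof (rule ccontr)
    assume "\<not> p * n' < q * m'"
    then have 1: "q * m' \<le> p * n'" by simp
    have det: "int m * int n' - int m' * int n = 1" using st unfolding state_def by blast
    define a where "a = p * n' - q * m'"
    define b where "b = q * m - p * n"
    have ab: "int a = int p * int n' - int q * int m'" "int b = int q * int m - int p * int n"
      unfolding a_def b_def using 1 le by (simp_all add: of_nat_diff)
    have "int (a * m + b * m') = int p * (int m * int n' - int m' * int n)" by (simp add: ab algebra_simps)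
    moreover have "int (a * n + b * n') = int q * (int m * int n' - int m' * int n)" by (simp add: ab algebra_simps)
    ultimately have "a * m + b * m' = p" "a * n + b * n' = q" unfolding det by (simp_all only: of_nat_eq_iff mult_1_right)
    then show False using state_rigid[OF st, of a b] nr by auto
  qed
  \<comment> \<open>Slopes of the sums of the two g-vectors. They depend only on the sums, so there
    are finitely many and one of them is largest.\<close>
  define Y where "Y = {(real n + real n') / (real m + real m') |m n m' n'. (\<exists>S T. state S T m n m' n') \<and> p * n' < q * m'}"
  have "Y \<subseteq> (\<lambda>(a, b). real b / real a) ` Z"
  proof
    fix y assume "y \<in> Y"
    then obtain m n m' n' where y: "y = (real n + real n') / (real m + real m')" "\<exists>S T. state S T m n m' n'" "p * n' < q * m'"
      unfolding Y_def by blast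
    have "0 < m'" using y(3) by (cases m') auto
    then have "(m + m', n + n') \<in> Z" using y(2) unfolding Z_def by blast
    then show "y \<in> (\<lambda>(a, b). real b / real a) ` Z" using y(1) by force
  qed
  then have finY: "finite Y" using finZ finite_subset by blast
  obtain T0 k where b: "state P0 T0 1 0 k 1" using state_base by blast
  have "p * 1 < q * k" using cover[OF b] by simp
  then have "Y \<noteq> {}" using b unfolding Y_def by blast
  then have max: "Max Y \<in> Y" "\<And>y. y \<in> Y \<Longrightarrow> y \<le> Max Y" using finY by auto
  then obtain m n m' n' S T where y: "Max Y = (real n + real n') / (real m + real m')" "state S T m n m' n'" "p * n' < q * m'"
    unfolding Y_def by auto
  have m'0: "0 < m'" using y(3) by (cases m') auto
  then obtain S' m'' n'' where s': "state T S' m' n' m'' n''" using state_step[OF y(2)] by blast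
  have "p * n'' < q * m''" using cover[OF s'] y(3) by simp
  then have "(real n' + real n'') / (real m' + real m'') \<in> Y" using s' unfolding Y_def by blast
  then have le: "(real n' + real n'') / (real m' + real m'') \<le> (real n + real n') / (real m + real m')"
    using max(2) y(1) by metis
  have d1: "int m * int n' - int m' * int n = 1" "0 < m" using y(2) unfolding state_def by auto
  have d2: "int m' * int n'' - int m'' * int n' = 1" using s' unfolding state_def by auto
  have d1': "real m * real n' - real m' * real n = 1" "real m' * real n'' - real m'' * real n' = 1"
    using arg_cong[OF d1(1), of real_of_int] arg_cong[OF d2, of real_of_int] by simp_all
  have a: "real m * real n' = 1 + real m' * real n" "real m' * real n'' = 1 + real m'' * real n'" using d1' by simp_all
  have pos: "0 < real m" "0 < real m'" using d1(2) m'0 by auto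
  have lt1: "real n * real m' < real n' * real m" using a(1) by (simp add: mult.commute)
  have lt2: "real n' * real m'' < real n'' * real m'" using a(2) by (simp add: mult.commute)
  \<comment> \<open>Mediant inequality: the slope of \<open>T\<close> lies strictly between the
    slope of this sum and that of the next, contradicting maximality.\<close>
  have "real n'* real m' + real n * real m' < (real m + real m') * real n'"
    using lt1 by (simp add: algebra_simps)
  then have "(real n + real n') / (real m + real m') < real n' / real m'"
    using pos by (simp add: divide_less_eq less_divide_eq field_simps)
  also have "\<dots> < (real n' + real n'') / (real m' + real m'')"
    using lt2 pos by (simp add: field_simps add_pos_nonneg)
  finally show False using le by simp
qed

lemma indec_isom:
  assumes "indec S" "isom S T" "obj T"
  shows "indec T"
proof -
  obtain a b where ab: "a \<in> hom S T" "b \<in> hom T S" "b * a = fst S" "a * b = fst T" using assms(2) unfolding isom_def by auto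
  obtain m n where "rk (fst S) m n" using assms(1) unfolding indec_def by auto
  then have rk: "rk (fst T) m n" using isom_rk[OF indec_obj[OF assms(1)] assms(2)] by blast
  note d = homD[OF ab(1)] homD[OF ab(2)]
  have "fst T \<noteq> 0"
  proof
    assume "fst T = 0"
    then have "b * (a * b) * a = 0" using ab(4) by simp
    then have "fst S * fst S = 0" using ab(3) by (metis mult.assoc)
    then show False using assms(1) objD(2) unfolding indec_def by metis
  qed
  moreover have "g = 0 \<or> g = fst T" if g: "g \<in> hom T T" "g * g = g" for g
  proof -
    have "b * g * a \<in> hom S S" using hom_comp ab g by blast
    moreover have "b * g * a * (b * g * a) = b * g * (a * b) * g * a" by (simp add: mult.assoc)
    then have "b * g * a * (b * g * a) = b * (g * g) * a"
      unfolding ab(4) using homD[OF g(1)] by (simp add: mult.assoc)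
    ultimately have "b * g * a = 0 \<or> b * g * a = fst S" using assms(1) g(2) unfolding indec_def by metis
    moreover have "g = a * (b * g * a) * b"
    proof -
      have "a * (b * g * a) * b = (a * b) * g * (a * b)" by (simp add: mult.assoc)
      then show ?thesis unfolding ab(4) using homD[OF g(1)] by simp
    qed
    ultimately show ?thesis using ab(4) d by (metis mult_zero_left mult_zero_right)
  qed
  ultimately show ?thesis using rk assms(3) unfolding indec_def by blast
qed

lemma isom_sym: "isom S T \<Longrightarrow> isom T S"
  unfolding isom_def by blast

lemma isom_add_of: "isom S T \<Longrightarrow> add_of S T"
  unfolding isom_def add_of_def using thru_comp by metis

lemma isom_ext0:
  assumes "ext0 S T" "isom S S'" "isom T T'" "obj S'" "obj T'"
  shows "ext0 S' T'"
  using ext0_add_right[OF ext0_add_left[OF assms(1) isom_add_of[OF assms(2)] assms(4)] isom_add_of[OF assms(3)] assms(5)] .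

lemma isom_transport:
  assumes "obj S" "eqv D (fst S) u"
  shows "\<exists>x. obj (u, x) \<and> isom S (u, x)"
proof -
  obtain a b where ab: "a \<in> D" "b \<in> D" "a * b = fst S" "b * a = u" "fst S * a = a" "a * u = a" "u * b = b" "b * fst S = b"
    using assms(2) unfolding eqv_def by auto
  note s = objD[OF assms(1)]
  let ?x = "b * snd S * a"
  have u: "u \<in> D" "u * u = u" using D.eqv_idem[OF eqv_sym[OF assms(2)]] by auto
  have c: "e1 * b = b * e1" "a * e2 = e2 * a" using D_e1[OF ab(2)] D_e2[OF ab(1)] by simp_all
  note r = ab(3-8) ab(3-8)[THEN asr] s(2,4-7) s(2,4-7)[THEN asr] c c[THEN asr] u(2)
  have o: "obj (u, ?x)" unfolding obj_def using u s(3) ab(1,2) D_G[OF ab(1)] D_G[OF ab(2)] by (auto simp: mult.assoc r intro!: G_mult)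
  have "b \<in> hom S (u, ?x)" "a \<in> hom (u, ?x) S" by (rule homI; use ab(1,2) in \<open>simp add: mult.assoc r\<close>)+
  then have "isom S (u, ?x)" unfolding isom_def using ab by auto
  then show ?thesis using o by blast
qed

subsection \<open>The homotopy category\<close>

text \<open>A two-term complex of arbitrary projectives is a triple \<open>(p, q, \<delta>)\<close> with \<open>\<delta>\<close> a map from \<open>p\<close> to \<open>q\<close>.\<close>

type_synonym 'r triple = "'r \<times> 'r \<times> 'r"

definition kmap :: "'g triple \<Rightarrow> 'g triple \<Rightarrow> 'g \<Rightarrow> 'g \<Rightarrow> bool" where
  "kmap X Y \<phi> \<psi> \<longleftrightarrow> \<phi> \<in> G \<and> \<psi> \<in> G \<and> fst Y * \<phi> = \<phi> \<and> \<phi> * fst X = \<phi> \<and> fst (snd Y) * \<psi> = \<psi> \<and> \<psi> * fst (snd X) = \<psi> \<and>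
     snd (snd Y) * \<phi> = \<psi> * snd (snd X)"

definition khomid :: "'g triple \<Rightarrow> 'g \<Rightarrow> 'g \<Rightarrow> bool" where
  "khomid X \<phi> \<psi> \<longleftrightarrow> (\<exists>\<eta>\<in>G. fst X * \<eta> = \<eta> \<and> \<eta> * fst (snd X) = \<eta> \<and>
     \<phi> = fst X + \<eta> * snd (snd X) \<and> \<psi> = fst (snd X) + snd (snd X) * \<eta>)"

definition kiso :: "'g triple \<Rightarrow> 'g triple \<Rightarrow> bool" where
  "kiso X Y \<longleftrightarrow> (\<exists>\<phi> \<psi> \<phi>' \<psi>'. kmap X Y \<phi> \<psi> \<and> kmap Y X \<phi>' \<psi>' \<and> khomid X (\<phi>' * \<phi>) (\<psi>' * \<psi>) \<and> khomid Y (\<phi> * \<phi>') (\<psi> * \<psi>'))"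

definition kval :: "'g triple \<Rightarrow> bool" where
  "kval X \<longleftrightarrow> fst X \<in> G \<and> fst (snd X) \<in> G \<and> snd (snd X) \<in> G \<and> fst X * fst X = fst X \<and> fst (snd X) * fst (snd X) = fst (snd X) \<and>
     fst (snd X) * snd (snd X) = snd (snd X) \<and> snd (snd X) * fst X = snd (snd X)"

abbreviation (input) "k0 \<equiv> (0, 0, 0)"

text \<open>Biproduct relations between honest chain maps, not merely up to homotopy; primed letters
  are the degree 0 components.\<close>

definition ksum :: "'g triple \<Rightarrow> 'g triple \<Rightarrow> 'g triple \<Rightarrow> bool" where
  "ksum X Y Z \<longleftrightarrow> (\<exists>a a' b b' c c' d d'. kmap Y X a a' \<and> kmap X Y b b' \<and> kmap Z X c c' \<and> kmap X Z d d' \<and>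
     b * a = fst Y \<and> b' * a' = fst (snd Y) \<and> d * c = fst Z \<and> d' * c' = fst (snd Z) \<and>
     a * b + c * d = fst X \<and> a' * b' + c' * d' = fst (snd X))"

lemma kiso_sym: "kiso X Y \<Longrightarrow> kiso Y X"
  unfolding kiso_def by blast

lemma khomid_0: "fst X = \<phi> \<Longrightarrow> fst (snd X) = \<psi> \<Longrightarrow> khomid X \<phi> \<psi>"
  unfolding khomid_def by (rule bexI[of _ 0]) (auto simp: G_zero)

lemma kmap_comp:
  assumes "kmap Y Z \<phi> \<psi>" "kmap X Y \<phi>' \<psi>'"
  shows "kmap X Z (\<phi> * \<phi>') (\<psi> * \<psi>')"
proof -
  have a: "\<phi> \<in> G" "\<psi> \<in> G" "fst Z * \<phi> = \<phi>" "\<phi> * fst Y = \<phi>" "fst (snd Z) * \<psi> = \<psi>" "\<psi> * fst (snd Y) = \<psi>"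
    "snd (snd Z) * \<phi> = \<psi> * snd (snd Y)" using assms(1) unfolding kmap_def by auto
  have b: "\<phi>' \<in> G" "\<psi>' \<in> G" "fst Y * \<phi>' = \<phi>'" "\<phi>' * fst X = \<phi>'" "fst (snd Y) * \<psi>' = \<psi>'" "\<psi>' * fst (snd X) = \<psi>'"
    "snd (snd Y) * \<phi>' = \<psi>' * snd (snd X)" using assms(2) unfolding kmap_def by auto
  show ?thesis unfolding kmap_def using a(1,2) b(1,2)
    by (auto simp: mult.assoc a(3-7) a(3-7)[THEN asr] b(3-7) intro: G_mult)
qed

lemma khomid_comp:
  assumes "kmap X Y \<phi> \<psi>" "kmap Y X \<phi>' \<psi>'" "khomid X (\<phi>' * \<phi>) (\<psi>' * \<psi>)" "khomid Y \<alpha> \<beta>"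
  shows "khomid X (\<phi>' * \<alpha> * \<phi>) (\<psi>' * \<beta> * \<psi>)"
proof -
  have a: "\<phi> \<in> G" "\<psi> \<in> G" "fst Y * \<phi> = \<phi>" "\<phi> * fst X = \<phi>" "fst (snd Y) * \<psi> = \<psi>" "\<psi> * fst (snd X) = \<psi>"
    "snd (snd Y) * \<phi> = \<psi> * snd (snd X)" using assms(1) unfolding kmap_def by auto
  have b: "\<phi>' \<in> G" "\<psi>' \<in> G" "fst X * \<phi>' = \<phi>'" "\<phi>' * fst Y = \<phi>'" "fst (snd X) * \<psi>' = \<psi>'" "\<psi>' * fst (snd Y) = \<psi>'"
    "snd (snd X) * \<phi>' = \<psi>' * snd (snd Y)" using assms(2) unfolding kmap_def by auto
  obtain \<eta> where e: "\<eta> \<in> G" "fst X * \<eta> = \<eta>" "\<eta> * fst (snd X) = \<eta>"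
     "\<phi>' * \<phi> = fst X + \<eta> * snd (snd X)" "\<psi>' * \<psi> = fst (snd X) + snd (snd X) * \<eta>" using assms(3) unfolding khomid_def by auto
  obtain \<theta> where t: "\<theta> \<in> G" "fst Y * \<theta> = \<theta>" "\<theta> * fst (snd Y) = \<theta>"
     "\<alpha> = fst Y + \<theta> * snd (snd Y)" "\<beta> = fst (snd Y) + snd (snd Y) * \<theta>" using assms(4) unfolding khomid_def by auto
  show ?thesis unfolding khomid_def
    by (rule bexI[of _ "\<eta> + \<phi>' * \<theta> * \<psi>"])
      (use a(1,2) b(1,2) e(1) t(1) in \<open>auto simp: distrib_left distrib_right mult.assoc t(4,5) a(3-7) b(3-7) b(3-7)[THEN asr] e(2-5) add.assoc
        intro!: G_add G_mult\<close>)
qed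

lemma kiso_trans:
  assumes "kiso X Y" "kiso Y Z"
  shows "kiso X Z"
proof -
  obtain \<phi> \<psi> \<phi>' \<psi>' where a: "kmap X Y \<phi> \<psi>" "kmap Y X \<phi>' \<psi>'" "khomid X (\<phi>' * \<phi>) (\<psi>' * \<psi>)" "khomid Y (\<phi> * \<phi>') (\<psi> * \<psi>')"
    using assms(1) unfolding kiso_def by blast
  obtain \<alpha> \<beta> \<alpha>' \<beta>' where b: "kmap Y Z \<alpha> \<beta>" "kmap Z Y \<alpha>' \<beta>'" "khomid Y (\<alpha>' * \<alpha>) (\<beta>' * \<beta>)" "khomid Z (\<alpha> * \<alpha>') (\<beta> * \<beta>')"
    using assms(2) unfolding kiso_def by blast
  have "khomid X ((\<phi>' * \<alpha>') * (\<alpha> * \<phi>)) ((\<psi>' * \<beta>') * (\<beta> * \<psi>))" using khomid_comp[OF a(1-3) b(3)] by (simp add: mult.assoc)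
  moreover have "khomid Z ((\<alpha> * \<phi>) * (\<phi>' * \<alpha>')) ((\<beta> * \<psi>) * (\<psi>' * \<beta>'))" using khomid_comp[OF b(2,1,4) a(4)] by (simp add: mult.assoc)
  ultimately show ?thesis unfolding kiso_def using kmap_comp[OF b(1) a(1)] kmap_comp[OF a(2) b(2)] by blast
qed

lemma kiso_0:
  assumes "\<eta> \<in> G" "fst X * \<eta> = \<eta>" "\<eta> * fst (snd X) = \<eta>" "0 = fst X + \<eta> * snd (snd X)" "0 = fst (snd X) + snd (snd X) * \<eta>"
  shows "kiso X k0"
  unfolding kiso_def kmap_def khomid_def using assms G_zero
  by (intro exI[of _ 0]) auto

definition cx :: "'g \<times> 'g \<Rightarrow> 'g triple" where
  "cx V = (e2 * fst V, e1 * fst V, snd V)"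

text \<open>A homotopy on the complex of \<open>V\<close> leads from copies of the first projective
  to copies of the second, so it vanishes by \<open>triangular\<close>.\<close>

lemma no_backward: "obj V \<Longrightarrow> \<eta> \<in> G \<Longrightarrow> e2 * fst V * \<eta> = \<eta> \<Longrightarrow> \<eta> * (e1 * fst V) = \<eta> \<Longrightarrow> \<eta> = 0"
proof -
  assume h: "obj V" "\<eta> \<in> G" "e2 * fst V * \<eta> = \<eta>" "\<eta> * (e1 * fst V) = \<eta>"
  have c: "fst V * e1 = e1 * fst V" using D_e1 objD[OF h(1)] by simp
  have "\<eta> = e2 * \<eta>" using h(3) by (metis e_simps(2) mult.assoc)
  moreover have "\<eta> = \<eta> * e1" using h(4) c by (metis e_simps(1) mult.assoc)
  ultimately show ?thesis using triangular[OF h(2)] by (metis mult.assoc)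
qed

lemma khomid_cx: "obj V \<Longrightarrow> khomid (cx V) \<phi> \<psi> \<Longrightarrow> \<phi> = e2 * fst V \<and> \<psi> = e1 * fst V"
proof -
  assume V: "obj V" and "khomid (cx V) \<phi> \<psi>"
  then obtain \<eta> where h: "\<eta> \<in> G" "e2 * fst V * \<eta> = \<eta>" "\<eta> * (e1 * fst V) = \<eta>"
    "\<phi> = e2 * fst V + \<eta> * snd V" "\<psi> = e1 * fst V + snd V * \<eta>"
    unfolding khomid_def cx_def by auto
  moreover have "\<eta> = 0" using no_backward[OF V h(1-3)] .
  ultimately show ?thesis by simp
qed

lemma hom_kmap: "obj V \<Longrightarrow> obj W \<Longrightarrow> f \<in> hom V W \<Longrightarrow> kmap (cx V) (cx W) (e2 * f) (e1 * f)"
proof -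
  assume h: "obj V" "obj W" "f \<in> hom V W"
  note d = objD[OF h(1)] objD[OF h(2)] homD[OF h(3)]
  have c: "fst V * e1 = e1 * fst V" "fst V * e2 = e2 * fst V" "fst W * e1 = e1 * fst W" "fst W * e2 = e2 * fst W"
    "f * e1 = e1 * f" "f * e2 = e2 * f" using D_e1 D_e2 d(1,8,15) by simp_all
  have "snd W * (e2 * f) = e1 * (f * snd V)" using d(12,18) by (simp add: mult.assoc[symmetric] d(11))
  moreover have "snd W * f = f * snd V" using d by simp
  ultimately show ?thesis unfolding kmap_def cx_def using D_G[OF d(15)] e1_G e2_G d(16,17)
    by (auto simp: mult.assoc c c[THEN asr] d(16,17)[THEN asr] intro: G_mult)
qed

lemma kmap_hom:
  assumes "obj V" "obj W" "kmap (cx V) (cx W) \<phi> \<psi>"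
  shows "\<phi> + \<psi> \<in> hom V W" "e2 * (\<phi> + \<psi>) = \<phi>" "e1 * (\<phi> + \<psi>) = \<psi>"
    "\<phi> * e2 = \<phi>" "\<psi> * e1 = \<psi>" "e2 * \<phi> = \<phi>" "e1 * \<psi> = \<psi>"
proof -
  note d = objD[OF assms(1)] objD[OF assms(2)]
  have k: "\<phi> \<in> G" "\<psi> \<in> G" "e2 * fst W * \<phi> = \<phi>" "\<phi> * (e2 * fst V) = \<phi>" "e1 * fst W * \<psi> = \<psi>" "\<psi> * (e1 * fst V) = \<psi>"
    "snd W * \<phi> = \<psi> * snd V" using assms(3) unfolding kmap_def cx_def by auto
  have c: "fst V * e1 = e1 * fst V" "fst V * e2 = e2 * fst V" "fst W * e1 = e1 * fst W" "fst W * e2 = e2 * fst W"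
    using D_e1 D_e2 d(1,8) by simp_all
  have p: "e2 * \<phi> = \<phi>" "e1 * \<psi> = \<psi>" using k by (metis e_simps(1,2) mult.assoc)+
  have p': "\<phi> * e2 = \<phi>" "\<psi> * e1 = \<psi>" using k c by (metis e_simps(1,2) mult.assoc)+
  have q: "e1 * \<phi> = 0" "e2 * \<psi> = 0" "\<phi> * e1 = 0" "\<psi> * e2 = 0"
    using p p' by (metis e_simps(3,4) mult.assoc mult_zero_left mult_zero_right)+
  have w: "fst W * \<phi> = \<phi>" "fst W * \<psi> = \<psi>" "\<phi> * fst V = \<phi>" "\<psi> * fst V = \<psi>"
    using k p p' c by (metis mult.assoc)+
  have "\<phi> + \<psi> \<in> D" unfolding D_def using k p p' q by (auto simp: distrib_left distrib_right intro: G_add)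
  moreover have "\<phi> * snd V = 0" "snd W * \<psi> = 0" using q d(4,12) by (metis mult.assoc mult_zero_left mult_zero_right)+
  ultimately show "\<phi> + \<psi> \<in> hom V W" by (intro homI) (use w k in \<open>auto simp: distrib_left distrib_right\<close>)
  show "e2 * (\<phi> + \<psi>) = \<phi>" "e1 * (\<phi> + \<psi>) = \<psi>" using p q by (simp_all add: distrib_left)
  show "\<phi> * e2 = \<phi>" "\<psi> * e1 = \<psi>" "e2 * \<phi> = \<phi>" "e1 * \<psi> = \<psi>" using p p' by simp_all
qed

lemma cross_zero: "a * e2 = a \<Longrightarrow> e1 * b = b \<Longrightarrow> a * b = 0" "a * e1 = a \<Longrightarrow> e2 * b = b \<Longrightarrow> a * b = 0"
  by (metis e_simps(3,4) mult.assoc mult_zero_left mult_zero_right)+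

lemma kiso_cx_isom:
  assumes V: "obj V" and W: "obj W" and iso: "kiso (cx V) (cx W)"
  shows "isom V W"
proof -
  obtain \<phi> \<psi> \<phi>' \<psi>' where k: "kmap (cx V) (cx W) \<phi> \<psi>" "kmap (cx W) (cx V) \<phi>' \<psi>'"
    "khomid (cx V) (\<phi>' * \<phi>) (\<psi>' * \<psi>)" "khomid (cx W) (\<phi> * \<phi>') (\<psi> * \<psi>')" using iso unfolding kiso_def by blast
  note h = kmap_hom[OF V W k(1)] and h' = kmap_hom[OF W V k(2)]
  have z: "\<phi>' * \<psi> = 0" "\<psi>' * \<phi> = 0" "\<phi> * \<psi>' = 0" "\<psi> * \<phi>' = 0" using cross_zero h h' by blast+
  have e: "e2 * s + e1 * s = s" for s using e12 by (metis add.commute distrib_right mult_1_left)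
  have "(\<phi>' + \<psi>') * (\<phi> + \<psi>) = fst V" "(\<phi> + \<psi>) * (\<phi>' + \<psi>') = fst W"
    using khomid_cx[OF V k(3)] khomid_cx[OF W k(4)] z e by (simp_all add: distrib_left distrib_right)
  then show ?thesis unfolding isom_def using h(1) h'(1) by blast
qed

lemma isom_kiso:
  assumes V: "obj V" and W: "obj W" and iso: "isom V W"
  shows "kiso (cx V) (cx W)"
proof -
  obtain a b where ab: "a \<in> hom V W" "b \<in> hom W V" "b * a = fst V" "a * b = fst W" using iso unfolding isom_def by auto
  note c = D_e1[OF homD(1)[OF ab(1)]] D_e2[OF homD(1)[OF ab(1)]] D_e1[OF homD(1)[OF ab(2)]] D_e2[OF homD(1)[OF ab(2)]]
  have "khomid (cx V) (e2 * b * (e2 * a)) (e1 * b * (e1 * a))" "khomid (cx W) (e2 * a * (e2 * b)) (e1 * a * (e1 * b))"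
    by (rule khomid_0; simp add: cx_def mult.assoc c[THEN asr] ab(3,4))+
  then show ?thesis unfolding kiso_def using hom_kmap[OF V W ab(1)] hom_kmap[OF W V ab(2)] by blast
qed

text \<open>A retract of the complex of \<open>V\<close> in the homotopy category, recorded by the honest idempotent of \<open>V\<close> it
  induces.\<close>

definition kret :: "'g \<times> 'g \<Rightarrow> 'g triple \<Rightarrow> 'g \<Rightarrow> 'g \<Rightarrow> 'g \<Rightarrow> 'g \<Rightarrow> 'g \<Rightarrow> bool" where
  "kret V Y e f f' g g' \<longleftrightarrow> obj V \<and> kval Y \<and> kmap Y (cx V) f f' \<and> kmap (cx V) Y g g' \<and>
     khomid Y (g * f) (g' * f') \<and> e = f * g + f' * g'"

lemma kret_parts:
  assumes "kret V Y e f f' g g'"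
  shows "e \<in> hom V V" "f * g = e2 * e" "f' * g' = e1 * e"
proof -
  have k: "kmap (cx V) (cx V) (f * g) (f' * g')" "obj V" "e = f * g + f' * g'"
    using assms kmap_comp unfolding kret_def by blast+
  show "e \<in> hom V V" "f * g = e2 * e" "f' * g' = e1 * e" using kmap_hom[OF k(2,2,1)] k(3) by simp_all
qed

text \<open>\<open>g * f\<close> is the identity of \<open>Y\<close> only up to a homotopy
  \<open>\<eta>\<close>. Carried to \<open>V\<close> by \<open>f\<close> and \<open>g'\<close>, this
  homotopy falls under \<open>no_backward\<close> and disappears, which makes the idempotent on
  \<open>V\<close> honest.\<close>

lemma kret_square:
  assumes "kret V Y e f f' g g'"
  obtains \<eta> where "\<eta> \<in> G" "fst Y * \<eta> = \<eta>" "\<eta> * fst (snd Y) = \<eta>"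
    "g * f * (g * f) = fst Y + \<eta> * snd (snd Y)" "g' * f' * (g' * f') = fst (snd Y) + snd (snd Y) * \<eta>"
    "f * (g * f) * g = f * g" "f' * (g' * f') * g' = f' * g'"
proof -
  have V: "obj V" and Y: "kval Y" and m: "kmap Y (cx V) f f'" "kmap (cx V) Y g g'" and h: "khomid Y (g * f) (g' * f')"
    using assms unfolding kret_def by auto
  obtain \<eta> where e: "\<eta> \<in> G" "fst Y * \<eta> = \<eta>" "\<eta> * fst (snd Y) = \<eta>"
    "g * f = fst Y + \<eta> * snd (snd Y)" "g' * f' = fst (snd Y) + snd (snd Y) * \<eta>" using h unfolding khomid_def by blast
  have y: "fst Y * fst Y = fst Y" "fst (snd Y) * fst (snd Y) = fst (snd Y)"
     "fst (snd Y) * snd (snd Y) = snd (snd Y)" "snd (snd Y) * fst Y = snd (snd Y)" "snd (snd Y) \<in> G" using Y unfolding kval_def by auto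
  have f: "f \<in> G" "e2 * fst V * f = f" "f * fst Y = f" "f' * fst (snd Y) = f'" "snd V * f = f' * snd (snd Y)" using m(1) unfolding kmap_def cx_def by auto
  have g: "g' \<in> G" "g' * (e1 * fst V) = g'" "fst Y * g = g" "fst (snd Y) * g' = g'" "snd (snd Y) * g = g' * snd V" using m(2) unfolding kmap_def cx_def by auto
  have "f * \<eta> * g' = 0"
    by (rule no_backward[OF V]) (use e f g in \<open>auto simp: mult.assoc[symmetric] intro: G_mult\<close>, simp add: mult.assoc)
  then have z: "f * (\<eta> * (g' * x)) = 0" for x by (metis mult.assoc mult_zero_left)
  have z': "f' * (snd (snd Y) * (\<eta> * g')) = 0"
  proof -
    have "f' * (snd (snd Y) * (\<eta> * g')) = f' * snd (snd Y) * (\<eta> * g')" by (simp add: mult.assoc)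
    also have "\<dots> = snd V * (f * (\<eta> * (g' * 1)))" unfolding f(5)[symmetric] by (simp add: mult.assoc)
    finally show ?thesis using z[of 1] by simp
  qed
  note r = e(2,3) y(1-4) f(3,4) g(3-5)
  note r' = r r[THEN asr]
  \<comment> \<open>The homotopy for the square comes from expanding the square of
    \<open>1 + \<eta> d\<close>, with \<open>d\<close> the differential of \<open>Y\<close>.\<close>
  show thesis
  proof (rule that[of "\<eta> + \<eta> + \<eta> * snd (snd Y) * \<eta>"])
    show "\<eta> + \<eta> + \<eta> * snd (snd Y) * \<eta> \<in> G" using e(1) y(5) by (intro G_add G_mult)
  qed (unfold e(4,5), simp_all add: distrib_left distrib_right mult.assoc r' z z' add.assoc)
qed

lemma kret_idem:
  assumes "kret V Y e f f' g g'"
  shows "e * e = e"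
proof -
  obtain \<eta> where e: "f * (g * f) * g = f * g" "f' * (g' * f') * g' = f' * g'" by (rule kret_square[OF assms])
  note p = kret_parts[OF assms]
  have c: "e * e2 = e2 * e" "e * e1 = e1 * e" using D_e2 D_e1 homD(1)[OF p(1)] by blast+
  have "f * g * (f * g) = f * g" "f' * g' * (f' * g') = f' * g'" using e by (simp_all add: mult.assoc)
  then have "e2 * (e * e) = e2 * e" "e1 * (e * e) = e1 * e" unfolding p by (simp_all add: mult.assoc c[THEN asr])
  then show ?thesis using e12 by (metis distrib_right mult_1_left)
qed

text \<open>The square of \<open>g * f\<close> is homotopic to the identity, but it contains the
  factor \<open>f * g = 0\<close>; so \<open>Y\<close> is contractible.\<close>

lemma kret_zero:
  assumes "kret V Y 0 f f' g g'"
  shows "kiso Y k0"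
proof -
  obtain \<eta> where e: "\<eta> \<in> G" "fst Y * \<eta> = \<eta>" "\<eta> * fst (snd Y) = \<eta>"
    "g * f * (g * f) = fst Y + \<eta> * snd (snd Y)" "g' * f' * (g' * f') = fst (snd Y) + snd (snd Y) * \<eta>" by (rule kret_square[OF assms])
  have "f * g = 0" "f' * g' = 0" using kret_parts[OF assms] by simp_all
  then have "g * f * (g * f) = 0" "g' * f' * (g' * f') = 0" by (metis mult.assoc mult_zero_left mult_zero_right)+
  then show ?thesis using kiso_0[OF e(1-3)] e(4,5) by simp
qed

lemma kret_kiso:
  assumes r: "kret V Y e f f' g g'" and W: "obj W" and u: "u \<in> hom W V" and v: "v \<in> hom V W" and uv: "u * v = e" "v * u = fst W"
  shows "kiso Y (cx W)"
proof -
  have V: "obj V" and m: "kmap Y (cx V) f f'" "kmap (cx V) Y g g'" using r unfolding kret_def by auto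
  obtain \<eta> where e: "\<eta> \<in> G" "fst Y * \<eta> = \<eta>" "\<eta> * fst (snd Y) = \<eta>"
    "g * f * (g * f) = fst Y + \<eta> * snd (snd Y)" "g' * f' * (g' * f') = fst (snd Y) + snd (snd Y) * \<eta>" by (rule kret_square[OF r])
  note p = kret_parts[OF r]
  have c: "u * e1 = e1 * u" "u * e2 = e2 * u" "v * e1 = e1 * v" "v * e2 = e2 * v"
    using D_e1 D_e2 homD(1) u v by blast+
  have "(g * (e2 * u)) * (e2 * v * f) = g * (e2 * (u * v)) * f" by (simp add: mult.assoc c c[THEN asr])
  also have "\<dots> = g * f * (g * f)" unfolding uv p(2)[symmetric] by (simp add: mult.assoc)
  finally have 1: "(g * (e2 * u)) * (e2 * v * f) = fst Y + \<eta> * snd (snd Y)" using e(4) by simp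
  have "(g' * (e1 * u)) * (e1 * v * f') = g' * (e1 * (u * v)) * f'" by (simp add: mult.assoc c c[THEN asr])
  also have "\<dots> = g' * f' * (g' * f')" unfolding uv p(3)[symmetric] by (simp add: mult.assoc)
  finally have 2: "(g' * (e1 * u)) * (e1 * v * f') = fst (snd Y) + snd (snd Y) * \<eta>" using e(5) by simp
  have veu: "v * (e * u) = fst W" using uv objD(2)[OF W] by (metis mult.assoc)
  have "(e2 * v * f) * (g * (e2 * u)) = e2 * (v * ((f * g) * (e2 * u)))" by (simp add: mult.assoc)
  also have "\<dots> = e2 * (v * (e * u))" unfolding p(2) using D_e2[OF homD(1)[OF p(1)]] by (simp add: mult.assoc c c[THEN asr] D_e2[OF homD(1)[OF p(1)], THEN asr])
  finally have 3: "(e2 * v * f) * (g * (e2 * u)) = e2 * fst W" using veu by simp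
  have "(e1 * v * f') * (g' * (e1 * u)) = e1 * (v * ((f' * g') * (e1 * u)))" by (simp add: mult.assoc)
  also have "\<dots> = e1 * (v * (e * u))" unfolding p(3) using D_e1[OF homD(1)[OF p(1)]] by (simp add: mult.assoc c c[THEN asr] D_e1[OF homD(1)[OF p(1)], THEN asr])
  finally have 4: "(e1 * v * f') * (g' * (e1 * u)) = e1 * fst W" using veu by simp
  have "khomid Y ((g * (e2 * u)) * (e2 * v * f)) ((g' * (e1 * u)) * (e1 * v * f'))"
    unfolding 1 2 khomid_def using e(1-3) by blast
  moreover have "khomid (cx W) ((e2 * v * f) * (g * (e2 * u))) ((e1 * v * f') * (g' * (e1 * u)))"
    by (rule khomid_0) (simp_all only: 3 4, simp_all add: cx_def)
  ultimately show ?thesis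
    unfolding kiso_def using kmap_comp[OF hom_kmap[OF V W v] m(1)] kmap_comp[OF m(2) hom_kmap[OF W V u]] by blast
qed

text \<open>The two idempotents induced on \<open>V\<close> add up to the identity exactly and not
  just up to homotopy, by \<open>khomid_cx\<close>.\<close>

lemma kret_of_ksum:
  assumes V: "obj V" and iso: "kiso (cx V) X" and sum: "ksum X Y Z" and Y: "kval Y" and Z: "kval Z"
  obtains e f f' g g' h h' k k' where "kret V Y e f f' g g'" "kret V Z (fst V - e) h h' k k'"
proof -
  obtain F F' H H' where i: "kmap (cx V) X F F'" "kmap X (cx V) H H'" "khomid (cx V) (H * F) (H' * F')" "khomid X (F * H) (F' * H')"
    using iso unfolding kiso_def by blast
  obtain a a' b b' c c' d d' where s: "kmap Y X a a'" "kmap X Y b b'" "kmap Z X c c'" "kmap X Z d d'"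
     "b * a = fst Y" "b' * a' = fst (snd Y)" "d * c = fst Z" "d' * c' = fst (snd Z)"
     "a * b + c * d = fst X" "a' * b' + c' * d' = fst (snd X)" using sum unfolding ksum_def by blast
  have 1: "khomid Y ((b * F) * (H * a)) ((b' * F') * (H' * a'))"
    using khomid_comp[OF s(1,2) khomid_0 i(4)] s(5,6) by (simp add: mult.assoc)
  have 2: "khomid Z ((d * F) * (H * c)) ((d' * F') * (H' * c'))"
    using khomid_comp[OF s(3,4) khomid_0 i(4)] s(7,8) by (simp add: mult.assoc)
  define e where e_def: "e = (H * a) * (b * F) + (H' * a') * (b' * F')"
  have k1: "kret V Y e (H * a) (H' * a') (b * F) (b' * F')"
    unfolding kret_def using V Y 1 kmap_comp[OF i(2) s(1)] kmap_comp[OF s(2) i(1)] e_def by blast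
  have hx: "H * fst X = H" "H' * fst (snd X) = H'" using i(2) unfolding kmap_def by auto
  have "H * (a * b + c * d) * F + H' * (a' * b' + c' * d') * F' = fst V"
    unfolding s(9,10) hx using khomid_cx[OF V i(3)] e12 by (metis add.commute distrib_right mult_1_left)
  then have "fst V - e = (H * c) * (d * F) + (H' * c') * (d' * F')"
    unfolding e_def by (simp add: distrib_left distrib_right mult.assoc diff_eq_eq ac_simps)
  then have k2: "kret V Z (fst V - e) (H * c) (H' * c') (d * F) (d' * F')"
    unfolding kret_def using V Z 2 kmap_comp[OF i(2) s(3)] kmap_comp[OF s(4) i(1)] by blast
  show thesis using that k1 k2 by blast
qed

lemma kret_full:
  assumes "kret V Y (fst V) f f' g g'"
  shows "kiso Y (cx V)"
proof -
  have V: "obj V" using assms unfolding kret_def by blast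
  show ?thesis by (rule kret_kiso[OF assms V hom_id[OF V] hom_id[OF V]]) (use objD[OF V] in auto)
qed

lemma indec_ksum:
  assumes V: "indec V" and iso: "kiso (cx V) X" and sum: "ksum X Y Z" and Y: "kval Y" and Z: "kval Z"
  shows "kiso Y k0 \<or> kiso Z k0"
proof -
  obtain e f f' g g' h h' k k' where r: "kret V Y e f f' g g'" "kret V Z (fst V - e) h h' k k'"
    using kret_of_ksum[OF indec_obj[OF V] iso sum Y Z] .
  have "e = 0 \<or> e = fst V" using V kret_parts(1)[OF r(1)] kret_idem[OF r(1)] unfolding indec_def by blast
  then show ?thesis using r kret_zero by (metis diff_self)
qed

lemma cx_not_zero:
  assumes "obj V" "fst V \<noteq> 0"
  shows "\<not> kiso (cx V) k0"
proof
  assume "kiso (cx V) k0"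
  then obtain \<phi> \<psi> \<phi>' \<psi>' where k: "kmap (cx V) k0 \<phi> \<psi>" "khomid (cx V) (\<phi>' * \<phi>) (\<psi>' * \<psi>)" unfolding kiso_def by blast
  have "\<phi> = 0" "\<psi> = 0" using k(1) unfolding kmap_def by auto
  then have "e2 * fst V = 0" "e1 * fst V = 0" using khomid_cx[OF assms(1) k(2)] by simp_all
  then show False using assms(2) e12 by (metis add_0 distrib_right mult_1_left)
qed

lemma sub_eqv:
  assumes V: "obj V" and p: "p \<in> hom V V" "p * p = p" and r: "kret V Y e f f' g g'" and e: "eqv (hom V V) e p"
  shows "kiso Y (cx (sub V p))"
proof -
  obtain a b where ab: "a \<in> hom V V" "b \<in> hom V V" "a * b = e" "b * a = p" "a * p = a" "p * b = b"
    using e unfolding eqv_def by auto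
  have "a \<in> hom (sub V p) V" "b \<in> hom V (sub V p)"
    using hom_comp[OF ab(1) sub_hom(3)[OF V p]] hom_comp[OF sub_hom(2)[OF V p] ab(2)] ab(5,6) by simp_all
  from kret_kiso[OF r sub_hom(1)[OF V p] this ab(3)] show ?thesis using ab(4) by (simp add: sub_def)
qed

lemma sub_local:
  assumes V: "obj V" and p: "p \<in> hom V V" "p * p = p" and i: "indec (sub V p)"
  shows "subrng.local_idem (hom V V) p"
proof -
  interpret H: subrng "hom V V" by (rule hom_subrng)
  have lift: "unit_in (hom V V) p g" if u: "un (sub V p) g" for g
  proof -
    obtain w where w: "w \<in> hom (sub V p) (sub V p)" "p * w = w" "w * p = w" "g * w = p" "w * g = p"
      using unit_inE[OF u] by (auto simp: sub_def)
    have "p * w * p \<in> hom V V" using hom_comp[OF hom_comp[OF sub_hom(3)[OF V p] w(1)] sub_hom(2)[OF V p]] .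
    then show ?thesis unfolding unit_in_def using w by (intro bexI[of _ w]) auto
  qed
  have "unit_in (hom V V) p g \<or> unit_in (hom V V) p (p - g)" if g: "g \<in> hom V V" "p * g = g" "g * p = g" for g
  proof -
    have gh: "g \<in> hom (sub V p) (sub V p)"
      using hom_comp[OF hom_comp[OF sub_hom(2)[OF V p] g(1)] sub_hom(3)[OF V p]] g by simp
    have "un (sub V p) g \<or> un (sub V p) (fst (sub V p) - g)"
      using un_or_nilpotent[OF i gh] nilpotent_un_diff[OF indec_obj[OF i] gh] by blast
    then show ?thesis using lift by (auto simp: sub_def)
  qed
  moreover have "p \<noteq> 0" using i unfolding indec_def sub_def by simp
  ultimately show ?thesis using p unfolding H.local_idem_def by blast
qed

text \<open>A homotopy summand \<open>Y\<close> becomes an honest idempotent of \<open>V\<close>.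
  Both \<open>p\<close> and \<open>q\<close> are local in \<open>hom V V\<close>, so
  \<open>idem_cases\<close> lists all possibilities.\<close>

lemma krull_schmidt:
  assumes V: "obj V" and p: "p \<in> hom V V" "p * p = p" and q: "q \<in> hom V V" "q * q = q"
    and pq: "p * q = 0" "q * p = 0" "p + q = fst V" and ip: "indec (sub V p)" and iq: "indec (sub V q)"
    and iso: "kiso (cx V) X" and sum: "ksum X Y Z" and Y: "kval Y" and Z: "kval Z"
  shows "kiso Y k0 \<or> (kiso Z k0 \<and> kiso Y (cx V)) \<or> (kiso Y (cx (sub V p)) \<and> kiso Z (cx (sub V q))) \<or>
    (kiso Y (cx (sub V q)) \<and> kiso Z (cx (sub V p)))"
proof -
  interpret H: subrng "hom V V" by (rule hom_subrng)
  obtain e f f' g g' h h' k k' where r: "kret V Y e f f' g g'" "kret V Z (fst V - e) h h' k k'"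
    using kret_of_ksum[OF V iso sum Y Z] .
  note e = kret_parts(1)[OF r(1)] kret_idem[OF r(1)]
  have "e = 0 \<or> e = p + q \<or> eqv (hom V V) e p \<and> eqv (hom V V) (p + q - e) q \<or> eqv (hom V V) e q \<and> eqv (hom V V) (p + q - e) p"
    by (rule H.idem_cases[OF sub_local[OF V p ip] sub_local[OF V q iq] pq(1,2) e(1) _ _ e(2)])
      (use homD[OF e(1)] pq(3) in auto)
  then consider "e = 0" | "e = fst V" | "eqv (hom V V) e p" "eqv (hom V V) (fst V - e) q"
    | "eqv (hom V V) e q" "eqv (hom V V) (fst V - e) p" unfolding pq(3) by blast
  then show ?thesis
  proof cases
    case 1
    then show ?thesis using kret_zero r(1) by blast
  next
    case 2
    then have "kret V Z 0 h h' k k'" "kret V Y (fst V) f f' g g'" using r by simp_all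
    then show ?thesis using kret_zero kret_full by blast
  next
    case 3
    then show ?thesis using sub_eqv[OF V p r(1)] sub_eqv[OF V q r(2)] by blast
  next
    case 4
    then show ?thesis using sub_eqv[OF V q r(1)] sub_eqv[OF V p r(2)] by blast
  qed
qed

lemma ksum_sym: "ksum X Y Z \<Longrightarrow> ksum X Z Y"
  unfolding ksum_def by (metis add.commute)

lemma ksum_unique:
  assumes "ksum X Y Z" "ksum X' Y Z"
  shows "kiso X X'"
proof -
  obtain a a' b b' c c' d d' where s: "kmap Y X a a'" "kmap X Y b b'" "kmap Z X c c'" "kmap X Z d d'"
     "b * a = fst Y" "b' * a' = fst (snd Y)" "d * c = fst Z" "d' * c' = fst (snd Z)"
     "a * b + c * d = fst X" "a' * b' + c' * d' = fst (snd X)" using assms(1) unfolding ksum_def by blast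
  obtain p p' q q' r r' t t' where s': "kmap Y X' p p'" "kmap X' Y q q'" "kmap Z X' r r'" "kmap X' Z t t'"
     "q * p = fst Y" "q' * p' = fst (snd Y)" "t * r = fst Z" "t' * r' = fst (snd Z)"
     "p * q + r * t = fst X'" "p' * q' + r' * t' = fst (snd X')" using assms(2) unfolding ksum_def by blast
  have kadd: "kmap S T (x + y) (x' + y')" if "kmap S T x x'" "kmap S T y y'" for S T x x' y y'
    using that unfolding kmap_def by (auto simp: distrib_left distrib_right G_add)
  \<comment> \<open>Multiplying \<open>x * u + v * w = m\<close> by \<open>u\<close> on the left and
    \<open>v\<close> on the right gives \<open>u * v + u * v = u * v\<close>.\<close>
  have orth: "u * v = 0" if "u * x = g" "w * v = h" "x * u + v * w = m" "u * m = u" "v * h = v" "g * u = u"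
    for u x g w v h m :: 'g
  proof -
    have "u * (x * u + v * w) * v = u * v" using that(3,4) by simp
    then have "g * u * v + u * v * h = u * v" using that(1,2) by (simp add: distrib_left distrib_right mult.assoc) (metis mult.assoc)
    then show ?thesis using that(5,6) by (simp add: mult.assoc)
  qed
  have m: "b * fst X = b" "b' * fst (snd X) = b'" "d * fst X = d" "d' * fst (snd X) = d'" "a * fst Y = a" "a' * fst (snd Y) = a'"
     "c * fst Z = c" "c' * fst (snd Z) = c'" "fst Y * b = b" "fst (snd Y) * b' = b'" "fst Z * d = d" "fst (snd Z) * d' = d'"
    using s(1-4) unfolding kmap_def by auto
  have m': "q * fst X' = q" "q' * fst (snd X') = q'" "t * fst X' = t" "t' * fst (snd X') = t'" "p * fst Y = p" "p' * fst (snd Y) = p'"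
     "r * fst Z = r" "r' * fst (snd Z) = r'" "fst Y * q = q" "fst (snd Y) * q' = q'" "fst Z * t = t" "fst (snd Z) * t' = t'"
    using s'(1-4) unfolding kmap_def by auto
  have z: "b * c = 0" "b' * c' = 0" "d * a = 0" "d' * a' = 0"
    using orth[OF s(5,7,9)] orth[OF s(6,8,10)] orth[OF s(7,5), of "fst X"] orth[OF s(8,6), of "fst (snd X)"] m s(9,10)
    by (simp_all add: add.commute)
  have z': "q * r = 0" "q' * r' = 0" "t * p = 0" "t' * p' = 0"
    using orth[OF s'(5,7,9)] orth[OF s'(6,8,10)] orth[OF s'(7,5), of "fst X'"] orth[OF s'(8,6), of "fst (snd X')"] m' s'(9,10)
    by (simp_all add: add.commute)
  have "kmap X X' (p * b + r * d) (p' * b' + r' * d')" "kmap X' X (a * q + c * t) (a' * q' + c' * t')"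
    using kadd[OF kmap_comp[OF s'(1) s(2)] kmap_comp[OF s'(3) s(4)]] kadd[OF kmap_comp[OF s(1) s'(2)] kmap_comp[OF s(3) s'(4)]] .
  moreover have "khomid X ((a * q + c * t) * (p * b + r * d)) ((a' * q' + c' * t') * (p' * b' + r' * d'))"
    by (rule khomid_0)
      (simp_all add: distrib_left distrib_right mult.assoc s'(5-8)[THEN asr] z'[THEN asr] m s(9,10))
  moreover have "khomid X' ((p * b + r * d) * (a * q + c * t)) ((p' * b' + r' * d') * (a' * q' + c' * t'))"
    by (rule khomid_0)
      (simp_all add: distrib_left distrib_right mult.assoc s(5-8)[THEN asr] z[THEN asr] m' s'(9,10))
  ultimately show ?thesis unfolding kiso_def by blast
qed

lemma khomid_k0: "kiso Z k0 \<Longrightarrow> khomid Z 0 0"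
  unfolding kiso_def kmap_def by force

text \<open>A contraction \<open>\<eta>\<close> of \<open>Z\<close> becomes the homotopy
  \<open>c * \<eta> * d'\<close> on \<open>X\<close>, which absorbs the \<open>Z\<close> part of the
  identity.\<close>

lemma ksum_zero:
  assumes "ksum X Y Z" "kiso Z k0" "kval Y"
  shows "kiso X Y"
proof -
  obtain a a' b b' c c' d d' where s: "kmap Y X a a'" "kmap X Y b b'" "kmap Z X c c'" "kmap X Z d d'"
     "b * a = fst Y" "b' * a' = fst (snd Y)"
     "a * b + c * d = fst X" "a' * b' + c' * d' = fst (snd X)" using assms(1) unfolding ksum_def by blast
  obtain \<eta> where e: "\<eta> \<in> G" "fst Z * \<eta> = \<eta>" "\<eta> * fst (snd Z) = \<eta>" "fst Z + \<eta> * snd (snd Z) = 0" "fst (snd Z) + snd (snd Z) * \<eta> = 0"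
    using khomid_k0[OF assms(2)] unfolding khomid_def by force
  have c: "c \<in> G" "fst X * c = c" "c * fst Z = c" "c' * fst (snd Z) = c'" "snd (snd X) * c = c' * snd (snd Z)" using s(3) unfolding kmap_def by auto
  have d: "d' \<in> G" "d' * fst (snd X) = d'" "fst Z * d = d" "fst (snd Z) * d' = d'" "snd (snd Z) * d = d' * snd (snd X)" using s(4) unfolding kmap_def by auto
  have "khomid Y (b * a) (b' * a')" by (rule khomid_0) (use s in auto)
  moreover have "khomid X (a * b) (a' * b')"
    unfolding khomid_def
  proof (rule bexI[of _ "c * \<eta> * d'"], intro conjI)
    have "c * (fst Z + \<eta> * snd (snd Z)) * d = 0" "c' * (fst (snd Z) + snd (snd Z) * \<eta>) * d' = 0" unfolding e(4,5) by simp_all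
    then have "c * d + c * (\<eta> * (d' * snd (snd X))) = 0" "c' * d' + snd (snd X) * (c * (\<eta> * d')) = 0"
      using c d by (simp_all add: distrib_left distrib_right mult.assoc c(5)[THEN asr])
    then show "a * b = fst X + c * \<eta> * d' * snd (snd X)" "a' * b' = fst (snd X) + snd (snd X) * (c * \<eta> * d')"
      unfolding s(7,8)[symmetric] by (simp_all add: add.assoc mult.assoc)
    show "fst X * (c * \<eta> * d') = c * \<eta> * d'" "c * \<eta> * d' * fst (snd X) = c * \<eta> * d'"
      using c(2) d(2) by (simp_all add: mult.assoc) (simp add: mult.assoc[symmetric])
    show "c * \<eta> * d' \<in> G" using c d e by (intro G_mult)
  qed
  ultimately show ?thesis unfolding kiso_def using s(1,2) by blast
qed

end

section \<open>The matrix ring of the bimodule\<close>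

typedef (overloaded) 'z aend = "{f :: 'z::ab_group_add \<Rightarrow> 'z. \<forall>x y. f (x + y) = f x + f y}"
  morphisms app Aend
  by (rule exI[of _ "\<lambda>x. x"]) simp

setup_lifting type_definition_aend

lemma app_add: "app f (x + y) = app f x + app f y"
  using app[of f] by simp

lemma app_zero [simp]: "app f 0 = 0"
  using app_add[of f 0 0] by simp

lemma aend_eqI: "(\<And>z. app f z = app g z) \<Longrightarrow> f = g"
  by (simp add: app_inject[symmetric] fun_eq_iff)

text \<open>Not an instance of \<open>ring_1\<close>: over the zero group 0 and 1 coincide.\<close>

instantiation aend :: (ab_group_add) "{ring, monoid_mult}"
begin

lift_definition plus_aend :: "'a aend \<Rightarrow> 'a aend \<Rightarrow> 'a aend" is "\<lambda>f g x. f x + g x" by (simp add: algebra_simps)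
lift_definition minus_aend :: "'a aend \<Rightarrow> 'a aend \<Rightarrow> 'a aend" is "\<lambda>f g x. f x - g x" by (simp add: algebra_simps)
lift_definition uminus_aend :: "'a aend \<Rightarrow> 'a aend" is "\<lambda>f x. - f x" by simp
lift_definition zero_aend :: "'a aend" is "\<lambda>x. 0" by simp
lift_definition one_aend :: "'a aend" is "\<lambda>x. x" by simp
lift_definition times_aend :: "'a aend \<Rightarrow> 'a aend \<Rightarrow> 'a aend" is "\<lambda>f g x. f (g x)" by simp

instance
  by standard (transfer; simp add: algebra_simps fun_eq_iff)+

end

lemma app_simps [simp]:
  "app (f + g) z = app f z + app g z" "app (f - g) z = app f z - app g z" "app (- f) z = - app f z"
  "app 0 z = 0" "app 1 z = z" "app (f * g) z = app f (app g z)"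
  by (transfer; simp)+

lemma app_Aend: "(\<And>x y. f (x + y) = f x + f y) \<Longrightarrow> app (Aend f) z = f z"
  by (simp add: Aend_inverse)

type_synonym ('a, 'x, 'b) col = "nat \<Rightarrow> 'a \<times> 'x \<times> 'b"

definition cA :: "('a, 'x, 'b) col \<Rightarrow> nat \<Rightarrow> 'a" where "cA z i = fst (z i)"
definition cX :: "('a, 'x, 'b) col \<Rightarrow> nat \<Rightarrow> 'x" where "cX z i = fst (snd (z i))"
definition cB :: "('a, 'x, 'b) col \<Rightarrow> nat \<Rightarrow> 'b" where "cB z i = snd (snd (z i))"
definition mk :: "(nat \<Rightarrow> 'a) \<Rightarrow> (nat \<Rightarrow> 'x) \<Rightarrow> (nat \<Rightarrow> 'b) \<Rightarrow> ('a, 'x, 'b) col" where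
  "mk a x b = (\<lambda>i. (a i, x i, b i))"

lemma mk_simps [simp]: "cA (mk a x b) = a" "cX (mk a x b) = x" "cB (mk a x b) = b"
  by (simp_all add: cA_def cX_def cB_def mk_def fun_eq_iff)

lemma c_add [simp]: "cA (z + w) i = cA z i + cA w i" "cX (z + w) i = cX z i + cX w i" "cB (z + w) i = cB z i + cB w i"
  by (simp_all add: cA_def cX_def cB_def)

lemma c_zero [simp]: "cA 0 i = 0" "cX 0 i = 0" "cB 0 i = 0"
  by (simp_all add: cA_def cX_def cB_def)

lemma c_minus [simp]: "cA (- z) i = - cA z i" "cX (- z) i = - cX z i" "cB (- z) i = - cB z i"
  by (simp_all add: cA_def cX_def cB_def)

lemma c_diff [simp]: "cA (z - w) i = cA z i - cA w i" "cX (z - w) i = cX z i - cX w i" "cB (z - w) i = cB z i - cB w i"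
  by (simp_all add: cA_def cX_def cB_def)

lemma col_eqI: "(\<And>i. cA z i = cA w i) \<Longrightarrow> (\<And>i. cX z i = cX w i) \<Longrightarrow> (\<And>i. cB z i = cB w i) \<Longrightarrow> z = w"
  by (simp add: cA_def cX_def cB_def fun_eq_iff prod_eq_iff)

locale bimodule =
  fixes sA :: "'k::field \<Rightarrow> 'a::ring_1 \<Rightarrow> 'a"
    and sB :: "'k \<Rightarrow> 'b::ring_1 \<Rightarrow> 'b"
    and sX :: "'k \<Rightarrow> 'x::ab_group_add \<Rightarrow> 'x"
    and L :: "'a \<Rightarrow> 'x \<Rightarrow> 'x"
    and R :: "'x \<Rightarrow> 'b \<Rightarrow> 'x"
  assumes fdA: "fd_algebra sA" and locA: "local_ring TYPE('a)"
    and fdB: "fd_algebra sB" and locB: "local_ring TYPE('b)"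
    and fdX: "fin_dim sX" and bim: "central_bimodule sA sB sX L R"
begin

lemma L_simps: "L (a + a') x = L a x + L a' x" "L a (x + x') = L a x + L a x'" "L (a * a') x = L a (L a' x)" "L 1 x = x"
  using bim unfolding central_bimodule_def by auto

lemma R_simps: "R x (b + b') = R x b + R x b'" "R (x + x') b = R x b + R x' b" "R x (b * b') = R (R x b) b'" "R x 1 = x"
  using bim unfolding central_bimodule_def by auto

lemma LR: "R (L a x) b = L a (R x b)"
  using bim unfolding central_bimodule_def by auto

lemma LR_central: "L (sA c 1) x = sX c x" "R x (sB c 1) = sX c x"
  using bim unfolding central_bimodule_def by auto

lemma L_zero [simp]: "L 0 x = 0" "L a 0 = 0"
  using L_simps(1)[of 0 0 x] L_simps(2)[of a 0 0] by simp_all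

lemma R_zero [simp]: "R x 0 = 0" "R 0 b = 0"
  using R_simps(1)[of x 0 0] R_simps(2)[of 0 0 b] by simp_all

lemma L_minus: "L (- a) x = - L a x" "L a (- x) = - L a x"
  using L_simps(1)[of a "- a" x] L_simps(2)[of a x "- x"] by (simp_all add: eq_neg_iff_add_eq_0 add.commute)

lemma R_minus: "R (- x) b = - R x b" "R x (- b) = - R x b"
  using R_simps(2)[of x "- x" b] R_simps(1)[of x b "- b"] by (simp_all add: eq_neg_iff_add_eq_0 add.commute)

lemma L_sum: "L (sum f S) x = (\<Sum>l\<in>S. L (f l) x)" "L a (sum g S) = (\<Sum>l\<in>S. L a (g l))"
  by (induction S rule: infinite_finite_induct; simp add: L_simps)+

lemma R_sum: "R x (sum f S) = (\<Sum>l\<in>S. R x (f l))" "R (sum g S) b = (\<Sum>l\<in>S. R (g l) b)"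
  by (induction S rule: infinite_finite_induct; simp add: R_simps)+

lemma scale_A: "sA c x * y = sA c (x * y)" "x * sA c y = sA c (x * y)"
  using fdA unfolding fd_algebra_def by metis+

lemma scale_B: "sB c x * y = sB c (x * y)" "x * sB c y = sB c (x * y)"
  using fdB unfolding fd_algebra_def by metis+

sublocale vA: vector_space sA using fdA unfolding fd_algebra_def fin_dim_def by blast
sublocale vB: vector_space sB using fdB unfolding fd_algebra_def fin_dim_def by blast
sublocale vX: vector_space sX using fdX unfolding fin_dim_def by blast

lemma scale_X: "sX c (L a x) = L a (sX c x)" "L (sA c a) x = sX c (L a x)" "sX c (R x b) = R (sX c x) b" "R x (sB c b) = sX c (R x b)"
proof -
  show 1: "sX c (L a x) = L a (sX c x)" using LR LR_central by metis
  show 2: "sX c (R x b) = R (sX c x) b" using LR LR_central by metis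
  show "L (sA c a) x = sX c (L a x)" using L_simps(3)[of a "sA c 1" x] LR_central 1 by (simp add: scale_A)
  show "R x (sB c b) = sX c (R x b)" using R_simps(3)[of x "sB c 1" b] LR_central 2 by (simp add: scale_B)
qed

text \<open>Right multiplication of a column by the element \<open>(c, y, d)\<close> of the triangular algebra.\<close>

definition ract :: "('a, 'x, 'b) col \<Rightarrow> 'a \<Rightarrow> 'x \<Rightarrow> 'b \<Rightarrow> ('a, 'x, 'b) col" where
  "ract z c y d = mk (\<lambda>i. cA z i * c) (\<lambda>i. L (cA z i) y + R (cX z i) d) (\<lambda>i. cB z i * d)"

lemma ract_add: "ract (z + w) c y d = ract z c y d + ract w c y d"
  by (rule col_eqI) (simp_all add: ract_def L_simps R_simps distrib_right)

lemma ract_minus: "ract (- z) c y d = - ract z c y d"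
  by (rule col_eqI) (simp_all add: ract_def L_minus R_minus)

definition e1 :: "('a, 'x, 'b) col aend" where "e1 = Aend (\<lambda>z. mk (cA z) (cX z) (\<lambda>i. 0))"
definition e2 :: "('a, 'x, 'b) col aend" where "e2 = Aend (\<lambda>z. mk (\<lambda>i. 0) (\<lambda>i. 0) (cB z))"

lemma app_e: "app e1 z = mk (cA z) (cX z) (\<lambda>i. 0)" "app e2 z = mk (\<lambda>i. 0) (\<lambda>i. 0) (cB z)"
  unfolding e1_def e2_def by (subst app_Aend; (rule col_eqI)?; simp)+

text \<open>The first condition is right linearity over Lambda. Infinite columns are not finite
  combinations of unit columns, so linearity there does not yet exclude maps from the first
  projective to the second; the other condition does.\<close>

definition GG :: "('a, 'x, 'b) col aend set" where
  "GG = {g. (\<forall>z c y d. app g (ract z c y d) = ract (app g z) c y d) \<and> e2 * g * e1 = 0}"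

definition one :: "obj \<Rightarrow> ('a, 'x, 'b) col aend" where
  "one P = Aend (\<lambda>z. mk (\<lambda>i. if i < fst P then cA z i else 0) (\<lambda>i. if i < fst P then cX z i else 0) (\<lambda>i. if i < snd P then cB z i else 0))"

lemma app_one: "app (one P) z = mk (\<lambda>i. if i < fst P then cA z i else 0) (\<lambda>i. if i < fst P then cX z i else 0) (\<lambda>i. if i < snd P then cB z i else 0)"
  unfolding one_def by (subst app_Aend; (rule col_eqI)?; simp)

text \<open>Partial reindexings cover projections, inclusions and interleavings at once. A-entries
  and X-entries move together, being the two coordinates of the first projective.\<close>

definition shift :: "(nat \<Rightarrow> nat option) \<Rightarrow> (nat \<Rightarrow> nat option) \<Rightarrow> ('a, 'x, 'b) col aend" where
  "shift \<sigma> \<tau> = Aend (\<lambda>z. mk (\<lambda>i. case \<sigma> i of None \<Rightarrow> 0 | Some j \<Rightarrow> cA z j) (\<lambda>i. case \<sigma> i of None \<Rightarrow> 0 | Some j \<Rightarrow> cX z j)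
     (\<lambda>i. case \<tau> i of None \<Rightarrow> 0 | Some j \<Rightarrow> cB z j))"

lemma app_shift: "app (shift \<sigma> \<tau>) z = mk (\<lambda>i. case \<sigma> i of None \<Rightarrow> 0 | Some j \<Rightarrow> cA z j) (\<lambda>i. case \<sigma> i of None \<Rightarrow> 0 | Some j \<Rightarrow> cX z j)
     (\<lambda>i. case \<tau> i of None \<Rightarrow> 0 | Some j \<Rightarrow> cB z j)"
  unfolding shift_def by (subst app_Aend; (rule col_eqI)?; simp split: option.split)

lemma shift_G: "shift \<sigma> \<tau> \<in> GG"
  unfolding GG_def
  by (auto simp: app_shift app_e ract_def intro!: aend_eqI col_eqI split: option.split)

lemma shift_e1: "shift \<sigma> \<tau> * e1 = e1 * shift \<sigma> \<tau>"
  by (auto simp: app_shift app_e intro!: aend_eqI col_eqI split: option.split)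

lemma one_shift: "one P = shift (\<lambda>i. if i < fst P then Some i else None) (\<lambda>i. if i < snd P then Some i else None)"
  by (auto simp: app_shift app_one intro!: aend_eqI col_eqI)

lemma one_G: "one P \<in> GG" unfolding one_shift by (rule shift_G)

definition kap :: "'k \<Rightarrow> ('a, 'x, 'b) col aend" where
  "kap c = Aend (\<lambda>z. ract z (sA c 1) 0 (sB c 1))"

lemma app_kap: "app (kap c) z = ract z (sA c 1) 0 (sB c 1)"
  unfolding kap_def by (subst app_Aend; simp add: ract_add)

lemma app_kap': "app (kap c) z = mk (\<lambda>i. sA c (cA z i)) (\<lambda>i. sX c (cX z i)) (\<lambda>i. sB c (cB z i))"
  unfolding app_kap ract_def by (simp add: scale_A scale_B LR_central)

definition op :: "obj \<Rightarrow> ('a, 'x, 'b) pmor \<Rightarrow> ('a, 'x, 'b) col aend" where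
  "op P f = Aend (\<lambda>z. mk (\<lambda>i. \<Sum>l<fst P. fst f i l * cA z l)
     (\<lambda>i. (\<Sum>l<fst P. L (fst f i l) (cX z l)) + (\<Sum>l<snd P. R (fst (snd f) i l) (cB z l)))
     (\<lambda>i. \<Sum>l<snd P. snd (snd f) i l * cB z l))"

lemma app_op: "app (op P f) z = mk (\<lambda>i. \<Sum>l<fst P. fst f i l * cA z l)
     (\<lambda>i. (\<Sum>l<fst P. L (fst f i l) (cX z l)) + (\<Sum>l<snd P. R (fst (snd f) i l) (cB z l)))
     (\<lambda>i. \<Sum>l<snd P. snd (snd f) i l * cB z l)"
  unfolding op_def
  by (subst app_Aend; (rule col_eqI)?; simp add: distrib_left sum.distrib L_simps R_simps)

lemma op_G: "op P f \<in> GG"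
  unfolding GG_def
  by (auto simp: app_op app_e ract_def sum_distrib_right mult.assoc L_sum R_sum L_simps R_simps LR sum.distrib add.assoc
     intro!: aend_eqI col_eqI)

lemma op_comp: "op P (pcomp L R Q g f) = op Q g * op P f"
proof (rule aend_eqI, rule col_eqI)
  fix z i
  show "cA (app (op P (pcomp L R Q g f)) z) i = cA (app (op Q g * op P f) z) i"
    by (simp add: app_op pcomp_def sum_distrib_left sum_distrib_right mult.assoc) (rule sum.swap)
  show "cB (app (op P (pcomp L R Q g f)) z) i = cB (app (op Q g * op P f) z) i"
    by (simp add: app_op pcomp_def sum_distrib_left sum_distrib_right mult.assoc) (rule sum.swap)
  have 1: "(\<Sum>l<fst P. \<Sum>k<fst Q. L (fst g i k) (L (fst f k l) (cX z l))) = (\<Sum>k<fst Q. \<Sum>l<fst P. L (fst g i k) (L (fst f k l) (cX z l)))"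
    by (rule sum.swap)
  have 2: "(\<Sum>l<snd P. \<Sum>k<fst Q. L (fst g i k) (R (fst (snd f) k l) (cB z l))) = (\<Sum>k<fst Q. \<Sum>l<snd P. L (fst g i k) (R (fst (snd f) k l) (cB z l)))"
    by (rule sum.swap)
  have 3: "(\<Sum>l<snd P. \<Sum>k<snd Q. R (R (fst (snd g) i k) (snd (snd f) k l)) (cB z l)) = (\<Sum>k<snd Q. \<Sum>l<snd P. R (R (fst (snd g) i k) (snd (snd f) k l)) (cB z l))"
    by (rule sum.swap)
  show "cX (app (op P (pcomp L R Q g f)) z) i = cX (app (op Q g * op P f) z) i"
    by (simp add: app_op pcomp_def L_sum R_sum L_simps R_simps LR sum.distrib 1 2 3 add.assoc)
qed

lemma op_add: "op P (padd f g) = op P f + op P g"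
  by (auto simp: app_op padd_def L_simps R_simps sum.distrib distrib_right intro!: aend_eqI col_eqI)

lemma op_pid: "op P (pid P) = one P"
proof (rule aend_eqI, rule col_eqI)
  fix z i
  have s: "(\<Sum>l<n. (if i = l \<and> i < m then 1 else 0) * h l) = (if i < m \<and> i < n then h i else 0)" for n m and h :: "nat \<Rightarrow> 'r::ring_1"
    by (induction n) auto
  have sL: "(\<Sum>l<n. L (if i = l \<and> i < m then 1 else 0) (h l)) = (if i < m \<and> i < n then h i else 0)" for n m h
    by (induction n) (auto simp: L_simps)
  show "cA (app (op P (pid P)) z) i = cA (app (one P) z) i" by (simp add: app_op pid_def app_one s)
  show "cB (app (op P (pid P)) z) i = cB (app (one P) z) i" by (simp add: app_op pid_def app_one s)
  show "cX (app (op P (pid P)) z) i = cX (app (one P) z) i" by (simp add: app_op pid_def app_one sL)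
qed

lemma op_one: "op P f * one P = op P f"
  by (auto simp: app_op app_one intro!: aend_eqI col_eqI)

lemma one_op: "is_pmor P Q f \<Longrightarrow> one Q * op P f = op P f"
  by (auto simp: app_op app_one is_pmor_def intro!: aend_eqI col_eqI)

lemma one_idem: "one P * one P = one P"
  by (auto simp: app_one intro!: aend_eqI col_eqI)

definition ucol :: "nat \<Rightarrow> 'a \<Rightarrow> 'x \<Rightarrow> 'b \<Rightarrow> ('a, 'x, 'b) col" where
  "ucol j a x b = mk (\<lambda>i. if i = j then a else 0) (\<lambda>i. if i = j then x else 0) (\<lambda>i. if i = j then b else 0)"

lemma ucol_simps [simp]: "cA (ucol j a x b) i = (if i = j then a else 0)" "cX (ucol j a x b) i = (if i = j then x else 0)"
    "cB (ucol j a x b) i = (if i = j then b else 0)"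
  by (simp_all add: ucol_def)

text \<open>The matrix of a right linear map: its columns are the images of the unit columns.\<close>

definition mat_of :: "obj \<Rightarrow> ('a, 'x, 'b) col aend \<Rightarrow> ('a, 'x, 'b) pmor" where
  "mat_of P g = ((\<lambda>i j. if j < fst P then cA (app g (ucol j 1 0 0)) i else 0),
     (\<lambda>i j. if j < snd P then cX (app g (ucol j 0 0 1)) i else 0),
     (\<lambda>i j. if j < snd P then cB (app g (ucol j 0 0 1)) i else 0))"

lemma mat_of_op:
  assumes "is_pmor P Q f"
  shows "mat_of P (op P f) = f"
proof -
  have s: "(\<Sum>l<n. h l * (if l = j then 1 else 0)) = (if j < n then h j else 0)" for n j and h :: "nat \<Rightarrow> 'r::ring_1"
    by (induction n) (auto simp: less_Suc_eq)
  have sR: "(\<Sum>l<n. R (h l) (if l = j then 1 else 0)) = (if j < n then h j else 0)" for n j :: nat and h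
    by (induction n) (auto simp: R_simps less_Suc_eq)
  show ?thesis
    using assms unfolding is_pmor_def
    by (auto simp: mat_of_def app_op s sR prod_eq_iff fun_eq_iff)
qed

lemma op_inj: "is_pmor P Q f \<Longrightarrow> is_pmor P Q' g \<Longrightarrow> op P f = op P g \<Longrightarrow> f = g"
  using mat_of_op by metis

lemma c_sum: "cA (sum h S) i = (\<Sum>l\<in>S. cA (h l) i)" "cX (sum h S) i = (\<Sum>l\<in>S. cX (h l) i)" "cB (sum h S) i = (\<Sum>l\<in>S. cB (h l) i)"
  using sum_comp_morphism[of "\<lambda>z. cA z i" h S] sum_comp_morphism[of "\<lambda>z. cX z i" h S] sum_comp_morphism[of "\<lambda>z. cB z i" h S]
  by (simp_all only: comp_def c_zero c_add)

lemma app_sum: "app g (sum h S) = (\<Sum>l\<in>S. app g (h l))"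
  using sum_comp_morphism[of "app g" h S] by (simp only: comp_def app_zero app_add)

text \<open>A unit column is fixed by right multiplication with a diagonal idempotent of Lambda, and
  so is its image; this kills the foreign components. A column cut off by \<open>one P\<close> is a
  finite sum of unit columns times elements of Lambda, so linearity determines
  \<open>g\<close>.\<close>

lemma op_mat_of:
  assumes "g \<in> GG" "one Q * g = g" "g * one P = g"
  shows "is_pmor P Q (mat_of P g)" "op P (mat_of P g) = g"
proof -
  have lin: "app g (ract z c y d) = ract (app g z) c y d" for z c y d using assms(1) unfolding GG_def by blast
  have q: "app g z = app (one Q) (app g z)" for z using assms(2) by (metis app_simps(6))
  have u1: "cB (app g (ucol j 1 0 0)) i = 0" for i j
  proof -
    have "app g (ucol j 1 0 0) = app g (ract (ucol j 1 0 0) 1 0 0)" by (rule arg_cong[of _ _ "app g"], rule col_eqI) (simp_all add: ract_def)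
    then show ?thesis unfolding lin by (rule ssubst) (simp add: ract_def)
  qed
  have u1x: "cX (app g (ucol j 1 0 0)) i = 0" for i j
  proof -
    have "app g (ucol j 1 0 0) = app g (ract (ucol j 1 0 0) 1 0 0)" by (rule arg_cong[of _ _ "app g"], rule col_eqI) (simp_all add: ract_def)
    then show ?thesis unfolding lin by (rule ssubst) (simp add: ract_def)
  qed
  have u2: "cA (app g (ucol j 0 0 1)) i = 0" for i j
  proof -
    have "app g (ucol j 0 0 1) = app g (ract (ucol j 0 0 1) 0 0 1)" by (rule arg_cong[of _ _ "app g"], rule col_eqI) (simp_all add: ract_def)
    then show ?thesis unfolding lin by (rule ssubst) (simp add: ract_def)
  qed
  have z: "app g z = (\<Sum>l<fst P. ract (app g (ucol l 1 0 0)) (cA z l) (cX z l) 0) + (\<Sum>l<snd P. ract (app g (ucol l 0 0 1)) 0 0 (cB z l))" for z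
  proof -
    have s: "(\<Sum>l<n. if i = l then h l else 0) = (if i < n then h i else 0)" for n i and h :: "nat \<Rightarrow> 'r::ab_group_add"
      by (induction n) auto
    have "app (one P) z = (\<Sum>l<fst P. ract (ucol l 1 0 0) (cA z l) (cX z l) 0) + (\<Sum>l<snd P. ract (ucol l 0 0 1) 0 0 (cB z l))"
      by (rule col_eqI) (simp_all add: app_one c_sum ract_def if_distrib[of "\<lambda>x. x * _"] if_distrib[of "\<lambda>x. L x _"] if_distrib[of "\<lambda>x. R x _"] L_simps s cong: if_cong)
    moreover have "app g z = app g (app (one P) z)" using assms(3) by (metis app_simps(6))
    ultimately show ?thesis by (simp only: app_add app_sum lin)
  qed
  have q0: "fst Q \<le> i \<Longrightarrow> cA (app g z) i = 0" "fst Q \<le> i \<Longrightarrow> cX (app g z) i = 0" "snd Q \<le> i \<Longrightarrow> cB (app g z) i = 0" for i z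
    by (subst q, simp add: app_one)+
  show "is_pmor P Q (mat_of P g)" unfolding is_pmor_def mat_of_def using q0 by auto
  show "op P (mat_of P g) = g"
  proof (rule aend_eqI)
    fix w
    show "app (op P (mat_of P g)) w = app g w"
      unfolding z[of w] by (rule col_eqI) (simp_all add: app_op mat_of_def c_sum ract_def u1 u1x u2)
  qed
qed

text \<open>Were \<open>x\<close> and \<open>1 - x\<close> both in the radical, a left inverse
  \<open>u\<close> of \<open>1 - x\<close> would make \<open>1 - u * (1 - x) = 0\<close> left
  invertible.\<close>

lemma local_dichotomy:
  assumes "local_ring TYPE('r::ring_1)"
  shows "(\<exists>u. u * x = 1 \<and> x * u = 1) \<or> (\<exists>u. u * (1 - x) = 1 \<and> (1 - x) * u = (1::'r))"
proof -
  have "\<not> (x \<in> jac \<and> 1 - x \<in> jac)"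
  proof
    assume h: "x \<in> jac \<and> 1 - x \<in> jac"
    obtain u where u: "u * (1 - 1 * x) = 1" using h unfolding jac_def by blast
    obtain v where "v * (1 - u * (1 - x)) = 1" using h unfolding jac_def by blast
    then show False using u by simp
  qed
  then show ?thesis using assms unfolding local_ring_def by blast
qed

lemma GG_closed: "0 \<in> GG" "1 \<in> GG" "a \<in> GG \<Longrightarrow> b \<in> GG \<Longrightarrow> a + b \<in> GG" "a \<in> GG \<Longrightarrow> - a \<in> GG" "a \<in> GG \<Longrightarrow> b \<in> GG \<Longrightarrow> a * b \<in> GG"
proof -
  have r0: "ract 0 c y d = 0" for c y d by (rule col_eqI) (simp_all add: ract_def)
  have e21: "e2 * e1 = 0" "e1 + e2 = 1" by (auto simp: app_e intro!: aend_eqI col_eqI)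
  show "0 \<in> GG" "1 \<in> GG" unfolding GG_def using e21 r0 by auto
  show "a \<in> GG \<Longrightarrow> b \<in> GG \<Longrightarrow> a + b \<in> GG" unfolding GG_def by (auto simp: ract_add distrib_left distrib_right)
  show "a \<in> GG \<Longrightarrow> - a \<in> GG" unfolding GG_def by (auto simp: ract_minus)
  assume ab: "a \<in> GG" "b \<in> GG"
  have "e2 * (a * b) * e1 = e2 * a * (e1 + e2) * b * e1" unfolding e21 by (simp add: mult.assoc)
  also have "\<dots> = (e2 * a * e1) * b * e1 + e2 * a * (e2 * b * e1)" by (simp add: distrib_left distrib_right mult.assoc)
  also have "\<dots> = 0" using ab unfolding GG_def by simp
  finally show "a * b \<in> GG" using ab unfolding GG_def by simp
qed

text \<open>The two corners consist of one-by-one matrices over A and over B, so locality of these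
  algebras is what is needed.\<close>

lemma one_unit:
  assumes "\<epsilon> = one (1, 0) \<or> \<epsilon> = one (0, 1)" "g \<in> GG" "\<epsilon> * g = g" "g * \<epsilon> = g"
  shows "unit_in GG \<epsilon> g \<or> unit_in GG \<epsilon> (\<epsilon> - g)"
  using assms(1)
proof
  assume e: "\<epsilon> = one (1, 0)"
  define mm where "mm a = op (1, 0) ((\<lambda>i j. if i = 0 \<and> j = 0 then a else 0), (\<lambda>i j. 0), (\<lambda>i j. 0))" for a
  have comp: "mm a * mm b = mm (a * b)" for a b
    by (auto simp: mm_def app_op L_simps mult.assoc intro!: aend_eqI col_eqI)
  have m1: "mm 1 = \<epsilon>" unfolding e by (auto simp: mm_def app_op app_one L_simps intro!: aend_eqI col_eqI)
  have mG: "mm a \<in> GG" for a unfolding mm_def by (rule op_G)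
  have md: "mm 1 - mm a = mm (1 - a)" for a
    by (auto simp: mm_def app_op left_diff_distrib L_simps intro!: aend_eqI col_eqI)
       (metis L_simps(1,4) add_diff_cancel_right' diff_add_cancel)
  have m: "is_pmor (1,0) (1,0) (mat_of (1, 0) g)" "op (1, 0) (mat_of (1, 0) g) = g"
    using op_mat_of[OF assms(2), of "(1,0)" "(1,0)"] assms(3,4) e by auto
  have "g = mm (fst (mat_of (1, 0) g) 0 0)"
    unfolding mm_def
    by (subst m(2)[symmetric], rule arg_cong[of _ _ "op (1, 0)"])
      (use m(1) in \<open>auto simp: is_pmor_def prod_eq_iff fun_eq_iff\<close>)
  then obtain a where g: "g = mm a" by blast
  have inv: "unit_in GG (mm 1) (mm x)" if "u * x = 1 \<and> x * u = 1" for u x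
    unfolding unit_in_def by (rule bexI[of _ "mm u"]) (use that mG in \<open>auto simp: comp\<close>)
  show ?thesis using local_dichotomy[OF locA, of a] inv unfolding g m1[symmetric] md by blast
next
  assume e: "\<epsilon> = one (0, 1)"
  define mm where "mm a = op (0, 1) ((\<lambda>i j. 0), (\<lambda>i j. 0), (\<lambda>i j. if i = 0 \<and> j = 0 then a else 0))" for a
  have comp: "mm a * mm b = mm (a * b)" for a b
    by (auto simp: mm_def app_op mult.assoc intro!: aend_eqI col_eqI)
  have m1: "mm 1 = \<epsilon>" unfolding e by (auto simp: mm_def app_op app_one intro!: aend_eqI col_eqI)
  have mG: "mm a \<in> GG" for a unfolding mm_def by (rule op_G)
  have md: "mm 1 - mm a = mm (1 - a)" for a
    by (auto simp: mm_def app_op left_diff_distrib intro!: aend_eqI col_eqI)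
  have m: "is_pmor (0,1) (0,1) (mat_of (0, 1) g)" "op (0, 1) (mat_of (0, 1) g) = g"
    using op_mat_of[OF assms(2), of "(0,1)" "(0,1)"] assms(3,4) e by auto
  have "g = mm (snd (snd (mat_of (0, 1) g)) 0 0)"
    unfolding mm_def
    by (subst m(2)[symmetric], rule arg_cong[of _ _ "op (0, 1)"])
      (use m(1) in \<open>auto simp: is_pmor_def prod_eq_iff fun_eq_iff\<close>)
  then obtain a where g: "g = mm a" by blast
  have inv: "unit_in GG (mm 1) (mm x)" if "u * x = 1 \<and> x * u = 1" for u x
    unfolding unit_in_def by (rule bexI[of _ "mm u"]) (use that mG in \<open>auto simp: comp\<close>)
  show ?thesis using local_dichotomy[OF locB, of a] inv unfolding g m1[symmetric] md by blast
qed

lemma kap_vs: "vector_space (\<lambda>c v. kap c * v)"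
  by unfold_locales
    (auto simp: app_kap' app_add vA.scale_left_distrib vB.scale_left_distrib vX.scale_left_distrib
       vA.scale_right_distrib vB.scale_right_distrib vX.scale_right_distrib intro!: aend_eqI col_eqI)

text \<open>The corner of one copy of each projective is Lambda itself, as a vector space the sum of
  A, X and B.\<close>

lemma fin_span: "\<exists>F. finite F \<and> (\<forall>g\<in>GG. (one (1, 0) + one (0, 1)) * g * (one (1, 0) + one (0, 1)) \<in> module.span (\<lambda>c v. kap c * v) F)"
proof -
  interpret V: vector_space "\<lambda>c v. kap c * v" by (rule kap_vs)
  have one11: "one (1, 0) + one (0, 1) = one (1, 1)" by (auto simp: app_one intro!: aend_eqI col_eqI)
  define tA where "tA a = op (1, 1) ((\<lambda>i j. if i = 0 \<and> j = 0 then a else 0), (\<lambda>i j. 0), (\<lambda>i j. 0))" for a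
  define tX where "tX a = op (1, 1) ((\<lambda>i j. 0), (\<lambda>i j. if i = 0 \<and> j = 0 then a else 0), (\<lambda>i j. 0))" for a
  define tB where "tB a = op (1, 1) ((\<lambda>i j. 0), (\<lambda>i j. 0), (\<lambda>i j. if i = 0 \<and> j = 0 then a else 0))" for a
  obtain SA where SA: "finite SA" "vA.span SA = UNIV" using fdA unfolding fd_algebra_def fin_dim_def by blast
  obtain SB where SB: "finite SB" "vB.span SB = UNIV" using fdB unfolding fd_algebra_def fin_dim_def by blast
  obtain SX where SX: "finite SX" "vX.span SX = UNIV" using fdX unfolding fin_dim_def by blast
  define F where "F = tA ` SA \<union> tX ` SX \<union> tB ` SB"
  have lin: "tA 0 = 0" "tX 0 = 0" "tB 0 = 0" "tA (sA c x + y) = kap c * tA x + tA y" "tB (sB c x' + y') = kap c * tB x' + tB y'"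
    "tX (sX c x'' + y'') = kap c * tX x'' + tX y''" for c x y x' y' x'' y''
    by (auto simp: tA_def tX_def tB_def app_op app_kap' distrib_right scale_A scale_B scale_X L_simps R_simps intro!: aend_eqI col_eqI)
  have A: "tA a \<in> V.span F" for a
  proof -
    have "a \<in> vA.span SA" using SA by simp
    then show ?thesis
    proof (induction rule: vA.span_induct_alt)
      case (step c x y)
      then have "tA x \<in> F" by (simp add: F_def)
      then show ?case unfolding lin using V.span_add[OF V.span_scale[OF V.span_base]] step(2) by blast
    qed (simp add: lin V.span_zero)
  qed
  have X: "tX a \<in> V.span F" for a
  proof -
    have "a \<in> vX.span SX" using SX by simp
    then show ?thesis
    proof (induction rule: vX.span_induct_alt)
      case (step c x y)
      then have "tX x \<in> F" by (simp add: F_def)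
      then show ?case unfolding lin using V.span_add[OF V.span_scale[OF V.span_base]] step(2) by blast
    qed (simp add: lin V.span_zero)
  qed
  have B: "tB a \<in> V.span F" for a
  proof -
    have "a \<in> vB.span SB" using SB by simp
    then show ?thesis
    proof (induction rule: vB.span_induct_alt)
      case (step c x y)
      then have "tB x \<in> F" by (simp add: F_def)
      then show ?case unfolding lin using V.span_add[OF V.span_scale[OF V.span_base]] step(2) by blast
    qed (simp add: lin V.span_zero)
  qed
  have "one (1, 1) * g * one (1, 1) \<in> V.span F" if "g \<in> GG" for g
  proof -
    let ?g = "one (1, 1) * g * one (1, 1)"
    have "?g \<in> GG" using GG_closed(5) one_G that by blast
    moreover have "one (1, 1) * ?g = ?g" "?g * one (1, 1) = ?g" by (simp_all add: mult.assoc one_idem one_idem[THEN asr])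
    ultimately have m: "is_pmor (1, 1) (1, 1) (mat_of (1, 1) ?g)" "op (1, 1) (mat_of (1, 1) ?g) = ?g"
      using op_mat_of by blast+
    define M where "M = mat_of (1, 1) ?g"
    have "M = padd (padd ((\<lambda>i j. if i = 0 \<and> j = 0 then fst M 0 0 else 0), (\<lambda>i j. 0), (\<lambda>i j. 0))
        ((\<lambda>i j. 0), (\<lambda>i j. if i = 0 \<and> j = 0 then fst (snd M) 0 0 else 0), (\<lambda>i j. 0)))
        ((\<lambda>i j. 0), (\<lambda>i j. 0), (\<lambda>i j. if i = 0 \<and> j = 0 then snd (snd M) 0 0 else 0))"
      using m(1) unfolding M_def[symmetric] is_pmor_def padd_def by (auto simp: prod_eq_iff fun_eq_iff)
    then have "op (1, 1) M = tA (fst M 0 0) + tX (fst (snd M) 0 0) + tB (snd (snd M) 0 0)"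
      unfolding tA_def tX_def tB_def op_add[symmetric] by simp
    then show ?thesis using m(2) A X B unfolding M_def[symmetric] by (metis V.span_add)
  qed
  then show ?thesis unfolding one11 using SA SX SB by (intro exI[of _ F]) (auto simp: F_def)
qed

text \<open>Even and odd positions of a column carry the two copies of the module.\<close>

definition i1 where "i1 = shift (\<lambda>n. if even n then Some (n div 2) else None) (\<lambda>n. if even n then Some (n div 2) else None)"
definition i2 where "i2 = shift (\<lambda>n. if odd n then Some (n div 2) else None) (\<lambda>n. if odd n then Some (n div 2) else None)"
definition r1 where "r1 = shift (\<lambda>n. Some (2 * n)) (\<lambda>n. Some (2 * n))"
definition r2 where "r2 = shift (\<lambda>n. Some (2 * n + 1)) (\<lambda>n. Some (2 * n + 1))"

lemma kap_G: "kap c \<in> GG"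
  unfolding GG_def
  by (auto simp: app_kap' app_e ract_def scale_A scale_B scale_X vX.scale_right_distrib intro!: aend_eqI col_eqI)

sublocale TR: tri_ring GG e1 e2 "one (1, 0)" "one (0, 1)" i1 i2 r1 r2 kap
proof
  show "e1 + e2 = 1" "e1 * e1 = e1" by (auto simp: app_e intro!: aend_eqI col_eqI)
  show "e1 \<in> GG" unfolding GG_def by (auto simp: app_e ract_def intro!: aend_eqI col_eqI)
  show "one (1, 0) \<in> GG" "one (0, 1) \<in> GG" by (rule one_G)+
  show "one (1, 0) * one (1, 0) = one (1, 0)" "one (0, 1) * one (0, 1) = one (0, 1)" by (rule one_idem)+
  have "cA (app (one (1, 0)) (mk (\<lambda>i. 1) (\<lambda>i. 0) (\<lambda>i. 0))) 0 = 1" "cB (app (one (0, 1)) (mk (\<lambda>i. 0) (\<lambda>i. 0) (\<lambda>i. 1))) 0 = 1"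
    by (simp_all add: app_one)
  then show "one (1, 0) \<noteq> 0" "one (0, 1) \<noteq> 0" by auto
  show "e1 * one (1, 0) = one (1, 0)" "one (1, 0) * e1 = one (1, 0)" "e2 * one (0, 1) = one (0, 1)" "one (0, 1) * e2 = one (0, 1)"
    by (auto simp: app_e app_one intro!: aend_eqI col_eqI)
  show "kap (c + d) = kap c + kap d" "kap (c * d) = kap c * kap d" "kap 1 = 1" for c d
    by (auto simp: app_kap' vA.scale_left_distrib vB.scale_left_distrib vX.scale_left_distrib intro!: aend_eqI col_eqI)
  show "kap c * g = g * kap c" if "g \<in> GG" for c g
    using that unfolding GG_def by (intro aend_eqI) (simp add: app_kap)
  show "i1 \<in> GG" "i2 \<in> GG" "r1 \<in> GG" "r2 \<in> GG" unfolding i1_def i2_def r1_def r2_def by (rule shift_G)+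
  show "i1 * e1 = e1 * i1" "i2 * e1 = e1 * i2" "r1 * e1 = e1 * r1" "r2 * e1 = e1 * r2"
    unfolding i1_def i2_def r1_def r2_def by (rule shift_e1)+
  show "r1 * i1 = 1" "r2 * i2 = 1" "r1 * i2 = 0" "r2 * i1 = 0"
    unfolding i1_def i2_def r1_def r2_def by (auto simp: app_shift intro!: aend_eqI col_eqI)
qed (use GG_closed one_unit kap_G fin_span GG_def in auto)

lemma shift_D: "shift \<sigma> \<tau> \<in> TR.D"
  unfolding TR.D_def using shift_G shift_e1 by auto

lemma one_D: "one P \<in> TR.D"
  unfolding one_shift by (rule shift_D)

lemma rk_one: "TR.rk (one (m, n)) m n"
proof (induction m)
  case 0
  show ?case
  proof (induction n)
    case 0
    have "one (0, 0) = 0" by (auto simp: app_one intro!: aend_eqI col_eqI)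
    then show ?case using TR.rk_0 by simp
  next
    case (Suc n)
    let ?p = "shift (\<lambda>i. None) (\<lambda>i. if i = n then Some n else None)"
    have 1: "eqv TR.D ?p (one (0, 1))"
      unfolding eqv_def
      by (rule bexI[OF _ shift_D[of "\<lambda>i. None" "\<lambda>i. if i = n then Some 0 else None"]],
          rule bexI[OF _ shift_D[of "\<lambda>i. None" "\<lambda>i. if i = 0 then Some n else None"]])
        (auto simp: app_shift app_one intro!: aend_eqI col_eqI)
    have 2: "?p + one (0, n) = one (0, Suc n)" "?p * one (0, n) = 0" "one (0, n) * ?p = 0"
      by (auto simp: less_Suc_eq app_shift app_one intro!: aend_eqI col_eqI)
    have "TR.simple ?p 0 1" unfolding TR.simple_def using 1 by blast
    from TR.rk_step[OF Suc this 2(2,3)] show ?case by (simp add: 2(1))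
  qed
next
  case (Suc m)
  let ?p = "shift (\<lambda>i. if i = m then Some m else None) (\<lambda>i. None)"
  have 1: "eqv TR.D ?p (one (1, 0))"
    unfolding eqv_def
    by (rule bexI[OF _ shift_D[of "\<lambda>i. if i = m then Some 0 else None" "\<lambda>i. None"]],
        rule bexI[OF _ shift_D[of "\<lambda>i. if i = 0 then Some m else None" "\<lambda>i. None"]])
      (auto simp: app_shift app_one intro!: aend_eqI col_eqI)
  have 2: "?p + one (m, n) = one (Suc m, n)" "?p * one (m, n) = 0" "one (m, n) * ?p = 0"
    by (auto simp: less_Suc_eq app_shift app_one intro!: aend_eqI col_eqI)
  have "TR.simple ?p 1 0" unfolding TR.simple_def using 1 by blast
  from TR.rk_step[OF Suc this 2(2,3)] show ?case by (simp add: 2(1))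
qed

section \<open>Translation of complexes\<close>

definition trp :: "('a, 'x, 'b) cpx \<Rightarrow> ('a, 'x, 'b) col aend \<times> ('a, 'x, 'b) col aend \<times> ('a, 'x, 'b) col aend" where
  "trp S = (one (fst S), one (fst (snd S)), op (fst S) (snd (snd S)))"

lemma trp_kval: "is_cpx S \<Longrightarrow> TR.kval (trp S)"
  unfolding TR.kval_def trp_def is_cpx_def by (simp add: one_G op_G one_idem one_op op_one)

lemma chain_map_kmap: "chain_map L R S T f \<Longrightarrow> TR.kmap (trp S) (trp T) (op (fst S) (fst f)) (op (fst (snd S)) (snd f))"
  unfolding chain_map_def TR.kmap_def trp_def
  by (auto simp: op_G one_op op_one op_comp[symmetric])

lemma homotopic_khomid:
  assumes "homotopic L R S S f (pid (fst S), pid (fst (snd S)))"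
  shows "TR.khomid (trp S) (op (fst S) (fst f)) (op (fst (snd S)) (snd f))"
proof -
  obtain h where h: "is_pmor (fst (snd S)) (fst S) h"
    "fst f = padd (pid (fst S)) (pcomp L R (fst (snd S)) h (snd (snd S)))"
    "snd f = padd (pid (fst (snd S))) (pcomp L R (fst S) (snd (snd S)) h)"
    using assms unfolding homotopic_def by auto
  show ?thesis unfolding TR.khomid_def
    by (rule bexI[OF _ op_G[of "fst (snd S)" h]]) (use h in \<open>simp add: trp_def one_op op_one op_add op_pid op_comp\<close>)
qed

lemma ciso_kiso: "ciso L R S T \<Longrightarrow> TR.kiso (trp S) (trp T)"
proof -
  assume "ciso L R S T"
  then obtain f g where fg: "chain_map L R S T f" "chain_map L R T S g"
    "homotopic L R S S (pcomp L R (fst T) (fst g) (fst f), pcomp L R (fst (snd T)) (snd g) (snd f)) (pid (fst S), pid (fst (snd S)))"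
    "homotopic L R T T (pcomp L R (fst S) (fst f) (fst g), pcomp L R (fst (snd S)) (snd f) (snd g)) (pid (fst T), pid (fst (snd T)))"
    unfolding ciso_def by blast
  show ?thesis unfolding TR.kiso_def
    using chain_map_kmap[OF fg(1)] chain_map_kmap[OF fg(2)] homotopic_khomid[OF fg(3)] homotopic_khomid[OF fg(4)]
    by (simp only: op_comp fst_conv snd_conv) blast
qed

lemma pcomp_pmor: "is_pmor P Q f \<Longrightarrow> is_pmor Q W g \<Longrightarrow> is_pmor P W (pcomp L R Q g f)"
  unfolding is_pmor_def pcomp_def by auto

lemma padd_pmor: "is_pmor P Q f \<Longrightarrow> is_pmor P Q g \<Longrightarrow> is_pmor P Q (padd f g)"
  for f g :: "('a, 'x, 'b) pmor"
  unfolding is_pmor_def padd_def by auto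

lemma pid_pmor: "is_pmor P P (pid P)"
  unfolding is_pmor_def pid_def by auto

lemma kmap_chain_map:
  assumes "is_cpx S" "is_cpx T" "TR.kmap (trp S) (trp T) \<phi> \<psi>"
  shows "\<exists>f. chain_map L R S T f \<and> op (fst S) (fst f) = \<phi> \<and> op (fst (snd S)) (snd f) = \<psi>"
proof -
  have k: "\<phi> \<in> GG" "\<psi> \<in> GG" "one (fst T) * \<phi> = \<phi>" "\<phi> * one (fst S) = \<phi>" "one (fst (snd T)) * \<psi> = \<psi>" "\<psi> * one (fst (snd S)) = \<psi>"
    "op (fst T) (snd (snd T)) * \<phi> = \<psi> * op (fst S) (snd (snd S))" using assms(3) unfolding TR.kmap_def trp_def by auto
  note m = op_mat_of[OF k(1,3,4)] op_mat_of[OF k(2,5,6)]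
  have "op (fst S) (pcomp L R (fst T) (snd (snd T)) (mat_of (fst S) \<phi>)) = op (fst S) (pcomp L R (fst (snd S)) (mat_of (fst (snd S)) \<psi>) (snd (snd S)))"
    using k(7) m by (simp add: op_comp)
  then have "pcomp L R (fst T) (snd (snd T)) (mat_of (fst S) \<phi>) = pcomp L R (fst (snd S)) (mat_of (fst (snd S)) \<psi>) (snd (snd S))"
    using op_inj pcomp_pmor m assms(1,2) unfolding is_cpx_def by metis
  then show ?thesis unfolding chain_map_def using m by (intro exI[of _ "(mat_of (fst S) \<phi>, mat_of (fst (snd S)) \<psi>)"]) simp
qed

lemma khomid_homotopic:
  assumes "is_cpx S" "TR.khomid (trp S) (op (fst S) f) (op (fst (snd S)) g)" "is_pmor (fst S) (fst S) f" "is_pmor (fst (snd S)) (fst (snd S)) g"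
  shows "homotopic L R S S (f, g) (pid (fst S), pid (fst (snd S)))"
proof -
  obtain \<eta> where e: "\<eta> \<in> GG" "one (fst S) * \<eta> = \<eta>" "\<eta> * one (fst (snd S)) = \<eta>"
    "op (fst S) f = one (fst S) + \<eta> * op (fst S) (snd (snd S))" "op (fst (snd S)) g = one (fst (snd S)) + op (fst S) (snd (snd S)) * \<eta>"
    using assms(2) unfolding TR.khomid_def trp_def by auto
  note m = op_mat_of[OF e(1-3)]
  let ?h = "mat_of (fst (snd S)) \<eta>"
  have S: "is_pmor (fst S) (fst (snd S)) (snd (snd S))" using assms(1) unfolding is_cpx_def .
  have 1: "f = padd (pid (fst S)) (pcomp L R (fst (snd S)) ?h (snd (snd S)))"
    by (rule op_inj[OF assms(3) padd_pmor[OF pid_pmor pcomp_pmor[OF S m(1)]]]) (simp add: op_add op_pid op_comp m(2) e(4))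
  have 2: "g = padd (pid (fst (snd S))) (pcomp L R (fst S) (snd (snd S)) ?h)"
    by (rule op_inj[OF assms(4) padd_pmor[OF pid_pmor pcomp_pmor[OF m(1) S]]]) (simp add: op_add op_pid op_comp m(2) e(5))
  show ?thesis unfolding homotopic_def using m(1) 1 2 by (intro exI[of _ ?h]) simp
qed

lemma kiso_ciso:
  assumes "is_cpx S" "is_cpx T" "TR.kiso (trp S) (trp T)"
  shows "ciso L R S T"
proof -
  obtain \<phi> \<psi> \<phi>' \<psi>' where k: "TR.kmap (trp S) (trp T) \<phi> \<psi>" "TR.kmap (trp T) (trp S) \<phi>' \<psi>'"
    "TR.khomid (trp S) (\<phi>' * \<phi>) (\<psi>' * \<psi>)" "TR.khomid (trp T) (\<phi> * \<phi>') (\<psi> * \<psi>')" using assms(3) unfolding TR.kiso_def by blast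
  obtain f where f: "chain_map L R S T f" "op (fst S) (fst f) = \<phi>" "op (fst (snd S)) (snd f) = \<psi>"
    using kmap_chain_map[OF assms(1,2) k(1)] by blast
  obtain g where g: "chain_map L R T S g" "op (fst T) (fst g) = \<phi>'" "op (fst (snd T)) (snd g) = \<psi>'"
    using kmap_chain_map[OF assms(2,1) k(2)] by blast
  have p: "is_pmor (fst S) (fst T) (fst f)" "is_pmor (fst (snd S)) (fst (snd T)) (snd f)"
    "is_pmor (fst T) (fst S) (fst g)" "is_pmor (fst (snd T)) (fst (snd S)) (snd g)"
    using f(1) g(1) unfolding chain_map_def by auto
  have "homotopic L R S S (pcomp L R (fst T) (fst g) (fst f), pcomp L R (fst (snd T)) (snd g) (snd f)) (pid (fst S), pid (fst (snd S)))"
    by (rule khomid_homotopic[OF assms(1)]) (use k(3) f g p pcomp_pmor in \<open>auto simp: op_comp\<close>)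
  moreover have "homotopic L R T T (pcomp L R (fst S) (fst f) (fst g), pcomp L R (fst (snd S)) (snd f) (snd g)) (pid (fst T), pid (fst (snd T)))"
    by (rule khomid_homotopic[OF assms(2)]) (use k(4) f g p pcomp_pmor in \<open>auto simp: op_comp\<close>)
  ultimately show ?thesis unfolding ciso_def using f(1) g(1) by blast
qed

text \<open>Inclusion of the second block of a direct sum at its shifted positions;
  \<open>dn\<close> is the matching projection.\<close>

definition up :: "obj \<Rightarrow> obj \<Rightarrow> ('a, 'x, 'b) col aend" where
  "up P P' = shift (\<lambda>i. if fst P \<le> i \<and> i < fst P + fst P' then Some (i - fst P) else None)
     (\<lambda>i. if snd P \<le> i \<and> i < snd P + snd P' then Some (i - snd P) else None)"

definition dn :: "obj \<Rightarrow> obj \<Rightarrow> ('a, 'x, 'b) col aend" where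
  "dn P P' = shift (\<lambda>i. if i < fst P' then Some (fst P + i) else None) (\<lambda>i. if i < snd P' then Some (snd P + i) else None)"

lemma up_dn: "dn P P' * up P P' = one P'" "one P * up P P' = 0" "dn P P' * one P = 0"
  "one P + up P P' * dn P P' = one (odsum P P')" "one (odsum P P') * one P = one P" "one P * one (odsum P P') = one P"
  "one (odsum P P') * up P P' = up P P'" "dn P P' * one (odsum P P') = dn P P'"
  "up P P' * one P' = up P P'" "one P' * dn P P' = dn P P'"
  by (auto simp: app_shift app_one up_def dn_def odsum_def intro!: aend_eqI col_eqI)

lemma sum_lessThan_add: "sum f {..<m + n} = sum f {..<m} + (\<Sum>l<n. f (m + l))" for f :: "nat \<Rightarrow> 'r::comm_monoid_add"
  by (induction n) (simp_all add: add.assoc)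

lemma op_pdsum:
  assumes "is_pmor P Q f" "is_pmor P' Q' f'"
  shows "op (odsum P P') (pdsum P Q f f') = op P f + up Q Q' * op P' f' * dn P P'"
proof (rule aend_eqI, rule col_eqI)
  note f = assms[unfolded is_pmor_def]
  have b: "bdiag r c M M' i j = M i j" if "j < c" "\<And>i j. r \<le> i \<Longrightarrow> M i j = 0" for r c i j and M M' :: "nat \<Rightarrow> nat \<Rightarrow> 'r::zero"
    using that by (auto simp: bdiag_def)
  have b': "bdiag r c M M' i (c + j) = (if r \<le> i \<and> i < r + r' then M' (i - r) j else 0)" if "\<And>i j. r' \<le> i \<Longrightarrow> M' i j = 0"
    for r r' c i j and M M' :: "nat \<Rightarrow> nat \<Rightarrow> 'r::zero"
    using that by (auto simp: bdiag_def)
  have fA: "fst Q \<le> i \<Longrightarrow> fst f i j = 0" "fst Q' \<le> i \<Longrightarrow> fst f' i j = 0"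
     and fX: "fst Q \<le> i \<Longrightarrow> fst (snd f) i j = 0" "fst Q' \<le> i \<Longrightarrow> fst (snd f') i j = 0"
     and fB: "snd Q \<le> i \<Longrightarrow> snd (snd f) i j = 0" "snd Q' \<le> i \<Longrightarrow> snd (snd f') i j = 0" for i j
    using f by auto
  fix z i
  show "cA (app (op (odsum P P') (pdsum P Q f f')) z) i = cA (app (op P f + up Q Q' * op P' f' * dn P P') z) i"
    by (auto simp: app_op odsum_def pdsum_def sum_lessThan_add b[OF _ fA(1)] b'[OF fA(2)] app_shift up_def dn_def intro!: sum.neutral)
  show "cB (app (op (odsum P P') (pdsum P Q f f')) z) i = cB (app (op P f + up Q Q' * op P' f' * dn P P') z) i"
    by (auto simp: app_op odsum_def pdsum_def sum_lessThan_add b[OF _ fB(1)] b'[OF fB(2)] app_shift up_def dn_def intro!: sum.neutral)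
  show "cX (app (op (odsum P P') (pdsum P Q f f')) z) i = cX (app (op P f + up Q Q' * op P' f' * dn P P') z) i"
    by (auto simp: app_op odsum_def pdsum_def sum_lessThan_add b[OF _ fA(1)] b'[OF fA(2)] b[OF _ fX(1)] b'[OF fX(2)] app_shift up_def dn_def intro!: sum.neutral)
qed

lemma cdsum_cpx: "is_cpx S \<Longrightarrow> is_cpx U \<Longrightarrow> is_cpx (cdsum S U)"
  unfolding is_cpx_def cdsum_def is_pmor_def pdsum_def odsum_def bdiag_def by auto

lemma cdsum_ksum:
  assumes "is_cpx S" "is_cpx U"
  shows "TR.ksum (trp (cdsum S U)) (trp S) (trp U)"
proof -
  obtain P Q d where S: "S = (P, Q, d)" by (metis prod.collapse)
  obtain P' Q' d' where U: "U = (P', Q', d')" by (metis prod.collapse)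
  have p: "is_pmor P Q d" "is_pmor P' Q' d'" using assms unfolding S U is_cpx_def by auto
  have t: "trp (cdsum S U) = (one (odsum P P'), one (odsum Q Q'), op P d + up Q Q' * op P' d' * dn P P')"
    "trp S = (one P, one Q, op P d)" "trp U = (one P', one Q', op P' d')"
    unfolding trp_def S U cdsum_def using op_pdsum[OF p] by simp_all
  have q: "dn Q Q' * op P d = 0" using one_op[OF p(1)] up_dn(3)[of Q Q', THEN asr, of "op P d"] by simp
  have q': "op P d * up P P' = 0" using op_one[of P d] up_dn(2)[of P P'] mult.assoc[of "op P d" "one P" "up P P'"] by simp
  have g: "up P P' \<in> GG" "dn P P' \<in> GG" for P P' unfolding up_def dn_def by (rule shift_G)+
  note r = up_dn(1-3,5-10) one_idem op_one one_op[OF p(1)] one_op[OF p(2)] q q'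
  note r' = r r[THEN asr]
  show ?thesis unfolding TR.ksum_def t
  proof (intro exI conjI)
    show "TR.kmap (one P, one Q, op P d) (one (odsum P P'), one (odsum Q Q'), op P d + up Q Q' * op P' d' * dn P P') (one P) (one Q)"
      unfolding TR.kmap_def by (simp add: one_G r' distrib_left distrib_right mult.assoc)
    show "TR.kmap (one (odsum P P'), one (odsum Q Q'), op P d + up Q Q' * op P' d' * dn P P') (one P, one Q, op P d) (one P) (one Q)"
      unfolding TR.kmap_def by (simp add: one_G r' distrib_left distrib_right mult.assoc)
    show "TR.kmap (one P', one Q', op P' d') (one (odsum P P'), one (odsum Q Q'), op P d + up Q Q' * op P' d' * dn P P') (up P P') (up Q Q')"
      unfolding TR.kmap_def by (simp add: g r' distrib_left distrib_right mult.assoc)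
    show "TR.kmap (one (odsum P P'), one (odsum Q Q'), op P d + up Q Q' * op P' d' * dn P P') (one P', one Q', op P' d') (dn P P') (dn Q Q')"
      unfolding TR.kmap_def by (simp add: g r' distrib_left distrib_right mult.assoc)
  qed (simp_all add: r' up_dn(4))
qed

lemma czero_cpx: "is_cpx czero"
  unfolding is_cpx_def czero_def is_pmor_def pzero_def by simp

lemma trp_czero: "trp czero = (0, 0, 0)"
  unfolding trp_def czero_def
  by (auto simp: app_one app_op intro!: aend_eqI col_eqI)

lemma ciso_zero: "is_cpx S \<Longrightarrow> ciso L R S czero \<longleftrightarrow> TR.kiso (trp S) (0, 0, 0)"
  using ciso_kiso[of S czero] kiso_ciso[OF _ czero_cpx, of S] trp_czero by auto

lemma kiso_refl: "is_cpx S \<Longrightarrow> TR.kiso (trp S) (trp S)"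
  unfolding TR.kiso_def TR.kmap_def TR.khomid_def trp_def is_cpx_def
  by (rule exI[of _ "one (fst S)"], rule exI[of _ "one (fst (snd S))"], rule exI[of _ "one (fst S)"], rule exI[of _ "one (fst (snd S))"])
    (auto simp: one_G one_idem one_op op_one TR.G_zero intro!: bexI[of _ 0])

text \<open>Complexes from the second to the first projective are objects in the sense of the abstract part.\<close>

definition ob :: "nat \<Rightarrow> nat \<Rightarrow> ('a, 'x, 'b) pmor \<Rightarrow> ('a, 'x, 'b) col aend \<times> ('a, 'x, 'b) col aend" where
  "ob m n d = (one (m, n), op (0, n) d)"

lemma one_parts: "e2 * one (m, n) = one (0, n)" "e1 * one (m, n) = one (m, 0)" "one (m, 0) * one (m, n) = one (m, 0)"
  "one (m, n) * one (m, 0) = one (m, 0)" "one (0, n) * one (m, n) = one (0, n)" "one (0, n) * e2 = one (0, n)" "e1 * one (m, 0) = one (m, 0)"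
  "one (m, n) * e2 = one (0, n)"
  by (auto simp: app_e app_one intro!: aend_eqI col_eqI)

lemma ob_obj: "is_pmor (0, n) (m, 0) d \<Longrightarrow> TR.obj (ob m n d)"
proof -
  assume p: "is_pmor (0, n) (m, 0) d"
  have 1: "one (m, 0) * op (0, n) d = op (0, n) d" "op (0, n) d * one (0, n) = op (0, n) d" using one_op[OF p] op_one by auto
  have "e1 * (one (m, 0) * op (0, n) d) = one (m, 0) * op (0, n) d" "one (m, n) * (one (m, 0) * op (0, n) d) = one (m, 0) * op (0, n) d"
    by (simp_all add: mult.assoc[symmetric] one_parts)
  moreover have "op (0, n) d * one (0, n) * e2 = op (0, n) d * one (0, n)" "op (0, n) d * one (0, n) * one (m, n) = op (0, n) d * one (0, n)"
    by (simp_all add: mult.assoc one_parts)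
  ultimately show ?thesis unfolding TR.obj_def ob_def 1 using one_D op_G one_idem by simp
qed

lemma cx_ob: "TR.cx (ob m n d) = trp ((0, n), (m, 0), d)"
  by (simp add: TR.cx_def ob_def trp_def one_parts)

lemma obj_ob:
  assumes "TR.obj (one (m, n), x)"
  obtains d where "is_pmor (0, n) (m, 0) d" "ob m n d = (one (m, n), x)"
proof -
  note o = TR.objD[OF assms, unfolded fst_conv snd_conv]
  have "e1 * one (m, n) * x = x" using o by (simp add: mult.assoc)
  moreover have "x * (one (m, n) * e2) = x" using o by (simp add: mult.assoc[symmetric])
  ultimately have "one (m, 0) * x = x" "x * one (0, n) = x" by (simp_all add: one_parts)
  from op_mat_of[OF o(3) this] show thesis using that unfolding ob_def by auto
qed

text \<open>Idempotents of equal rank are equivalent, so the differential can be transported to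
  standard coordinates, where it is a matrix.\<close>

lemma state_std:
  assumes "TR.obj S" "TR.rk (fst S) m n"
  obtains d where "is_pmor (0, n) (m, 0) d" "TR.isom S (ob m n d)"
proof -
  have "eqv TR.D (fst S) (one (m, n))" using TR.rk_eqv_same[OF assms(2) rk_one] .
  then obtain x where "TR.obj (one (m, n), x)" "TR.isom S (one (m, n), x)" using TR.isom_transport[OF assms(1)] by blast
  then show thesis using obj_ob that by metis
qed

section \<open>Silting complexes of the mutation sequence\<close>

lemma indecomposable_ob:
  assumes "is_pmor (0, n) (m, 0) d" "TR.indec (ob m n d)"
  shows "indecomposable L R ((0, n), (m, 0), d)"
proof -
  let ?T = "((0, n), (m, 0), d)"
  have c: "is_cpx ?T" using assms(1) by (simp add: is_cpx_def)
  have "\<not> ciso L R ?T czero"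
    unfolding ciso_zero[OF c] cx_ob[symmetric]
    using TR.cx_not_zero TR.indec_obj[OF assms(2)] assms(2) unfolding TR.indec_def by blast
  moreover have "ciso L R S czero \<or> ciso L R U czero" if h: "is_cpx S" "is_cpx U" "ciso L R ?T (cdsum S U)" for S U
    using TR.indec_ksum[OF assms(2) _ cdsum_ksum[OF h(1,2)] trp_kval[OF h(1)] trp_kval[OF h(2)]] ciso_kiso[OF h(3)] ciso_zero h(1,2)
    unfolding cx_ob by blast
  ultimately show ?thesis unfolding indecomposable_def using c by blast
qed

text \<open>A degreewise map with boundary \<open>f\<close> yields both matrices: \<open>h0\<close>
  is its degree 0 component and \<open>h1\<close> the negative of its degree -1 component, the sign
  coming from \<open>del\<close>.\<close>

lemma presilting_ob:
  assumes p: "is_pmor (0, n) (m, 0) d" and e: "TR.ext0 (ob m n d) (ob m n d)"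
  shows "presilting L R ((0, n), (m, 0), d)"
proof -
  have "\<exists>h1 h0. is_pmor (0, n) (0, n) h1 \<and> is_pmor (m, 0) (m, 0) h0 \<and> f = padd (pcomp L R (0, n) d h1) (pcomp L R (m, 0) h0 d)"
    if f: "is_pmor (0, n) (m, 0) f" for f
  proof -
    note V = TR.objD[OF ob_obj[OF p], unfolded ob_def fst_conv snd_conv]
    note Z = TR.objD[OF ob_obj[OF f], unfolded ob_def fst_conv snd_conv]
    have "op (0, n) f \<in> TR.hx (ob m n d) (ob m n d)" unfolding TR.hx_def ob_def using Z by simp
    then obtain a where a: "a \<in> TR.dmap (ob m n d) (ob m n d)" "op (0, n) f = TR.del (ob m n d) (ob m n d) a"
      using e unfolding TR.ext0_def by blast
    note ad = TR.dmapD[OF a(1), unfolded ob_def fst_conv]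
    have ac: "a * e2 = e2 * a" "a * e1 = e1 * a" using TR.D_e1 TR.D_e2 ad(1) by auto
    have g: "e1 * a \<in> GG" "- (e2 * a) \<in> GG" using TR.D_G[OF ad(1)] TR.e1_G TR.e2_G GG_closed by auto
    have 1: "one (m, 0) * (e1 * a) = e1 * a" "e1 * a * one (m, 0) = e1 * a"
      "one (0, n) * - (e2 * a) = - (e2 * a)" "- (e2 * a) * one (0, n) = - (e2 * a)"
    proof -
      have x: "one (m, 0) * e1 = e1 * one (m, n)" "e1 * one (m, 0) = e1 * one (m, n)" "one (0, n) * e2 = e2 * one (m, n)" "e2 * one (0, n) = e2 * one (m, n)"
        by (auto simp: app_e app_one intro!: aend_eqI col_eqI)
      show "one (m, 0) * (e1 * a) = e1 * a" by (simp add: mult.assoc[symmetric] x(1)) (simp add: mult.assoc ad(2))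
      show "one (0, n) * - (e2 * a) = - (e2 * a)" by (simp add: mult.assoc[symmetric] x(3)) (simp add: mult.assoc ad(2))
      have "e1 * a * one (m, 0) = a * (e1 * one (m, n))" unfolding ac(2)[symmetric] x(2)[symmetric] by (simp add: mult.assoc)
      also have "\<dots> = e1 * a" by (simp add: TR.D_e1[OF one_D, symmetric] mult.assoc[symmetric] ad(3) ac)
      finally show "e1 * a * one (m, 0) = e1 * a" .
      have "e2 * a * one (0, n) = a * (e2 * one (m, n))" unfolding ac(1)[symmetric] x(4)[symmetric] by (simp add: mult.assoc)
      also have "\<dots> = e2 * a" by (simp add: TR.D_e2[OF one_D, symmetric] mult.assoc[symmetric] ad(3) ac)
      finally show "- (e2 * a) * one (0, n) = - (e2 * a)" by simp
    qed
    note h0 = op_mat_of[OF g(1) 1(1,2)] and h1 = op_mat_of[OF g(2) 1(3,4)]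
    have "f = padd (pcomp L R (0, n) d (mat_of (0, n) (- (e2 * a)))) (pcomp L R (m, 0) (mat_of (m, 0) (e1 * a)) d)"
    proof (rule op_inj[OF f])
      show "is_pmor (0, n) (m, 0) (padd (pcomp L R (0, n) d (mat_of (0, n) (- (e2 * a)))) (pcomp L R (m, 0) (mat_of (m, 0) (e1 * a)) d))"
        by (rule padd_pmor[OF pcomp_pmor[OF h1(1) p] pcomp_pmor[OF p h0(1)]])
      have "op (0, n) d * (e2 * a) = op (0, n) d * a" "e1 * a * op (0, n) d = a * op (0, n) d"
        using V(4,5) mult.assoc[of "op (0, n) d" e2 a] mult.assoc[of a e1 "op (0, n) d"] ac by simp_all
      then show "op (0, n) f = op (0, n) (padd (pcomp L R (0, n) d (mat_of (0, n) (- (e2 * a)))) (pcomp L R (m, 0) (mat_of (m, 0) (e1 * a)) d))"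
        unfolding op_add op_comp h0(2) h1(2) a(2) TR.del_def ob_def by simp
    qed
    then show ?thesis using h0(1) h1(1) by blast
  qed
  then show ?thesis unfolding presilting_def is_cpx_def using p by simp
qed

text \<open>The first block occupies the leading positions, so its image is literally
  \<open>ob m n d1\<close>. The second sits at shifted positions and is only isomorphic to its
  standard form.\<close>

lemma sum_decomposition:
  fixes d1 d2 :: "('a, 'x, 'b) pmor"
  assumes p: "is_pmor (0, n) (m, 0) d1" "is_pmor (0, n') (m', 0) d2"
  defines "V \<equiv> ob (m + m') (n + n') (pdsum (0, n) (m, 0) d1 d2)"
  defines "q \<equiv> one (m + m', n + n') - one (m, n)"
  shows "TR.obj V" "one (m, n) \<in> TR.hom V V" "q \<in> TR.hom V V" "q * q = q" "one (m, n) * q = 0" "q * one (m, n) = 0"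
    "one (m, n) + q = fst V" "TR.sub V (one (m, n)) = ob m n d1" "TR.isom (TR.sub V q) (ob m' n' d2)" "TR.obj (TR.sub V q)"
proof -
  let ?d = "pdsum (0, n) (m, 0) d1 d2"
  let ?p = "one (m, n)"
  have "is_cpx (cdsum ((0, n), (m, 0), d1) ((0, n'), (m', 0), d2))" by (rule cdsum_cpx) (use p in \<open>simp_all add: is_cpx_def\<close>)
  then have d: "is_pmor (0, n + n') (m + m', 0) ?d" by (simp add: is_cpx_def cdsum_def odsum_def)
  show V: "TR.obj V" unfolding V_def by (rule ob_obj[OF d])
  define y where "y = up (m, 0) (m', 0) * op (0, n') d2 * dn (0, n) (0, n')"
  have sv: "snd V = op (0, n) d1 + y" using op_pdsum[OF p] by (simp add: V_def ob_def odsum_def y_def)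
  have fv: "fst V = one (m + m', n + n')" by (simp add: V_def ob_def)
  have o1: "?p * up (m, 0) (m', 0) = 0" "dn (0, n) (0, n') * ?p = 0"
    by (auto simp: app_shift app_one up_def dn_def intro!: aend_eqI col_eqI)
  have oi: "fst V * ?p = ?p" "?p * fst V = ?p" unfolding fv by (auto simp: app_one intro!: aend_eqI col_eqI)
  note W1 = TR.objD[OF ob_obj[OF p(1)], unfolded ob_def fst_conv snd_conv]
  have py: "?p * y = 0" "y * ?p = 0" unfolding y_def
    by (simp_all only: mult.assoc o1(1)[THEN asr] o1(2)) (simp_all add: o1)
  have pv: "?p * snd V = op (0, n) d1" "snd V * ?p = op (0, n) d1" unfolding sv
    using W1 py by (simp_all add: distrib_left distrib_right)
  show ph: "?p \<in> TR.hom V V" by (rule TR.homI) (use one_D oi pv in auto)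
  have q: "q = fst V - ?p" by (simp add: q_def fv)
  show qh: "q \<in> TR.hom V V" unfolding q using TR.hom_diff[OF TR.hom_id[OF V] ph] .
  show qq: "q * q = q" "?p * q = 0" "q * ?p = 0" "?p + q = fst V"
    unfolding q using oi one_idem TR.objD(2)[OF V] by (simp_all add: left_diff_distrib right_diff_distrib)
  show "TR.sub V ?p = ob m n d1" using pv by (simp add: TR.sub_def ob_def)
  show oq: "TR.obj (TR.sub V q)" using TR.sub_hom(1)[OF V qh qq(1)] .
  have qv: "q * snd V = y" using pv TR.objD(6)[OF V] sv by (simp add: q left_diff_distrib)
  let ?u = "up (m, n) (m', n')" and ?v = "dn (m, n) (m', n')"
  have uv: "?u * ?v = q" using up_dn(4)[of "(m, n)" "(m', n')"] by (simp add: q fv odsum_def eq_diff_eq add.commute)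
  have vu: "?v * ?u = one (m', n')" by (rule up_dn(1))
  have x: "?v * up (m, 0) (m', 0) = one (m', 0)" "one (0, n') * ?v = dn (0, n) (0, n')"
    "dn (0, n) (0, n') * ?u = one (0, n')"  "?u * one (m', 0) = up (m, 0) (m', 0)"
    by (auto simp: app_shift app_one up_def dn_def intro!: aend_eqI col_eqI)
  have op2: "one (m', 0) * op (0, n') d2 = op (0, n') d2" "op (0, n') d2 * one (0, n') = op (0, n') d2" using one_op[OF p(2)] op_one by auto
  have uD: "?u \<in> TR.D" "?v \<in> TR.D" unfolding up_def dn_def by (rule shift_D)+
  have vq: "?v * q = ?v" "q * ?u = ?u"
  proof -
    show "?v * q = ?v" unfolding uv[symmetric] by (simp add: mult.assoc[symmetric] vu up_dn(10))
    show "q * ?u = ?u" unfolding uv[symmetric] by (simp add: mult.assoc vu up_dn(9))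
  qed
  have "op (0, n') d2 * ?v = op (0, n') d2 * one (0, n') * ?v" using op2 by simp
  also have "\<dots> = op (0, n') d2 * dn (0, n) (0, n')" by (simp add: mult.assoc x)
  finally have 1: "op (0, n') d2 * ?v = op (0, n') d2 * dn (0, n) (0, n')" .
  have "?v * y = one (m', 0) * op (0, n') d2 * dn (0, n) (0, n')" unfolding y_def by (simp add: mult.assoc[symmetric] x(1))
  then have 2: "?v * y = op (0, n') d2 * ?v" using 1 op2 by simp
  have "y * ?u = up (m, 0) (m', 0) * (op (0, n') d2 * one (0, n'))" unfolding y_def by (simp add: mult.assoc x(3))
  also have "\<dots> = ?u * (one (m', 0) * op (0, n') d2)" using op2 x(4)[THEN asr, of "op (0, n') d2"] by simp
  finally have 3: "y * ?u = ?u * op (0, n') d2" using op2 by simp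
  have "?v \<in> TR.hom (TR.sub V q) (ob m' n' d2)"
    by (rule TR.homI) (use uD vq qv 2 up_dn(10)[of "(m', n')" "(m, n)"] in \<open>auto simp: TR.sub_def ob_def\<close>)
  moreover have "?u \<in> TR.hom (ob m' n' d2) (TR.sub V q)"
    by (rule TR.homI) (use uD vq qv 3 up_dn(9)[of "(m, n)" "(m', n')"] in \<open>auto simp: TR.sub_def ob_def\<close>)
  ultimately show "TR.isom (TR.sub V q) (ob m' n' d2)"
    unfolding TR.isom_def using uv vu by (auto simp: TR.sub_def ob_def)
qed

lemma ob_size: "TR.isom (ob m n d) (ob m' n' d') \<Longrightarrow> TR.obj (ob m n d) \<Longrightarrow> m = m' \<and> n = n'"
  using TR.isom_rk[of "ob m n d" "ob m' n' d'" m n] rk_one TR.rk_unique by (simp add: ob_def) blast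

text \<open>The block sum of the two standard forms is rigid, and Krull-Schmidt identifies its
  indecomposable summands. The two are not isomorphic because equal ranks would make the determinant
  0.\<close>

lemma silting_of_state:
  assumes "TR.state S T m n m' n'"
  shows "\<exists>d. is_pmor (0, n + n') (m + m', 0) d \<and> basic L R ((0, n + n'), (m + m', 0), d) \<and>
    two_term_silting L R ((0, n + n'), (m + m', 0), d)"
proof -
  note st = assms[unfolded TR.state_def]
  have S: "TR.obj S" "TR.rk (fst S) m n" and T: "TR.obj T" "TR.rk (fst T) m' n'" using st TR.indec_obj by auto
  obtain d1 where d1: "is_pmor (0, n) (m, 0) d1" "TR.isom S (ob m n d1)" using state_std[OF S] .
  obtain d2 where d2: "is_pmor (0, n') (m', 0) d2" "TR.isom T (ob m' n' d2)" using state_std[OF T] .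
  let ?d = "pdsum (0, n) (m, 0) d1 d2"
  let ?S1 = "((0, n), (m, 0), d1)" and ?S2 = "((0, n'), (m', 0), d2)"
  let ?T = "((0, n + n'), (m + m', 0), ?d)"
  define W1 where "W1 = ob m n d1"
  define W2 where "W2 = ob m' n' d2"
  have W: "TR.obj W1" "TR.obj W2" unfolding W1_def W2_def using ob_obj d1 d2 by auto
  define V where "V = ob (m + m') (n + n') ?d"
  define p where "p = one (m, n)"
  define q where "q = one (m + m', n + n') - one (m, n)"
  note sd = sum_decomposition[OF d1(1) d2(1), folded V_def q_def W1_def W2_def, folded p_def]
  have pp: "p * p = p" unfolding p_def by (rule one_idem)
  have iW: "TR.indec W1" "TR.indec W2" using st TR.indec_isom d1(2) d2(2) W unfolding W1_def W2_def by blast+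
  have iq: "TR.indec (TR.sub V q)" using TR.indec_isom[OF iW(2) TR.isom_sym[OF sd(9)] sd(10)] .
  have ip: "TR.indec (TR.sub V p)" unfolding sd(8) by (rule iW(1))
  have SV: "TR.isom S (TR.sub V p)" "TR.isom T W2" using d1(2) d2(2) sd(8) unfolding W1_def W2_def by simp_all
  have ext2: "TR.ext0 (TR.sub V p) (TR.sub V p)" "TR.ext0 (TR.sub V p) (TR.sub V q)" "TR.ext0 (TR.sub V q) (TR.sub V p)" "TR.ext0 (TR.sub V q) (TR.sub V q)"
  proof -
    have e: "TR.ext0 W1 W1" "TR.ext0 W1 W2" "TR.ext0 W2 W1" "TR.ext0 W2 W2"
      using st TR.isom_ext0 SV W unfolding sd(8) by metis+
    have r: "TR.isom W1 W1" using TR.hom_id[OF W(1)] TR.objD(2)[OF W(1)] unfolding TR.isom_def by blast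
    note s2 = TR.isom_sym[OF sd(9)]
    show "TR.ext0 (TR.sub V p) (TR.sub V p)" "TR.ext0 (TR.sub V p) (TR.sub V q)" "TR.ext0 (TR.sub V q) (TR.sub V p)" "TR.ext0 (TR.sub V q) (TR.sub V q)"
      using e TR.isom_ext0[OF e(2) r s2 W(1) sd(10)] TR.isom_ext0[OF e(3) s2 r sd(10) W(1)] TR.isom_ext0[OF e(4) s2 s2 sd(10) sd(10)]
      unfolding sd(8) by auto
  qed
  have "p \<in> TR.thru (TR.sub V p) V V" "q \<in> TR.thru (TR.sub V q) V V"
    using TR.thru_comp[OF TR.sub_hom(3)[OF sd(1,2) pp] TR.sub_hom(2)[OF sd(1,2) pp]]
      TR.thru_comp[OF TR.sub_hom(3)[OF sd(1,3,4)] TR.sub_hom(2)[OF sd(1,3,4)]] pp sd(4) by simp_all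
  then have a2: "TR.add2_of (TR.sub V p) (TR.sub V q) V" unfolding TR.add2_of_def using sd(7) by metis
  have eV: "TR.ext0 V V"
    using TR.ext0_add2_right[OF TR.ext0_add2_left[OF ext2(1,3) a2 sd(1)] TR.ext0_add2_left[OF ext2(2,4) a2 sd(1)] a2 sd(1)] .
  have c1: "is_cpx ?S1" and c2: "is_cpx ?S2" using d1 d2 by (simp_all add: is_cpx_def)
  have T_eq: "cdsum ?S1 ?S2 = ?T" by (simp add: cdsum_def odsum_def)
  have cT: "is_cpx ?T" using cdsum_cpx[OF c1 c2] T_eq by simp
  then have dT: "is_pmor (0, n + n') (m + m', 0) ?d" by (simp add: is_cpx_def)
  have t: "trp ?S1 = TR.cx (TR.sub V p)" "trp ?S2 = TR.cx W2" "trp ?T = TR.cx V"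
    by (simp add: sd(8) W1_def cx_ob, simp add: W2_def cx_ob, simp add: V_def cx_ob)
  have kq: "TR.kiso (TR.cx (TR.sub V q)) (trp ?S2)" unfolding t using TR.isom_kiso[OF sd(10) W(2) sd(9)] .
  have ind1: "indecomposable L R ?S1" and ind2: "indecomposable L R ?S2"
    using indecomposable_ob d1(1) d2(1) iW unfolding W1_def W2_def by auto
  have n1: "\<not> ciso L R ?S1 czero" and n2: "\<not> ciso L R ?S2 czero" using ind1 ind2 unfolding indecomposable_def by auto
  have n12: "\<not> TR.kiso (trp ?S1) (trp ?S2)"
  proof
    assume "TR.kiso (trp ?S1) (trp ?S2)"
    then have "TR.isom (ob m n d1) (ob m' n' d2)"
      using TR.kiso_cx_isom[OF W] unfolding W1_def W2_def cx_ob by blast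
    then have "m = m' \<and> n = n'" using ob_size W(1) unfolding W1_def by blast
    then show False using st by simp
  qed
  have ks: "(ciso L R Y czero \<or> (ciso L R Z czero \<and> ciso L R Y ?T) \<or> (ciso L R Y ?S1 \<and> ciso L R Z ?S2) \<or> (ciso L R Y ?S2 \<and> ciso L R Z ?S1))"
    if h: "is_cpx Y" "is_cpx Z" "ciso L R ?T (cdsum Y Z)" for Y Z
  proof -
    have "TR.kiso (TR.cx V) (trp (cdsum Y Z))" using ciso_kiso[OF h(3)] t(3) by simp
    from TR.krull_schmidt[OF sd(1,2) pp sd(3-7) ip iq this cdsum_ksum[OF h(1,2)] trp_kval[OF h(1)] trp_kval[OF h(2)]]
    have "TR.kiso (trp Y) (0, 0, 0) \<or> TR.kiso (trp Z) (0, 0, 0) \<and> TR.kiso (trp Y) (trp ?T) \<or>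
      TR.kiso (trp Y) (trp ?S1) \<and> TR.kiso (trp Z) (trp ?S2) \<or> TR.kiso (trp Y) (trp ?S2) \<and> TR.kiso (trp Z) (trp ?S1)"
      using TR.kiso_trans[OF _ kq] unfolding t(1,3) by blast
    then show ?thesis using kiso_ciso[OF h(1) c1] kiso_ciso[OF h(1) c2] kiso_ciso[OF h(2) c1] kiso_ciso[OF h(2) c2]
        kiso_ciso[OF h(1) cT] ciso_zero[OF h(1)] ciso_zero[OF h(2)] by blast
  qed
  have notT: "\<not> ciso L R Y ?T" if "indecomposable L R Y" for Y
    using that n1 n2 c1 c2 unfolding indecomposable_def T_eq[symmetric] by blast
  have "two_term_silting L R ?T"
    unfolding two_term_silting_def
  proof (intro conjI exI)
    show "presilting L R ?T" using presilting_ob[OF dT] eV unfolding V_def by simp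
    show "indecomposable L R ?S1" "indecomposable L R ?S2" by fact+
    show "summand L R ?S1 ?T" unfolding summand_def
      using c1 c2 kiso_ciso[OF cT cT kiso_refl[OF cT]] T_eq by metis
    have "TR.kiso (trp (cdsum ?S1 ?S2)) (trp (cdsum ?S2 ?S1))"
      using TR.ksum_unique[OF cdsum_ksum[OF c1 c2] TR.ksum_sym[OF cdsum_ksum[OF c2 c1]]] .
    then have "ciso L R ?T (cdsum ?S2 ?S1)" using kiso_ciso[OF cT cdsum_cpx[OF c2 c1]] T_eq by simp
    then show "summand L R ?S2 ?T" unfolding summand_def using c1 c2 by blast
    show "\<not> ciso L R ?S1 ?S2" using n12 ciso_kiso by blast
    show "\<forall>Y. indecomposable L R Y \<and> summand L R Y ?T \<longrightarrow> ciso L R Y ?S1 \<or> ciso L R Y ?S2"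
    proof (intro allI impI)
      fix Y assume h: "indecomposable L R Y \<and> summand L R Y ?T"
      then obtain Z where Z: "is_cpx Y" "is_cpx Z" "ciso L R ?T (cdsum Y Z)" unfolding summand_def by blast
      have "\<not> ciso L R Y czero" using h unfolding indecomposable_def by blast
      then show "ciso L R Y ?S1 \<or> ciso L R Y ?S2" using ks[OF Z] notT h by blast
    qed
  qed
  moreover have "basic L R ?T"
    unfolding basic_def
  proof (intro conjI notI)
    show "is_cpx ?T" by (rule cT)
    assume "\<exists>Y Z. indecomposable L R Y \<and> is_cpx Z \<and> ciso L R ?T (cdsum Y (cdsum Y Z))"
    then obtain Y Z where h: "indecomposable L R Y" "is_cpx Z" "ciso L R ?T (cdsum Y (cdsum Y Z))" by blast
    have Y: "is_cpx Y" "\<not> ciso L R Y czero" using h(1) unfolding indecomposable_def by auto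
    have YZ: "is_cpx (cdsum Y Z)" using cdsum_cpx Y(1) h(2) by blast
    \<comment> \<open>If \<open>Y\<close> occurred twice, its complement \<open>cdsum Y Z\<close>
      would be one of the indecomposables, so \<open>Z\<close> would be contractible and
      \<open>Y\<close> isomorphic to that one. It is also isomorphic to the other one, against
      \<open>n12\<close>.\<close>
    have two: "TR.kiso (trp Y) (trp W)" if w: "indecomposable L R W" "ciso L R (cdsum Y Z) W" for W
    proof -
      have cW: "is_cpx W" using w unfolding indecomposable_def by blast
      have "ciso L R W (cdsum Y Z)" using kiso_ciso[OF cW YZ TR.kiso_sym[OF ciso_kiso[OF w(2)]]] .
      then have "ciso L R Z czero" using w(1) Y h(2) unfolding indecomposable_def by blast
      then have "TR.kiso (trp (cdsum Y Z)) (trp Y)"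
        using TR.ksum_zero[OF cdsum_ksum[OF Y(1) h(2)]] trp_kval[OF Y(1)] ciso_zero[OF h(2)] by blast
      then show ?thesis using TR.kiso_trans[OF TR.kiso_sym ciso_kiso[OF w(2)]] by blast
    qed
    consider "ciso L R Y ?S1" "ciso L R (cdsum Y Z) ?S2" | "ciso L R Y ?S2" "ciso L R (cdsum Y Z) ?S1"
      using ks[OF Y(1) YZ h(3)] Y(2) notT[OF h(1)] by blast
    then show False
    proof cases
      case 1
      then show ?thesis using two[OF ind2] n12 TR.kiso_trans[OF TR.kiso_sym] ciso_kiso by blast
    next
      case 2
      then show ?thesis using two[OF ind1] n12 TR.kiso_trans[OF TR.kiso_sym] ciso_kiso by blast
    qed
  qed
  ultimately show ?thesis using dT by blast
qed

text \<open>The differential of a rigid complex of rank \<open>(p, q)\<close> is a matrix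
  \<open>\<xi>\<close> over X. Since every degree 1 map is a boundary, every matrix over X comes
  from \<open>\<xi>\<close> by acting with endomorphisms of the two terms.\<close>

lemma rigid_matrix:
  fixes p q :: nat
  assumes "g_finite L R" "0 < p"
  shows "\<exists>\<xi>. \<forall>\<eta>. \<exists>\<alpha> \<beta>. \<forall>i<p. \<forall>j<q. \<eta> i j = (\<Sum>l<q. R (\<xi> i l) (\<beta> l j)) + (\<Sum>l<p. L (\<alpha> i l) (\<xi> l j))"
proof -
  define Z where "Z = {(m + m', n + n') |m n m' n'. 0 < m' \<and> (\<exists>S T. TR.state S T m n m' n')}"
  obtain F where F: "finite F" "\<And>T. basic L R T \<Longrightarrow> two_term_silting L R T \<Longrightarrow> \<exists>S\<in>F. ciso L R T S"
    using assms(1) unfolding g_finite_def by blast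
  have "\<forall>z\<in>Z. \<exists>S. S \<in> F \<and> (\<exists>d. is_pmor (0, snd z) (fst z, 0) d \<and> ciso L R ((0, snd z), (fst z, 0), d) S)"
  proof
    fix z assume "z \<in> Z"
    then obtain m n m' n' S T where z: "z = (m + m', n + n')" "TR.state S T m n m' n'" unfolding Z_def by blast
    show "\<exists>S. S \<in> F \<and> (\<exists>d. is_pmor (0, snd z) (fst z, 0) d \<and> ciso L R ((0, snd z), (fst z, 0), d) S)"
      using silting_of_state[OF z(2)] F(2) z(1) by fastforce
  qed
  then obtain h where h: "\<And>z. z \<in> Z \<Longrightarrow> h z \<in> F"
    "\<And>z. z \<in> Z \<Longrightarrow> \<exists>d. is_pmor (0, snd z) (fst z, 0) d \<and> ciso L R ((0, snd z), (fst z, 0), d) (h z)" by metis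
  \<comment> \<open>The sum of the two g-vectors is an isomorphism invariant of the silting complex,
    so finitely many complexes allow only finitely many sums.\<close>
  have "inj_on h Z"
  proof (rule inj_onI)
    fix z w assume zw: "z \<in> Z" "w \<in> Z" "h z = h w"
    obtain d where d: "is_pmor (0, snd z) (fst z, 0) d" "ciso L R ((0, snd z), (fst z, 0), d) (h z)" using h(2) zw by blast
    obtain d' where d': "is_pmor (0, snd w) (fst w, 0) d'" "ciso L R ((0, snd w), (fst w, 0), d') (h w)" using h(2) zw by blast
    have "TR.kiso (TR.cx (ob (fst z) (snd z) d)) (TR.cx (ob (fst w) (snd w) d'))"
      unfolding cx_ob using TR.kiso_trans[OF ciso_kiso[OF d(2)] TR.kiso_sym[OF ciso_kiso[OF d'(2)[folded zw(3)]]]] .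
    then have "TR.isom (ob (fst z) (snd z) d) (ob (fst w) (snd w) d')" using TR.kiso_cx_isom ob_obj d(1) d'(1) by blast
    then show "z = w" using ob_size ob_obj[OF d(1)] prod_eq_iff by blast
  qed
  then have "finite Z" using h(1) F(1) by (meson finite_imageD finite_subset image_subsetI)
  then obtain V where V: "TR.obj V" "TR.rk (fst V) p q" "TR.ext0 V V"
    using TR.rigid_or_infinite[OF assms(2), of q] unfolding Z_def by blast
  obtain d where d: "is_pmor (0, q) (p, 0) d" "TR.isom V (ob p q d)" using state_std[OF V(1,2)] .
  have "TR.ext0 (ob p q d) (ob p q d)" using TR.isom_ext0[OF V(3) d(2,2)] ob_obj[OF d(1)] by blast
  then have pre: "presilting L R ((0, q), (p, 0), d)" by (rule presilting_ob[OF d(1)])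
  have P: "\<exists>h1 h0. f = padd (pcomp L R (0, q) d h1) (pcomp L R (p, 0) h0 d)" if "is_pmor (0, q) (p, 0) f" for f
    using pre that unfolding presilting_def fst_conv snd_conv by blast
  have "\<exists>\<alpha> \<beta>. \<forall>i<p. \<forall>j<q. \<eta> i j = (\<Sum>l<q. R (fst (snd d) i l) (\<beta> l j)) + (\<Sum>l<p. L (\<alpha> i l) (fst (snd d) l j))" for \<eta>
  proof -
    define f :: "('a, 'x, 'b) pmor" where "f = ((\<lambda>i j. 0), (\<lambda>i j. if i < p \<and> j < q then \<eta> i j else 0), (\<lambda>i j. 0))"
    have "is_pmor (0, q) (p, 0) f" by (auto simp: is_pmor_def f_def)
    then obtain h1 h0 where e: "f = padd (pcomp L R (0, q) d h1) (pcomp L R (p, 0) h0 d)"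
      using P by blast
    have eq: "fst (snd f) i j = (\<Sum>l<q. R (fst (snd d) i l) (snd (snd h1) l j)) + (\<Sum>l<p. L (fst h0 i l) (fst (snd d) l j))" for i j
      unfolding e by (simp add: padd_def pcomp_def)
    have "\<eta> i j = (\<Sum>l<q. R (fst (snd d) i l) (snd (snd h1) l j)) + (\<Sum>l<p. L (fst h0 i l) (fst (snd d) l j))"
      if "i < p" "j < q" for i j
    proof -
      have "\<eta> i j = fst (snd f) i j" using that by (simp add: f_def)
      then show ?thesis unfolding eq .
    qed
    then show ?thesis by (intro exI[of _ "fst h0"] exI[of _ "snd (snd h1)"]) simp
  qed
  then show ?thesis by blast
qed

section \<open>Uniseriality\<close>

text \<open>If two submodules were incomparable, a quotient of the module would have a two-dimensional subspace \<open>k u + k v\<close>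
  in its socle. A rigid vector with one entry less than the dimension of the quotient has a nontrivial combination
  in that subspace, and rigidity then forces its entries to span the quotient.\<close>

lemma uniserial_core:
  fixes Op J :: "('x \<Rightarrow> 'x) set"
  assumes add: "\<And>f x y. f \<in> Op \<Longrightarrow> f (x + y) = f x + f y"
    and lin: "\<And>f c x. f \<in> Op \<Longrightarrow> f (sX c x) = sX c (f x)"
    and J: "J \<subseteq> Op" "(\<lambda>x. 0) \<in> J" "\<And>f g. f \<in> J \<Longrightarrow> g \<in> J \<Longrightarrow> (\<lambda>x. f x + g x) \<in> J"
      "\<And>f g. f \<in> Op \<Longrightarrow> g \<in> J \<Longrightarrow> (\<lambda>x. f (g x)) \<in> J"
    and res: "\<And>f. f \<in> Op \<Longrightarrow> \<exists>c. (\<lambda>x. f x - sX c x) \<in> J"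
    and inv: "\<And>g. g \<in> J \<Longrightarrow> \<exists>h\<in>Op. \<forall>x. h (x - g x) = x"
    and scal: "\<And>c. (\<lambda>x. sX c x) \<in> Op"
    and U: "0 \<in> U" "\<And>x y. x \<in> U \<Longrightarrow> y \<in> U \<Longrightarrow> x + y \<in> U" "\<And>f x. f \<in> Op \<Longrightarrow> x \<in> U \<Longrightarrow> f x \<in> U"
    and V: "0 \<in> V" "\<And>x y. x \<in> V \<Longrightarrow> y \<in> V \<Longrightarrow> x + y \<in> V" "\<And>f x. f \<in> Op \<Longrightarrow> x \<in> V \<Longrightarrow> f x \<in> V"
    and gen: "\<And>n::nat. \<exists>\<xi>. \<forall>\<eta>. \<exists>f\<in>Op. \<exists>k. \<forall>j<n. \<eta> j - f (\<xi> j) - (\<Sum>l<n. sX (k l j) (\<xi> l)) \<in> U \<inter> V"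
  shows "U \<subseteq> V \<or> V \<subseteq> U"
proof (rule ccontr)
  assume "\<not> ?thesis"
  then obtain u v where uv: "u \<in> U" "u \<notin> V" "v \<in> V" "v \<notin> U" by blast
  \<comment> \<open>Modulo \<open>N\<close> the vectors \<open>u\<close> and \<open>v\<close> are
    killed by \<open>J\<close>; dividing only by \<open>U \<inter> V\<close> would not achieve
    this.\<close>
  define N where "N = {w + f u + g v |w f g. w \<in> U \<inter> V \<and> f \<in> J \<and> g \<in> J}"
  have NI: "w + f u + g v \<in> N" if "w \<in> U" "w \<in> V" "f \<in> J" "g \<in> J" for w f g using that unfolding N_def by blast
  have UVN: "w \<in> N" if "w \<in> U \<inter> V" for w using NI[of w "\<lambda>x. 0" "\<lambda>x. 0"] that J(2) by simp
  have Nadd: "x + y \<in> N" if xy: "x \<in> N" "y \<in> N" for x y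
  proof -
    obtain w f g w' f' g' where e: "x = w + f u + g v" "w \<in> U \<inter> V" "f \<in> J" "g \<in> J" "y = w' + f' u + g' v" "w' \<in> U \<inter> V" "f' \<in> J" "g' \<in> J"
      using xy unfolding N_def by auto
    have "x + y = (w + w') + (f u + f' u) + (g v + g' v)" unfolding e by (simp add: ac_simps)
    moreover have "(w + w') + (f u + f' u) + (g v + g' v) \<in> N"
      by (rule NI[of "w + w'" "\<lambda>x. f x + f' x" "\<lambda>x. g x + g' x"]) (use e U(2) V(2) J(3) in auto)
    ultimately show ?thesis by simp
  qed
  have Nop: "h x \<in> N" if hx: "h \<in> Op" "x \<in> N" for h x
  proof -
    obtain w f g where e: "x = w + f u + g v" "w \<in> U \<inter> V" "f \<in> J" "g \<in> J" using hx unfolding N_def by auto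
    have "h x = h w + h (f u) + h (g v)" unfolding e(1) using add hx by simp
    moreover have "h w + h (f u) + h (g v) \<in> N"
      by (rule NI[of "h w" "\<lambda>x. h (f x)" "\<lambda>x. h (g x)"]) (use e U(3) V(3) J(4) hx in auto)
    ultimately show ?thesis by simp
  qed
  have Nsub: "vX.subspace N"
    by (rule vX.subspaceI) (use UVN[of 0] U V Nadd Nop[OF scal] in auto)
  have Uneg: "- x \<in> U" if "x \<in> U" for x using U(3)[OF scal[of "- 1"] that] by simp
  have Vneg: "- x \<in> V" if "x \<in> V" for x using V(3)[OF scal[of "- 1"] that] by simp
  have Udiff: "x - y \<in> U" if "x \<in> U" "y \<in> U" for x y using U(2)[OF that(1) Uneg[OF that(2)]] by simp
  have Vdiff: "x - y \<in> V" if "x \<in> V" "y \<in> V" for x y using V(2)[OF that(1) Vneg[OF that(2)]] by simp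
  \<comment> \<open>A relation would put \<open>u - f u\<close> into \<open>V\<close> for some
    \<open>f\<close> in \<open>J\<close>; by \<open>inv\<close> then \<open>u\<close> itself would
    be in \<open>V\<close>.\<close>
  have uN: "u - sX \<beta> v \<notin> N" for \<beta>
  proof
    assume "u - sX \<beta> v \<in> N"
    then obtain w f g where e: "u - sX \<beta> v = w + f u + g v" "w \<in> U \<inter> V" "f \<in> J" "g \<in> J" unfolding N_def by auto
    have "u - f u = w + g v + sX \<beta> v" using e(1) by (simp add: algebra_simps)
    moreover have "g v \<in> V" "sX \<beta> v \<in> V" using V(3) e(4) J(1) uv(3) scal by blast+
    ultimately have "u - f u \<in> V" using e(2) V(2) by auto
    then show False using inv[OF e(3)] V(3) uv(2) by metis
  qed
  have vN: "v \<notin> N"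
  proof
    assume "v \<in> N"
    then obtain w f g where e: "v = w + f u + g v" "w \<in> U \<inter> V" "f \<in> J" "g \<in> J" unfolding N_def by auto
    have "v - g v = w + f u" using e(1) by (metis add_diff_cancel_right')
    moreover have "f u \<in> U" using U(3) e(3) J(1) uv(1) by blast
    ultimately have "v - g v \<in> U" using e(2) U(2) by auto
    then show False using inv[OF e(4)] U(3) uv(4) by metis
  qed
  obtain S where S: "finite S" "vX.span S = UNIV" using fdX unfolding fin_dim_def by blast
  obtain Bs where Bs: "Bs \<subseteq> S" "vX.independent Bs" "S \<subseteq> vX.span Bs" using vX.maximal_independent_subset[of S] by metis
  have spanB: "vX.span Bs = UNIV" using S(2) Bs(3) vX.span_mono vX.span_span by (metis top.extremum_uniqueI)
  interpret FX: finite_dimensional_vector_space sX Bs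
    by unfold_locales (use Bs S spanB finite_subset in auto)
  let ?M = "insert u (insert v N)"
  have spanN: "vX.span N = N" using Nsub by (rule iffD2[OF vX.span_eq_iff])
  have "v \<notin> vX.span N" unfolding spanN by (rule vN)
  then have dv: "vX.dim (insert v N) = vX.dim N + 1" by (simp add: FX.dim_insert)
  have "u \<notin> vX.span (insert v N)" using uN by (auto simp: vX.span_insert[of v] spanN)
  then have dM: "vX.dim ?M = vX.dim N + 2" using dv by (simp add: FX.dim_insert)
  \<comment> \<open>The subtraction does not truncate: adjoining \<open>u\<close> and
    \<open>v\<close> to \<open>N\<close> raises the dimension by 2.\<close>
  define n where "n = vX.dim (UNIV :: 'x set) - vX.dim N - 1"
  have le: "vX.dim ?M \<le> vX.dim (UNIV :: 'x set)" by (rule FX.dim_subset) simp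
  have n: "n + vX.dim N + 1 = vX.dim (UNIV :: 'x set)" using le dM unfolding n_def by linarith
  obtain \<xi> where \<xi>: "\<And>\<eta>. \<exists>f\<in>Op. \<exists>k. \<forall>j<n. \<eta> j - f (\<xi> j) - (\<Sum>l<n. sX (k l j) (\<xi> l)) \<in> U \<inter> V" using gen[of n] by blast
  have spanI: "\<exists>c. x - (\<Sum>l<m. sX (c l) (\<xi> l)) \<in> vX.span K" if "x \<in> vX.span (K \<union> \<xi> ` {..<m})" for x m K
    using that
  proof (induction m arbitrary: x)
    case (Suc m)
    have "K \<union> \<xi> ` {..<Suc m} = insert (\<xi> m) (K \<union> \<xi> ` {..<m})" by (auto simp: lessThan_Suc)
    then obtain k where "x - sX k (\<xi> m) \<in> vX.span (K \<union> \<xi> ` {..<m})" using Suc(2) by (auto simp: vX.span_insert)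
    then obtain c where "x - sX k (\<xi> m) - (\<Sum>l<m. sX (c l) (\<xi> l)) \<in> vX.span K" using Suc(1) by blast
    moreover have "(\<Sum>l<Suc m. sX ((c(m := k)) l) (\<xi> l)) = sX k (\<xi> m) + (\<Sum>l<m. sX (c l) (\<xi> l))"
      by (simp add: add.commute)
    ultimately show ?case by (intro exI[of _ "c(m := k)"]) (simp only: diff_diff_eq)
  qed simp
  \<comment> \<open>Otherwise the entries of \<open>\<xi>\<close> together with \<open>?M\<close>
    would have dimension \<open>dim N + 2 + n\<close>, one more than X has.\<close>
  have "\<exists>c. (\<exists>l<n. c l \<noteq> 0) \<and> (\<Sum>l<n. sX (c l) (\<xi> l)) \<in> vX.span ?M"
  proof (rule ccontr)
    assume neg: "\<not> ?thesis"
    have "vX.dim (?M \<union> \<xi> ` {..<m}) = vX.dim ?M + m" if "m \<le> n" for m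
      using that
    proof (induction m)
      case (Suc m)
      have "\<xi> m \<notin> vX.span (?M \<union> \<xi> ` {..<m})"
      proof
        assume "\<xi> m \<in> vX.span (?M \<union> \<xi> ` {..<m})"
        then obtain c where c: "\<xi> m - (\<Sum>l<m. sX (c l) (\<xi> l)) \<in> vX.span ?M" using spanI by blast
        define c' where "c' l = (if l < m then - c l else if l = m then 1 else 0)" for l
        have "(\<Sum>l<n. sX (c' l) (\<xi> l)) = (\<Sum>l<Suc m. sX (c' l) (\<xi> l))"
          by (rule sum.mono_neutral_right) (use Suc(2) in \<open>auto simp: c'_def\<close>)
        also have "\<dots> = \<xi> m - (\<Sum>l<m. sX (c l) (\<xi> l))"
          by (simp add: c'_def sum_negf)
        finally have "(\<Sum>l<n. sX (c' l) (\<xi> l)) \<in> vX.span ?M" using c by simp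
        moreover have "c' m \<noteq> 0" "m < n" using Suc(2) by (auto simp: c'_def)
        ultimately show False using neg by blast
      qed
      moreover have "?M \<union> \<xi> ` {..<Suc m} = insert (\<xi> m) (?M \<union> \<xi> ` {..<m})" by (auto simp: lessThan_Suc)
      ultimately show ?case using Suc by (simp add: FX.dim_insert)
    qed simp
    from this[of n] have "vX.dim ?M + n \<le> vX.dim (UNIV :: 'x set)" by (metis FX.dim_subset le_refl subset_UNIV)
    then show False using dM n by linarith
  qed
  then obtain c l0 where c: "l0 < n" "c l0 \<noteq> 0" "(\<Sum>l<n. sX (c l) (\<xi> l)) \<in> vX.span ?M" by blast
  define s where "s = (\<Sum>l<n. sX (c l) (\<xi> l))"
  obtain \<alpha> \<beta> where ab: "s - sX \<alpha> u - sX \<beta> v \<in> N"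
    using c(3) unfolding s_def[symmetric] by (auto simp: vX.span_insert spanN)
  have f0: "f 0 = 0" if "f \<in> Op" for f using add[OF that, of 0 0] by simp
  have fsum: "f (\<Sum>l\<in>I. g l) = (\<Sum>l\<in>I. f (g l))" if "f \<in> Op" for f I and g :: "nat \<Rightarrow> 'x"
    using sum_comp_morphism[of f g I] f0[OF that] add[OF that] by (simp add: comp_def)
  have Js: "g s \<in> N" if g: "g \<in> J" for g
  proof -
    have gO: "g \<in> Op" using g J(1) by blast
    define y where "y = s - sX \<alpha> u - sX \<beta> v"
    have "g s = g y + (g (sX \<alpha> u) + g (sX \<beta> v))"
      using add[OF gO, of y "sX \<alpha> u + sX \<beta> v"] add[OF gO, of "sX \<alpha> u" "sX \<beta> v"] by (simp add: y_def)
    moreover have "g y \<in> N" using Nop[OF gO] ab unfolding y_def by blast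
    moreover have "g u \<in> N" "g v \<in> N" using NI[of 0 g "\<lambda>x. 0"] NI[of 0 "\<lambda>x. 0" g] U(1) V(1) g J(2) by simp_all
    then have "g (sX \<alpha> u) \<in> N" "g (sX \<beta> v) \<in> N" using lin[OF gO] Nop[OF scal] by simp_all
    ultimately show ?thesis using Nadd by simp
  qed
  have "y \<in> vX.span (N \<union> \<xi> ` {..<n})" for y
  proof -
    let ?K = "vX.span (N \<union> \<xi> ` {..<n})"
    have KN: "x \<in> ?K" if "x \<in> N" for x by (rule vX.span_base) (use that in simp)
    have K\<xi>: "\<xi> l \<in> ?K" if "l < n" for l by (rule vX.span_base) (use that in simp)
    \<comment> \<open>Concentrated at \<open>l0\<close> and scaled so that the combination of its
      entries with coefficients \<open>c\<close> is \<open>y\<close>. In the rigidity equation this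
      combination turns \<open>f\<close> of the entries into \<open>f s\<close>.\<close>
    define \<eta> where "\<eta> j = (if j = l0 then sX (inverse (c l0)) y else 0)" for j
    obtain f k where f: "f \<in> Op" "\<forall>j<n. \<eta> j - f (\<xi> j) - (\<Sum>l<n. sX (k l j) (\<xi> l)) \<in> U \<inter> V" using \<xi> by blast
    define e where "e j = \<eta> j - f (\<xi> j) - (\<Sum>l<n. sX (k l j) (\<xi> l))" for j
    have ej: "e j \<in> N" if "j < n" for j using UVN f(2) that unfolding e_def by blast
    have "(\<Sum>j<n. sX (c j) (\<eta> j)) = (\<Sum>j<n. if j = l0 then sX (c j) (sX (inverse (c l0)) y) else 0)"
      by (rule sum.cong) (auto simp: \<eta>_def)
    also have "\<dots> = y" using c(1,2) by simp
    finally have "y = (\<Sum>j<n. sX (c j) (e j + f (\<xi> j) + (\<Sum>l<n. sX (k l j) (\<xi> l))))" by (simp add: e_def)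
    also have "\<dots> = (\<Sum>j<n. sX (c j) (e j)) + (\<Sum>j<n. f (sX (c j) (\<xi> j))) + (\<Sum>j<n. sX (c j) (\<Sum>l<n. sX (k l j) (\<xi> l)))"
      by (simp add: vX.scale_right_distrib sum.distrib lin[OF f(1)])
    also have "(\<Sum>j<n. f (sX (c j) (\<xi> j))) = f s" unfolding s_def fsum[OF f(1)] ..
    finally have y: "y = (\<Sum>j<n. sX (c j) (e j)) + f s + (\<Sum>j<n. sX (c j) (\<Sum>l<n. sX (k l j) (\<xi> l)))" .
    \<comment> \<open>Up to \<open>J\<close> the operator \<open>f\<close> is the scalar
      \<open>t\<close>, and \<open>J\<close> sends \<open>s\<close> into \<open>N\<close>; so
      \<open>f s\<close> adds nothing to the span of \<open>N\<close> and the entries of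
      \<open>\<xi>\<close>.\<close>
    obtain t where t: "(\<lambda>x. f x - sX t x) \<in> J" using res[OF f(1)] by blast
    have "s \<in> ?K" unfolding s_def by (intro vX.span_sum vX.span_scale K\<xi>) simp
    then have "(f s - sX t s) + sX t s \<in> ?K" using Js[OF t] KN vX.span_scale vX.span_add by blast
    then have a1: "f s \<in> ?K" by simp
    have a2: "(\<Sum>j<n. sX (c j) (e j)) \<in> ?K" by (intro vX.span_sum vX.span_scale KN ej) simp
    have a3: "(\<Sum>j<n. sX (c j) (\<Sum>l<n. sX (k l j) (\<xi> l))) \<in> ?K" by (intro vX.span_sum vX.span_scale K\<xi>) simp
    show ?thesis by (subst y) (rule vX.span_add[OF vX.span_add[OF a2 a1] a3])
  qed
  then have "vX.span (N \<union> \<xi> ` {..<n}) = UNIV" by blast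
  then have full: "vX.dim (N \<union> \<xi> ` {..<n}) = vX.dim (UNIV :: 'x set)" by (metis vX.dim_span)
  have "vX.dim (N \<union> \<xi> ` {..<m}) \<le> vX.dim N + m" for m
  proof (induction m)
    case (Suc m)
    have "N \<union> \<xi> ` {..<Suc m} = insert (\<xi> m) (N \<union> \<xi> ` {..<m})" by (auto simp: lessThan_Suc)
    then show ?case using Suc by (simp add: FX.dim_insert)
  qed simp
  from this[of n] show False using n full by linarith
qed

end

section \<open>The Jacobson radical of a local ring\<close>

lemma jac_left: "a \<in> jac \<Longrightarrow> r * a \<in> jac"
  unfolding jac_def by (simp add: mult.assoc[symmetric])

lemma jac_add: "a \<in> jac \<Longrightarrow> b \<in> jac \<Longrightarrow> a + b \<in> jac"
proof -
  assume h: "a \<in> jac" "b \<in> jac"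
  have "\<exists>u. u * (1 - r * (a + b)) = 1" for r
  proof -
    obtain u where u: "u * (1 - r * a) = 1" using h(1) unfolding jac_def by blast
    obtain v where v: "v * (1 - (u * r) * b) = 1" using h(2) unfolding jac_def by blast
    have "u * (1 - r * (a + b)) = u * (1 - r * a) - u * r * b" by (simp add: distrib_left right_diff_distrib mult.assoc)
    then have "v * u * (1 - r * (a + b)) = 1" using u v by (simp add: mult.assoc)
    then show ?thesis by blast
  qed
  then show ?thesis unfolding jac_def by blast
qed

lemma jac_zero: "0 \<in> jac"
  unfolding jac_def by (auto intro: exI[of _ 1])

text \<open>If \<open>a * w = 1\<close>, then \<open>1 - w * a\<close> is a left invertible
  idempotent, hence 1. So \<open>w * a = 0\<close>, and squaring \<open>a * w\<close> gives
  0.\<close>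

lemma jac_not_right_invertible:
  fixes a :: "'r::ring_1"
  assumes "a \<in> jac"
  shows "a * w \<noteq> 1"
proof
  assume w: "a * w = 1"
  obtain u where u: "u * (1 - w * a) = 1" using assms unfolding jac_def by blast
  have "(1 - w * a) * (1 - w * a) = 1 - w * a"
    using w by (simp add: left_diff_distrib right_diff_distrib mult.assoc[symmetric]) (simp add: mult.assoc)
  then have "u * (1 - w * a) * (1 - w * a) = u * (1 - w * a)" by (simp add: mult.assoc)
  then have "w * a = 0" using u by simp
  then have "a * w * (a * w) = 0" by (metis mult.assoc mult_zero_left mult_zero_right)
  then show False using w by simp
qed

text \<open>The radical is described from the left; on the right, an invertible \<open>a * b\<close>
  would make \<open>a\<close> right invertible. For right modules this closes the radical operators
  under composition.\<close>

lemma jac_right: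
  fixes a :: "'r::ring_1"
  assumes "local_ring TYPE('r)" "a \<in> jac"
  shows "a * b \<in> jac"
proof (rule ccontr)
  assume "a * b \<notin> jac"
  then obtain u where "a * b * u = 1" using assms(1) unfolding local_ring_def by blast
  then show False using jac_not_right_invertible[OF assms(2)] by (simp add: mult.assoc)
qed

lemma jac_one_minus:
  fixes a :: "'r::ring_1"
  assumes "local_ring TYPE('r)" "a \<in> jac"
  shows "\<exists>u. u * (1 - a) = 1 \<and> (1 - a) * u = 1"
proof -
  obtain u where u: "u * (1 - 1 * a) = 1" using assms(2) unfolding jac_def by blast
  have "1 - a \<notin> jac"
  proof
    assume "1 - a \<in> jac"
    then obtain v where "v * (1 - u * (1 - a)) = 1" unfolding jac_def by blast
    then show False using u by simp
  qed
  then show ?thesis using assms(1) unfolding local_ring_def by blast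
qed

theorem theorem3p14:
  fixes sA :: "'k::field \<Rightarrow> 'a::ring_1 \<Rightarrow> 'a"
    and sB :: "'k \<Rightarrow> 'b::ring_1 \<Rightarrow> 'b"
    and sX :: "'k \<Rightarrow> 'x::ab_group_add \<Rightarrow> 'x"
    and L :: "'a \<Rightarrow> 'x \<Rightarrow> 'x"
    and R :: "'x \<Rightarrow> 'b \<Rightarrow> 'x"
  assumes "fd_algebra sA" and "local_ring TYPE('a)" and "residue_field_is_k sA"
    and "fd_algebra sB" and "local_ring TYPE('b)" and "residue_field_is_k sB"
    and "fin_dim sX" and "central_bimodule sA sB sX L R"
    and "g_finite L R"
  shows "uniserial_left_top L R \<and> uniserial_right_top L R"
proof
  interpret bimodule sA sB sX L R by unfold_locales (use assms in auto)
  obtain cA' where resA: "\<And>a. a - sA (cA' a) 1 \<in> jac"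
    using assms(3) unfolding residue_field_is_k_def by metis
  obtain cB' where resB: "\<And>b. b - sB (cB' b) 1 \<in> jac"
    using assms(6) unfolding residue_field_is_k_def by metis
  have Ld: "L (a - a') x = L a x - L a' x" "L a (x - x') = L a x - L a x'" for a a' x x'
    using L_simps(1)[of a "- a'" x] L_simps(2)[of a x "- x'"] L_minus by simp_all
  have Rd: "R x (b - b') = R x b - R x b'" "R (x - x') b = R x b - R x' b" for b b' x x'
    using R_simps(1)[of x b "- b'"] R_simps(2)[of x "- x'" b] R_minus by simp_all
  show "uniserial_left_top L R"
    unfolding uniserial_left_top_def
  proof (intro allI impI)
    fix U V assume h: "left_submodule L U \<and> left_submodule L V \<and> (\<forall>x. \<forall>b\<in>jac. R x b \<in> U) \<and> (\<forall>x. \<forall>b\<in>jac. R x b \<in> V)"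
    show "U \<subseteq> V \<or> V \<subseteq> U"
    proof (rule uniserial_core[where Op = "range L" and J = "L ` jac"])
      fix n :: nat
      \<comment> \<open>One copy of the first projective and \<open>n\<close> of the second: A acts
        by a single operator, B by an \<open>n\<close> by \<open>n\<close> matrix.\<close>
      obtain \<xi> where rig: "\<forall>\<eta>. \<exists>\<alpha> \<beta>. \<forall>i<1::nat. \<forall>j<n. \<eta> i j = (\<Sum>l<n. R (\<xi> i l) (\<beta> l j)) + (\<Sum>l<1::nat. L (\<alpha> i l) (\<xi> l j))"
        using rigid_matrix[OF assms(9) zero_less_one, of n] by (rule exE)
      have "\<exists>f\<in>range L. \<exists>k. \<forall>j<n. \<eta> j - f (\<xi> 0 j) - (\<Sum>l<n. sX (k l j) (\<xi> 0 l)) \<in> U \<inter> V" for \<eta>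
      proof -
        obtain \<alpha> \<beta> where e: "\<And>j. j < n \<Longrightarrow> \<eta> j = (\<Sum>l<n. R (\<xi> 0 l) (\<beta> l j)) + L (\<alpha> 0 0) (\<xi> 0 j)"
          using rig[THEN spec, of "\<lambda>i. \<eta>"] by auto
        \<comment> \<open>Modulo X J_B, which both submodules contain, the matrix over B acts
          through its residues in the field.\<close>
        define k where "k l j = cB' (\<beta> l j)" for l j
        have k: "\<beta> l j - sB (k l j) 1 \<in> jac" for l j unfolding k_def by (rule resB)
        have sumU: "sum g I \<in> U \<inter> V" if "\<And>l. g l \<in> U \<inter> V" for g and I :: "nat set"
          using that h unfolding left_submodule_def by (induction I rule: infinite_finite_induct) auto
        have "\<eta> j - L (\<alpha> 0 0) (\<xi> 0 j) - (\<Sum>l<n. sX (k l j) (\<xi> 0 l)) \<in> U \<inter> V" if "j < n" for j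
        proof -
          have "\<eta> j - L (\<alpha> 0 0) (\<xi> 0 j) - (\<Sum>l<n. sX (k l j) (\<xi> 0 l)) = (\<Sum>l<n. R (\<xi> 0 l) (\<beta> l j - sB (k l j) 1))"
            by (simp add: e[OF that] Rd LR_central sum_subtractf)
          then show ?thesis using sumU[of "\<lambda>l. R (\<xi> 0 l) (\<beta> l j - sB (k l j) 1)"] k h by simp
        qed
        then show ?thesis by blast
      qed
      then show "\<exists>\<xi>. \<forall>\<eta>. \<exists>f\<in>range L. \<exists>k. \<forall>j<n. \<eta> j - f (\<xi> j) - (\<Sum>l<n. sX (k l j) (\<xi> l)) \<in> U \<inter> V" by blast
    next
      fix f assume "f \<in> range L"
      then obtain a where a: "f = L a" by blast
      show "\<exists>c. (\<lambda>x. f x - sX c x) \<in> L ` jac"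
        by (intro exI[of _ "cA' a"] image_eqI[OF _ resA[of a]]) (simp add: fun_eq_iff Ld LR_central a)
    next
      fix g assume "g \<in> L ` jac"
      then obtain a where a: "g = L a" "a \<in> jac" by blast
      obtain w where "w * (1 - a) = 1" using jac_one_minus[OF assms(2) a(2)] by blast
      then have "L w (x - g x) = x" for x using L_simps(3)[of w "1 - a" x] by (simp add: a(1) Ld L_simps(4))
      then show "\<exists>h\<in>range L. \<forall>x. h (x - g x) = x" by blast
    next
      show "(\<lambda>x. sX c x) \<in> range L" for c by (rule range_eqI[of _ _ "sA c 1"]) (simp add: fun_eq_iff LR_central)
      show "(\<lambda>x. 0) \<in> L ` jac" by (rule image_eqI[OF _ jac_zero]) (simp add: fun_eq_iff)
      show "(\<lambda>x. f x + g x) \<in> L ` jac" if "f \<in> L ` jac" "g \<in> L ` jac" for f g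
      proof -
        obtain a b where "f = L a" "g = L b" "a \<in> jac" "b \<in> jac" using \<open>f \<in> L ` jac\<close> \<open>g \<in> L ` jac\<close> by blast
        then show ?thesis by (intro image_eqI[OF _ jac_add[of a b]]) (auto simp: fun_eq_iff L_simps)
      qed
      show "(\<lambda>x. f (g x)) \<in> L ` jac" if "f \<in> range L" "g \<in> L ` jac" for f g
      proof -
        obtain a b where "f = L a" "g = L b" "b \<in> jac" using \<open>f \<in> range L\<close> \<open>g \<in> L ` jac\<close> by blast
        then show ?thesis by (intro image_eqI[OF _ jac_left[of b a]]) (auto simp: fun_eq_iff L_simps)
      qed
    qed (use h in \<open>auto simp: left_submodule_def L_simps scale_X\<close>)
  qed
  show "uniserial_right_top L R"
    unfolding uniserial_right_top_def
  proof (intro allI impI)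
    fix U V assume h: "right_submodule R U \<and> right_submodule R V \<and> (\<forall>x. \<forall>a\<in>jac. L a x \<in> U) \<and> (\<forall>x. \<forall>a\<in>jac. L a x \<in> V)"
    show "U \<subseteq> V \<or> V \<subseteq> U"
    proof (rule uniserial_core[where Op = "range (\<lambda>b x. R x b)" and J = "(\<lambda>b x. R x b) ` jac"])
      fix n :: nat
      show "\<exists>\<xi>. \<forall>\<eta>. \<exists>f\<in>range (\<lambda>b x. R x b). \<exists>k. \<forall>j<n. \<eta> j - f (\<xi> j) - (\<Sum>l<n. sX (k l j) (\<xi> l)) \<in> U \<inter> V"
      \<comment> \<open>\<open>rigid_matrix\<close> needs a positive number of copies of the first
        projective, here \<open>n\<close>; for \<open>n = 0\<close> there is no condition to
        satisfy.\<close>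
      proof (cases "n = 0")
        case False
        then have "0 < n" by simp
        obtain \<xi> where rig: "\<forall>\<eta>. \<exists>\<alpha> \<beta>. \<forall>i<n. \<forall>j<1::nat. \<eta> i j = (\<Sum>l<1::nat. R (\<xi> i l) (\<beta> l j)) + (\<Sum>l<n. L (\<alpha> i l) (\<xi> l j))"
          using rigid_matrix[OF assms(9) \<open>0 < n\<close>, of 1] by (rule exE)
        have "\<exists>f\<in>range (\<lambda>b x. R x b). \<exists>k. \<forall>j<n. \<eta> j - f (\<xi> j 0) - (\<Sum>l<n. sX (k l j) (\<xi> l 0)) \<in> U \<inter> V" for \<eta>
        proof -
          obtain \<alpha> \<beta> where e: "\<And>i. i < n \<Longrightarrow> \<eta> i = R (\<xi> i 0) (\<beta> 0 0) + (\<Sum>l<n. L (\<alpha> i l) (\<xi> l 0))"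
            using rig[THEN spec, of "\<lambda>i j. \<eta> i"] by auto
          \<comment> \<open>The roles are exchanged, and the indices with them: the matrix over A
            acts from the left and becomes scalar modulo J_A X.\<close>
          define k where "k l j = cA' (\<alpha> j l)" for l j
          have k: "\<alpha> j l - sA (k l j) 1 \<in> jac" for l j unfolding k_def by (rule resA)
          have sumU: "sum g I \<in> U \<inter> V" if "\<And>l. g l \<in> U \<inter> V" for g and I :: "nat set"
            using that h unfolding right_submodule_def by (induction I rule: infinite_finite_induct) auto
          have "\<eta> j - R (\<xi> j 0) (\<beta> 0 0) - (\<Sum>l<n. sX (k l j) (\<xi> l 0)) \<in> U \<inter> V" if "j < n" for j
          proof -
            have "\<eta> j - R (\<xi> j 0) (\<beta> 0 0) - (\<Sum>l<n. sX (k l j) (\<xi> l 0)) = (\<Sum>l<n. L (\<alpha> j l - sA (k l j) 1) (\<xi> l 0))"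
              by (simp add: e[OF that] Ld LR_central sum_subtractf)
            then show ?thesis using sumU[of "\<lambda>l. L (\<alpha> j l - sA (k l j) 1) (\<xi> l 0)"] k h by simp
          qed
          then show ?thesis by (intro bexI[of _ "\<lambda>x. R x (\<beta> 0 0)"] exI[of _ k]) auto
        qed
        then show ?thesis by (intro exI[of _ "\<lambda>l. \<xi> l 0"] allI)
      qed auto
    next
      fix f assume "f \<in> range (\<lambda>b x. R x b)"
      then obtain a where a: "f = (\<lambda>x. R x a)" by blast
      show "\<exists>c. (\<lambda>x. f x - sX c x) \<in> (\<lambda>b x. R x b) ` jac"
        by (intro exI[of _ "cB' a"] image_eqI[OF _ resB[of a]]) (simp add: fun_eq_iff Rd LR_central a)
    next
      fix g assume "g \<in> (\<lambda>b x. R x b) ` jac"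
      then obtain a where a: "g = (\<lambda>x. R x a)" "a \<in> jac" by blast
      obtain w where "(1 - a) * w = 1" using jac_one_minus[OF assms(5) a(2)] by blast
      then have "R (x - g x) w = x" for x using R_simps(3)[of x "1 - a" w] by (simp add: a(1) Rd R_simps(4))
      then show "\<exists>h\<in>range (\<lambda>b x. R x b). \<forall>x. h (x - g x) = x" by (intro bexI[of _ "\<lambda>x. R x w"]) auto
    next
      show "(\<lambda>x. sX c x) \<in> range (\<lambda>b x. R x b)" for c by (rule range_eqI[of _ _ "sB c 1"]) (simp add: fun_eq_iff LR_central)
      show "(\<lambda>x. 0) \<in> (\<lambda>b x. R x b) ` jac" by (rule image_eqI[OF _ jac_zero]) (simp add: fun_eq_iff)
      show "(\<lambda>x. f x + g x) \<in> (\<lambda>b x. R x b) ` jac" if "f \<in> (\<lambda>b x. R x b) ` jac" "g \<in> (\<lambda>b x. R x b) ` jac" for f g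
      proof -
        obtain a b where "f = (\<lambda>x. R x a)" "g = (\<lambda>x. R x b)" "a \<in> jac" "b \<in> jac"
          using \<open>f \<in> (\<lambda>b x. R x b) ` jac\<close> \<open>g \<in> (\<lambda>b x. R x b) ` jac\<close> by blast
        then show ?thesis by (intro image_eqI[OF _ jac_add[of a b]]) (auto simp: fun_eq_iff R_simps)
      qed
      show "(\<lambda>x. f (g x)) \<in> (\<lambda>b x. R x b) ` jac" if "f \<in> range (\<lambda>b x. R x b)" "g \<in> (\<lambda>b x. R x b) ` jac" for f g
      proof -
        obtain a b where "f = (\<lambda>x. R x a)" "g = (\<lambda>x. R x b)" "b \<in> jac"
          using \<open>f \<in> range (\<lambda>b x. R x b)\<close> \<open>g \<in> (\<lambda>b x. R x b) ` jac\<close> by blast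
        then show ?thesis by (intro image_eqI[OF _ jac_right[OF assms(5), of b a]]) (auto simp: fun_eq_iff R_simps)
      qed
    qed (use h in \<open>auto simp: right_submodule_def R_simps scale_X\<close>)
  qed
qed

end
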